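(* Let $K$ be an algebraically closed field of characteristic zero and let $W$ be a Coxeter group of type $B_n$, $n\ge 1$, identified with the wreath product $S_n(G)=G^n\rtimes S_n$ where $G$ is the cyclic group of order $2$. Let $V=\mathrm{Ind}_{G\times S_{n-1}(G)}^{S_n(G)}(\chi\boxtimes \mathbf{1}_{S_{n-1}(G)})$, where $\chi$ is the nontrivial character of $G$ (so $V$ is the reflection representation of $W$), and let $U$ be the reflection representation of $S_n$, regarded as a representation of $W$ by letting $G^n$ act trivially. Then the representation ring $R(W)$ is generated as a ring by the classes of $\Lambda^k U$ and $\Lambda^k V$, $k\ge 0$.
   Context: The representation ring $R(W)$ is the Grothendieck ring (with $\mathbb{Z}$ coefficients, unital) of the category of finite-dimensional $K$-representations of $W$, with multiplication given by tensor product over $K$. $\Lambda^k$ denotes the $k$th exterior power. $S_m(G)=G^m\rtimes S_m$, $G\times S_{n-1}(G)\subset S_n(G)$ is the natural subgroup, and $\mathbf{1}_H$ is the trivial representation of $H$. The reflection representation of $S_n$ is the $(n-1)$-dimensional irreducible representation corresponding to the partition $(n-1,1)$, i.e. the quotient of the permutation representation $K^n$ by the trivial representation. *)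

theory Defs
  imports
    "HOL-Algebra.Algebra"
    "HOL-Library.Poly_Mapping"
    "Jordan_Normal_Form.Matrix_Kernel"
begin

section \<open>Finite-dimensional representations, in matrix form\<close>

text \<open>
  A representation of a group \<open>G\<close> on \<open>K\<^sup>d\<close> is a homomorphism from \<open>G\<close> to the invertible
  \<open>d \<times> d\<close> matrices, acting on column vectors. Every finite-dimensional representation is isomorphic
  to one of these, so they represent all isomorphism classes. Degree 0 is allowed. The values of
  \<open>\<rho>\<close> outside \<open>carrier G\<close> are irrelevant.
\<close>

definition rep_degree :: "('g, 'm) monoid_scheme \<Rightarrow> ('g \<Rightarrow> 'k mat) \<Rightarrow> nat"
  where "rep_degree G \<rho> = dim_row (\<rho> \<one>\<^bsub>G\<^esub>)"

definition group_rep :: "('g, 'm) monoid_scheme \<Rightarrow> ('g \<Rightarrow> 'k::field mat) \<Rightarrow> bool"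
  where "group_rep G \<rho> \<longleftrightarrow>
    (\<forall>g\<in>carrier G. \<rho> g \<in> carrier_mat (rep_degree G \<rho>) (rep_degree G \<rho>)) \<and>
    \<rho> \<one>\<^bsub>G\<^esub> = 1\<^sub>m (rep_degree G \<rho>) \<and>
    (\<forall>g\<in>carrier G. \<forall>h\<in>carrier G. \<rho> (g \<otimes>\<^bsub>G\<^esub> h) = \<rho> g * \<rho> h)"

definition intertwiner ::
    "('g, 'm) monoid_scheme \<Rightarrow> ('g \<Rightarrow> 'k::field mat) \<Rightarrow> ('g \<Rightarrow> 'k mat) \<Rightarrow> 'k mat \<Rightarrow> bool"
  where "intertwiner G \<rho> \<sigma> F \<longleftrightarrow>
    F \<in> carrier_mat (rep_degree G \<sigma>) (rep_degree G \<rho>) \<and> (\<forall>g\<in>carrier G. F * \<rho> g = \<sigma> g * F)"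

text \<open>Exactness of \<open>0 \<rightarrow> \<alpha> \<rightarrow> \<beta> \<rightarrow> \<gamma> \<rightarrow> 0\<close> for some choice of the two maps.\<close>

definition short_exact ::
    "('g, 'm) monoid_scheme \<Rightarrow> ('g \<Rightarrow> 'k::field mat) \<Rightarrow> ('g \<Rightarrow> 'k mat) \<Rightarrow> ('g \<Rightarrow> 'k mat) \<Rightarrow> bool"
  where "short_exact G \<alpha> \<beta> \<gamma> \<longleftrightarrow>
    group_rep G \<alpha> \<and> group_rep G \<beta> \<and> group_rep G \<gamma> \<and>
    (\<exists>F P. intertwiner G \<alpha> \<beta> F \<and> intertwiner G \<beta> \<gamma> P \<and>
       inj_on ((*\<^sub>v) F) (carrier_vec (rep_degree G \<alpha>)) \<and>
       (*\<^sub>v) P ` carrier_vec (rep_degree G \<beta>) = carrier_vec (rep_degree G \<gamma>) \<and>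
       mat_kernel P = (*\<^sub>v) F ` carrier_vec (rep_degree G \<alpha>))"


section \<open>Constructions on representations\<close>

definition trivial_rep :: "'g \<Rightarrow> 'k::field mat"
  where "trivial_rep = (\<lambda>_. 1\<^sub>m 1)"

text \<open>Kronecker product: the matrix of \<open>A \<otimes> B\<close> in the lexicographically ordered basis \<open>e\<^sub>i \<otimes> e\<^sub>j\<close>.\<close>

definition tensor_mat :: "'k::field mat \<Rightarrow> 'k mat \<Rightarrow> 'k mat"
  where "tensor_mat A B = mat (dim_row A * dim_row B) (dim_col A * dim_col B)
    (\<lambda>(i, j). A $$ (i div dim_row B, j div dim_col B) * B $$ (i mod dim_row B, j mod dim_col B))"

definition tensor_rep :: "('g \<Rightarrow> 'k::field mat) \<Rightarrow> ('g \<Rightarrow> 'k mat) \<Rightarrow> 'g \<Rightarrow> 'k mat"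
  where "tensor_rep \<rho> \<sigma> = (\<lambda>g. tensor_mat (\<rho> g) (\<sigma> g))"

definition external_tensor_rep ::
    "('g \<Rightarrow> 'k::field mat) \<Rightarrow> ('h \<Rightarrow> 'k mat) \<Rightarrow> 'g \<times> 'h \<Rightarrow> 'k mat"
  where "external_tensor_rep \<rho> \<sigma> = (\<lambda>(g, h). tensor_mat (\<rho> g) (\<sigma> h))"

text \<open>
  The basis of \<open>\<Lambda>\<^sup>k K\<^sup>d\<close> consists of the \<open>e\<^sub>I = e\<^bsub>I!0\<^esub> \<and> \<dots> \<and> e\<^bsub>I!(k-1)\<^esub>\<close>, with \<open>I\<close> ranging over the
  increasing lists of length \<open>k\<close> in \<open>{0..<d}\<close>. In this basis \<open>wedge d vs\<close> is the coordinate vector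
  of the product \<open>vs!0 \<and> \<dots> \<and> vs!(k-1)\<close> of vectors in \<open>K\<^sup>d\<close>, whose \<open>I\<close>-th coordinate is a minor.
\<close>

definition ext_index :: "nat \<Rightarrow> nat \<Rightarrow> nat list list"
  where "ext_index d k = filter (\<lambda>I. length I = k) (subseqs [0..<d])"

definition wedge :: "nat \<Rightarrow> 'k::field vec list \<Rightarrow> 'k vec"
  where "wedge d vs = vec_of_list
    (map (\<lambda>I. det (mat (length vs) (length vs) (\<lambda>(a, b). (vs ! b) $ (I ! a))))
      (ext_index d (length vs)))"

text \<open>\<open>\<Lambda>\<^sup>k A\<close> sends \<open>e\<^bsub>j\<^sub>1\<^esub> \<and> \<dots> \<and> e\<^bsub>j\<^sub>k\<^esub>\<close> to \<open>A e\<^bsub>j\<^sub>1\<^esub> \<and> \<dots> \<and> A e\<^bsub>j\<^sub>k\<^esub>\<close>.\<close>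

definition ext_mat :: "nat \<Rightarrow> 'k::field mat \<Rightarrow> 'k mat"
  where "ext_mat k A = mat_of_cols (length (ext_index (dim_row A) k))
    (map (\<lambda>J. wedge (dim_row A) (map (col A) J)) (ext_index (dim_col A) k))"

definition ext_rep :: "nat \<Rightarrow> ('g \<Rightarrow> 'k::field mat) \<Rightarrow> 'g \<Rightarrow> 'k mat"
  where "ext_rep k \<rho> = (\<lambda>g. ext_mat k (\<rho> g))"

text \<open>
  For a representation \<open>\<rho>\<close> of degree \<open>d\<close> of a subgroup \<open>H\<close> of a finite group \<open>G\<close>, and
  representatives \<open>t\<^sub>0, \<dots>, t\<^bsub>m-1\<^esub>\<close> of the left cosets of \<open>H\<close>, the induced module
  \<open>K[G] \<otimes>\<^bsub>K[H]\<^esub> K\<^sup>d\<close> has the basis \<open>t\<^sub>i \<otimes> e\<^sub>r\<close>, placed here at position \<open>i * d + r\<close>. If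
  \<open>g t\<^sub>j = t\<^sub>i h\<close> with \<open>h \<in> H\<close> then \<open>g (t\<^sub>j \<otimes> v) = t\<^sub>i \<otimes> \<rho>(h) v\<close>. The choice of representatives does
  not affect the isomorphism class.
\<close>

definition left_transversal :: "('g, 'm) monoid_scheme \<Rightarrow> 'g set \<Rightarrow> 'g list \<Rightarrow> bool"
  where "left_transversal G H ts \<longleftrightarrow>
    distinct ts \<and> set ts \<subseteq> carrier G \<and>
    bij_betw (\<lambda>t. t <#\<^bsub>G\<^esub> H) (set ts) (lcosets\<^bsub>G\<^esub> H)"

definition induced_rep ::
    "('g, 'm) monoid_scheme \<Rightarrow> 'g set \<Rightarrow> ('g \<Rightarrow> 'k::field mat) \<Rightarrow> 'g \<Rightarrow> 'k mat"
  where "induced_rep G H \<rho> = (\<lambda>g.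
    let ts = (SOME ts. left_transversal G H ts); d = rep_degree G \<rho> in
    mat (length ts * d) (length ts * d) (\<lambda>(a, b).
      let h = inv\<^bsub>G\<^esub> (ts ! (a div d)) \<otimes>\<^bsub>G\<^esub> g \<otimes>\<^bsub>G\<^esub> (ts ! (b div d)) in
      if h \<in> H then \<rho> h $$ (a mod d, b mod d) else 0))"


section \<open>The representation ring\<close>

text \<open>
  The free abelian group on the representations, with the multiplication that extends the tensor
  product bilinearly. The representation ring is its quotient by the subgroup generated by the
  \<open>[\<beta>] - [\<alpha>] - [\<gamma>]\<close> for short exact sequences. These relations identify isomorphic representations:
  for \<open>\<gamma> = 0\<close> exactness means \<open>\<alpha> \<cong> \<beta>\<close>, and \<open>[0] = 0\<close>.
\<close>

definition free_rep_ring ::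
    "('g, 'm) monoid_scheme \<Rightarrow> (('g \<Rightarrow> 'k::field mat) \<Rightarrow>\<^sub>0 int) ring"
  where "free_rep_ring G =
    \<lparr>carrier = {x. Poly_Mapping.keys x \<subseteq> Collect (group_rep G)},
     monoid.mult = (\<lambda>x y. frag_extend (\<lambda>\<rho>. frag_extend (\<lambda>\<sigma>. frag_of (tensor_rep \<rho> \<sigma>)) y) x),
     one = frag_of trivial_rep, ring.zero = 0, add = (+)\<rparr>"

definition rep_relations ::
    "('g, 'm) monoid_scheme \<Rightarrow> (('g \<Rightarrow> 'k::field mat) \<Rightarrow>\<^sub>0 int) set"
  where "rep_relations G = generate (add_monoid (free_rep_ring G))
    {frag_of \<beta> - frag_of \<alpha> - frag_of \<gamma> | \<alpha> \<beta> \<gamma>. short_exact G \<alpha> \<beta> \<gamma>}"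

definition rep_ring ::
    "('g, 'm) monoid_scheme \<Rightarrow> (('g \<Rightarrow> 'k::field mat) \<Rightarrow>\<^sub>0 int) set ring"
  where "rep_ring G = free_rep_ring G Quot rep_relations G"

definition rep_class ::
    "('g, 'm) monoid_scheme \<Rightarrow> ('g \<Rightarrow> 'k::field mat) \<Rightarrow> (('g \<Rightarrow> 'k mat) \<Rightarrow>\<^sub>0 int) set"
  where "rep_class G \<rho> = rep_relations G +>\<^bsub>free_rep_ring G\<^esub> frag_of \<rho>"


section \<open>Wreath products\<close>

text \<open>
  \<open>wreath G I\<close> is \<open>G\<^sup>I \<rtimes> Sym(I)\<close>, where \<open>\<sigma>\<close> acts on \<open>G\<^sup>I\<close> by \<open>(\<sigma> f) i = f (\<sigma>\<^sup>-\<^sup>1 i)\<close>. Thus \<open>S\<^sub>n(G)\<close> is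
  \<open>wreath G {1..n}\<close>.
\<close>

definition wreath ::
    "('g, 'm) monoid_scheme \<Rightarrow> 'i set \<Rightarrow> (('i \<Rightarrow> 'g) \<times> ('i \<Rightarrow> 'i)) monoid"
  where "wreath G I =
    \<lparr>carrier = (I \<rightarrow>\<^sub>E carrier G) \<times> {\<sigma>. \<sigma> permutes I},
     monoid.mult = (\<lambda>(f, \<sigma>) (g, \<tau>). (\<lambda>i\<in>I. f i \<otimes>\<^bsub>G\<^esub> g (inv_into UNIV \<sigma> i), \<sigma> \<circ> \<tau>)),
     one = (\<lambda>i\<in>I. \<one>\<^bsub>G\<^esub>, id)\<rparr>"

text \<open>
  The natural embedding of \<open>G \<times> S\<^bsub>n-1\<^esub>(G)\<close> into \<open>S\<^sub>n(G)\<close>: the factor \<open>G\<close> sits at index 1, and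
  \<open>S\<^bsub>n-1\<^esub>(G)\<close> is realised on the index set \<open>{2..n}\<close>.
\<close>

definition wreath_embed ::
    "'g \<times> (nat \<Rightarrow> 'g) \<times> (nat \<Rightarrow> nat) \<Rightarrow> (nat \<Rightarrow> 'g) \<times> (nat \<Rightarrow> nat)"
  where "wreath_embed = (\<lambda>(x, f, \<sigma>). (f(1 := x), \<sigma>))"

text \<open>
  \<open>Ind (\<chi> \<boxtimes> 1)\<close> from \<open>G \<times> S\<^bsub>n-1\<^esub>(G)\<close> to \<open>S\<^sub>n(G)\<close>, with \<open>\<chi> \<boxtimes> 1\<close> transported to the image of the
  embedding.
\<close>

definition wreath_induced_rep ::
    "('g, 'm) monoid_scheme \<Rightarrow> nat \<Rightarrow> ('g \<Rightarrow> 'k::field mat)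
      \<Rightarrow> (nat \<Rightarrow> 'g) \<times> (nat \<Rightarrow> nat) \<Rightarrow> 'k mat"
  where "wreath_induced_rep G n \<chi> =
    (let P = carrier (G \<times>\<times> wreath G {2..n}) in
     induced_rep (wreath G {1..n}) (wreath_embed ` P)
       (\<lambda>h. external_tensor_rep \<chi> trivial_rep (inv_into P wreath_embed h)))"


section \<open>Representations of symmetric groups\<close>

definition perm_rep :: "nat \<Rightarrow> (nat \<Rightarrow> nat) \<Rightarrow> 'k::field mat"
  where "perm_rep n = (\<lambda>\<sigma>. mat n n (\<lambda>(i, j). if \<sigma> (Suc j) = Suc i then 1 else 0))"

text \<open>
  \<open>U\<close> is a quotient of the permutation representation on \<open>K\<^sup>n\<close> by the trivial representation. This
  determines \<open>U\<close> up to isomorphism; its degree is \<open>n - 1\<close>.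
\<close>

definition reflection_rep_sym :: "nat \<Rightarrow> ((nat \<Rightarrow> nat) \<Rightarrow> 'k::field mat) \<Rightarrow> bool"
  where "reflection_rep_sym n U \<longleftrightarrow> short_exact (sym_group n) trivial_rep (perm_rep n) U"

definition inflate :: "('h \<Rightarrow> 'k mat) \<Rightarrow> 'f \<times> 'h \<Rightarrow> 'k mat"
  where "inflate U = (\<lambda>(f, \<sigma>). U \<sigma>)"

end

theory Submission
  imports Defs
begin

text \<open>
  Two virtual representations of a finite group in characteristic 0 with the same character are equal
  in the representation ring (\<open>rep_relations_iff\<close>). The claim is therefore about functions on the
  group: every character of \<open>W\<close> must be an integral polynomial in the characters of the \<open>\<Lambda>\<^sup>k U\<close> and
  the \<open>\<Lambda>\<^sup>k V\<close> (\<open>generate_rep_ring\<close>). Here \<open>W\<close> is identified with the group of signed permutations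
  of \<open>S = {1..n}\<close>.

  The trace of \<open>\<Lambda>\<^sup>k\<close> of a matrix is the sum of its principal \<open>k\<close>-minors. A principal minor of a signed
  permutation matrix on an index set \<open>A\<close> vanishes unless \<open>A\<close> is stable, and otherwise it is the sign of
  the permutation of \<open>A\<close> times the product of the signs over \<open>A\<close>. For \<open>V\<close>, which is the
  representation by signed permutation matrices up to a change of basis, this gives the sum over
  the stable \<open>k\<close>-subsets \<open>A\<close> of the linear character \<open>sgn \<sqdot> \<epsilon>\<close> of the signed permutations of \<open>A\<close>.
  The permutation representation gives the same sum with \<open>sgn\<close> in place of \<open>sgn \<sqdot> \<epsilon>\<close>, and it reduces to
  \<open>U\<close> by \<open>\<Lambda>\<^sup>k K\<^sup>n = \<Lambda>\<^sup>k U + \<Lambda>\<^bsup>k-1\<^esup> U\<close>. These sums are the block characters with one block of size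
  \<open>k\<close> and of sign type; in the language of symmetric functions they are the \<open>e\<^sub>k\<close> of one of two
  alphabets, multiplied by a complete function of the remaining points.

  It remains to see that the ring generated by these functions contains every character. There are two
  steps. First, the ring contains every block character, that is, every sum over ordered families of
  disjoint stable sets of prescribed sizes, weighted by linear characters
  (\<open>function_ring.block_char_in\<close>): a product of a one-block character with a block character is
  the block character with that block added, plus block characters with fewer points in their
  blocks, and blocks without sign are removed by the identity \<open>\<Sum> (-1)\<^sup>i e\<^sub>i h\<^bsub>k-i\<^esub> = 0\<close>.

  Secondly, a class function is an integral combination of block characters of sign type as soon as all
  its scalar products with the characters induced from linear characters \<open>1\<close> or \<open>\<epsilon>\<close> on the blocks
  of a set partition are integers (\<open>integral_class_function_comb\<close>). The proof strips blocks: averaging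
  over the signed permutations of a block \<open>R\<close> against \<open>1\<close> or \<open>\<epsilon>\<close> sends a block character of sign type
  to the sum of the block characters in which the points of \<open>R\<close> have been removed from different
  blocks of the right colour (the rule \<open>h\<^sub>r\<^sup>\<bottom> e\<^sub>k = e\<^sub>k\<close>, \<open>e\<^bsub>k-1\<^esub>\<close>, \<open>0\<close> for \<open>r = 0\<close>, \<open>r = 1\<close>,
  \<open>r \<ge> 2\<close>). So the largest size of a block with a nonzero average can be lowered by subtracting block
  characters, and a class function without nonzero averages is \<open>0\<close>. A character meets the integrality
  condition because each such scalar product is the trace of an idempotent matrix
  (\<open>integral_averages_rep\<close>).
\<close>

section \<open>Signed permutations and block characters\<close>

text \<open>
  The pair \<open>(s, \<sigma>)\<close> acts by \<open>e\<^sub>j \<mapsto> s(j) e\<^bsub>\<sigma>(j)\<^esub>\<close>. The groups for all finite sets of indices are realised in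
  one type: outside its support a signed permutation has sign 1 and fixes every point.
\<close>

type_synonym sperm = "(nat \<Rightarrow> int) \<times> (nat \<Rightarrow> nat)"

definition signed_perms :: "nat set \<Rightarrow> sperm set"
  where "signed_perms S = {w. snd w permutes S \<and> (\<forall>i. fst w i = 1 \<or> fst w i = -1) \<and>
    (\<forall>i. i \<notin> S \<longrightarrow> fst w i = 1)}"

definition sp_mult :: "sperm \<Rightarrow> sperm \<Rightarrow> sperm"  (infixl "\<star>" 70)
  where "w \<star> v = (\<lambda>j. fst v j * fst w (snd v j), snd w \<circ> snd v)"

definition sp_one :: sperm
  where "sp_one = (\<lambda>_. 1, id)"

text \<open>
  The condition is on the restriction to \<open>S\<close> only, so that it passes from a signed permutation to its
  stable subsets.
\<close>

definition stabilizes :: "sperm \<Rightarrow> nat set \<Rightarrow> bool"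
  where "stabilizes w S \<longleftrightarrow> finite S \<and> bij_betw (snd w) S S \<and> (\<forall>i\<in>S. fst w i = 1 \<or> fst w i = -1)"

text \<open>
  The type \<open>\<theta>\<close> selects one of the four products of the sign of the permutation and the product \<open>\<epsilon>\<close> of the
  signs.
\<close>

definition lin_char :: "bool \<times> bool \<Rightarrow> nat set \<Rightarrow> sperm \<Rightarrow> int"
  where "lin_char \<theta> A w =
    (if fst \<theta> then sign_on A (snd w) else 1) * (if snd \<theta> then (\<Prod>i\<in>A. fst w i) else 1)"

definition stable_subsets :: "nat \<Rightarrow> nat set \<Rightarrow> sperm \<Rightarrow> nat set set"
  where "stable_subsets k S w = {A. A \<subseteq> S \<and> card A = k \<and> snd w ` A = A}"

text \<open>
  A column \<open>(k, \<theta>)\<close> stands for a block of size \<open>k\<close> carrying the linear character \<open>\<theta>\<close>. This is the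
  character induced from the stabilizer of an ordered family of disjoint blocks, with the trivial
  character on the points outside the blocks.
\<close>

fun block_char :: "nat set \<Rightarrow> (nat \<times> bool \<times> bool) list \<Rightarrow> sperm \<Rightarrow> int"
  where
    "block_char S [] w = 1"
  | "block_char S ((k, \<theta>) # \<kappa>) w =
      (\<Sum>A\<in>stable_subsets k S w. lin_char \<theta> A w * block_char (S - A) \<kappa> w)"

lemma stabilizes_signed_perm:
  assumes "w \<in> signed_perms S" "finite S" shows "stabilizes w S"
  using assms by (auto simp: signed_perms_def stabilizes_def permutes_imp_bij)

lemma stabilizes_subset:
  assumes "stabilizes w S" "A \<subseteq> S" "snd w ` A = A" shows "stabilizes w A"
  using assms by (auto simp: stabilizes_def bij_betw_def intro: finite_subset inj_on_subset)

lemma image_Diff_stable: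
  assumes "stabilizes w S" "A \<subseteq> S" "snd w ` A = A" shows "snd w ` (S - A) = S - A"
  using assms inj_on_image_set_diff[of "snd w" S S A] by (auto simp: stabilizes_def bij_betw_def)

lemma image_Int_stable:
  assumes "stabilizes w S" "A \<subseteq> S" "B \<subseteq> S" "snd w ` A = A" "snd w ` B = B"
  shows "snd w ` (A \<inter> B) = A \<inter> B"
  using assms inj_on_image_Int[of "snd w" S A B] by (auto simp: stabilizes_def bij_betw_def)

lemma stabilizes_Diff:
  assumes "stabilizes w S" "A \<subseteq> S" "snd w ` A = A" shows "stabilizes w (S - A)"
  using assms image_Diff_stable[OF assms] stabilizes_subset[of w S "S - A"] by auto

lemma finite_stable_subsets [simp]: "finite S \<Longrightarrow> finite (stable_subsets k S w)"
  unfolding stable_subsets_def by (rule finite_subset[of _ "Pow S"]) auto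

lemma stable_subsets_0 [simp]: "finite S \<Longrightarrow> stable_subsets 0 S w = {{}}"
  by (auto simp: stable_subsets_def dest: finite_subset)

lemma stable_subsetsD:
  assumes "A \<in> stable_subsets k S w" shows "A \<subseteq> S" "card A = k" "snd w ` A = A"
  using assms by (auto simp: stable_subsets_def)

lemma lin_char_empty [simp]: "lin_char \<theta> {} w = 1"
proof -
  have "restrict_id (snd w) {} = id" by (auto simp: restrict_id_def)
  then show ?thesis by (simp add: lin_char_def sign_on_def)
qed

lemma lin_char_cong:
  assumes "\<And>i. i \<in> A \<Longrightarrow> fst w i = fst v i" "\<And>i. i \<in> A \<Longrightarrow> snd w i = snd v i"
  shows "lin_char \<theta> A w = lin_char \<theta> A v"
proof -
  have "sign_on A (snd w) = sign_on A (snd v)" using assms(2) by (intro sign_on_cong) auto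
  then show ?thesis using assms by (simp add: lin_char_def)
qed

lemma lin_char_xor:
  assumes "stabilizes w A"
  shows "lin_char \<theta> A w * lin_char \<phi> A w = lin_char (fst \<theta> \<noteq> fst \<phi>, snd \<theta> \<noteq> snd \<phi>) A w"
proof -
  have "(\<Prod>i\<in>A. fst w i) * (\<Prod>i\<in>A. fst w i) = (\<Prod>i\<in>A. fst w i * fst w i)"
    by (simp add: prod.distrib)
  also have "\<dots> = 1" using assms by (intro prod.neutral) (auto simp: stabilizes_def)
  finally show ?thesis by (auto simp: lin_char_def sign_on_def algebra_simps)
qed

lemma sign_on_Un:
  assumes "finite A" "finite B" "bij_betw f A A" "bij_betw f B B" "A \<inter> B = {}"
  shows "sign_on (A \<union> B) f = sign_on A f * sign_on B f"
proof -
  have "restrict_id f (A \<union> B) = restrict_id f A \<circ> restrict_id f B"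
    using assms by (force simp: fun_eq_iff restrict_id_def bij_betw_def)
  then show ?thesis
    using assms by (simp add: sign_on_def)
      (rule sign_compose; rule permutes_imp_permutation; auto intro: permutes_restrict_id)
qed

lemma lin_char_Un:
  assumes "stabilizes w A" "stabilizes w B" "A \<inter> B = {}"
  shows "lin_char \<theta> (A \<union> B) w = lin_char \<theta> A w * lin_char \<theta> B w"
  using assms sign_on_Un[of A B "snd w"] by (simp add: lin_char_def stabilizes_def prod.union_disjoint)

lemma Diff_Diff_comm: "S - A - B = S - B - (A :: 'a set)"
  by blast

lemma block_char_cong:
  assumes "\<And>i. i \<in> S \<Longrightarrow> fst w i = fst v i" "\<And>i. i \<in> S \<Longrightarrow> snd w i = snd v i"
  shows "block_char S \<kappa> w = block_char S \<kappa> v"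
  using assms
proof (induction \<kappa> arbitrary: S)
  case (Cons c \<kappa>)
  obtain k \<theta> where c: "c = (k, \<theta>)" by (cases c)
  have im: "snd w ` A = snd v ` A" if "A \<subseteq> S" for A
    using Cons.prems that by (intro image_cong) auto
  have st: "stable_subsets k S w = stable_subsets k S v"
    unfolding stable_subsets_def by (rule Collect_cong) (use im in metis)
  show ?case unfolding c block_char.simps st
  proof (rule sum.cong[OF refl])
    fix A assume "A \<in> stable_subsets k S v"
    then have "A \<subseteq> S" by (simp add: stable_subsets_def)
    then show "lin_char \<theta> A w * block_char (S - A) \<kappa> w = lin_char \<theta> A v * block_char (S - A) \<kappa> v"
      using Cons.prems Cons.IH[of "S - A"] lin_char_cong[of A w v \<theta>] by (auto simp: subset_iff)
  qed
qed simp

lemma block_char_0: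
  "finite S \<Longrightarrow> block_char S ((0, \<theta>) # \<kappa>) w = block_char S \<kappa> w"
  by simp

lemma sum_stable_swap:
  assumes "stabilizes w S"
  shows "(\<Sum>A\<in>stable_subsets k S w. \<Sum>B\<in>stable_subsets l (S - A) w. g A B) =
    (\<Sum>B\<in>stable_subsets l S w. \<Sum>A\<in>stable_subsets k (S - B) w. (g A B :: 'a::comm_monoid_add))"
proof -
  have fin: "finite S" using assms by (simp add: stabilizes_def)
  show ?thesis
    using fin apply (simp add: sum.Sigma)
    by (rule sum.reindex_bij_witness[of _ "\<lambda>(B, A). (A, B)" "\<lambda>(A, B). (B, A)"])
      (auto simp: stable_subsets_def)
qed

lemma block_char_swap:
  assumes "stabilizes w S"
  shows "block_char S (c # d # \<kappa>) w = block_char S (d # c # \<kappa>) w"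
proof -
  obtain k \<theta> l \<phi> where c: "c = (k, \<theta>)" "d = (l, \<phi>)" by (cases c, cases d)
  have "block_char S (c # d # \<kappa>) w = (\<Sum>A\<in>stable_subsets k S w. \<Sum>B\<in>stable_subsets l (S - A) w.
      lin_char \<theta> A w * lin_char \<phi> B w * block_char (S - A - B) \<kappa> w)"
    by (simp add: c sum_distrib_left mult.assoc)
  also have "\<dots> = (\<Sum>B\<in>stable_subsets l S w. \<Sum>A\<in>stable_subsets k (S - B) w.
      lin_char \<theta> A w * lin_char \<phi> B w * block_char (S - A - B) \<kappa> w)"
    by (rule sum_stable_swap[OF assms])
  also have "\<dots> = block_char S (d # c # \<kappa>) w"
    by (simp add: c sum_distrib_left mult_ac Diff_Diff_comm)
  finally show ?thesis .
qed

text \<open>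
  A stable \<open>k\<close>-set with a stable \<open>a\<close>-subset is the same as two disjoint stable sets of sizes \<open>a\<close> and
  \<open>k - a\<close>, because the complement of a stable subset is stable.
\<close>

lemma sum_stable_refine:
  assumes "stabilizes w S" "a \<le> k"
  shows "(\<Sum>A\<in>stable_subsets k S w. \<Sum>B\<in>stable_subsets a A w. g A B) =
    (\<Sum>B\<in>stable_subsets a S w. \<Sum>C\<in>stable_subsets (k - a) (S - B) w. (g (B \<union> C) B :: 'a::comm_monoid_add))"
proof -
  have fin: "finite S" using assms by (simp add: stabilizes_def)
  have fin': "finite A" if "A \<in> stable_subsets k S w" for A k
    using that fin by (auto simp: stable_subsets_def dest: finite_subset)
  have dif: "snd w ` (A - B) = A - B" if "A \<in> stable_subsets k S w" "B \<in> stable_subsets a A w" for A B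
    using image_Diff_stable[OF stabilizes_subset[OF assms(1)], of A B] that
    by (auto simp: stable_subsets_def)
  have "(\<Sum>A\<in>stable_subsets k S w. \<Sum>B\<in>stable_subsets a A w. g A B) =
      (\<Sum>(A, B)\<in>Sigma (stable_subsets k S w) (\<lambda>A. stable_subsets a A w). g A B)"
    using fin fin' by (simp add: sum.Sigma)
  also have "\<dots> = (\<Sum>(B, C)\<in>Sigma (stable_subsets a S w) (\<lambda>B. stable_subsets (k - a) (S - B) w). g (B \<union> C) B)"
  proof (rule sum.reindex_bij_witness[of _ "\<lambda>(B, C). (B \<union> C, B)" "\<lambda>(A, B). (B, A - B)"], goal_cases)
    case (1 p)
    then show ?case by (auto simp: stable_subsets_def)
  next
    case (2 p)
    obtain A B where p: "p = (A, B)" by (cases p)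
    have AB: "A \<in> stable_subsets k S w" "B \<in> stable_subsets a A w" using 2 p by auto
    have "finite B" "card (A - B) = k - a"
      using AB fin'[OF AB(1)] finite_subset[of B A] by (auto simp: stable_subsets_def card_Diff_subset)
    then show ?case using AB dif[OF AB] p by (auto simp: stable_subsets_def)
  next
    case (3 p)
    then show ?case by (auto simp: stable_subsets_def)
  next
    case (4 p)
    obtain B C where p: "p = (B, C)" by (cases p)
    have BC: "B \<in> stable_subsets a S w" "C \<in> stable_subsets (k - a) (S - B) w" using 4 p by auto
    have "finite B" "finite C" using BC fin by (auto simp: stable_subsets_def dest: finite_subset)
    moreover have "B \<inter> C = {}" using BC by (auto simp: stable_subsets_def)
    ultimately have "card (B \<union> C) = k" using BC assms(2) by (simp add: card_Un_disjoint stable_subsets_def)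
    then show ?case using BC p by (simp add: stable_subsets_def image_Un) blast
  next
    case (5 p)
    then show ?case by (auto simp: stable_subsets_def Un_absorb1)
  qed
  also have "\<dots> = (\<Sum>B\<in>stable_subsets a S w. \<Sum>C\<in>stable_subsets (k - a) (S - B) w. g (B \<union> C) B)"
    using fin by (simp add: sum.Sigma)
  finally show ?thesis .
qed

text \<open>
  A stable set meets a stable set \<open>A\<close> and its complement in stable sets.
\<close>

lemma sum_stable_split:
  assumes "stabilizes w S" "A \<subseteq> S" "snd w ` A = A"
  shows "(\<Sum>D\<in>stable_subsets k S w. g D) =
    (\<Sum>a\<le>k. \<Sum>B\<in>stable_subsets a A w. \<Sum>C\<in>stable_subsets (k - a) (S - A) w. (g (B \<union> C) :: 'a::comm_monoid_add))"
proof -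
  have fin: "finite S" "finite A" using assms by (auto simp: stabilizes_def dest: finite_subset)
  have int: "snd w ` (D \<inter> A) = D \<inter> A" if "D \<subseteq> S" "snd w ` D = D" for D
    using image_Int_stable[OF assms(1), of D A] assms that by auto
  have dif: "snd w ` (D - A) = D - A" if "D \<subseteq> S" "snd w ` D = D" for D
    using image_Diff_stable[OF stabilizes_subset[OF assms(1)], of D "D \<inter> A"] that int[OF that]
    by (auto simp: Diff_Int2)
  have cd: "card (D - A) = card D - card (D \<inter> A)" "card (D \<inter> A) \<le> card D" if "D \<subseteq> S" for D
  proof -
    have "finite D" using fin that finite_subset by blast
    then show "card (D - A) = card D - card (D \<inter> A)" "card (D \<inter> A) \<le> card D"
      by (auto simp: card_Diff_subset_Int card_mono)
  qed
  have cu: "card (B \<union> C) = card B + card C" if "B \<subseteq> A" "C \<subseteq> S - A" for B C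
    using that fin by (intro card_Un_disjoint) (auto dest: finite_subset)
  define Y where "Y = Sigma {..k} (\<lambda>a. Sigma (stable_subsets a A w) (\<lambda>_. stable_subsets (k - a) (S - A) w))"
  have Y: "x \<in> Y \<longleftrightarrow> fst x \<le> k \<and> fst (snd x) \<in> stable_subsets (fst x) A w \<and>
      snd (snd x) \<in> stable_subsets (k - fst x) (S - A) w" for x
    unfolding Y_def by (cases x) auto
  have "(\<Sum>D\<in>stable_subsets k S w. g D) = (\<Sum>x\<in>Y. g (fst (snd x) \<union> snd (snd x)))"
  proof (rule sum.reindex_bij_witness[of _ "\<lambda>x. fst (snd x) \<union> snd (snd x)" "\<lambda>D. (card (D \<inter> A), D \<inter> A, D - A)"], goal_cases)
    case (1 D)
    then show ?case by auto
  next
    case (2 D)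
    then have D: "D \<subseteq> S" "card D = k" "snd w ` D = D" by (auto simp: stable_subsets_def)
    show ?case unfolding Y using D int[OF D(1,3)] dif[OF D(1,3)] cd[OF D(1)]
      by (simp add: stable_subsets_def) blast
  next
    case (3 x)
    then have B: "fst (snd x) \<subseteq> A" "snd (snd x) \<subseteq> S - A" "card (fst (snd x)) = fst x"
      by (auto simp: Y stable_subsets_def)
    have "(fst (snd x) \<union> snd (snd x)) \<inter> A = fst (snd x)" "fst (snd x) \<union> snd (snd x) - A = snd (snd x)"
      using B by blast+
    then show ?case using B(3) by (simp add: prod_eq_iff)
  next
    case (4 x)
    then have B: "fst (snd x) \<subseteq> A" "snd (snd x) \<subseteq> S - A" by (auto simp: Y stable_subsets_def)
    show ?case using 4 cu[OF B] assms(2) by (simp add: Y stable_subsets_def image_Un) blast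
  next
    case (5 D)
    then show ?case by (simp add: Int_Diff_Un)
  qed
  also have "\<dots> = (\<Sum>a\<le>k. \<Sum>B\<in>stable_subsets a A w. \<Sum>C\<in>stable_subsets (k - a) (S - A) w. g (B \<union> C))"
    unfolding Y_def sum.cartesian_product by (subst sum.Sigma) (use fin in \<open>auto simp: split_beta\<close>)
  finally show ?thesis .
qed

section \<open>Products of block characters\<close>

abbreviation total :: "(nat \<times> bool \<times> bool) list \<Rightarrow> nat"
  where "total \<kappa> \<equiv> sum_list (map fst \<kappa>)"

abbreviation xor_type :: "bool \<times> bool \<Rightarrow> bool \<times> bool \<Rightarrow> bool \<times> bool"
  where "xor_type \<theta> \<phi> \<equiv> (fst \<theta> \<noteq> fst \<phi>, snd \<theta> \<noteq> snd \<phi>)"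

lemma Diff_Un_eq: "S - (A \<union> B) = S - A - (B :: 'a set)"
  by blast

text \<open>
  On the smaller set \<open>B\<close> the two linear characters multiply, which adds their types modulo 2.
\<close>

lemma block_char_refine:
  assumes "stabilizes w S"
  shows "(\<Sum>A\<in>stable_subsets k S w. lin_char \<theta> A w * (\<Sum>B\<in>stable_subsets a A w. lin_char \<phi> B w) * block_char (S - A) \<kappa> w) =
    (if a \<le> k then block_char S ((a, xor_type \<theta> \<phi>) # (k - a, \<theta>) # \<kappa>) w else 0)"
proof (cases "a \<le> k")
  case True
  have "(\<Sum>A\<in>stable_subsets k S w. lin_char \<theta> A w * (\<Sum>B\<in>stable_subsets a A w. lin_char \<phi> B w) * block_char (S - A) \<kappa> w) =
     (\<Sum>A\<in>stable_subsets k S w. \<Sum>B\<in>stable_subsets a A w. lin_char \<theta> A w * lin_char \<phi> B w * block_char (S - A) \<kappa> w)"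
    by (simp add: sum_distrib_left sum_distrib_right)
  also have "\<dots> = (\<Sum>B\<in>stable_subsets a S w. \<Sum>C\<in>stable_subsets (k - a) (S - B) w.
      lin_char \<theta> (B \<union> C) w * lin_char \<phi> B w * block_char (S - (B \<union> C)) \<kappa> w)"
    by (rule sum_stable_refine[OF assms True])
  also have "\<dots> = (\<Sum>B\<in>stable_subsets a S w. \<Sum>C\<in>stable_subsets (k - a) (S - B) w.
      lin_char (xor_type \<theta> \<phi>) B w * (lin_char \<theta> C w * block_char (S - B - C) \<kappa> w))"
  proof (intro sum.cong refl)
    fix B C assume B: "B \<in> stable_subsets a S w" and C: "C \<in> stable_subsets (k - a) (S - B) w"
    have sB: "stabilizes w B" using stabilizes_subset[OF assms] stable_subsetsD[OF B] by blast
    have sC: "stabilizes w C" using stabilizes_subset[OF assms, of C] stable_subsetsD[OF C] by blast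
    have "B \<inter> C = {}" using stable_subsetsD[OF C] by blast
    then have "lin_char \<theta> (B \<union> C) w = lin_char \<theta> B w * lin_char \<theta> C w" by (rule lin_char_Un[OF sB sC])
    then show "lin_char \<theta> (B \<union> C) w * lin_char \<phi> B w * block_char (S - (B \<union> C)) \<kappa> w =
        lin_char (xor_type \<theta> \<phi>) B w * (lin_char \<theta> C w * block_char (S - B - C) \<kappa> w)"
      using Diff_Un_eq[of S B C] by (simp only: lin_char_xor[OF sB, symmetric] mult_ac)
  qed
  also have "\<dots> = block_char S ((a, xor_type \<theta> \<phi>) # (k - a, \<theta>) # \<kappa>) w"
    by (simp add: sum_distrib_left)
  finally show ?thesis using True by simp
next
  case False
  have "stable_subsets a A w = {}" if "A \<in> stable_subsets k S w" for A
  proof -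
    have "finite A" "card A = k" using that assms by (auto simp: stable_subsets_def stabilizes_def dest: finite_subset)
    then show ?thesis using False card_mono[of A] by (fastforce simp: stable_subsets_def)
  qed
  then show ?thesis using False by simp
qed

text \<open>
  Mackey's rule. A \<open>k\<close>-set \<open>D\<close> meets the first block of \<open>\<kappa>\<close> in \<open>a\<close> points; for \<open>a > 0\<close> these points cut that
  block in two, and the total size of all blocks is then smaller than if \<open>D\<close> had been disjoint from
  it. The family with the new block disjoint from all others is the only one of maximal total size. The list
  \<open>L\<close> depends on the sizes and types only, which is why it is chosen before \<open>S\<close> and \<open>w\<close>.
\<close>

lemma block_char_times:
  "\<exists>L. (\<forall>\<kappa>'\<in>set L. total \<kappa>' < k + total \<kappa>) \<and> (\<forall>S w. stabilizes w S \<longrightarrow>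
     block_char S [(k, \<phi>)] w * block_char S \<kappa> w =
     block_char S ((k, \<phi>) # \<kappa>) w + (\<Sum>\<kappa>'\<leftarrow>L. block_char S \<kappa>' w))"
proof (induction \<kappa> arbitrary: k)
  case Nil
  show ?case by (rule exI[of _ "[]"]) simp
next
  case (Cons c \<kappa>)
  obtain l \<theta> where c: "c = (l, \<theta>)" by (cases c)
  obtain M where M: "\<And>k \<kappa>'. \<kappa>' \<in> set (M k) \<Longrightarrow> total \<kappa>' < k + total \<kappa>"
    and M': "\<And>k S w. stabilizes w S \<Longrightarrow> block_char S [(k, \<phi>)] w * block_char S \<kappa> w =
     block_char S ((k, \<phi>) # \<kappa>) w + (\<Sum>\<kappa>'\<leftarrow>M k. block_char S \<kappa>' w)"
    using Cons.IH by metis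
  \<comment> \<open>terms in which \<open>D\<close> meets the first block in \<open>a\<close> points; \<open>a = 0\<close> is counted separately\<close>
  define N where "N a = (if a \<le> l then map (\<lambda>\<kappa>'. (a, xor_type \<theta> \<phi>) # (l - a, \<theta>) # \<kappa>')
      (((k - a, \<phi>) # \<kappa>) # M (k - a)) else [])" for a
  define L where "L = map (\<lambda>\<kappa>'. (l, \<theta>) # \<kappa>') (M k) @ concat (map N [1..<Suc k])"
  have "total \<kappa>' < k + total (c # \<kappa>)" if "\<kappa>' \<in> set L" for \<kappa>'
  proof -
    consider \<mu> where "\<mu> \<in> set (M k)" "\<kappa>' = (l, \<theta>) # \<mu>" | a where "1 \<le> a" "a \<le> k" "\<kappa>' \<in> set (N a)"
      using \<open>\<kappa>' \<in> set L\<close> unfolding L_def by auto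
    then show ?thesis
    proof cases
      case 1
      then show ?thesis using M[of \<mu> k] by (simp add: c)
    next
      case 2
      then show ?thesis using M[of _ "k - a"] by (fastforce simp: c N_def split: if_splits)
    qed
  qed
  moreover have "block_char S [(k, \<phi>)] w * block_char S (c # \<kappa>) w =
     block_char S ((k, \<phi>) # c # \<kappa>) w + (\<Sum>\<kappa>'\<leftarrow>L. block_char S \<kappa>' w)" if st: "stabilizes w S" for S w
  proof -
    define F where "F a A = (\<Sum>B\<in>stable_subsets a A w. lin_char \<phi> B w)" for a A
    define Q where "Q a = ((k - a, \<phi>) # \<kappa>) # M (k - a)" for a
    have F: "F k S = (\<Sum>a\<le>k. F a A * F (k - a) (S - A))" if "A \<in> stable_subsets l S w" for A
    proof -
      note A = stable_subsetsD[OF that]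
      have "F k S = (\<Sum>a\<le>k. \<Sum>B\<in>stable_subsets a A w. \<Sum>C\<in>stable_subsets (k - a) (S - A) w. lin_char \<phi> (B \<union> C) w)"
        unfolding F_def by (rule sum_stable_split[OF st A(1,3)])
      also have "\<dots> = (\<Sum>a\<le>k. \<Sum>B\<in>stable_subsets a A w. \<Sum>C\<in>stable_subsets (k - a) (S - A) w. lin_char \<phi> B w * lin_char \<phi> C w)"
      proof (intro sum.cong refl)
        fix a B C assume B: "B \<in> stable_subsets a A w" and C: "C \<in> stable_subsets (k - a) (S - A) w"
        show "lin_char \<phi> (B \<union> C) w = lin_char \<phi> B w * lin_char \<phi> C w"
          using stable_subsetsD[OF B] stable_subsetsD[OF C] A
          by (intro lin_char_Un stabilizes_subset[OF st]) auto
      qed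
      also have "\<dots> = (\<Sum>a\<le>k. F a A * F (k - a) (S - A))"
        by (simp add: F_def sum_product)
      finally show ?thesis .
    qed
    have IH: "F (k - a) (S - A) * block_char (S - A) \<kappa> w = (\<Sum>\<kappa>'\<leftarrow>Q a. block_char (S - A) \<kappa>' w)"
      if "A \<in> stable_subsets l S w" for a A
      using M'[of w "S - A" "k - a"] stabilizes_Diff[OF st, of A] stable_subsetsD[OF that]
      by (simp add: F_def Q_def)
    have pull: "(\<Sum>A\<in>stable_subsets l S w. lin_char \<theta> A w * F a A * (\<Sum>\<kappa>'\<leftarrow>K. block_char (S - A) \<kappa>' w)) =
        (\<Sum>\<kappa>'\<leftarrow>K. if a \<le> l then block_char S ((a, xor_type \<theta> \<phi>) # (l - a, \<theta>) # \<kappa>') w else 0)" for a K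
    proof (induction K)
      case (Cons \<mu> K)
      then show ?case using block_char_refine[OF st, where k = l and a = a and \<theta> = \<theta> and \<phi> = \<phi> and \<kappa> = \<mu>]
        by (simp add: F_def distrib_left sum.distrib del: block_char.simps)
    qed simp
    have "block_char S [(k, \<phi>)] w * block_char S (c # \<kappa>) w =
        F k S * (\<Sum>A\<in>stable_subsets l S w. lin_char \<theta> A w * block_char (S - A) \<kappa> w)"
      by (simp add: F_def c)
    also have "\<dots> = (\<Sum>A\<in>stable_subsets l S w. lin_char \<theta> A w * (\<Sum>a\<le>k. F a A * F (k - a) (S - A)) * block_char (S - A) \<kappa> w)"
      using F by (simp add: sum_distrib_left mult_ac)
    also have "\<dots> = (\<Sum>A\<in>stable_subsets l S w. \<Sum>a\<le>k. lin_char \<theta> A w * F a A * (F (k - a) (S - A) * block_char (S - A) \<kappa> w))"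
      by (simp add: sum_distrib_left sum_distrib_right mult_ac)
    also have "\<dots> = (\<Sum>a\<le>k. \<Sum>A\<in>stable_subsets l S w. lin_char \<theta> A w * F a A * (F (k - a) (S - A) * block_char (S - A) \<kappa> w))"
      by (rule sum.swap)
    also have "\<dots> = (\<Sum>a\<le>k. \<Sum>A\<in>stable_subsets l S w. lin_char \<theta> A w * F a A * (\<Sum>\<kappa>'\<leftarrow>Q a. block_char (S - A) \<kappa>' w))"
      using IH by (intro sum.cong refl) simp
    also have "\<dots> = (\<Sum>a\<le>k. \<Sum>\<kappa>'\<leftarrow>Q a. if a \<le> l then block_char S ((a, xor_type \<theta> \<phi>) # (l - a, \<theta>) # \<kappa>') w else 0)"
      by (simp only: pull)
    also have "\<dots> = (\<Sum>a\<le>k. \<Sum>\<kappa>'\<leftarrow>N a. block_char S \<kappa>' w)"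
      by (intro sum.cong refl) (auto simp: N_def Q_def o_def simp del: block_char.simps)
    also have "\<dots> = (\<Sum>\<kappa>'\<leftarrow>N 0. block_char S \<kappa>' w) + (\<Sum>a\<leftarrow>[1..<Suc k]. \<Sum>\<kappa>'\<leftarrow>N a. block_char S \<kappa>' w)"
    proof -
      have "{..k} = insert 0 {1..<Suc k}" by auto
      then show ?thesis by (simp add: sum_list_distinct_conv_sum_set del: upt_Suc)
    qed
    also have "(\<Sum>a\<leftarrow>[1..<Suc k]. \<Sum>\<kappa>'\<leftarrow>N a. block_char S \<kappa>' w) = (\<Sum>\<kappa>'\<leftarrow>concat (map N [1..<Suc k]). block_char S \<kappa>' w)"
      by (induction k) simp_all
    also have "(\<Sum>\<kappa>'\<leftarrow>N 0. block_char S \<kappa>' w) = (\<Sum>\<kappa>'\<leftarrow>Q 0. block_char S ((l, \<theta>) # \<kappa>') w)"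
      using st by (simp add: N_def Q_def block_char_0 o_def stabilizes_def del: block_char.simps)
    also have "\<dots> = block_char S ((l, \<theta>) # (k, \<phi>) # \<kappa>) w + (\<Sum>\<kappa>'\<leftarrow>map (\<lambda>\<kappa>'. (l, \<theta>) # \<kappa>') (M k). block_char S \<kappa>' w)"
      by (simp add: Q_def o_def del: block_char.simps)
    also have "block_char S ((l, \<theta>) # (k, \<phi>) # \<kappa>) w = block_char S ((k, \<phi>) # c # \<kappa>) w"
      unfolding c by (rule block_char_swap[OF st])
    finally show ?thesis by (simp add: L_def del: block_char.simps upt_Suc)
  qed
  ultimately show ?case by blast
qed

section \<open>The ring generated by the one-block sign characters\<close>

text \<open>
  A finite set without proper nonempty stable subsets is a single orbit, hence a cycle through the iterates
  of any point.
\<close>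

lemma cycle_enumeration:
  assumes "finite C" "C \<noteq> {}" "bij_betw \<sigma> C C" "\<And>B. B \<subseteq> C \<Longrightarrow> \<sigma> ` B = B \<Longrightarrow> B = {} \<or> B = C"
  shows "\<exists>cs. distinct cs \<and> set cs = C \<and> map \<sigma> cs = rotate1 cs"
proof -
  obtain x where x: "x \<in> C" using assms(2) by blast
  define f where "f i = (\<sigma> ^^ i) x" for i
  have fC: "f i \<in> C" for i
    by (induction i) (use x assms(3) in \<open>auto simp: f_def bij_betw_def\<close>)
  have cancel: "f d = x" if "f (i + d) = f i" for i d
    using that
  proof (induction i)
    case (Suc i)
    have "\<sigma> (f (i + d)) = \<sigma> (f i)" using Suc.prems by (simp add: f_def)
    then have "f (i + d) = f i" using assms(3) fC by (auto simp: bij_betw_def inj_on_def)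
    then show ?case by (rule Suc.IH)
  qed (simp add: f_def)
  have "\<not> inj f" using assms(1) fC finite_imageD[of f UNIV] finite_subset[of "range f" C]
    by (metis image_subsetI infinite_UNIV_nat)
  then obtain i j where "i < j" "f i = f j" by (metis injI linorder_neqE_nat)
  then have "\<exists>m. 0 < m \<and> f m = x" using cancel[of i "j - i"] by (intro exI[of _ "j - i"]) auto
  then obtain m where m: "0 < m" "f m = x" and min: "\<And>k. k < m \<Longrightarrow> 0 < k \<Longrightarrow> f k \<noteq> x"
    using exists_least_iff[of "\<lambda>m. 0 < m \<and> f m = x"] by blast
  define cs where "cs = map f [0..<m]"
  have "inj_on f {0..<m}"
  proof (rule linorder_inj_onI')
    fix i j assume ij: "i \<in> {0..<m}" "j \<in> {0..<m}" "i < j"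
    show "f i \<noteq> f j" using cancel[of i "j - i"] min[of "j - i"] ij by auto
  qed
  then have d: "distinct cs" by (simp add: cs_def distinct_map)
  have "map \<sigma> cs = map f [Suc 0..<Suc m]"
    by (simp add: cs_def map_Suc_upt[symmetric] f_def del: upt_Suc)
  also have "\<dots> = map f [Suc 0..<m] @ [f 0]" using m by (simp add: f_def)
  also have "\<dots> = rotate1 cs" using m(1) by (simp add: cs_def upt_conv_Cons)
  finally have r: "map \<sigma> cs = rotate1 cs" .
  have "\<sigma> ` set cs = set cs" by (metis r set_map set_rotate1)
  moreover have "set cs \<subseteq> C" "set cs \<noteq> {}" using fC m by (auto simp: cs_def)
  ultimately have "set cs = C" using assms(4) by blast
  then show ?thesis using d r by blast
qed

lemma sign_cycle_of_list:
  "distinct cs \<Longrightarrow> cs \<noteq> [] \<Longrightarrow> sign (cycle_of_list cs) = (-1) ^ (length cs - 1)"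
proof (induction cs rule: cycle_of_list.induct)
  case (1 i j cs)
  have "sign (cycle_of_list (i # j # cs)) = sign (Transposition.transpose i j) * sign (cycle_of_list (j # cs))"
    unfolding cycle_of_list.simps by (rule sign_compose[OF permutation_swap_id permutation_of_cycle])
  also have "\<dots> = (-1) ^ (length (i # j # cs) - 1)" using 1 by (simp add: sign_swap_id)
  finally show ?case .
qed simp_all

lemma sign_on_cycle:
  assumes "distinct cs" "cs \<noteq> []" "map \<sigma> cs = rotate1 cs"
  shows "sign_on (set cs) \<sigma> = (-1) ^ (length cs - 1)"
proof -
  have "map (cycle_of_list cs) cs = map \<sigma> cs" using cyclic_rotation[OF assms(1), of 1] assms(3) by simp
  then have "restrict_id \<sigma> (set cs) = cycle_of_list cs"
    by (auto simp: fun_eq_iff restrict_id_def id_outside_supp)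
  then show ?thesis using sign_cycle_of_list[OF assms(1,2)] by (simp add: sign_on_def)
qed

text \<open>
  Adding a fixed cycle \<open>C\<close> to a stable set that avoids it is a bijection onto the stable sets that contain
  \<open>C\<close>, and it changes the sign of the summand, since \<open>(-1)\<^bsup>|C|\<^esup>\<close> times the sign of a cycle of length \<open>|C|\<close> is
  \<open>-1\<close>. This is the identity \<open>\<Sum> (-1)\<^sup>i e\<^sub>i h\<^bsub>m-i\<^esub> = 0\<close>.
\<close>

lemma alternating_sum_stable_subsets:
  assumes "stabilizes w S" "S \<noteq> {}"
  shows "(\<Sum>B | B \<subseteq> S \<and> snd w ` B = B. (-1) ^ card B * sign_on B (snd w)) = 0"
proof -
  define T where "T = {B. B \<subseteq> S \<and> snd w ` B = B}"
  have fin: "finite S" "finite T" using assms by (auto simp: stabilizes_def T_def)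
  have "S \<in> T - {{}}" using assms by (auto simp: T_def stabilizes_def bij_betw_def)
  \<comment> \<open>a minimal nonempty stable set is a cycle\<close>
  then have "\<exists>C\<in>T - {{}}. \<forall>B\<in>T - {{}}. B \<subseteq> C \<longrightarrow> C = B"
    using fin by (intro finite_has_minimal) auto
  then obtain C where C: "C \<in> T" "C \<noteq> {}" and min: "\<And>B. B \<in> T \<Longrightarrow> B \<noteq> {} \<Longrightarrow> B \<subseteq> C \<Longrightarrow> B = C"
    by (metis Diff_iff insertCI insertE empty_iff)
  have stab: "stabilizes w B" if "B \<in> T" for B using stabilizes_subset[OF assms(1)] that by (auto simp: T_def)
  obtain cs where cs: "distinct cs" "set cs = C" "map (snd w) cs = rotate1 cs"
  proof -
    have CS: "C \<subseteq> S" using C by (simp add: T_def)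
    have "\<exists>cs. distinct cs \<and> set cs = C \<and> map (snd w) cs = rotate1 cs"
    proof (rule cycle_enumeration)
      fix B assume "B \<subseteq> C" "snd w ` B = B"
      then have "B \<in> T" using CS by (auto simp: T_def)
      then show "B = {} \<or> B = C" using min \<open>B \<subseteq> C\<close> by blast
    qed (use stab[OF C(1)] C in \<open>auto simp: stabilizes_def\<close>)
    then show ?thesis using that by blast
  qed
  have "cs \<noteq> []" using C cs by auto
  then have "(-1) ^ length cs = - ((-1::int) ^ (length cs - 1))" by (cases cs) auto
  then have sgnC: "(-1) ^ card C * sign_on C (snd w) = (-1 :: int)"
    using sign_on_cycle[OF cs(1) \<open>cs \<noteq> []\<close> cs(3)] cs distinct_card[OF cs(1)] by (simp add: power_mult_distrib[symmetric])
  define g where "g B = (-1) ^ card B * sign_on B (snd w)" for B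
  define T0 where "T0 = {B \<in> T. B \<inter> C = {}}"
  have gU: "g (B \<union> C) = - g B" if "B \<in> T0" for B
  proof -
    have B: "B \<in> T" "B \<inter> C = {}" using that by (auto simp: T0_def)
    have f: "finite B" "finite C" using stab[OF B(1)] stab[OF C(1)] by (auto simp: stabilizes_def)
    have "g (B \<union> C) = g B * ((-1) ^ card C * sign_on C (snd w))"
      using sign_on_Un[of B C "snd w"] stab[OF B(1)] stab[OF C(1)] B f
      by (simp add: g_def card_Un_disjoint power_add stabilizes_def)
    then show ?thesis using sgnC by simp
  qed
  have "T = T0 \<union> (\<lambda>B. B \<union> C) ` T0"
  proof (intro equalityI subsetI)
    fix B assume B: "B \<in> T"
    have BC: "B \<inter> C \<in> T" using image_Int_stable[OF assms(1), of B C] B C by (auto simp: T_def)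
    show "B \<in> T0 \<union> (\<lambda>B. B \<union> C) ` T0"
    proof (cases "B \<inter> C = {}")
      case False
      then have "C \<subseteq> B" using min[OF BC] by auto
      have "snd w ` (B - C) = B - C" using image_Diff_stable[OF stab[OF B] \<open>C \<subseteq> B\<close>] C by (auto simp: T_def)
      then have "B - C \<in> T0" using B by (auto simp: T0_def T_def)
      moreover have "B = (B - C) \<union> C" using \<open>C \<subseteq> B\<close> by auto
      ultimately show ?thesis by blast
    qed (use B in \<open>auto simp: T0_def\<close>)
  next
    fix B assume "B \<in> T0 \<union> (\<lambda>B. B \<union> C) ` T0"
    then show "B \<in> T" using C by (auto simp: T0_def T_def image_Un)
  qed
  moreover have "T0 \<inter> (\<lambda>B. B \<union> C) ` T0 = {}" using C by (auto simp: T0_def)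
  moreover have "finite T0" using fin by (simp add: T0_def)
  ultimately have "sum g T = sum g T0 + sum g ((\<lambda>B. B \<union> C) ` T0)"
    by (simp add: sum.union_disjoint)
  also have "sum g ((\<lambda>B. B \<union> C) ` T0) = (\<Sum>B\<in>T0. g (B \<union> C))"
    by (rule sum.reindex_cong[of "\<lambda>B. B \<union> C"]) (auto simp: inj_on_def T0_def)
  also have "\<dots> = - sum g T0" using gU by (simp add: sum_negf)
  finally show ?thesis by (simp add: T_def g_def)
qed

text \<open>
  Replaces a block without sign by blocks with sign, of which at least one is nonempty; this solves the
  alternating identity for its term \<open>i = 0\<close>.
\<close>

lemma block_char_untwist:
  assumes st: "stabilizes w S" and k: "k > 0"
  shows "block_char S ((k, False, b) # \<kappa>) w =
    - (\<Sum>i=1..k. (-1) ^ i * block_char S ((i, True, b) # (k - i, False, b) # \<kappa>) w)"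
proof -
  have fin: "finite S" using st by (simp add: stabilizes_def)
  define g where "g A = lin_char (False, b) A w * block_char (S - A) \<kappa> w" for A
  have zero: "(\<Sum>i\<le>k. \<Sum>B\<in>stable_subsets i A w. (-1) ^ i * lin_char (True, False) B w) = 0"
    if "A \<in> stable_subsets k S w" for A
  proof -
    note A = stable_subsetsD[OF that]
    have fA: "finite A" using A fin finite_subset by blast
    have "(\<Sum>i\<le>k. \<Sum>B\<in>stable_subsets i A w. (-1) ^ i * lin_char (True, False) B w) =
       (\<Sum>i\<le>k. \<Sum>B | B \<in> {B. B \<subseteq> A \<and> snd w ` B = B} \<and> card B = i. (-1) ^ card B * sign_on B (snd w))"
      by (intro sum.cong) (auto simp: stable_subsets_def lin_char_def)
    also have "\<dots> = (\<Sum>B | B \<subseteq> A \<and> snd w ` B = B. (-1) ^ card B * sign_on B (snd w))"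
      by (rule sum.group) (use fA A card_mono in auto)
    also have "\<dots> = 0"
      using alternating_sum_stable_subsets[OF stabilizes_subset[OF st A(1,3)]] A k by fastforce
    finally show ?thesis .
  qed
  have "(\<Sum>i\<le>k. (-1) ^ i * block_char S ((i, True, b) # (k - i, False, b) # \<kappa>) w) =
      (\<Sum>i\<le>k. (-1) ^ i * (\<Sum>A\<in>stable_subsets k S w. lin_char (False, b) A w * (\<Sum>B\<in>stable_subsets i A w. lin_char (True, False) B w) * block_char (S - A) \<kappa> w))"
    using block_char_refine[OF st, where \<theta> = "(False, b)" and \<phi> = "(True, False)" and k = k and \<kappa> = \<kappa>]
    by (intro sum.cong refl) simp
  also have "\<dots> = (\<Sum>i\<le>k. \<Sum>A\<in>stable_subsets k S w. g A * (\<Sum>B\<in>stable_subsets i A w. (-1) ^ i * lin_char (True, False) B w))"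
    by (simp add: g_def sum_distrib_left mult_ac)
  also have "\<dots> = (\<Sum>A\<in>stable_subsets k S w. \<Sum>i\<le>k. g A * (\<Sum>B\<in>stable_subsets i A w. (-1) ^ i * lin_char (True, False) B w))"
    by (rule sum.swap)
  also have "\<dots> = (\<Sum>A\<in>stable_subsets k S w. g A * (\<Sum>i\<le>k. \<Sum>B\<in>stable_subsets i A w. (-1) ^ i * lin_char (True, False) B w))"
    by (simp add: sum_distrib_left)
  also have "\<dots> = 0" using zero by simp
  also have "{..k} = insert 0 {1..k}" by auto
  finally show ?thesis
    using fin by (simp add: block_char_0 del: block_char.simps)
qed

text \<open>
  Rings of functions whose values outside \<open>signed_perms S\<close> are irrelevant. Subtraction and 1 give all
  integral combinations.
\<close>

locale function_ring =
  fixes S :: "nat set" and \<A> :: "(sperm \<Rightarrow> 'a::comm_ring_1) set"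
  assumes finite: "finite S"
    and one: "(\<lambda>_. 1) \<in> \<A>"
    and diff: "f \<in> \<A> \<Longrightarrow> g \<in> \<A> \<Longrightarrow> (\<lambda>w. f w - g w) \<in> \<A>"
    and mult: "f \<in> \<A> \<Longrightarrow> g \<in> \<A> \<Longrightarrow> (\<lambda>w. f w * g w) \<in> \<A>"
    and cong: "f \<in> \<A> \<Longrightarrow> (\<And>w. w \<in> signed_perms S \<Longrightarrow> f w = g w) \<Longrightarrow> g \<in> \<A>"
begin

lemma zero: "(\<lambda>_. 0) \<in> \<A>" using diff[OF one one] by simp

lemma uminus: "f \<in> \<A> \<Longrightarrow> (\<lambda>w. - f w) \<in> \<A>" using diff[OF zero] by simp

lemma add: "f \<in> \<A> \<Longrightarrow> g \<in> \<A> \<Longrightarrow> (\<lambda>w. f w + g w) \<in> \<A>" using diff[OF _ uminus] by fastforce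

lemma sum: "(\<And>i. i \<in> I \<Longrightarrow> f i \<in> \<A>) \<Longrightarrow> (\<lambda>w. \<Sum>i\<in>I. f i w) \<in> \<A>"
  by (induction I rule: infinite_finite_induct) (auto simp: zero intro: add)

lemma sum_list: "(\<And>i. i \<in> set xs \<Longrightarrow> f i \<in> \<A>) \<Longrightarrow> (\<lambda>w. \<Sum>i\<leftarrow>xs. f i w) \<in> \<A>"
  by (induction xs) (auto simp: zero intro: add)

lemma of_int: "(\<lambda>_. of_int c) \<in> \<A>"
proof -
  have *: "(\<lambda>_. of_nat n) \<in> \<A>" for n by (induction n) (auto simp: zero one intro: add)
  show ?thesis by (cases c) (use * uminus[OF *] in \<open>auto simp del: of_nat_Suc\<close>)
qed

text \<open>
  Induction on the total size of the blocks. A nonempty first block of sign type is split off by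
  \<open>block_char_times\<close>, whose error terms are smaller. A first block without sign is turned into one of sign
  type by \<open>block_char_untwist\<close>, which preserves the total size.
\<close>

lemma block_char_in:
  assumes gen: "\<And>k b. (\<lambda>w. of_int (block_char S [(k, True, b)] w)) \<in> \<A>"
  shows "(\<lambda>w. of_int (block_char S \<kappa> w)) \<in> \<A>"
proof (induction "total \<kappa>" arbitrary: \<kappa> rule: less_induct)
  case less
  have head: "(\<lambda>w. of_int (block_char S ((k, True, b) # \<mu>) w)) \<in> \<A>" if "k > 0" "k + total \<mu> = total \<kappa>" for k b \<mu>
  proof -
    obtain L where L: "\<And>\<kappa>'. \<kappa>' \<in> set L \<Longrightarrow> total \<kappa>' < k + total \<mu>"
      and eq: "\<And>w. stabilizes w S \<Longrightarrow> block_char S [(k, True, b)] w * block_char S \<mu> w =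
        block_char S ((k, True, b) # \<mu>) w + (\<Sum>\<kappa>'\<leftarrow>L. block_char S \<kappa>' w)"
      using block_char_times[of k \<mu> "(True, b)"] by metis
    have "(\<lambda>w. of_int (block_char S [(k, True, b)] w) * of_int (block_char S \<mu> w) -
        (\<Sum>\<kappa>'\<leftarrow>L. of_int (block_char S \<kappa>' w))) \<in> \<A>"
      by (intro diff mult gen sum_list less) (use that L in auto)
    then show ?thesis
    proof (rule cong)
      fix w assume "w \<in> signed_perms S"
      then have "stabilizes w S" using finite by (rule stabilizes_signed_perm)
      from eq[OF this] have "of_int (block_char S [(k, True, b)] w) * of_int (block_char S \<mu> w) =
        (of_int (block_char S ((k, True, b) # \<mu>) w) + of_int (\<Sum>\<kappa>'\<leftarrow>L. block_char S \<kappa>' w) :: 'a)"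
        by (simp only: of_int_mult[symmetric] of_int_add[symmetric])
      moreover have "of_int (\<Sum>\<kappa>'\<leftarrow>L. block_char S \<kappa>' w) = (\<Sum>\<kappa>'\<leftarrow>L. of_int (block_char S \<kappa>' w) :: 'a)"
        by (induction L) auto
      ultimately show "of_int (block_char S [(k, True, b)] w) * of_int (block_char S \<mu> w) -
          (\<Sum>\<kappa>'\<leftarrow>L. of_int (block_char S \<kappa>' w)) = (of_int (block_char S ((k, True, b) # \<mu>) w) :: 'a)"
        by simp
    qed
  qed
  \<comment> \<open>removing empty leading blocks preserves the total size, hence this inner induction on the list\<close>
  have "total \<mu> = total \<kappa> \<longrightarrow> (\<lambda>w. of_int (block_char S \<mu> w)) \<in> \<A>" for \<mu>
  proof (induction \<mu>)
    case (Cons c \<mu>)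
    show ?case
    proof
      assume tot: "total (c # \<mu>) = total \<kappa>"
      obtain k a b where c: "c = (k, a, b)" by (cases c)
      consider "k = 0" | "k > 0" "a" | "k > 0" "\<not> a" by auto
      then show "(\<lambda>w. of_int (block_char S (c # \<mu>) w)) \<in> \<A>"
      proof cases
        case 1
        then show ?thesis using Cons tot finite by (simp add: c block_char_0 del: block_char.simps)
      next
        case 2
        then show ?thesis using head[of k \<mu> b] tot by (simp add: c del: block_char.simps)
      next
        case 3
        have "(\<lambda>w. - (\<Sum>i=1..k. of_int ((-1) ^ i) * of_int (block_char S ((i, True, b) # (k - i, False, b) # \<mu>) w))) \<in> \<A>"
          by (intro uminus sum mult of_int head) (use tot c in auto)
        then show ?thesis
        proof (rule cong)
          fix w assume "w \<in> signed_perms S"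
          then have "stabilizes w S" using finite by (rule stabilizes_signed_perm)
          from block_char_untwist[OF this 3(1), of b \<mu>] 3(2)
          show "- (\<Sum>i=1..k. of_int ((-1) ^ i) * of_int (block_char S ((i, True, b) # (k - i, False, b) # \<mu>) w)) =
              (of_int (block_char S (c # \<mu>) w) :: 'a)"
            by (simp add: c del: block_char.simps)
        qed
      qed
    qed
  qed (simp add: one)
  then show ?case by blast
qed

end

section \<open>Averages of block characters over a block\<close>

lemma signed_permsD:
  assumes "w \<in> signed_perms S"
  shows "snd w permutes S" "fst w i = 1 \<or> fst w i = -1" "i \<notin> S \<Longrightarrow> fst w i = 1" "i \<notin> S \<Longrightarrow> snd w i = i"
  using assms by (auto simp: signed_perms_def permutes_not_in)

lemma bij_betw_signed_perms:
  "bij_betw (\<lambda>(\<sigma>, N). (\<lambda>i. if i \<in> N then -1 else 1, \<sigma>)) (Sigma {\<sigma>. \<sigma> permutes S} (\<lambda>_. Pow S)) (signed_perms S)"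
proof (rule bij_betw_byWitness[where f' = "\<lambda>w. (snd w, {i. fst w i = -1})"], goal_cases)
  case 1
  show ?case by auto
next
  case 2
  show ?case
  proof
    fix w assume w: "w \<in> signed_perms S"
    have "(\<lambda>i. if fst w i = -1 then -1 else 1) = fst w"
      using signed_permsD(2)[OF w] by fastforce
    then show "(case (snd w, {i. fst w i = -1}) of (\<sigma>, N) \<Rightarrow> (\<lambda>i. if i \<in> N then -1 else 1, \<sigma>)) = w"
      by (simp add: prod_eq_iff)
  qed
next
  case 3
  show ?case by (auto simp: signed_perms_def)
next
  case 4
  show ?case
  proof
    fix p assume "p \<in> (\<lambda>w. (snd w, {i. fst w i = -1})) ` signed_perms S"
    then obtain w where w: "w \<in> signed_perms S" and p: "p = (snd w, {i. fst w i = -1})" by blast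
    have "{i. fst w i = -1} \<subseteq> S"
    proof
      fix i assume "i \<in> {i. fst w i = -1}"
      then show "i \<in> S" using signed_permsD(3)[OF w, of i] by fastforce
    qed
    then show "p \<in> Sigma {\<sigma>. \<sigma> permutes S} (\<lambda>_. Pow S)" using signed_permsD(1)[OF w] p by simp
  qed
qed

lemma finite_signed_perms [simp]: "finite S \<Longrightarrow> finite (signed_perms S)"
  using bij_betw_finite[OF bij_betw_signed_perms[of S]] by (simp add: finite_permutations)

lemma card_signed_perms:
  assumes "finite S" shows "card (signed_perms S) = fact (card S) * 2 ^ card S"
  using bij_betw_same_card[OF bij_betw_signed_perms[of S]] assms
  by (simp add: card_permutations[OF refl] card_Pow finite_permutations)

lemma sp_one_in [simp]: "sp_one \<in> signed_perms S"
  by (simp add: sp_one_def signed_perms_def)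

lemma signed_perms_mono: "S \<subseteq> T \<Longrightarrow> w \<in> signed_perms S \<Longrightarrow> w \<in> signed_perms T"
  by (auto simp: signed_perms_def permutes_subset)

lemma signed_perms_empty [simp]: "signed_perms {} = {sp_one}"
  by (auto simp: signed_perms_def sp_one_def prod_eq_iff)

lemma sp_mult_in:
  assumes "w \<in> signed_perms S" "v \<in> signed_perms S" shows "w \<star> v \<in> signed_perms S"
proof -
  have "snd w \<circ> snd v permutes S" using assms by (auto simp: signed_perms_def intro: permutes_compose)
  moreover have "fst v i * fst w (snd v i) = 1 \<or> fst v i * fst w (snd v i) = -1" for i
    using signed_permsD(2)[OF assms(1), of "snd v i"] signed_permsD(2)[OF assms(2), of i] by auto
  moreover have "fst v i * fst w (snd v i) = 1" if "i \<notin> S" for i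
    using that signed_permsD(3)[OF assms(1), of i] signed_permsD(3,4)[OF assms(2), of i] by auto
  ultimately show ?thesis by (simp add: sp_mult_def signed_perms_def)
qed

lemma sp_mult_assoc: "(u \<star> v) \<star> w = u \<star> (v \<star> w)"
  by (simp add: sp_mult_def o_assoc mult_ac)

lemma sp_mult_one [simp]: "sp_one \<star> w = w" "w \<star> sp_one = w"
  by (simp_all add: sp_mult_def sp_one_def)

text \<open>
  The two factors act on disjoint sets, so their product is read off factor by factor.
\<close>

lemma sp_mult_disjoint:
  assumes "u \<in> signed_perms R" "w \<in> signed_perms Q" "Q \<inter> R = {}"
  shows "fst (u \<star> w) i = (if i \<in> R then fst u i else fst w i)"
    "snd (u \<star> w) i = (if i \<in> R then snd u i else snd w i)"
proof -
  have "snd w i \<notin> R" if "i \<notin> R"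
    using that assms(3) permutes_in_image[OF signed_permsD(1)[OF assms(2)], of i] signed_permsD(4)[OF assms(2), of i]
    by (cases "i \<in> Q") auto
  then have "snd u (snd w i) = snd w i" "fst u (snd w i) = 1" if "i \<notin> R"
    using that signed_permsD[OF assms(1)] by auto
  moreover have "snd w i = i" "fst w i = 1" if "i \<in> R"
    using that assms(3) signed_permsD[OF assms(2)] by auto
  ultimately show "fst (u \<star> w) i = (if i \<in> R then fst u i else fst w i)"
    "snd (u \<star> w) i = (if i \<in> R then snd u i else snd w i)"
    by (auto simp: sp_mult_def)
qed

lemma sp_mult_commute:
  assumes "u \<in> signed_perms R" "w \<in> signed_perms Q" "Q \<inter> R = {}"
  shows "u \<star> w = w \<star> u"
proof -
  have "R \<inter> Q = {}" using assms by auto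
  then show ?thesis
    using assms(3) sp_mult_disjoint[OF assms] sp_mult_disjoint[OF assms(2,1)] signed_permsD[OF assms(1)] signed_permsD[OF assms(2)]
    by (intro prod_eqI ext) (auto simp: disjoint_iff)
qed

definition sp_restrict :: "nat set \<Rightarrow> sperm \<Rightarrow> sperm"
  where "sp_restrict A u = (\<lambda>i. if i \<in> A then fst u i else 1, restrict_id (snd u) A)"

lemma sp_restrict_in:
  assumes "stabilizes u A" "A \<subseteq> S" shows "sp_restrict A u \<in> signed_perms A"
  using assms by (auto simp: sp_restrict_def signed_perms_def stabilizes_def permutes_restrict_id)

text \<open>
  The stabilizer of \<open>A\<close> is the direct product of the groups on \<open>A\<close> and on its complement.
\<close>

lemma bij_betw_sp_mult_disjoint:
  assumes "finite R" "A \<subseteq> R"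
  shows "bij_betw (\<lambda>(u, v). u \<star> v) (Sigma (signed_perms A) (\<lambda>_. signed_perms (R - A)))
    {u \<in> signed_perms R. snd u ` A = A}"
proof (rule bij_betw_byWitness[where f' = "\<lambda>u. (sp_restrict A u, sp_restrict (R - A) u)"], goal_cases)
  case 1
  show ?case
  proof (intro ballI, goal_cases)
    case (1 p)
    obtain u v where p: "p = (u, v)" "u \<in> signed_perms A" "v \<in> signed_perms (R - A)" using 1 by auto
    have d: "(R - A) \<inter> A = {}" by auto
    have "sp_restrict A (u \<star> v) = u" "sp_restrict (R - A) (u \<star> v) = v"
      using sp_mult_disjoint[OF p(2,3) d] signed_permsD[OF p(2)] signed_permsD[OF p(3)]
      by (auto simp: sp_restrict_def prod_eq_iff fun_eq_iff restrict_id_def)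
    then show ?case using p by simp
  qed
next
  case 2
  show ?case
  proof (intro ballI, goal_cases)
    case (1 u)
    then have u: "u \<in> signed_perms R" "snd u ` A = A" by auto
    have st: "stabilizes u R" using stabilizes_signed_perm[OF u(1) assms(1)] .
    have a: "sp_restrict A u \<in> signed_perms A" "sp_restrict (R - A) u \<in> signed_perms (R - A)"
      using sp_restrict_in[OF stabilizes_subset[OF st assms(2) u(2)]] sp_restrict_in[OF stabilizes_Diff[OF st assms(2) u(2)]] by auto
    have d: "(R - A) \<inter> A = {}" by auto
    show ?case using sp_mult_disjoint[OF a d] signed_permsD[OF u(1)]
      by (auto simp: prod_eq_iff fun_eq_iff sp_restrict_def restrict_id_def)
  qed
next
  case 3
  show ?case
  proof (intro image_subsetI, goal_cases)
    case (1 p)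
    obtain u v where p: "p = (u, v)" "u \<in> signed_perms A" "v \<in> signed_perms (R - A)" using 1 by auto
    have d: "(R - A) \<inter> A = {}" by auto
    have "u \<star> v \<in> signed_perms R"
      by (rule sp_mult_in; rule signed_perms_mono[of _ R]) (use p assms in auto)
    moreover have "snd (u \<star> v) ` A = snd u ` A" using sp_mult_disjoint[OF p(2,3) d] by (intro image_cong) auto
    moreover have "\<dots> = A" using signed_permsD(1)[OF p(2)] by (rule permutes_image)
    ultimately show ?case using p by simp
  qed
next
  case 4
  show ?case
  proof (intro image_subsetI, goal_cases)
    case (1 u)
    then have u: "u \<in> signed_perms R" "snd u ` A = A" by auto
    have st: "stabilizes u R" using stabilizes_signed_perm[OF u(1) assms(1)] .
    then show ?case
      using sp_restrict_in[OF stabilizes_subset[OF st assms(2) u(2)]] sp_restrict_in[OF stabilizes_Diff[OF st assms(2) u(2)]] by auto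
  qed
qed

text \<open>
  Orthogonality of the linear characters \<open>\<epsilon>\<^sup>b\<close> and \<open>sgn \<sqdot> \<epsilon>\<^sup>c\<close>. They agree only on groups of degree at most 1,
  since a transposition separates them in degree 2 and more.
\<close>

lemma sum_lin_char_sign:
  assumes "finite B"
  shows "(\<Sum>u\<in>signed_perms B. lin_char (False, b) B u * lin_char (True, c) B u) =
    (if card B = 0 then 1 else if card B = 1 \<and> b = c then 2 else 0)"
proof -
  have eq: "(\<Sum>u\<in>signed_perms B. lin_char (False, b) B u * lin_char (True, c) B u) =
      (\<Sum>u\<in>signed_perms B. lin_char (True, b \<noteq> c) B u)"
    using lin_char_xor[OF stabilizes_signed_perm[OF _ assms], of _ "(False, b)" "(True, c)"]
    by (intro sum.cong refl) simp
  consider "card B = 0" | "card B = 1" | "card B \<ge> 2" by linarith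
  then show ?thesis
  proof cases
    case 1
    then show ?thesis using assms by simp
  next
    case 2
    then obtain i where B: "B = {i}" by (auto simp: card_1_singleton_iff)
    define e where "e = (\<lambda>j. if j = i then -1 else (1::int), id :: nat \<Rightarrow> nat)"
    have ne: "sp_one \<noteq> e" by (auto simp: e_def sp_one_def fun_eq_iff)
    have ein: "e \<in> signed_perms B" by (auto simp: signed_perms_def e_def B)
    have "signed_perms B = {sp_one, e}"
      using card_seteq[of "signed_perms B" "{sp_one, e}"] card_signed_perms[OF assms] ne ein 2 assms by auto
    then have "(\<Sum>u\<in>signed_perms B. lin_char (True, b \<noteq> c) B u) = lin_char (True, b \<noteq> c) B sp_one + lin_char (True, b \<noteq> c) B e"
      using ne by simp
    also have "\<dots> = (if b = c then 2 else 0)" by (auto simp: lin_char_def sp_one_def e_def B)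
    finally show ?thesis using eq 2 by simp
  next
    case 3
    then obtain i j where ij: "i \<in> B" "j \<in> B" "i \<noteq> j"
    proof -
      have "\<not> card B \<le> Suc 0" using 3 by simp
      then show ?thesis using card_le_Suc0_iff_eq[OF assms] that by blast
    qed
    define t where "t = (\<lambda>_::nat. 1::int, Transposition.transpose i j)"
    have t: "t \<in> signed_perms B" using ij by (simp add: t_def signed_perms_def permutes_swap_id)
    have tt: "t \<star> (t \<star> u) = u" for u by (auto simp: t_def sp_mult_def prod_eq_iff fun_eq_iff)
    have "lin_char (True, b \<noteq> c) B (t \<star> u) = - lin_char (True, b \<noteq> c) B u" if "u \<in> signed_perms B" for u
    proof -
      have "bij_betw (snd u) B B" "bij_betw (Transposition.transpose i j) B B"
        using that ij by (auto simp: signed_perms_def permutes_imp_bij permutes_swap_id)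
      then have "sign_on B (Transposition.transpose i j \<circ> snd u) = - sign_on B (snd u)"
        using sign_on_compose[of "Transposition.transpose i j" B "snd u"] ij assms by (simp add: sign_on_transpose)
      then show ?thesis by (simp add: lin_char_def sp_mult_def t_def)
    qed
    then have "(\<Sum>u\<in>signed_perms B. lin_char (True, b \<noteq> c) B (t \<star> u)) = - (\<Sum>u\<in>signed_perms B. lin_char (True, b \<noteq> c) B u)"
      by (simp add: sum_negf)
    moreover have "(\<Sum>u\<in>signed_perms B. lin_char (True, b \<noteq> c) B (t \<star> u)) = (\<Sum>u\<in>signed_perms B. lin_char (True, b \<noteq> c) B u)"
      by (rule sum.reindex_bij_witness[of _ "(\<star>) t" "(\<star>) t"]) (auto simp: tt sp_mult_in[OF t])
    ultimately show ?thesis using eq 3 by auto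
  qed
qed

text \<open>
  All ways to remove one point from each of \<open>r\<close> different nonempty columns of colour \<open>b\<close>: the effect of
  averaging over a block of \<open>r\<close> points.
\<close>

fun shrink :: "bool \<Rightarrow> nat \<Rightarrow> (nat \<times> bool \<times> bool) list \<Rightarrow> (nat \<times> bool \<times> bool) list list"
  where
    "shrink b r [] = (if r = 0 then [[]] else [])"
  | "shrink b r ((k, \<theta>) # \<kappa>) = map (Cons (k, \<theta>)) (shrink b r \<kappa>) @
      (if 0 < r \<and> 0 < k \<and> snd \<theta> = b then map (Cons (k - 1, \<theta>)) (shrink b (r - 1) \<kappa>) else [])"

definition twisted_sum :: "nat set \<Rightarrow> bool \<Rightarrow> nat set \<Rightarrow> (nat \<times> bool \<times> bool) list \<Rightarrow> sperm \<Rightarrow> int"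
  where "twisted_sum R b S \<kappa> w = (\<Sum>u\<in>signed_perms R. lin_char (False, b) R u * block_char S \<kappa> (u \<star> w))"

text \<open>
  The first block of the character is \<open>B \<union> C\<close> with \<open>B \<subseteq> R\<close> and \<open>C\<close> outside \<open>R\<close>. Summing first over the
  signed permutations of \<open>B\<close> leaves only the sets \<open>B\<close> with at most one point, by orthogonality.
\<close>

lemma twisted_sum_Cons:
  assumes fin: "finite S" and RS: "R \<subseteq> S" and w: "w \<in> signed_perms Q" "Q \<inter> R = {}" "snd w ` (S - R) = S - R"
  shows "twisted_sum R b S ((k, True, c) # \<kappa>) w =
    (\<Sum>a\<le>k. \<Sum>C\<in>stable_subsets (k - a) (S - R) w. lin_char (True, c) C w *
      (\<Sum>B | B \<subseteq> R \<and> card B = a. (if a = 0 then 1 else if a = 1 \<and> b = c then 2 else 0) *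
        twisted_sum (R - B) b (S - B - C) \<kappa> w))"
proof -
  define \<theta> where "\<theta> = (True, c)"
  have finR: "finite R" using fin RS finite_subset by blast
  let ?E = "\<lambda>B C v. block_char (S - B - C) \<kappa> v"
  have uw: "fst (u \<star> w) i = (if i \<in> R then fst u i else fst w i)"
      "snd (u \<star> w) i = (if i \<in> R then snd u i else snd w i)" if "u \<in> signed_perms R" for u i
    using sp_mult_disjoint[OF that w(1,2)] by auto
  have expand: "block_char S ((k, \<theta>) # \<kappa>) (u \<star> w) =
      (\<Sum>a\<le>k. \<Sum>B\<in>stable_subsets a R u. \<Sum>C\<in>stable_subsets (k - a) (S - R) w.
        lin_char \<theta> B u * lin_char \<theta> C w * ?E B C (u \<star> w))" if u: "u \<in> signed_perms R" for u
  proof -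
    have im1: "snd (u \<star> w) ` B = snd u ` B" if "B \<subseteq> R" for B
      using uw(2)[OF u] that by (intro image_cong) auto
    have im2: "snd (u \<star> w) ` C = snd w ` C" if "C \<subseteq> S - R" for C
      using uw(2)[OF u] that by (intro image_cong) auto
    have imR: "snd (u \<star> w) ` R = R"
      using im1[of R] permutes_image[OF signed_permsD(1)[OF u]] by simp
    have imS: "snd (u \<star> w) ` S = S"
    proof -
      have "S = R \<union> (S - R)" using RS by auto
      then show ?thesis using imR im2[of "S - R"] w(3) by (metis image_Un subset_refl)
    qed
    have st: "stabilizes (u \<star> w) S"
      unfolding stabilizes_def bij_betw_def
      using imS fin uw[OF u] signed_permsD(2)[OF u] signed_permsD(2)[OF w(1)]
      by (auto intro: eq_card_imp_inj_on)
    have s1: "stable_subsets a R (u \<star> w) = stable_subsets a R u" for a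
      unfolding stable_subsets_def by (rule Collect_cong) (use im1 in metis)
    have s2: "stable_subsets a (S - R) (u \<star> w) = stable_subsets a (S - R) w" for a
      unfolding stable_subsets_def by (rule Collect_cong) (use im2 in metis)
    have "block_char S ((k, \<theta>) # \<kappa>) (u \<star> w) =
      (\<Sum>a\<le>k. \<Sum>B\<in>stable_subsets a R (u \<star> w). \<Sum>C\<in>stable_subsets (k - a) (S - R) (u \<star> w).
        lin_char \<theta> (B \<union> C) (u \<star> w) * block_char (S - (B \<union> C)) \<kappa> (u \<star> w))"
      unfolding block_char.simps by (rule sum_stable_split[OF st RS imR])
    also have "\<dots> = (\<Sum>a\<le>k. \<Sum>B\<in>stable_subsets a R (u \<star> w). \<Sum>C\<in>stable_subsets (k - a) (S - R) (u \<star> w).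
        lin_char \<theta> B u * lin_char \<theta> C w * ?E B C (u \<star> w))"
    proof (intro sum.cong refl)
      fix a B C assume "B \<in> stable_subsets a R (u \<star> w)" "C \<in> stable_subsets (k - a) (S - R) (u \<star> w)"
      note B = stable_subsetsD[OF this(1)] and C = stable_subsetsD[OF this(2)]
      have "lin_char \<theta> (B \<union> C) (u \<star> w) = lin_char \<theta> B (u \<star> w) * lin_char \<theta> C (u \<star> w)"
        using B C RS by (intro lin_char_Un stabilizes_subset[OF st]) auto
      moreover have "lin_char \<theta> B (u \<star> w) = lin_char \<theta> B u"
        using B by (intro lin_char_cong) (auto simp: uw[OF u])
      moreover have "lin_char \<theta> C (u \<star> w) = lin_char \<theta> C w"
        using C by (intro lin_char_cong) (auto simp: uw[OF u])
      ultimately show "lin_char \<theta> (B \<union> C) (u \<star> w) * block_char (S - (B \<union> C)) \<kappa> (u \<star> w) =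
          lin_char \<theta> B u * lin_char \<theta> C w * ?E B C (u \<star> w)"
        by (simp add: Diff_Un_eq)
    qed
    finally show ?thesis unfolding s1 s2 .
  qed
  have part: "(\<Sum>u | u \<in> signed_perms R \<and> snd u ` B = B. lin_char (False, b) R u * lin_char \<theta> B u * ?E B C (u \<star> w)) =
      (if a = 0 then 1 else if a = 1 \<and> b = c then 2 else 0) * twisted_sum (R - B) b (S - B - C) \<kappa> w"
    if B: "B \<subseteq> R" "card B = a" and C: "C \<subseteq> S - R" for B C a
  proof -
    have fB: "finite B" using B finR finite_subset by blast
    have dB: "(R - B) \<inter> B = {}" by auto
    have "(\<Sum>u | u \<in> signed_perms R \<and> snd u ` B = B. lin_char (False, b) R u * lin_char \<theta> B u * ?E B C (u \<star> w)) =
      (\<Sum>(u, v)\<in>Sigma (signed_perms B) (\<lambda>_. signed_perms (R - B)).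
        lin_char (False, b) R (u \<star> v) * lin_char \<theta> B (u \<star> v) * ?E B C ((u \<star> v) \<star> w))"
      using sum.reindex_bij_betw[OF bij_betw_sp_mult_disjoint[OF finR B(1)],
          of "\<lambda>u. lin_char (False, b) R u * lin_char \<theta> B u * ?E B C (u \<star> w)"]
      by (simp add: split_beta)
    also have "\<dots> = (\<Sum>(u, v)\<in>Sigma (signed_perms B) (\<lambda>_. signed_perms (R - B)).
        (lin_char (False, b) B u * lin_char \<theta> B u) * (lin_char (False, b) (R - B) v * ?E B C (v \<star> w)))"
    proof (intro sum.cong refl, clarify)
      fix u v assume u: "u \<in> signed_perms B" and v: "v \<in> signed_perms (R - B)"
      have uv: "u \<star> v \<in> signed_perms R"
        by (rule sp_mult_in; rule signed_perms_mono[of _ R]) (use u v B in auto)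
      note d = sp_mult_disjoint[OF u v dB]
      have st: "stabilizes (u \<star> v) R" using stabilizes_signed_perm[OF uv finR] .
      have imB: "snd (u \<star> v) ` B = B"
      proof -
        have "snd (u \<star> v) ` B = snd u ` B" using d by (intro image_cong) auto
        then show ?thesis using permutes_image[OF signed_permsD(1)[OF u]] by simp
      qed
      have "lin_char (False, b) (B \<union> (R - B)) (u \<star> v) = lin_char (False, b) B (u \<star> v) * lin_char (False, b) (R - B) (u \<star> v)"
        by (rule lin_char_Un[OF stabilizes_subset[OF st B(1) imB] stabilizes_Diff[OF st B(1) imB]]) auto
      moreover have "lin_char (False, b) B (u \<star> v) = lin_char (False, b) B u" "lin_char \<theta> B (u \<star> v) = lin_char \<theta> B u"
        by (intro lin_char_cong; simp add: d)+
      moreover have "lin_char (False, b) (R - B) (u \<star> v) = lin_char (False, b) (R - B) v"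
        by (intro lin_char_cong) (simp_all add: d)
      moreover have "B \<union> (R - B) = R" using B by auto
      moreover have "?E B C ((u \<star> v) \<star> w) = ?E B C (v \<star> w)"
      proof (rule block_char_cong)
        fix i assume i: "i \<in> S - B - C"
        have Qv: "Q \<inter> (R - B) = {}" using w by auto
        show "fst ((u \<star> v) \<star> w) i = fst (v \<star> w) i" "snd ((u \<star> v) \<star> w) i = snd (v \<star> w) i"
          using i by (auto simp: uw[OF uv] sp_mult_disjoint[OF v w(1) Qv] d)
      qed
      ultimately show "lin_char (False, b) R (u \<star> v) * lin_char \<theta> B (u \<star> v) * ?E B C ((u \<star> v) \<star> w) =
        (lin_char (False, b) B u * lin_char \<theta> B u) * (lin_char (False, b) (R - B) v * ?E B C (v \<star> w))"
        by (simp add: mult_ac)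
    qed
    also have "\<dots> = (\<Sum>u\<in>signed_perms B. lin_char (False, b) B u * lin_char \<theta> B u) *
        (\<Sum>v\<in>signed_perms (R - B). lin_char (False, b) (R - B) v * ?E B C (v \<star> w))"
      using fB finR by (simp add: sum_product sum.Sigma)
    finally show ?thesis using sum_lin_char_sign[OF fB, of b c] B by (simp add: twisted_sum_def \<theta>_def)
  qed
  have swap: "(\<Sum>u\<in>signed_perms R. \<Sum>B\<in>stable_subsets a R u. g u B) =
      (\<Sum>B | B \<subseteq> R \<and> card B = a. \<Sum>u | u \<in> signed_perms R \<and> snd u ` B = B. g u B)" for g :: "sperm \<Rightarrow> nat set \<Rightarrow> int" and a
  proof -
    have "(\<Sum>u\<in>signed_perms R. \<Sum>B | B \<in> {B. B \<subseteq> R \<and> card B = a} \<and> snd u ` B = B. g u B) =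
      (\<Sum>B | B \<subseteq> R \<and> card B = a. \<Sum>u | u \<in> signed_perms R \<and> snd u ` B = B. g u B)"
      by (rule sum.swap_restrict) (use finR in auto)
    then show ?thesis by (simp add: stable_subsets_def conj_assoc)
  qed
  have "twisted_sum R b S ((k, \<theta>) # \<kappa>) w =
      (\<Sum>u\<in>signed_perms R. \<Sum>a\<le>k. \<Sum>B\<in>stable_subsets a R u. \<Sum>C\<in>stable_subsets (k - a) (S - R) w.
        lin_char \<theta> C w * (lin_char (False, b) R u * lin_char \<theta> B u * ?E B C (u \<star> w)))"
    unfolding twisted_sum_def using expand
    by (intro sum.cong refl) (simp add: sum_distrib_left mult_ac del: block_char.simps)
  also have "\<dots> = (\<Sum>a\<le>k. \<Sum>u\<in>signed_perms R. \<Sum>B\<in>stable_subsets a R u. \<Sum>C\<in>stable_subsets (k - a) (S - R) w.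
        lin_char \<theta> C w * (lin_char (False, b) R u * lin_char \<theta> B u * ?E B C (u \<star> w)))"
    by (rule sum.swap)
  also have "\<dots> = (\<Sum>a\<le>k. \<Sum>B | B \<subseteq> R \<and> card B = a. \<Sum>u | u \<in> signed_perms R \<and> snd u ` B = B. \<Sum>C\<in>stable_subsets (k - a) (S - R) w.
        lin_char \<theta> C w * (lin_char (False, b) R u * lin_char \<theta> B u * ?E B C (u \<star> w)))"
    by (simp only: swap)
  also have "\<dots> = (\<Sum>a\<le>k. \<Sum>B | B \<subseteq> R \<and> card B = a. \<Sum>C\<in>stable_subsets (k - a) (S - R) w.
        lin_char \<theta> C w * (\<Sum>u | u \<in> signed_perms R \<and> snd u ` B = B. lin_char (False, b) R u * lin_char \<theta> B u * ?E B C (u \<star> w)))"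
    by (subst sum.swap) (simp only: sum_distrib_left)
  also have "\<dots> = (\<Sum>a\<le>k. \<Sum>B | B \<subseteq> R \<and> card B = a. \<Sum>C\<in>stable_subsets (k - a) (S - R) w.
        lin_char \<theta> C w * ((if a = 0 then 1 else if a = 1 \<and> b = c then 2 else 0) * twisted_sum (R - B) b (S - B - C) \<kappa> w))"
    using part stable_subsetsD(1) by (intro sum.cong refl) auto
  also have "\<dots> = (\<Sum>a\<le>k. \<Sum>C\<in>stable_subsets (k - a) (S - R) w. \<Sum>B | B \<subseteq> R \<and> card B = a.
        lin_char \<theta> C w * ((if a = 0 then 1 else if a = 1 \<and> b = c then 2 else 0) * twisted_sum (R - B) b (S - B - C) \<kappa> w))"
    by (intro sum.cong refl sum.swap)
  finally show ?thesis by (simp only: \<theta>_def sum_distrib_left)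
qed

lemma sum_times_sum_list:
  "(\<Sum>C\<in>Y. l C * (N * (\<Sum>x\<leftarrow>xs. g C x))) = N * (\<Sum>x\<leftarrow>xs. \<Sum>C\<in>Y. l C * (g C x :: int))"
  by (induction xs) (simp_all add: sum.distrib distrib_left sum_distrib_left mult_ac)

text \<open>
  By \<open>twisted_sum_Cons\<close> at most one point of \<open>R\<close> lies in the first block; the \<open>|R|\<close> choices of that point,
  each with factor 2, restore the group order \<open>2\<^sup>r r!\<close> from \<open>2\<^bsup>r-1\<^esup> (r-1)!\<close>. All points of \<open>S\<close> must lie in
  blocks, since the points outside the blocks would carry the trivial character instead of a sign.
\<close>

lemma twisted_sum_eq:
  assumes "finite S" "R \<subseteq> S" "w \<in> signed_perms Q" "Q \<inter> R = {}" "snd w ` (S - R) = S - R"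
    "\<forall>c\<in>set \<kappa>. fst (snd c)" "total \<kappa> = card S"
  shows "twisted_sum R b S \<kappa> w =
    int (card (signed_perms R)) * (\<Sum>\<kappa>'\<leftarrow>shrink b (card R) \<kappa>. block_char (S - R) \<kappa>' w)"
  using assms
proof (induction \<kappa> arbitrary: R S)
  case Nil
  then show ?case by (simp add: twisted_sum_def lin_char_def)
next
  case (Cons d \<kappa>)
  obtain k c where d: "d = (k, True, c)" using Cons.prems(6) by (cases d) auto
  note fin = Cons.prems(1) and RS = Cons.prems(2)
  have finR: "finite R" using fin RS finite_subset by blast
  have st: "stabilizes w (S - R)"
    unfolding stabilizes_def bij_betw_def
    using Cons.prems(5) fin signed_permsD(2)[OF Cons.prems(3)] by (auto intro: eq_card_imp_inj_on)
  define N where "N = int (card (signed_perms R))"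
  have cS: "k + total \<kappa> = card S" using Cons.prems(7) by (simp add: d)
  have IH: "twisted_sum (R - B) b (S - B - C) \<kappa> w =
      int (card (signed_perms (R - B))) * (\<Sum>\<kappa>'\<leftarrow>shrink b (card R - a) \<kappa>. block_char (S - R - C) \<kappa>' w)"
    if B: "B \<subseteq> R" "card B = a" and C: "C \<in> stable_subsets (k - a) (S - R) w" and a: "a \<le> k" for B C a
  proof -
    note C' = stable_subsetsD[OF C]
    have fBC: "finite B" "finite C"
      using finite_subset[OF B(1) finR] finite_subset[OF C'(1)] fin by auto
    have eq: "S - B - C - (R - B) = S - R - C" using B C' by auto
    have "card (S - B - C) = card S - k"
    proof -
      have "card (B \<union> C) = k" using fBC B C' a by (subst card_Un_disjoint) auto
      moreover have "B \<union> C \<subseteq> S" using B C' RS by auto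
      ultimately show ?thesis using fBC by (simp add: Diff_Un_eq[symmetric] card_Diff_subset)
    qed
    moreover have "snd w ` (S - R - C) = S - R - C" by (rule image_Diff_stable[OF st C'(1,3)])
    moreover have "card (R - B) = card R - a" using B fBC by (simp add: card_Diff_subset)
    moreover have "Q \<inter> (R - B) = {}" using Cons.prems(4) by auto
    moreover have "R - B \<subseteq> S - B - C" using B RS C' by auto
    ultimately show ?thesis
      using Cons.IH[of "S - B - C" "R - B"] Cons.prems(3,6) fin cS eq by simp
  qed
  define f where "f a = (\<Sum>C\<in>stable_subsets (k - a) (S - R) w. lin_char (True, c) C w *
      (\<Sum>B | B \<subseteq> R \<and> card B = a. (if a = 0 then 1 else if a = 1 \<and> b = c then 2 else 0) *
        twisted_sum (R - B) b (S - B - C) \<kappa> w))" for a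
  have f0: "f 0 = N * (\<Sum>\<kappa>'\<leftarrow>shrink b (card R) \<kappa>. block_char (S - R) ((k, True, c) # \<kappa>') w)"
  proof -
    have "{B. B \<subseteq> R \<and> card B = 0} = {{}}" using finR finite_subset by fastforce
    then have "f 0 = (\<Sum>C\<in>stable_subsets k (S - R) w. lin_char (True, c) C w * (N * (\<Sum>\<kappa>'\<leftarrow>shrink b (card R) \<kappa>. block_char (S - R - C) \<kappa>' w)))"
      unfolding f_def using IH[of "{}" 0] by (simp add: N_def)
    also have "\<dots> = N * (\<Sum>\<kappa>'\<leftarrow>shrink b (card R) \<kappa>. block_char (S - R) ((k, True, c) # \<kappa>') w)"
      by (simp only: sum_times_sum_list block_char.simps)
    finally show ?thesis .
  qed
  have f1: "f 1 = N * (if 0 < card R \<and> c = b then \<Sum>\<kappa>'\<leftarrow>shrink b (card R - 1) \<kappa>. block_char (S - R) ((k - 1, True, c) # \<kappa>') w else 0)"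
    if k: "k \<ge> 1"
  proof (cases "b = c \<and> 0 < card R")
    case True
    have "(\<Sum>B | B \<subseteq> R \<and> card B = 1. 2 * twisted_sum (R - B) b (S - B - C) \<kappa> w) =
        N * (\<Sum>\<kappa>'\<leftarrow>shrink b (card R - 1) \<kappa>. block_char (S - R - C) \<kappa>' w)" (is "?l = N * ?r")
      if C: "C \<in> stable_subsets (k - 1) (S - R) w" for C
    proof -
      have "{B. B \<subseteq> R \<and> card B = 1} = (\<lambda>i. {i}) ` R" by (auto simp: card_1_singleton_iff)
      then have "?l = (\<Sum>i\<in>R. 2 * twisted_sum (R - {i}) b (S - {i} - C) \<kappa> w)"
        by (simp add: sum.reindex)
      also have "\<dots> = (\<Sum>i\<in>R. 2 * (fact (card R - 1) * 2 ^ (card R - 1)) * ?r)"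
      proof (intro sum.cong refl)
        fix i assume i: "i \<in> R"
        have "twisted_sum (R - {i}) b (S - {i} - C) \<kappa> w = int (card (signed_perms (R - {i}))) * ?r"
          by (rule IH) (use i C k in auto)
        moreover have "card (signed_perms (R - {i})) = fact (card R - 1) * 2 ^ (card R - 1)"
          using i finR by (simp add: card_signed_perms)
        ultimately show "2 * twisted_sum (R - {i}) b (S - {i} - C) \<kappa> w = 2 * (fact (card R - 1) * 2 ^ (card R - 1)) * ?r"
          by simp
      qed
      also have "\<dots> = (card R * fact (card R - 1)) * (2 * 2 ^ (card R - 1)) * ?r"
        by simp
      also have "\<dots> = N * ?r"
        using True by (cases "card R") (simp_all add: N_def card_signed_perms[OF finR])
      finally show ?thesis .
    qed
    then have "f 1 = (\<Sum>C\<in>stable_subsets (k - 1) (S - R) w. lin_char (True, c) C w * (N * (\<Sum>\<kappa>'\<leftarrow>shrink b (card R - 1) \<kappa>. block_char (S - R - C) \<kappa>' w)))"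
      unfolding f_def using True by (intro sum.cong refl) simp
    also have "\<dots> = N * (\<Sum>\<kappa>'\<leftarrow>shrink b (card R - 1) \<kappa>. block_char (S - R) ((k - 1, True, c) # \<kappa>') w)"
      by (simp only: sum_times_sum_list block_char.simps)
    finally show ?thesis using True by simp
  next
    case False
    have "{B. B \<subseteq> R \<and> card B = 1} = {}" if "card R = 0" using that finR by auto
    with False have "b \<noteq> c \<or> {B. B \<subseteq> R \<and> card B = 1} = {}" by blast
    then have "f 1 = 0"
    proof
      assume "{B. B \<subseteq> R \<and> card B = 1} = {}"
      then show ?thesis unfolding f_def by (simp only: sum.empty mult_zero_right sum.neutral_const)
    qed (simp add: f_def)
    then show ?thesis using False by auto
  qed
  have fa: "f a = 0" if "a \<ge> 2" for a using that by (simp add: f_def)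
  have "twisted_sum R b S (d # \<kappa>) w = (\<Sum>a\<le>k. f a)"
    unfolding d f_def by (rule twisted_sum_Cons) (use Cons.prems in auto)
  also have "\<dots> = (\<Sum>a\<in>{a. a \<le> k \<and> a < 2}. f a)"
    by (rule sum.mono_neutral_right) (auto simp: fa)
  also have "\<dots> = f 0 + (if k \<ge> 1 then f 1 else 0)"
  proof (cases "k \<ge> 1")
    case True
    then have "{a. a \<le> k \<and> a < 2} = {0, 1}" by auto
    then show ?thesis using True by simp
  next
    case False
    then have "{a. a \<le> k \<and> a < 2} = {0}" by auto
    then show ?thesis using False by simp
  qed
  also have "\<dots> = N * (\<Sum>\<kappa>'\<leftarrow>shrink b (card R) (d # \<kappa>). block_char (S - R) \<kappa>' w)"
    using f0 f1 by (auto simp: d o_def distrib_left simp del: block_char.simps)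
  finally show ?case by (simp add: N_def)
qed

section \<open>Class functions are determined by their block averages\<close>

definition class_function :: "nat set \<Rightarrow> (sperm \<Rightarrow> 'a) \<Rightarrow> bool"
  where "class_function S y \<longleftrightarrow> (\<forall>p\<in>signed_perms S. \<forall>w\<in>signed_perms S. \<forall>w'\<in>signed_perms S.
    p \<star> w = w' \<star> p \<longrightarrow> y w = y w')"

text \<open>
  The adjoint of induction: for a character \<open>y\<close> this is the character of the multiplicity space of
  \<open>\<epsilon>\<^sup>b\<close> on the block \<open>R\<close>, on which the signed permutations of the remaining points act.
\<close>

definition block_avg :: "nat set \<Rightarrow> bool \<Rightarrow> (sperm \<Rightarrow> 'a::field_char_0) \<Rightarrow> sperm \<Rightarrow> 'a"
  where "block_avg R b y w = (\<Sum>u\<in>signed_perms R. of_int (lin_char (False, b) R u) * y (u \<star> w)) / of_nat (card (signed_perms R))"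

lemma class_functionD:
  assumes "class_function S y" "p \<star> w = w' \<star> p" "p \<in> signed_perms S" "w \<in> signed_perms S" "w' \<in> signed_perms S"
  shows "y w = y w'"
  using assms unfolding class_function_def by blast

lemma sp_mult_in_block:
  assumes "R \<subseteq> S" "u \<in> signed_perms R" "w \<in> signed_perms (S - R)" shows "u \<star> w \<in> signed_perms S"
  using assms sp_mult_in[OF signed_perms_mono[OF _ assms(2)] signed_perms_mono[OF _ assms(3)]] by blast

lemma block_avg_cong:
  assumes "\<And>w. w \<in> signed_perms S \<Longrightarrow> y w = y' w" "R \<subseteq> S" "w \<in> signed_perms (S - R)"
  shows "block_avg R b y w = block_avg R b y' w"
proof -
  have "y (u \<star> w) = y' (u \<star> w)" if "u \<in> signed_perms R" for u
    by (rule assms(1), rule sp_mult_in_block[OF assms(2) that assms(3)])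
  then show ?thesis by (simp add: block_avg_def)
qed

lemma block_avg_diff: "block_avg R b (\<lambda>w. f w - g w) w = block_avg R b f w - block_avg R b g w"
  by (simp add: block_avg_def sum_subtractf right_diff_distrib diff_divide_distrib)

lemma block_avg_scale: "block_avg R b (\<lambda>w. c * f w) w = c * block_avg R b f w"
  by (simp add: block_avg_def sum_distrib_left mult_ac)

lemma block_avg_sum_list: "block_avg R b (\<lambda>w. \<Sum>x\<leftarrow>xs. f x w) w = (\<Sum>x\<leftarrow>xs. block_avg R b (f x) w)"
proof (induction xs)
  case Nil
  show ?case by (simp add: block_avg_def)
next
  case (Cons x xs)
  have "block_avg R b (\<lambda>w. \<Sum>x\<leftarrow>x # xs. f x w) w = block_avg R b (f x) w + block_avg R b (\<lambda>w. \<Sum>x\<leftarrow>xs. f x w) w"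
    by (simp add: block_avg_def sum.distrib distrib_left add_divide_distrib)
  then show ?case using Cons by simp
qed

lemma block_avg_commute:
  assumes "R \<inter> R' = {}"
  shows "block_avg R b (block_avg R' b' y) w = block_avg R' b' (block_avg R b y) w"
proof -
  have "(\<Sum>u\<in>signed_perms R. \<Sum>v\<in>signed_perms R'. of_int (lin_char (False, b) R u) * (of_int (lin_char (False, b') R' v) * y (v \<star> (u \<star> w)))) =
    (\<Sum>v\<in>signed_perms R'. \<Sum>u\<in>signed_perms R. of_int (lin_char (False, b) R u) * (of_int (lin_char (False, b') R' v) * y (v \<star> (u \<star> w))))"
    by (rule sum.swap)
  also have "\<dots> = (\<Sum>v\<in>signed_perms R'. \<Sum>u\<in>signed_perms R. of_int (lin_char (False, b') R' v) * (of_int (lin_char (False, b) R u) * y (u \<star> (v \<star> w))))"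
  proof (intro sum.cong refl)
    fix u v assume "v \<in> signed_perms R'" "u \<in> signed_perms R"
    then have "v \<star> u = u \<star> v" using assms by (intro sp_mult_commute)
    then show "of_int (lin_char (False, b) R u) * (of_int (lin_char (False, b') R' v) * y (v \<star> (u \<star> w))) =
        of_int (lin_char (False, b') R' v) * (of_int (lin_char (False, b) R u) * y (u \<star> (v \<star> w)))"
      by (simp add: sp_mult_assoc[symmetric] mult_ac)
  qed
  finally show ?thesis
    by (simp add: block_avg_def sum_distrib_left sum_divide_distrib[symmetric] mult_ac)
qed

lemma class_function_block_avg:
  assumes "class_function S y" "R \<subseteq> S"
  shows "class_function (S - R) (block_avg R b y)"
  unfolding class_function_def
proof (intro ballI impI)
  fix p w w' assume p: "p \<in> signed_perms (S - R)" and w: "w \<in> signed_perms (S - R)" "w' \<in> signed_perms (S - R)" and eq: "p \<star> w = w' \<star> p"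
  have "y (u \<star> w) = y (u \<star> w')" if u: "u \<in> signed_perms R" for u
  proof -
    have "p \<star> u = u \<star> p" by (rule sp_mult_commute[OF p u]) (use assms in auto)
    then have "p \<star> (u \<star> w) = (u \<star> w') \<star> p"
      using eq by (metis sp_mult_assoc)
    moreover have "p \<in> signed_perms S" "u \<star> w \<in> signed_perms S" "u \<star> w' \<in> signed_perms S"
      using sp_mult_in_block[OF assms(2) u] w signed_perms_mono[OF _ p, of S] by auto
    ultimately show ?thesis by (rule class_functionD[OF assms(1)])
  qed
  then show "block_avg R b y w = block_avg R b y w'" by (simp add: block_avg_def)
qed

definition sp_perm :: "(nat \<Rightarrow> nat) \<Rightarrow> sperm"
  where "sp_perm \<pi> = (\<lambda>_. 1, \<pi>)"

lemma sp_perm_in: "\<pi> permutes S \<Longrightarrow> sp_perm \<pi> \<in> signed_perms S"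
  by (simp add: sp_perm_def signed_perms_def)

lemma sp_perm_inv:
  assumes "\<pi> permutes S" "\<rho> = inv_into UNIV \<pi>"
  shows "sp_perm \<pi> \<star> (sp_perm \<rho> \<star> w) = w" "sp_perm \<rho> \<star> (sp_perm \<pi> \<star> w) = w"
    "(w \<star> sp_perm \<pi>) \<star> sp_perm \<rho> = w" "(w \<star> sp_perm \<rho>) \<star> sp_perm \<pi> = w"
  using permutes_inverses[OF assms(1)] assms(2)
  by (simp_all add: sp_mult_def sp_perm_def prod_eq_iff fun_eq_iff)

lemma conj_signed_perm:
  assumes "\<pi> permutes S" "R \<subseteq> S" "u \<in> signed_perms R" "\<rho> = inv_into UNIV \<pi>"
  shows "sp_perm \<pi> \<star> u \<star> sp_perm \<rho> \<in> signed_perms (\<pi> ` R)"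
proof -
  have eq: "sp_perm \<pi> \<star> u \<star> sp_perm \<rho> = (\<lambda>j. fst u (\<rho> j), \<pi> \<circ> snd u \<circ> \<rho>)"
    by (simp add: sp_mult_def sp_perm_def o_def)
  have inv: "\<rho> (\<pi> x) = x" "\<pi> (\<rho> x) = x" for x using permutes_inverses[OF assms(1)] assms(4) by auto
  have mem: "\<rho> j \<in> R \<longleftrightarrow> j \<in> \<pi> ` R" for j using inv by (metis imageE imageI)
  have uR: "snd u permutes R" using signed_permsD(1)[OF assms(3)] .
  have "\<pi> \<circ> snd u \<circ> \<rho> permutes \<pi> ` R"
  proof (rule bij_imp_permutes)
    have "bij_betw \<rho> (\<pi> ` R) R" by (rule bij_betw_byWitness[of _ \<pi>]) (auto simp: inv)
    moreover have "bij_betw (snd u) R R" using uR by (rule permutes_imp_bij)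
    moreover have "bij_betw \<pi> R (\<pi> ` R)" by (rule bij_betw_byWitness[of _ \<rho>]) (auto simp: inv)
    ultimately show "bij_betw (\<pi> \<circ> snd u \<circ> \<rho>) (\<pi> ` R) (\<pi> ` R)"
      by (metis bij_betw_trans)
  next
    fix x assume "x \<notin> \<pi> ` R"
    then have "snd u (\<rho> x) = \<rho> x" using mem[of x] permutes_not_in[OF uR] by auto
    then show "(\<pi> \<circ> snd u \<circ> \<rho>) x = x" by (simp add: inv)
  qed
  then show ?thesis
    unfolding eq signed_perms_def using signed_permsD(2,3)[OF assms(3)] mem by auto
qed

text \<open>
  A permutation that carries \<open>R\<close> to \<open>R'\<close> conjugates one average into the other, so the vanishing of the
  averages depends on the size of the block only.
\<close>

lemma block_avg_zero_transport:
  assumes "finite S" "class_function S y" "R \<subseteq> S" "R' \<subseteq> S" "card R = card R'"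
    and zero: "\<And>w. w \<in> signed_perms (S - R) \<Longrightarrow> block_avg R b y w = 0" and w: "w \<in> signed_perms (S - R')"
  shows "block_avg R' b y w = 0"
proof -
  have fin: "finite R" "finite R'" using assms finite_subset by auto
  obtain f where f: "bij_betw f R R'" using finite_same_card_bij[OF fin assms(5)] by blast
  have "card (S - R) = card (S - R')" using assms fin by (simp add: card_Diff_subset)
  then obtain g where g: "bij_betw g (S - R) (S - R')" using finite_same_card_bij[of "S - R" "S - R'"] assms(1) by auto
  define \<pi> where "\<pi> x = (if x \<in> R then f x else if x \<in> S then g x else x)" for x
  have 1: "bij_betw \<pi> R R'" using f by (rule bij_betw_cong[THEN iffD1, rotated]) (simp add: \<pi>_def)
  have 2: "bij_betw \<pi> (S - R) (S - R')" using g by (rule bij_betw_cong[THEN iffD1, rotated]) (simp add: \<pi>_def)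
  have "bij_betw \<pi> (R \<union> (S - R)) (R' \<union> (S - R'))" by (rule bij_betw_combine[OF 1 2]) auto
  moreover have "R \<union> (S - R) = S" "R' \<union> (S - R') = S" using assms by auto
  ultimately have \<pi>: "\<pi> permutes S" using assms(3) by (intro bij_imp_permutes) (auto simp: \<pi>_def)
  have \<pi>R: "\<pi> ` R = R'" "\<pi> ` (S - R) = S - R'" using 1 2 by (auto simp: bij_betw_def)
  define \<rho> where "\<rho> = inv_into UNIV \<pi>"
  have \<rho>: "\<rho> permutes S" using permutes_inv[OF \<pi>] by (simp add: \<rho>_def)
  have inv\<rho>: "inv_into UNIV \<rho> = \<pi>" using permutes_inv_inv[OF \<pi>] by (simp add: \<rho>_def)
  have inv: "\<rho> (\<pi> x) = x" "\<pi> (\<rho> x) = x" for x using permutes_inverses[OF \<pi>] \<rho>_def by auto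
  have ip: "\<rho> ` \<pi> ` A = A" for A by (simp add: image_comp o_def inv)
  have \<rho>R: "\<rho> ` R' = R" "\<rho> ` (S - R') = S - R" using ip[of R] ip[of "S - R"] \<pi>R by simp_all
  note P = sp_perm_inv[OF \<pi> \<rho>_def]
  define c where "c v = sp_perm \<pi> \<star> v \<star> sp_perm \<rho>" for v
  define d where "d v = sp_perm \<rho> \<star> v \<star> sp_perm \<pi>" for v
  have cd: "c (d v) = v" "d (c v) = v" for v
    unfolding c_def d_def using P by (metis sp_mult_assoc)+
  have cR: "c u \<in> signed_perms R'" if "u \<in> signed_perms R" for u
    unfolding c_def using conj_signed_perm[OF \<pi> assms(3) that \<rho>_def] \<pi>R by simp
  have dR: "d u \<in> signed_perms R" if "u \<in> signed_perms R'" for u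
    unfolding d_def using conj_signed_perm[OF \<rho> assms(4) that inv\<rho>[symmetric]] \<rho>R by simp
  have dw: "d w \<in> signed_perms (S - R)"
    unfolding d_def using conj_signed_perm[OF \<rho> _ w inv\<rho>[symmetric]] \<rho>R by auto
  have yc: "y (u \<star> d w) = y (c u \<star> w)" if u: "u \<in> signed_perms R" for u
  proof -
    have "sp_perm \<pi> \<star> (u \<star> d w) = (c u \<star> w) \<star> sp_perm \<pi>"
      unfolding c_def d_def using P by (metis sp_mult_assoc)
    moreover have "sp_perm \<pi> \<in> signed_perms S" by (rule sp_perm_in[OF \<pi>])
    moreover have "u \<star> d w \<in> signed_perms S" "c u \<star> w \<in> signed_perms S"
      using sp_mult_in_block[OF assms(3) u dw] sp_mult_in_block[OF assms(4) cR[OF u] w] by auto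
    ultimately show ?thesis using class_functionD[OF assms(2)] by blast
  qed
  have lin: "lin_char (False, b) R' (c u) = lin_char (False, b) R u" for u
  proof -
    have "(\<Prod>i\<in>R'. fst u (\<rho> i)) = (\<Prod>i\<in>R. fst u i)"
      by (rule prod.reindex_bij_witness[of _ \<pi> \<rho>]) (use \<pi>R \<rho>R inv in auto)
    then show ?thesis by (simp add: lin_char_def c_def sp_mult_def sp_perm_def)
  qed
  have "(\<Sum>u\<in>signed_perms R'. of_int (lin_char (False, b) R' u) * y (u \<star> w)) =
      (\<Sum>u\<in>signed_perms R. of_int (lin_char (False, b) R u) * y (u \<star> d w))"
    by (rule sum.reindex_bij_witness[of _ c d]) (use cd cR dR yc lin in \<open>auto simp: lin[symmetric]\<close>)
  also have "\<dots> = 0"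
    using zero[OF dw] fin card_signed_perms[OF fin(1)] by (auto simp: block_avg_def)
  finally show ?thesis by (simp add: block_avg_def)
qed

text \<open>
  Conjugation by \<open>p\<close> carries the stable sets of \<open>w\<close> to those of \<open>w'\<close>. The signs of \<open>p\<close> cancel in the product
  over a stable set.
\<close>

lemma block_char_conj:
  assumes "stabilizes w S" "inj_on (snd p) S" "\<And>i. i \<in> S \<Longrightarrow> fst p i \<noteq> 0"
    and "\<And>i. i \<in> S \<Longrightarrow> snd p (snd w i) = snd w' (snd p i)"
    and "\<And>i. i \<in> S \<Longrightarrow> fst w i * fst p (snd w i) = fst p i * fst w' (snd p i)"
  shows "block_char (snd p ` S) \<kappa> w' = block_char S \<kappa> w"
  using assms
proof (induction \<kappa> arbitrary: S)
  case (Cons d \<kappa>)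
  obtain k \<theta> where d: "d = (k, \<theta>)" by (cases d)
  have st: "stable_subsets k (snd p ` S) w' = (\<lambda>A. snd p ` A) ` stable_subsets k S w"
  proof (intro equalityI subsetI)
    fix B assume B: "B \<in> stable_subsets k (snd p ` S) w'"
    define A where "A = {i \<in> S. snd p i \<in> B}"
    have BA: "B = snd p ` A" using stable_subsetsD(1)[OF B] by (auto simp: A_def)
    have inj: "inj_on (snd p) A" using Cons.prems(2) by (rule inj_on_subset) (auto simp: A_def)
    have sub: "snd w ` A \<subseteq> A"
    proof
      fix j assume "j \<in> snd w ` A"
      then obtain i where i: "i \<in> A" "j = snd w i" by auto
      then have "j \<in> S" using Cons.prems(1) by (auto simp: A_def stabilizes_def bij_betw_def)
      moreover have "snd p j \<in> B" using i Cons.prems(4)[of i] stable_subsetsD(3)[OF B] by (auto simp: A_def)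
      ultimately show "j \<in> A" by (simp add: A_def)
    qed
    have "finite A" using Cons.prems(1) by (simp add: A_def stabilizes_def)
    moreover have "inj_on (snd w) A" using Cons.prems(1) by (auto simp: A_def stabilizes_def bij_betw_def intro: inj_on_subset)
    ultimately have "snd w ` A = A" using sub by (intro endo_inj_surj)
    moreover have "card A = k" using stable_subsetsD(2)[OF B] BA inj by (simp add: card_image)
    ultimately have "A \<in> stable_subsets k S w" by (auto simp: stable_subsets_def A_def)
    then show "B \<in> (\<lambda>A. snd p ` A) ` stable_subsets k S w" using BA by blast
  next
    fix B assume "B \<in> (\<lambda>A. snd p ` A) ` stable_subsets k S w"
    then obtain A where A: "A \<in> stable_subsets k S w" "B = snd p ` A" by blast
    note A' = stable_subsetsD[OF A(1)]
    have "card B = k" using A A' inj_on_subset[OF Cons.prems(2) A'(1)] by (simp add: card_image)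
    moreover have "snd w' ` B = B"
    proof -
      have "snd w' ` B = (\<lambda>i. snd w' (snd p i)) ` A" using A by (simp add: image_image)
      also have "\<dots> = (\<lambda>i. snd p (snd w i)) ` A" using Cons.prems(4) A' by (intro image_cong) auto
      also have "\<dots> = snd p ` snd w ` A" by (simp add: image_image)
      finally show ?thesis using A A' by simp
    qed
    ultimately show "B \<in> stable_subsets k (snd p ` S) w'" using A A' by (auto simp: stable_subsets_def)
  qed
  have inj: "inj_on (\<lambda>A. snd p ` A) (stable_subsets k S w)"
    using Cons.prems(2) stable_subsetsD(1) by (metis (no_types, lifting) inj_on_image_eq_iff inj_onI)
  have "block_char (snd p ` S) (d # \<kappa>) w' =
      (\<Sum>A\<in>stable_subsets k S w. lin_char \<theta> (snd p ` A) w' * block_char (snd p ` S - snd p ` A) \<kappa> w')"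
    unfolding d block_char.simps st using inj by (simp add: sum.reindex)
  also have "\<dots> = (\<Sum>A\<in>stable_subsets k S w. lin_char \<theta> A w * block_char (S - A) \<kappa> w)"
  proof (intro sum.cong refl arg_cong2[where f = "(*)"])
    fix A assume "A \<in> stable_subsets k S w"
    note A = stable_subsetsD[OF this]
    have stA: "stabilizes w A" using stabilizes_subset[OF Cons.prems(1)] A by auto
    have injA: "inj_on (snd p) A" using Cons.prems(2) A(1) by (rule inj_on_subset)
    have "snd p ` S - snd p ` A = snd p ` (S - A)" using Cons.prems(2) A by (auto simp: inj_on_image_set_diff)
    moreover have "block_char (snd p ` (S - A)) \<kappa> w' = block_char (S - A) \<kappa> w"
      by (rule Cons.IH) (use Cons.prems A stabilizes_Diff in \<open>auto intro: inj_on_subset\<close>)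
    ultimately show "block_char (snd p ` S - snd p ` A) \<kappa> w' = block_char (S - A) \<kappa> w" by simp
    have "sign_on (snd p ` A) (snd w') = sign_on A (snd w)"
    proof -
      have "restrict_id (snd w) A permutes A" using stA by (auto simp: stabilizes_def intro: permutes_restrict_id)
      then have "sign (map_permutation A (snd p) (restrict_id (snd w) A)) = sign (restrict_id (snd w) A)"
        using injA stA by (intro sign_map_permutation) (auto simp: stabilizes_def)
      moreover have "map_permutation A (snd p) (restrict_id (snd w) A) = restrict_id (snd w') (snd p ` A)"
        unfolding map_permutation_def using injA Cons.prems(4) A(1)
        by (intro restrict_id_cong) (auto simp: subset_iff)
      ultimately show ?thesis by (simp add: sign_on_def)
    qed
    moreover have "(\<Prod>i\<in>snd p ` A. fst w' i) = (\<Prod>i\<in>A. fst w i)"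
    proof -
      have "(\<Prod>i\<in>A. fst p i) * (\<Prod>i\<in>snd p ` A. fst w' i) = (\<Prod>i\<in>A. fst p i * fst w' (snd p i))"
        using injA by (simp add: prod.reindex prod.distrib)
      also have "\<dots> = (\<Prod>i\<in>A. fst w i * fst p (snd w i))" using Cons.prems(5) A by (intro prod.cong) auto
      also have "\<dots> = (\<Prod>i\<in>A. fst w i) * (\<Prod>i\<in>snd w ` A. fst p i)"
      proof -
        have "inj_on (snd w) A" using stA by (simp add: stabilizes_def bij_betw_def)
        then show ?thesis by (simp add: prod.distrib prod.reindex)
      qed
      also have "snd w ` A = A" by (rule A)
      finally have "(\<Prod>i\<in>A. fst p i) * (\<Prod>i\<in>snd p ` A. fst w' i) = (\<Prod>i\<in>A. fst p i) * (\<Prod>i\<in>A. fst w i)" by simp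
      moreover have "(\<Prod>i\<in>A. fst p i) \<noteq> 0" using Cons.prems(3) A stA by (auto simp: stabilizes_def)
      ultimately show ?thesis by simp
    qed
    ultimately show "lin_char \<theta> (snd p ` A) w' = lin_char \<theta> A w" by (simp add: lin_char_def)
  qed
  finally show ?case by (simp add: d)
qed simp

lemma class_function_block_char:
  assumes "finite S" shows "class_function S (\<lambda>w. of_int (block_char S \<kappa> w))"
  unfolding class_function_def
proof (intro ballI impI)
  fix p w w' assume p: "p \<in> signed_perms S" and w: "w \<in> signed_perms S" "w' \<in> signed_perms S" and eq: "p \<star> w = w' \<star> p"
  have "snd p ` S = S" using signed_permsD(1)[OF p] by (rule permutes_image)
  moreover have "block_char (snd p ` S) \<kappa> w' = block_char S \<kappa> w"
  proof (rule block_char_conj)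
    show "stabilizes w S" by (rule stabilizes_signed_perm[OF w(1) assms])
    show "inj_on (snd p) S" using signed_permsD(1)[OF p] by (rule permutes_inj_on)
    show "fst p i \<noteq> 0" for i using signed_permsD(2)[OF p, of i] by auto
    show "snd p (snd w i) = snd w' (snd p i)" for i using eq by (auto simp: sp_mult_def fun_eq_iff)
    show "fst w i * fst p (snd w i) = fst p i * fst w' (snd p i)" for i using eq by (auto simp: sp_mult_def fun_eq_iff)
  qed
  ultimately show "(of_int (block_char S \<kappa> w) :: 'a) = of_int (block_char S \<kappa> w')" by simp
qed

text \<open>
  The signed cycles through all points of \<open>R\<close> are classified by the product of their signs: signs can be
  moved along the cycle. The permutation part of the conjugating element matches the two cycles, and its
  sign at a point is the partial product of the signs of \<open>u\<close> and \<open>v\<close> up to that point.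
\<close>

lemma signed_cycles_conjugate:
  assumes u: "u \<in> signed_perms R" and v: "v \<in> signed_perms R"
    and cs: "distinct cs" "set cs = R" "map (snd u) cs = rotate1 cs"
    and ds: "distinct ds" "set ds = R" "map (snd v) ds = rotate1 ds"
    and eps: "(\<Prod>i\<in>R. fst u i) = (\<Prod>i\<in>R. fst v i)"
  shows "\<exists>p\<in>signed_perms R. p \<star> u = v \<star> p"
proof -
  define n where "n = length cs"
  have len: "length ds = n" using distinct_card[OF cs(1)] distinct_card[OF ds(1)] cs ds by (simp add: n_def)
  have nth: "snd u (cs ! i) = cs ! (Suc i mod n)" "snd v (ds ! i) = ds ! (Suc i mod n)" if "i < n" for i
    using that arg_cong[OF cs(3), of "\<lambda>l. l ! i"] arg_cong[OF ds(3), of "\<lambda>l. l ! i"] len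
    by (simp_all add: n_def nth_rotate1)
  have bc: "bij_betw ((!) cs) {..<n} R" and bd: "bij_betw ((!) ds) {..<n} R"
    using cs ds len by (auto simp: n_def intro!: bij_betw_nth)
  define idx where "idx = inv_into {..<n} ((!) cs)"
  have idx: "idx (cs ! i) = i" if "i < n" for i
    using that bc by (simp add: idx_def bij_betw_inv_into_left)
  have ex: "\<exists>i<n. x = cs ! i" if "x \<in> R" for x using that bc by (auto simp: bij_betw_def)
  define \<pi> where "\<pi> x = (if x \<in> R then ds ! idx x else x)" for x
  define q where "q x = (if x \<in> R then \<Prod>j<idx x. fst u (cs ! j) * fst v (ds ! j) else 1)" for x
  have csR: "cs ! i \<in> R" "ds ! i \<in> R" if "i < n" for i using that bc bd by (auto simp: bij_betw_def)
  have \<pi>cs: "\<pi> (cs ! i) = ds ! i" if "i < n" for i using that csR idx by (simp add: \<pi>_def)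
  have qcs: "q (cs ! i) = (\<Prod>j<i. fst u (cs ! j) * fst v (ds ! j))" if "i < n" for i using that csR idx by (simp add: q_def)
  have bi: "bij_betw idx R {..<n}" unfolding idx_def using bc by (rule bij_betw_inv_into)
  have \<pi>: "\<pi> permutes R"
  proof (rule bij_imp_permutes)
    have "bij_betw ((!) ds \<circ> idx) R R" using bij_betw_trans[OF bi bd] .
    then show "bij_betw \<pi> R R" by (rule bij_betw_cong[THEN iffD1, rotated]) (simp add: \<pi>_def)
  qed (simp add: \<pi>_def)
  have pm: "x * y = 1 \<or> x * y = -1" if "x = 1 \<or> x = -1" "y = 1 \<or> y = -1" for x y :: int using that by auto
  have "q x = 1 \<or> q x = -1" for x
  proof -
    have "(\<Prod>j<i. fst u (cs ! j) * fst v (ds ! j)) = 1 \<or> (\<Prod>j<i. fst u (cs ! j) * fst v (ds ! j)) = -1" for i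
      by (induction i) (use pm signed_permsD(2)[OF u] signed_permsD(2)[OF v] in simp_all)
    then show ?thesis by (simp add: q_def)
  qed
  then have p: "(q, \<pi>) \<in> signed_perms R" using \<pi> by (simp add: signed_perms_def q_def)
  have sq: "fst u x * (fst u x * y) = y" for x y using signed_permsD(2)[OF u, of x] by auto
  \<comment> \<open>equal total signs make the partial products consistent when the cycle closes\<close>
  have prod1: "(\<Prod>j<n. fst u (cs ! j) * fst v (ds ! j)) = 1"
  proof -
    have "(\<Prod>j<n. fst u (cs ! j)) = (\<Prod>i\<in>R. fst u i)" by (rule prod.reindex_bij_betw[OF bc])
    moreover have "(\<Prod>j<n. fst v (ds ! j)) = (\<Prod>i\<in>R. fst v i)" by (rule prod.reindex_bij_betw[OF bd])
    moreover have "(\<Prod>i\<in>R. fst u i) * (\<Prod>i\<in>R. fst u i) = (\<Prod>i\<in>R. fst u i * fst u i)" by (simp add: prod.distrib)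
    moreover have "\<dots> = 1" using sq[of _ 1] by (intro prod.neutral) auto
    ultimately show ?thesis using eps by (simp add: prod.distrib)
  qed
  have "snd ((q, \<pi>) \<star> u) x = snd (v \<star> (q, \<pi>)) x \<and> fst ((q, \<pi>) \<star> u) x = fst (v \<star> (q, \<pi>)) x" for x
  proof (cases "x \<in> R")
    case True
    then obtain i where i: "i < n" "x = cs ! i" using ex by blast
    have "Suc i mod n < n" using i by simp
    then have 1: "\<pi> (snd u x) = snd v (\<pi> x)" using i nth \<pi>cs by simp
    have 2: "fst u x * q (snd u x) = q x * fst v (\<pi> x)"
    proof (cases "Suc i < n")
      case True
      then show ?thesis using i by (simp add: nth qcs \<pi>cs mult_ac sq)
    next
      case False
      then have n: "n = Suc i" using i by simp
      have "q (snd u x) = 1" using i nth qcs[of 0] by (simp add: n)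
      moreover have "q x * (fst u x * fst v (\<pi> x)) = 1" using prod1 i qcs \<pi>cs by (simp add: n mult_ac)
      then have "fst u x * (q x * (fst u x * fst v (\<pi> x))) = fst u x" by simp
      then have "q x * fst v (\<pi> x) = fst u x" using sq by (simp add: mult_ac)
      ultimately show ?thesis by simp
    qed
    show ?thesis using 1 2 by (simp add: sp_mult_def)
  next
    case False
    then show ?thesis using signed_permsD(3,4)[OF u False] signed_permsD(3)[OF v False] signed_permsD(4)[OF v False]
      by (simp add: sp_mult_def \<pi>_def q_def)
  qed
  then have "(q, \<pi>) \<star> u = v \<star> (q, \<pi>)" by (simp add: prod_eq_iff fun_eq_iff)
  then show ?thesis using p by blast
qed

text \<open>
  Induction on the size of \<open>R\<close>. If \<open>v\<close> splits along a proper subset of \<open>R\<close>, then \<open>y\<close> vanishes at \<open>v \<star> w\<close> by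
  induction. So the only nonzero values are at full cycles on \<open>R\<close>, which form two classes according to
  \<open>\<epsilon>\<close>. The averages against 1 and against \<open>\<epsilon>\<close> separate the two classes, and both are 0.
\<close>

lemma class_function_eq_0:
  fixes y :: "sperm \<Rightarrow> 'a::field_char_0"
  assumes fin: "finite S" and cl: "class_function S y"
    and avg: "\<And>R b w. R \<subseteq> S \<Longrightarrow> R \<noteq> {} \<Longrightarrow> w \<in> signed_perms (S - R) \<Longrightarrow> block_avg R b y w = 0"
    and "R \<subseteq> S" "R \<noteq> {}" "u \<in> signed_perms R" "w \<in> signed_perms (S - R)"
  shows "y (u \<star> w) = 0"
  using assms(4-)
proof (induction "card R" arbitrary: R u w rule: less_induct)
  case less
  have finR: "finite R" using less.prems fin finite_subset by blast
  have SR: "signed_perms R \<subseteq> signed_perms S" "signed_perms (S - R) \<subseteq> signed_perms S"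
    using less.prems(1) signed_perms_mono by blast+
  have full: "\<exists>cs. distinct cs \<and> set cs = R \<and> map (snd v) cs = rotate1 cs"
    if v: "v \<in> signed_perms R" and nz: "y (v \<star> w) \<noteq> 0" for v
  proof (rule cycle_enumeration[OF finR less.prems(2)])
    show "bij_betw (snd v) R R" using signed_permsD(1)[OF v] by (rule permutes_imp_bij)
    fix B assume B: "B \<subseteq> R" "snd v ` B = B"
    show "B = {} \<or> B = R"
    proof (rule ccontr)
      assume ne: "\<not> (B = {} \<or> B = R)"
      have "v \<in> (\<lambda>(u, v). u \<star> v) ` (Sigma (signed_perms B) (\<lambda>_. signed_perms (R - B)))"
        using bij_betw_sp_mult_disjoint[OF finR B(1)] v B(2) by (auto simp: bij_betw_def)
      then obtain v1 v2 where v12: "v1 \<in> signed_perms B" "v2 \<in> signed_perms (R - B)" "v = v1 \<star> v2" by auto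
      have "card B < card R" using ne B finR by (intro psubset_card_mono) auto
      moreover have "v2 \<star> w \<in> signed_perms (S - B)"
      proof (rule sp_mult_in)
        have "R - B \<subseteq> S - B" "S - R \<subseteq> S - B" using less.prems(1) B by auto
        then show "v2 \<in> signed_perms (S - B)" "w \<in> signed_perms (S - B)"
          using signed_perms_mono v12(2) less.prems(4) by blast+
      qed
      ultimately have "y (v1 \<star> (v2 \<star> w)) = 0"
        using less.hyps[of B v1 "v2 \<star> w"] ne B v12 less.prems by auto
      then show False using nz v12(3) by (simp add: sp_mult_assoc)
    qed
  qed
  show ?case
  proof (rule ccontr)
    assume nz: "y (u \<star> w) \<noteq> 0"
    define e where "e v = lin_char (False, True) R v" for v
    have e1: "e v * e v = 1" if "v \<in> signed_perms R" for v
      unfolding e_def using lin_char_xor[OF stabilizes_signed_perm[OF that finR], of "(False, True)" "(False, True)"]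
      by (simp add: lin_char_def)
    have pm: "e v = e u \<or> e v = - e u" if "v \<in> signed_perms R" for v
      using e1[OF that] e1[OF less.prems(3)] by (metis square_eq_iff)
    have card0: "(of_nat (card (signed_perms R)) :: 'a) \<noteq> 0"
      using card_signed_perms[OF finR] by simp
    have z: "(\<Sum>v\<in>signed_perms R. y (v \<star> w)) = 0" "(\<Sum>v\<in>signed_perms R. of_int (e v) * y (v \<star> w)) = 0"
      using avg[OF less.prems(1,2,4), of False] avg[OF less.prems(1,2,4), of True] card0
      by (auto simp: block_avg_def e_def lin_char_def)
    \<comment> \<open>the part of the block average that survives adding the two twisted averages\<close>
    define V where "V = {v \<in> signed_perms R. e v = e u \<and> y (v \<star> w) \<noteq> 0}"
    have yV: "y (v \<star> w) = y (u \<star> w)" if "v \<in> V" for v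
    proof -
      have v: "v \<in> signed_perms R" "e v = e u" "y (v \<star> w) \<noteq> 0" using that by (auto simp: V_def)
      obtain cs where cs: "distinct cs" "set cs = R" "map (snd v) cs = rotate1 cs" using full[OF v(1,3)] by blast
      obtain ds where ds: "distinct ds" "set ds = R" "map (snd u) ds = rotate1 ds" using full[OF less.prems(3) nz] by blast
      obtain p where p: "p \<in> signed_perms R" "p \<star> v = u \<star> p"
        using signed_cycles_conjugate[OF v(1) less.prems(3) cs ds] v(2) by (auto simp: e_def lin_char_def)
      have "p \<star> w = w \<star> p" by (rule sp_mult_commute[OF p(1) less.prems(4)]) auto
      then have "p \<star> (v \<star> w) = (u \<star> w) \<star> p" using p(2) by (metis sp_mult_assoc)
      moreover have "v \<star> w \<in> signed_perms S" "u \<star> w \<in> signed_perms S" "p \<in> signed_perms S"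
        using v(1) p(1) less.prems(3,4) SR by (auto intro!: sp_mult_in)
      ultimately show ?thesis using class_functionD[OF cl] by blast
    qed
    have "0 = (\<Sum>v\<in>signed_perms R. y (v \<star> w)) + of_int (e u) * (\<Sum>v\<in>signed_perms R. of_int (e v) * y (v \<star> w))"
      using z by simp
    also have "\<dots> = (\<Sum>v\<in>signed_perms R. (1 + of_int (e u * e v)) * y (v \<star> w))"
      by (simp add: sum_distrib_left sum.distrib algebra_simps)
    also have "\<dots> = (\<Sum>v\<in>V. (1 + of_int (e u * e v)) * y (v \<star> w))"
    proof (rule sum.mono_neutral_right)
      show "\<forall>v\<in>signed_perms R - V. (1 + of_int (e u * e v)) * y (v \<star> w) = 0"
      proof
        fix v assume v: "v \<in> signed_perms R - V"
        then consider "y (v \<star> w) = 0" | "e v = - e u" using pm[of v] by (auto simp: V_def)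
        then show "(1 + of_int (e u * e v)) * y (v \<star> w) = 0"
          by cases (use e1[OF less.prems(3)] in simp_all)
      qed
    qed (use finR in \<open>auto simp: V_def\<close>)
    also have "\<dots> = (\<Sum>v\<in>V. 2 * y (u \<star> w))"
      using yV e1[OF less.prems(3)] by (intro sum.cong refl) (simp add: V_def)
    also have "\<dots> = of_nat (card V) * (2 * y (u \<star> w))" by simp
    finally have "card V = 0" using nz by auto
    moreover have "u \<in> V" using less.prems nz by (simp add: V_def)
    moreover have "finite V" using finR by (simp add: V_def)
    ultimately show False by auto
  qed
qed

section \<open>Integral class functions are combinations of block characters\<close>

abbreviation sgn_type :: "(nat \<times> bool \<times> bool) list \<Rightarrow> bool"
  where "sgn_type \<kappa> \<equiv> list_all (\<lambda>c. fst (snd c)) \<kappa>"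

text \<open>
  The colour of a column is the second component of its type: whether \<open>\<epsilon>\<close> occurs in it.
\<close>

definition count_cols :: "bool \<Rightarrow> (nat \<times> bool \<times> bool) list \<Rightarrow> nat"
  where "count_cols b \<kappa> = length (filter (\<lambda>c. snd (snd c) = b) \<kappa>)"

definition grow :: "bool \<Rightarrow> (nat \<times> bool \<times> bool) list \<Rightarrow> (nat \<times> bool \<times> bool) list"
  where "grow b \<kappa> = map (\<lambda>c. if snd (snd c) = b then (Suc (fst c), snd c) else c) \<kappa>"

lemma shrink_many: "count_cols b \<kappa> < r \<Longrightarrow> shrink b r \<kappa> = []"
proof (induction \<kappa> arbitrary: r)
  case (Cons c \<kappa>)
  obtain k \<theta> where c: "c = (k, \<theta>)" by (cases c)
  have "shrink b r \<kappa> = []"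
    by (rule Cons.IH) (use Cons.prems in \<open>simp add: c count_cols_def split: if_splits\<close>)
  moreover have "shrink b (r - 1) \<kappa> = []" if "snd \<theta> = b"
    by (rule Cons.IH) (use Cons.prems that in \<open>simp add: c count_cols_def\<close>)
  ultimately show ?case by (simp add: c)
qed (simp add: count_cols_def)

lemma map_snd_grow: "map snd (grow b \<kappa>) = map snd \<kappa>"
  by (simp add: grow_def if_distrib cong: if_cong)

lemma count_cols_alt: "count_cols b \<kappa> = length (filter (\<lambda>\<theta>. snd \<theta> = b) (map snd \<kappa>))"
  by (simp add: count_cols_def filter_map o_def)

lemma count_cols_grow: "count_cols b' (grow b \<kappa>) = count_cols b' \<kappa>"
  by (simp only: count_cols_alt map_snd_grow)

lemma sgn_type_grow: "sgn_type (grow b \<kappa>) \<longleftrightarrow> sgn_type \<kappa>"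
proof -
  have "sgn_type \<mu> \<longleftrightarrow> list_all fst (map snd \<mu>)" for \<mu> :: "(nat \<times> bool \<times> bool) list"
    by (simp add: list.pred_map o_def)
  then show ?thesis by (simp only: map_snd_grow)
qed

lemma grow_Cons: "grow b ((k, \<theta>) # \<kappa>) = (if snd \<theta> = b then Suc k else k, \<theta>) # grow b \<kappa>"
  by (simp add: grow_def)

lemma count_cols_Cons: "count_cols b ((k, \<theta>) # \<kappa>) = (if snd \<theta> = b then Suc (count_cols b \<kappa>) else count_cols b \<kappa>)"
  by (simp add: count_cols_def)

lemma total_grow: "total (grow b \<kappa>) = total \<kappa> + count_cols b \<kappa>"
proof (induction \<kappa>)
  case (Cons c \<kappa>)
  then show ?case by (cases c) (simp add: grow_Cons count_cols_Cons)
qed (simp add: grow_def count_cols_def)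

text \<open>
  When a point is to be removed from every column of colour \<open>b\<close>, only one choice is left; \<open>grow\<close> thus
  provides a right inverse of the average.
\<close>

lemma shrink_grow: "shrink b (count_cols b \<kappa>) (grow b \<kappa>) = [\<kappa>]"
proof (induction \<kappa>)
  case (Cons c \<kappa>)
  obtain k \<theta> where c: "c = (k, \<theta>)" by (cases c)
  have "shrink b (Suc (count_cols b \<kappa>)) (grow b \<kappa>) = []" by (intro shrink_many) (simp add: count_cols_grow)
  then show ?case using Cons by (cases "snd \<theta> = b") (simp_all add: c count_cols_Cons grow_Cons)
qed (simp add: count_cols_def grow_def)

lemma shrink_props:
  assumes "\<kappa>' \<in> set (shrink b r \<kappa>)"
  shows "total \<kappa>' + r = total \<kappa>" "sgn_type \<kappa> \<Longrightarrow> sgn_type \<kappa>'"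
proof -
  have "total \<kappa>' + r = total \<kappa> \<and> (sgn_type \<kappa> \<longrightarrow> sgn_type \<kappa>')" using assms
  proof (induction \<kappa> arbitrary: \<kappa>' r)
    case (Cons c \<kappa>)
    obtain k \<theta> where c: "c = (k, \<theta>)" by (cases c)
    from Cons.prems consider \<mu> where "\<mu> \<in> set (shrink b r \<kappa>)" "\<kappa>' = (k, \<theta>) # \<mu>"
      | \<mu> where "0 < r" "0 < k" "\<mu> \<in> set (shrink b (r - 1) \<kappa>)" "\<kappa>' = (k - 1, \<theta>) # \<mu>"
      unfolding c shrink.simps by (auto split: if_splits)
    then show ?case
    proof cases
      case 1
      then show ?thesis using Cons.IH[OF 1(1)] by (simp add: c)
    next
      case 2
      then show ?thesis using Cons.IH[OF 2(3)] by (auto simp: c)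
    qed
  qed (simp split: if_splits)
  then show "total \<kappa>' + r = total \<kappa>" "sgn_type \<kappa> \<Longrightarrow> sgn_type \<kappa>'" by auto
qed

lemma block_avg_block_char:
  fixes w :: sperm
  assumes "finite S" "R \<subseteq> S" "w \<in> signed_perms (S - R)" "sgn_type \<kappa>" "total \<kappa> = card S"
  shows "block_avg R b (\<lambda>w. of_int (block_char S \<kappa> w)) w =
    (\<Sum>\<kappa>'\<leftarrow>shrink b (card R) \<kappa>. of_int (block_char (S - R) \<kappa>' w) :: 'a::field_char_0)"
proof -
  have "finite R" using assms finite_subset by auto
  then have nz: "(of_nat (card (signed_perms R)) :: 'a) \<noteq> 0" by (simp add: card_signed_perms)
  have "twisted_sum R b S \<kappa> w =
    int (card (signed_perms R)) * (\<Sum>\<kappa>'\<leftarrow>shrink b (card R) \<kappa>. block_char (S - R) \<kappa>' w)"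
    by (rule twisted_sum_eq[OF assms(1,2,3) _ _ assms(4)[unfolded list_all_iff] assms(5)])
      (use permutes_image[OF signed_permsD(1)[OF assms(3)]] in auto)
  then have "(of_int (twisted_sum R b S \<kappa> w) :: 'a) =
      of_nat (card (signed_perms R)) * of_int (\<Sum>\<kappa>'\<leftarrow>shrink b (card R) \<kappa>. block_char (S - R) \<kappa>' w)"
    by simp
  moreover have "of_int (\<Sum>x\<leftarrow>xs. f x) = (\<Sum>x\<leftarrow>xs. of_int (f x) :: 'a)" for xs :: "'b list" and f
    by (induction xs) auto
  ultimately show ?thesis using nz by (simp add: block_avg_def twisted_sum_def)
qed

text \<open>
  If the sets in \<open>l\<close> form a partition, then \<open>iter_avg l y sp_one\<close> is the scalar product of \<open>y\<close> with the
  character induced from the linear character \<open>\<epsilon>\<^sup>b\<close> on each block.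
\<close>

fun iter_avg :: "(nat set \<times> bool) list \<Rightarrow> (sperm \<Rightarrow> 'a::field_char_0) \<Rightarrow> sperm \<Rightarrow> 'a"
  where
    "iter_avg [] y = y"
  | "iter_avg ((R, b) # l) y = iter_avg l (block_avg R b y)"

fun blocks :: "nat set \<Rightarrow> (nat set \<times> bool) list \<Rightarrow> bool"
  where
    "blocks S [] = (S = {})"
  | "blocks S ((R, b) # l) = (R \<subseteq> S \<and> blocks (S - R) l)"

definition integral_averages :: "nat set \<Rightarrow> (sperm \<Rightarrow> 'a::field_char_0) \<Rightarrow> bool"
  where "integral_averages S y \<longleftrightarrow> (\<forall>l. blocks S l \<longrightarrow> iter_avg l y sp_one \<in> \<int>)"

lemma iter_avg_cong:
  assumes "blocks S l" "\<And>w. w \<in> signed_perms S \<Longrightarrow> y w = y' w"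
  shows "iter_avg l y sp_one = iter_avg l y' sp_one"
  using assms
proof (induction S l arbitrary: y y' rule: blocks.induct)
  case (2 S R b l)
  have "iter_avg l (block_avg R b y) sp_one = iter_avg l (block_avg R b y') sp_one"
  proof (rule "2.IH")
    show "blocks (S - R) l" using "2.prems" by simp
    fix w assume "w \<in> signed_perms (S - R)"
    then show "block_avg R b y w = block_avg R b y' w"
      using "2.prems" block_avg_cong[of S y y' R w b] by simp
  qed
  then show ?case by simp
qed simp

lemma iter_avg_diff: "iter_avg l (\<lambda>w. f w - g w) = (\<lambda>w. iter_avg l f w - iter_avg l g w)"
proof (induction l arbitrary: f g)
  case (Cons c l)
  have "block_avg R b (\<lambda>w. f w - g w) = (\<lambda>w. block_avg R b f w - block_avg R b g w)" for R b
    by (rule ext) (rule block_avg_diff)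
  then show ?case using Cons by (cases c) simp
qed simp

lemma iter_avg_scale: "iter_avg l (\<lambda>w. c * f w) = (\<lambda>w. c * iter_avg l f w)"
proof (induction l arbitrary: f)
  case (Cons d l)
  have "block_avg R b (\<lambda>w. c * f w) = (\<lambda>w. c * block_avg R b f w)" for R b
    by (rule ext) (rule block_avg_scale)
  then show ?case using Cons by (cases d) simp
qed simp

lemma iter_avg_sum_list: "iter_avg l (\<lambda>w. \<Sum>x\<leftarrow>xs. f x w) = (\<lambda>w. \<Sum>x\<leftarrow>xs. iter_avg l (f x) w)"
proof (induction l arbitrary: f)
  case (Cons d l)
  have "block_avg R b (\<lambda>w. \<Sum>x\<leftarrow>xs. f x w) = (\<lambda>w. \<Sum>x\<leftarrow>xs. block_avg R b (f x) w)" for R b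
    by (rule ext) (rule block_avg_sum_list)
  then show ?case using Cons[of "\<lambda>x. block_avg (fst d) (snd d) (f x)"] by (cases d) simp
qed simp

lemma Ints_sum_list: "(\<And>x. x \<in> set xs \<Longrightarrow> f x \<in> \<int>) \<Longrightarrow> (\<Sum>x\<leftarrow>xs. f x) \<in> \<int>"
  by (induction xs) auto

lemma integral_averages_block_char:
  assumes "finite S" "sgn_type \<kappa>" "total \<kappa> = card S"
  shows "integral_averages S (\<lambda>w. of_int (block_char S \<kappa> w) :: 'a::field_char_0)"
proof -
  have "iter_avg l (\<lambda>w. of_int (block_char S \<kappa> w)) sp_one \<in> (\<int> :: 'a set)" if "blocks S l" for l
    using that assms
  proof (induction S l arbitrary: \<kappa> rule: blocks.induct)
    case (2 S R b l)
    then have R: "R \<subseteq> S" "blocks (S - R) l" "finite R" "finite (S - R)" by (auto intro: finite_subset)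
    have "iter_avg ((R, b) # l) (\<lambda>w. of_int (block_char S \<kappa> w)) sp_one =
        iter_avg l (\<lambda>w. \<Sum>\<kappa>'\<leftarrow>shrink b (card R) \<kappa>. of_int (block_char (S - R) \<kappa>' w) :: 'a) sp_one"
      unfolding iter_avg.simps
      by (rule iter_avg_cong[OF R(2)], rule block_avg_block_char[OF "2.prems"(2) R(1) _ "2.prems"(3,4)])
    also have "\<dots> = (\<Sum>\<kappa>'\<leftarrow>shrink b (card R) \<kappa>. iter_avg l (\<lambda>w. of_int (block_char (S - R) \<kappa>' w)) sp_one)"
      by (simp only: iter_avg_sum_list)
    also have "\<dots> \<in> \<int>"
    proof (rule Ints_sum_list)
      fix \<kappa>' assume k: "\<kappa>' \<in> set (shrink b (card R) \<kappa>)"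
      show "iter_avg l (\<lambda>w. of_int (block_char (S - R) \<kappa>' w) :: 'a) sp_one \<in> \<int>"
        by (rule "2.IH"[OF R(2,4)])
          (use shrink_props[OF k] "2.prems" R in \<open>auto simp: card_Diff_subset\<close>)
    qed
    finally show ?case .
  qed simp
  then show ?thesis by (simp add: integral_averages_def)
qed

lemma integral_averages_block_avg:
  "integral_averages S y \<Longrightarrow> R \<subseteq> S \<Longrightarrow> integral_averages (S - R) (block_avg R b y)"
  unfolding integral_averages_def by (metis blocks.simps(2) iter_avg.simps(2))

lemma integral_averages_diff:
  "integral_averages S f \<Longrightarrow> integral_averages S g \<Longrightarrow> integral_averages S (\<lambda>w. f w - g w)"
  by (simp add: integral_averages_def iter_avg_diff)

definition comb_at :: "(int \<times> (nat \<times> bool \<times> bool) list) list \<Rightarrow> nat set \<Rightarrow> sperm \<Rightarrow> 'a::field_char_0"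
  where "comb_at cs S w = (\<Sum>c\<leftarrow>cs. of_int (fst c) * of_int (block_char S (snd c) w))"

text \<open>
  Combinations of sign type products with exactly \<open>m b\<close> columns of colour \<open>b\<close>. Empty columns count, so
  the number of columns can always be increased (\<open>pad_comb\<close>).
\<close>

definition good_comb :: "nat set \<Rightarrow> (bool \<Rightarrow> nat) \<Rightarrow> (int \<times> (nat \<times> bool \<times> bool) list) list \<Rightarrow> bool"
  where "good_comb S m cs \<longleftrightarrow> (\<forall>(c, \<kappa>)\<in>set cs. sgn_type \<kappa> \<and> total \<kappa> = card S \<and> (\<forall>b. count_cols b \<kappa> = m b))"

lemma class_function_comb:
  assumes "finite S" shows "class_function S (comb_at cs S)"
  unfolding class_function_def
proof (intro ballI impI)
  fix p w w' assume *: "p \<in> signed_perms S" "w \<in> signed_perms S" "w' \<in> signed_perms S" "p \<star> w = w' \<star> p"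
  have "of_int (block_char S \<kappa> w) = (of_int (block_char S \<kappa> w') :: 'a)" for \<kappa>
    using class_functionD[OF class_function_block_char[OF assms] *(4,1,2,3)] .
  then show "comb_at cs S w = (comb_at cs S w' :: 'a)" by (simp add: comb_at_def)
qed

lemma class_function_diff:
  assumes "class_function S f" "class_function S g" shows "class_function S (\<lambda>w. f w - g w :: 'a::ab_group_add)"
  unfolding class_function_def
proof (intro ballI impI)
  fix p w w' assume *: "p \<in> signed_perms S" "w \<in> signed_perms S" "w' \<in> signed_perms S" "p \<star> w = w' \<star> p"
  show "f w - g w = f w' - g w'"
    using class_functionD[OF assms(1) *(4,1,2,3)] class_functionD[OF assms(2) *(4,1,2,3)] by simp
qed

lemma block_avg_comb:
  assumes "finite S" "R \<subseteq> S" "w \<in> signed_perms (S - R)" "good_comb S m cs"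
  shows "block_avg R b (comb_at cs S) w =
    (\<Sum>c\<leftarrow>cs. of_int (fst c) * (\<Sum>\<kappa>'\<leftarrow>shrink b (card R) (snd c). of_int (block_char (S - R) \<kappa>' w)) :: 'a::field_char_0)"
proof -
  have "block_avg R b (comb_at cs S) w = (\<Sum>c\<leftarrow>cs. of_int (fst c) * block_avg R b (\<lambda>w. of_int (block_char S (snd c) w) :: 'a) w)"
    unfolding comb_at_def[abs_def] block_avg_sum_list block_avg_scale ..
  also have "\<dots> = (\<Sum>c\<leftarrow>cs. of_int (fst c) * (\<Sum>\<kappa>'\<leftarrow>shrink b (card R) (snd c). of_int (block_char (S - R) \<kappa>' w)))"
    using assms(4) block_avg_block_char[where 'a = 'a, OF assms(1,2,3)]
    by (intro arg_cong[where f = sum_list] map_cong refl) (auto simp: good_comb_def)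
  finally show ?thesis .
qed

lemma integral_averages_comb:
  assumes "finite S" "good_comb S m cs" shows "integral_averages S (comb_at cs S)"
proof -
  have "iter_avg l (comb_at cs S) sp_one \<in> (\<int> :: 'a set)" if l: "blocks S l" for l
  proof -
    have "iter_avg l (comb_at cs S) sp_one = (\<Sum>c\<leftarrow>cs. of_int (fst c) * iter_avg l (\<lambda>w. of_int (block_char S (snd c) w) :: 'a) sp_one)"
      unfolding comb_at_def[abs_def] iter_avg_sum_list iter_avg_scale ..
    also have "\<dots> \<in> \<int>"
    proof (intro Ints_sum_list Ints_mult)
      fix c assume "c \<in> set cs"
      then have "sgn_type (snd c)" "total (snd c) = card S" using assms(2) by (auto simp: good_comb_def)
      from integral_averages_block_char[where 'a = 'a, OF assms(1) this] l
      show "iter_avg l (\<lambda>w. of_int (block_char S (snd c) w) :: 'a) sp_one \<in> \<int>" by (simp add: integral_averages_def)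
    qed simp
    finally show ?thesis .
  qed
  then show ?thesis by (simp add: integral_averages_def)
qed

lemma pad_comb:
  assumes "finite S" "good_comb S (m(b := m b - 1)) cs" "m b > 0"
  defines "cs' \<equiv> map (\<lambda>(c, \<kappa>). (c, (0, True, b) # \<kappa>)) cs"
  shows "good_comb S m cs'" "comb_at cs' S w = (comb_at cs S w :: 'a::field_char_0)"
proof -
  show "good_comb S m cs'"
    unfolding good_comb_def
  proof clarify
    fix c \<mu> assume "(c, \<mu>) \<in> set cs'"
    then obtain \<kappa> where k: "(c, \<kappa>) \<in> set cs" "\<mu> = (0, True, b) # \<kappa>" by (auto simp: cs'_def)
    then have "sgn_type \<kappa>" "total \<kappa> = card S" "\<forall>d. count_cols d \<kappa> = (m(b := m b - 1)) d"
      using assms(2) by (auto simp: good_comb_def)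
    then show "sgn_type \<mu> \<and> total \<mu> = card S \<and> (\<forall>d. count_cols d \<mu> = m d)"
      using assms(3) by (simp add: k(2) count_cols_Cons)
  qed
  show "comb_at cs' S w = (comb_at cs S w :: 'a)"
    unfolding cs'_def comb_at_def using assms(1) by (induction cs) (auto simp: block_char_0 simp del: block_char.simps)
qed

text \<open>
  The bound \<open>m b\<close> on the sizes of blocks of colour \<open>b\<close> with nonzero average is the number of columns that
  are needed. Let \<open>R\<close> be a block of the maximal size \<open>m b > 0\<close>. Its average \<open>z\<close> lives on fewer points, so by
  induction it is a combination with \<open>m b\<close> columns of colour \<open>b\<close>. Adding a point to each of these columns
  gives a combination with the same average over \<open>R\<close>. After subtracting it, the average over blocks of size
  \<open>m b\<close> is 0, and the bound drops by one. When both bounds are 0 the function vanishes by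
  \<open>class_function_eq_0\<close>, or there are no points left and integrality gives the coefficient.
\<close>

theorem integral_class_function_comb:
  fixes y :: "sperm \<Rightarrow> 'a::field_char_0"
  assumes "finite S" "class_function S y" "integral_averages S y"
    and "\<And>b R w. R \<subseteq> S \<Longrightarrow> card R > m b \<Longrightarrow> w \<in> signed_perms (S - R) \<Longrightarrow> block_avg R b y w = 0"
  shows "\<exists>cs. good_comb S m cs \<and> (\<forall>w\<in>signed_perms S. y w = comb_at cs S w)"
  using assms
proof (induction "card S + m False + m True" arbitrary: S m y rule: less_induct)
  case less
  note fin = less.prems(1) and cl = less.prems(2) and int = less.prems(3) and van = less.prems(4)
  show ?case
  proof (cases "\<exists>b. m b > 0")
    case True
    then obtain b where b: "m b > 0" by blast
    define m' where "m' = m(b := m b - 1)"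
    have m'b: "m' b = m b - 1" and m'o: "b' \<noteq> b \<Longrightarrow> m' b' = m b'" for b'
      by (simp_all add: m'_def)
    have smaller: "m' False + m' True < m False + m True"
      using m'b m'o[of "\<not> b"] b by (cases b) simp_all
    show ?thesis
    proof (cases "m b \<le> card S")
      case False
      have "\<exists>cs. good_comb S m' cs \<and> (\<forall>w\<in>signed_perms S. y w = comb_at cs S w)"
      proof (rule less.hyps[OF _ fin cl int])
        fix b' R w assume R: "R \<subseteq> S" "card R > m' b'" "w \<in> signed_perms (S - R)"
        have "card R \<le> card S" using R fin by (simp add: card_mono)
        have "b' \<noteq> b"
        proof
          assume "b' = b"
          then have "card R > m b - 1" using R(2) unfolding \<open>b' = b\<close> m'b by simp
          then show False using \<open>card R \<le> card S\<close> False b by simp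
        qed
        then have "card R > m b'" using R(2) unfolding m'o[OF \<open>b' \<noteq> b\<close>] by simp
        then show "block_avg R b' y w = 0" using van R by blast
      qed (use smaller in simp)
      then obtain cs where "good_comb S m' cs \<and> (\<forall>w\<in>signed_perms S. y w = comb_at cs S w)" by (rule exE)
      then have cs: "good_comb S m' cs" "\<And>w. w \<in> signed_perms S \<Longrightarrow> y w = comb_at cs S w" by simp_all
      show ?thesis
      proof (intro exI conjI ballI)
        show "good_comb S m (map (\<lambda>(c, \<kappa>). (c, (0, True, b) # \<kappa>)) cs)"
          by (rule pad_comb(1)[OF fin cs(1)[unfolded m'_def] b])
        show "y w = comb_at (map (\<lambda>(c, \<kappa>). (c, (0, True, b) # \<kappa>)) cs) S w" if "w \<in> signed_perms S" for w
          using cs(2)[OF that] pad_comb(2)[where 'a = 'a, OF fin cs(1)[unfolded m'_def] b] by simp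
      qed
    next
      case True
      then obtain R where R: "R \<subseteq> S" "card R = m b" using obtain_subset_with_card_n by metis
      have finR: "finite R" using R fin finite_subset by blast
      define z where "z = block_avg R b y"
      have cSR: "card (S - R) + card R = card S"
        using card_mono[OF fin R(1)] R(1) finR by (simp add: card_Diff_subset)
      then have "card (S - R) < card S" using R b by simp
      have "\<exists>cs. good_comb (S - R) m cs \<and> (\<forall>w\<in>signed_perms (S - R). z w = comb_at cs (S - R) w)"
      proof (rule less.hyps)
        show "class_function (S - R) z" unfolding z_def by (rule class_function_block_avg[OF cl R(1)])
        show "integral_averages (S - R) z" unfolding z_def by (rule integral_averages_block_avg[OF int R(1)])
        fix b' R' w assume R': "R' \<subseteq> S - R" "card R' > m b'" "w \<in> signed_perms (S - R - R')"
        have "block_avg R' b' z w = block_avg R b (block_avg R' b' y) w"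
          unfolding z_def by (rule block_avg_commute) (use R' in auto)
        also have "\<dots> = block_avg R b (\<lambda>_. 0) w"
        proof (rule block_avg_cong[of "S - R'"])
          show "w \<in> signed_perms (S - R' - R)" using R'(3) by (simp add: Diff_Diff_comm)
          show "R \<subseteq> S - R'" using R' R by auto
          fix v assume "v \<in> signed_perms (S - R')"
          then show "block_avg R' b' y v = 0" using van[of R' b' v] R' by blast
        qed
        also have "\<dots> = 0" by (simp add: block_avg_def)
        finally show "block_avg R' b' z w = 0" .
      qed (use fin \<open>card (S - R) < card S\<close> in simp_all)
      then obtain cs where "good_comb (S - R) m cs \<and> (\<forall>w\<in>signed_perms (S - R). z w = comb_at cs (S - R) w)"
        by (rule exE)
      then have cs: "good_comb (S - R) m cs" "\<And>w. w \<in> signed_perms (S - R) \<Longrightarrow> z w = comb_at cs (S - R) w"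
        by simp_all
      \<comment> \<open>the combination to be subtracted: one more point in each column of colour \<open>b\<close>\<close>
      define gs where "gs = map (\<lambda>(c, \<kappa>). (c, grow b \<kappa>)) cs"
      have gs: "good_comb S m gs"
        unfolding good_comb_def
      proof (clarify)
        fix c \<mu> assume "(c, \<mu>) \<in> set gs"
        then obtain \<kappa> where k: "(c, \<kappa>) \<in> set cs" "\<mu> = grow b \<kappa>" by (auto simp: gs_def)
        then have "sgn_type \<kappa>" "total \<kappa> = card (S - R)" "\<And>b. count_cols b \<kappa> = m b"
          using cs(1) by (auto simp: good_comb_def)
        then show "sgn_type \<mu> \<and> total \<mu> = card S \<and> (\<forall>b. count_cols b \<mu> = m b)"
          using R cSR by (simp add: k sgn_type_grow total_grow count_cols_grow)
      qed
      define y' where "y' w = y w - comb_at gs S w" for w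
      \<comment> \<open>larger blocks still have average 0, since there are too few columns to take their points from\<close>
      have shrink0: "(\<Sum>c\<leftarrow>gs. of_int (fst c) * (\<Sum>\<kappa>'\<leftarrow>shrink b' r (snd c). g \<kappa>')) = (0::'a)"
        if "r > m b'" for b' r g
      proof -
        have "shrink b' r (snd c) = []" if "c \<in> set gs" for c
          using gs that \<open>r > m b'\<close> by (intro shrink_many) (auto simp: good_comb_def)
        then have "(\<Sum>c\<leftarrow>gs. of_int (fst c) * (\<Sum>\<kappa>'\<leftarrow>shrink b' r (snd c). g \<kappa>')) = (\<Sum>c\<leftarrow>gs. 0::'a)"
          by (intro arg_cong[where f = sum_list] map_cong refl) simp
        then show ?thesis by simp
      qed
      have cl': "class_function S y'"
        unfolding y'_def by (rule class_function_diff[OF cl class_function_comb[OF fin]])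
      have zero: "block_avg R b y' w = 0" if w: "w \<in> signed_perms (S - R)" for w
      proof -
        have "block_avg R b (comb_at gs S) w = (\<Sum>c\<leftarrow>gs. of_int (fst c) * (\<Sum>\<kappa>'\<leftarrow>shrink b (m b) (snd c). of_int (block_char (S - R) \<kappa>' w) :: 'a))"
          using block_avg_comb[OF fin R(1) w gs] R by simp
        also have "\<dots> = (\<Sum>c\<leftarrow>cs. of_int (fst c) * (\<Sum>\<kappa>'\<leftarrow>shrink b (m b) (grow b (snd c)). of_int (block_char (S - R) \<kappa>' w)))"
          unfolding gs_def by (simp add: o_def split_beta)
        also have "\<dots> = (\<Sum>c\<leftarrow>cs. of_int (fst c) * of_int (block_char (S - R) (snd c) w))"
        proof (intro arg_cong[where f = sum_list] map_cong refl)
          fix c assume "c \<in> set cs"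
          then have "count_cols b (snd c) = m b" using cs(1) by (auto simp: good_comb_def)
          then show "of_int (fst c) * (\<Sum>\<kappa>'\<leftarrow>shrink b (m b) (grow b (snd c)). of_int (block_char (S - R) \<kappa>' w)) =
              (of_int (fst c) * of_int (block_char (S - R) (snd c) w) :: 'a)"
            using shrink_grow[of b "snd c"] by simp
        qed
        also have "\<dots> = z w" using cs(2)[OF w] by (simp add: comb_at_def)
        finally show ?thesis unfolding y'_def by (simp add: block_avg_diff z_def)
      qed
      have "\<exists>cs. good_comb S m' cs \<and> (\<forall>w\<in>signed_perms S. y' w = comb_at cs S w)"
      proof (rule less.hyps[OF _ fin cl'])
        show "integral_averages S y'"
          unfolding y'_def by (rule integral_averages_diff[OF int integral_averages_comb[OF fin gs]])
        fix b' R' w assume R': "R' \<subseteq> S" "card R' > m' b'" "w \<in> signed_perms (S - R')"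
        show "block_avg R' b' y' w = 0"
        proof (cases "b' = b \<and> card R' = m b")
          case True
          have "block_avg R' b y' w = 0"
            by (rule block_avg_zero_transport[OF fin cl' R(1) R'(1) _ zero R'(3)]) (use R True in auto)
          then show ?thesis using True by simp
        next
          case False
          have "card R' > m b'"
          proof (cases "b' = b")
            case True
            have "card R' > m b - 1" using R'(2) unfolding True m'b by simp
            moreover have "card R' \<noteq> m b" using False True by blast
            ultimately show ?thesis unfolding True using b by linarith
          next
            case False
            then show ?thesis using R'(2) unfolding m'o[OF False] by simp
          qed
          have "block_avg R' b' (comb_at gs S) w = (0 :: 'a)"
            unfolding block_avg_comb[OF fin R'(1,3) gs] by (rule shrink0[OF \<open>card R' > m b'\<close>])
          then show ?thesis
            using van[OF R'(1) \<open>card R' > m b'\<close> R'(3)] unfolding y'_def by (simp add: block_avg_diff)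
        qed
      qed (use smaller in simp)
      then obtain ds where "good_comb S m' ds \<and> (\<forall>w\<in>signed_perms S. y' w = comb_at ds S w)" by (rule exE)
      then have ds: "good_comb S m' ds" "\<And>w. w \<in> signed_perms S \<Longrightarrow> y' w = comb_at ds S w" by simp_all
      define ds' where "ds' = map (\<lambda>(c, \<kappa>). (c, (0, True, b) # \<kappa>)) ds"
      have ds': "good_comb S m ds'" "comb_at ds' S w = (comb_at ds S w :: 'a)" for w
        unfolding ds'_def using pad_comb(1)[OF fin ds(1)[unfolded m'_def] b]
          pad_comb(2)[where 'a = 'a, OF fin ds(1)[unfolded m'_def] b] by blast+
      have "good_comb S m (ds' @ gs)" using ds' gs by (auto simp: good_comb_def)
      moreover have "y w = comb_at (ds' @ gs) S w" if "w \<in> signed_perms S" for w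
      proof -
        have "y w = comb_at ds' S w + comb_at gs S w" using ds(2)[OF that] ds'(2)[of w]
          unfolding y'_def by (simp add: algebra_simps)
        then show ?thesis by (simp add: comb_at_def)
      qed
      ultimately show ?thesis by (intro exI conjI ballI) simp_all
    qed
  next
    case False
    then have m0: "m b = 0" for b by auto
    show ?thesis
    proof (cases "S = {}")
      case True
      have "blocks S []" using True by simp
      then have "y sp_one \<in> \<int>" using int unfolding integral_averages_def by fastforce
      then obtain c where "y sp_one = of_int c" by (auto elim: Ints_cases)
      then have "\<forall>w\<in>signed_perms S. y w = comb_at [(c, [])] S w"
        using True by (simp add: comb_at_def)
      moreover have "good_comb S m [(c, [])]"
        using True m0 by (simp add: good_comb_def count_cols_def)
      ultimately show ?thesis by (intro exI conjI ballI) simp_all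
    next
      case False
      have "y w = 0" if "w \<in> signed_perms S" for w
      proof -
        have "block_avg R b y w = 0" if "R \<subseteq> S" "R \<noteq> {}" "w \<in> signed_perms (S - R)" for R b w
        proof (rule van[OF that(1) _ that(3)])
          show "card R > m b" using that finite_subset[OF that(1) fin] m0[of b] by (simp add: card_gt_0_iff)
        qed
        then have "y (w \<star> sp_one) = 0"
          by (rule class_function_eq_0[OF fin cl _ subset_refl False that sp_one_in])
        then show ?thesis by (simp only: sp_mult_one)
      qed
      then have "\<forall>w\<in>signed_perms S. y w = comb_at [] S w" by (simp add: comb_at_def)
      moreover have "good_comb S m []" by (simp add: good_comb_def)
      ultimately show ?thesis by (intro exI conjI ballI) simp_all
    qed
  qed
qed

theorem integral_class_function_in:
  fixes \<B> :: "(sperm \<Rightarrow> 'b::field_char_0) set"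
  assumes "function_ring S \<B>"
    and gen: "\<And>k b. (\<lambda>w. of_int (block_char S [(k, True, b)] w)) \<in> \<B>"
    and "class_function S y" "integral_averages S y"
  shows "y \<in> \<B>"
proof -
  interpret B: function_ring S \<B> by fact
  have "\<exists>cs. good_comb S (\<lambda>_. card S) cs \<and> (\<forall>w\<in>signed_perms S. y w = comb_at cs S w)"
  \<comment> \<open>no block has more than \<open>|S|\<close> points\<close>
  proof (rule integral_class_function_comb[OF B.finite assms(3,4)])
    fix b R w assume "R \<subseteq> S" "card S < card R"
    then show "block_avg R b y w = 0" using card_mono[OF B.finite, of R] by simp
  qed
  then obtain cs where "good_comb S (\<lambda>_. card S) cs \<and> (\<forall>w\<in>signed_perms S. y w = comb_at cs S w)" by (rule exE)
  then have cs: "\<And>w. w \<in> signed_perms S \<Longrightarrow> y w = comb_at cs S w" by simp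
  have "comb_at cs S \<in> \<B>"
    unfolding comb_at_def[abs_def]
    by (rule B.sum_list, rule B.mult, rule B.of_int, rule B.block_char_in, rule gen)
  then show ?thesis by (rule B.cong) (simp add: cs)
qed

section \<open>Traces, rank factorizations and idempotents\<close>

definition mtrace :: "'a::comm_ring_1 mat \<Rightarrow> 'a"
  where "mtrace A = (\<Sum>i<dim_row A. A $$ (i, i))"

lemma index_mult_mat_sum:
  assumes "A \<in> carrier_mat n m" "B \<in> carrier_mat m l" "i < n" "j < l"
  shows "(A * B) $$ (i, j) = (\<Sum>k<m. A $$ (i, k) * B $$ (k, j))"
  using assms by (simp add: scalar_prod_def atLeast0LessThan)

lemma assoc_mult_dim:
  "dim_col A = dim_row B \<Longrightarrow> dim_col B = dim_row C \<Longrightarrow> A * B * C = A * (B * C)"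
  by (rule assoc_mult_mat[of A "dim_row A" "dim_row B" B "dim_row C" C "dim_col C"]) auto

lemma mtrace_comm:
  assumes "A \<in> carrier_mat n m" "B \<in> carrier_mat m n"
  shows "mtrace (A * B) = mtrace (B * A)"
proof -
  have "mtrace (A * B) = (\<Sum>i<n. \<Sum>k<m. A $$ (i, k) * B $$ (k, i))"
    using assms index_mult_mat_sum[OF assms] by (simp add: mtrace_def)
  also have "\<dots> = (\<Sum>k<m. \<Sum>i<n. B $$ (k, i) * A $$ (i, k))"
    by (subst sum.swap) (simp add: mult.commute)
  also have "\<dots> = mtrace (B * A)"
    using assms index_mult_mat_sum[OF assms(2,1)] by (simp add: mtrace_def)
  finally show ?thesis .
qed

lemma mtrace_one [simp]: "mtrace (1\<^sub>m n) = of_nat n"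
  by (simp add: mtrace_def)

lemma mtrace_add:
  assumes "A \<in> carrier_mat n n" "B \<in> carrier_mat n n"
  shows "mtrace (A + B) = mtrace A + mtrace B"
  using assms by (simp add: mtrace_def sum.distrib)

text \<open>
  Gaussian elimination, one column at a time. The statement uses indexed families instead of matrices so that
  columns can be removed without renumbering.
\<close>

lemma left_inverse_family:
  fixes F :: "'i \<Rightarrow> 'j \<Rightarrow> 'a::field"
  assumes "finite J" "finite I" "\<And>v. (\<And>i. i \<in> I \<Longrightarrow> (\<Sum>j\<in>J. F i j * v j) = 0) \<Longrightarrow> (\<forall>j\<in>J. v j = 0)"
  shows "\<exists>L. \<forall>a\<in>J. \<forall>c\<in>J. (\<Sum>i\<in>I. L a i * F i c) = (if a = c then 1 else 0)"
  using assms(1,3)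
proof (induction J rule: finite_induct)
  case (insert k J)
  have "\<forall>j\<in>J. v j = 0" if "\<And>i. i \<in> I \<Longrightarrow> (\<Sum>j\<in>J. F i j * v j) = 0" for v
  proof -
    have "\<forall>j\<in>insert k J. (v(k := 0)) j = 0"
    proof (rule insert.prems)
      fix i assume "i \<in> I"
      have "(\<Sum>j\<in>J. F i j * (v(k := 0)) j) = (\<Sum>j\<in>J. F i j * v j)"
        using insert.hyps by (intro sum.cong) auto
      then show "(\<Sum>j\<in>insert k J. F i j * (v(k := 0)) j) = 0"
        using insert.hyps that[OF \<open>i \<in> I\<close>] by simp
    qed
    then show ?thesis using insert.hyps by (metis fun_upd_other insertCI)
  qed
  from insert.IH[OF this] obtain M where M: "\<And>a c. a \<in> J \<Longrightarrow> c \<in> J \<Longrightarrow> (\<Sum>i\<in>I. M a i * F i c) = (if a = c then 1 else 0)"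
    by blast
  define c where "c j = (\<Sum>i\<in>I. M j i * F i k)" for j
  define b where "b i = F i k - (\<Sum>j\<in>J. F i j * c j)" for i
  have "\<exists>i0\<in>I. b i0 \<noteq> 0"
  proof (rule ccontr)
    assume "\<not> (\<exists>i0\<in>I. b i0 \<noteq> 0)"
    have "\<forall>j\<in>insert k J. (c(k := -1)) j = 0"
    proof (rule insert.prems)
      fix i assume "i \<in> I"
      have "(\<Sum>j\<in>J. F i j * (c(k := -1)) j) = (\<Sum>j\<in>J. F i j * c j)"
        using insert.hyps by (intro sum.cong) auto
      moreover have "b i = 0" using \<open>i \<in> I\<close> \<open>\<not> (\<exists>i0\<in>I. b i0 \<noteq> 0)\<close> by blast
      ultimately show "(\<Sum>j\<in>insert k J. F i j * (c(k := -1)) j) = 0"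
        using insert.hyps by (simp add: b_def)
    qed
    then show False by simp
  qed
  then obtain i0 where i0: "i0 \<in> I" "b i0 \<noteq> 0" by blast
  define P where "P i = (if i = i0 then 1 else 0) - (\<Sum>j\<in>J. F i0 j * M j i)" for i
  have P: "(\<Sum>i\<in>I. P i * F i a) = F i0 a - (\<Sum>j\<in>J. F i0 j * (\<Sum>i\<in>I. M j i * F i a))" for a
  proof -
    have "(\<Sum>i\<in>I. P i * F i a) = (\<Sum>i\<in>I. (if i = i0 then F i a else 0)) - (\<Sum>i\<in>I. \<Sum>j\<in>J. F i0 j * (M j i * F i a))"
      unfolding sum_subtractf[symmetric]
      by (intro sum.cong refl) (simp add: P_def left_diff_distrib sum_distrib_right mult.assoc)
    also have "(\<Sum>i\<in>I. (if i = i0 then F i a else 0)) = F i0 a" using assms(2) i0 by simp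
    finally show ?thesis by (subst (asm) sum.swap) (simp add: sum_distrib_left)
  qed
  have P0: "(\<Sum>i\<in>I. P i * F i a) = 0" if "a \<in> J" for a
  proof -
    have "(\<Sum>j\<in>J. F i0 j * (\<Sum>i\<in>I. M j i * F i a)) = (\<Sum>j\<in>J. if j = a then F i0 j else 0)"
      using M that by (intro sum.cong) auto
    then show ?thesis using P[of a] that insert.hyps by simp
  qed
  have Pk: "(\<Sum>i\<in>I. P i * F i k) = b i0" using P[of k] by (simp add: b_def c_def)
  define L where "L a i = (if a = k then P i / b i0 else M a i - c a * (P i / b i0))" for a i
  have "(\<Sum>i\<in>I. L a i * F i d) = (if a = d then 1 else 0)" if "a \<in> insert k J" "d \<in> insert k J" for a d
  proof -
    have PF: "(\<Sum>i\<in>I. P i / b i0 * F i d) = (if d = k then 1 else 0)"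
    proof -
      have "(\<Sum>i\<in>I. P i / b i0 * F i d) = (\<Sum>i\<in>I. P i * F i d) / b i0" by (simp add: sum_divide_distrib)
      then show ?thesis using P0 Pk i0 that(2) by auto
    qed
    show ?thesis
    proof (cases "a = k")
      case True
      then show ?thesis using PF by (simp add: L_def)
    next
      case False
      then have "(\<Sum>i\<in>I. L a i * F i d) = (\<Sum>i\<in>I. M a i * F i d) - c a * (\<Sum>i\<in>I. P i / b i0 * F i d)"
        by (simp add: L_def left_diff_distrib sum_subtractf sum_distrib_left mult.assoc)
      then show ?thesis using PF M[of a d] that False insert.hyps by (auto simp: c_def)
    qed
  qed
  then show ?case by blast
qed simp

text \<open>
  A linear dependency \<open>v\<close> among the columns of \<open>B\<close> allows one term of the factorization to be absorbed into
  the others.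
\<close>

lemma factorization_drop:
  fixes B :: "'i \<Rightarrow> 'j \<Rightarrow> 'a::field"
  assumes "finite J" "j0 \<in> J" "v j0 \<noteq> 0" "(\<Sum>j\<in>J. B r j * v j) = 0"
  shows "(\<Sum>j\<in>J. B r j * L j c) = (\<Sum>j\<in>J - {j0}. B r j * (L j c - v j / v j0 * L j0 c))"
proof -
  have "B r j0 * v j0 = - (\<Sum>j\<in>J - {j0}. B r j * v j)"
    using assms sum.remove[OF assms(1,2), of "\<lambda>j. B r j * v j"] by (simp add: eq_neg_iff_add_eq_0)
  then have "B r j0 = - (\<Sum>j\<in>J - {j0}. B r j * v j) / v j0" using assms(3) by (simp add: field_simps)
  then have "B r j0 * L j0 c = - (\<Sum>j\<in>J - {j0}. B r j * (v j / v j0 * L j0 c))"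
    by (simp add: sum_divide_distrib sum_distrib_right mult.assoc)
  then show ?thesis
    using sum.remove[OF assms(1,2), of "\<lambda>j. B r j * L j c"] by (simp add: right_diff_distrib sum_subtractf)
qed

text \<open>
  In a factorization with the least number of inner indices, both factors have full rank by
  \<open>factorization_drop\<close>, hence one-sided inverses.
\<close>

lemma rank_factorization:
  fixes A :: "'a::field mat"
  assumes A: "A \<in> carrier_mat m d"
  shows "\<exists>k B L B' L'. B \<in> carrier_mat m k \<and> L \<in> carrier_mat k d \<and> B' \<in> carrier_mat k m \<and> L' \<in> carrier_mat d k \<and>
    A = B * L \<and> B' * B = 1\<^sub>m k \<and> L * L' = 1\<^sub>m k"
proof -
  define fac where "fac J B L \<longleftrightarrow> finite J \<and> (\<forall>r<m. \<forall>c<d. A $$ (r, c) = (\<Sum>j\<in>J. B r j * L j c))"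
    for J :: "nat set" and B L
  define ex where "ex n \<longleftrightarrow> (\<exists>J B L. fac J B L \<and> card J = n)" for n
  have "fac {..<m} (\<lambda>r j. if r = j then 1 else 0) (\<lambda>j c. A $$ (j, c))"
    unfolding fac_def
  proof (intro conjI allI impI)
    fix r c assume "r < m"
    have "(\<Sum>j<m. (if r = j then 1 else 0) * A $$ (j, c)) = (\<Sum>j<m. if j = r then A $$ (j, c) else 0)"
      by (intro sum.cong) auto
    then show "A $$ (r, c) = (\<Sum>j<m. (if r = j then 1 else 0) * A $$ (j, c))" using \<open>r < m\<close> by simp
  qed simp
  then have "ex m" unfolding ex_def by (metis card_lessThan)
  then obtain k where k: "ex k" and min: "\<And>n. n < k \<Longrightarrow> \<not> ex n"
    using exists_least_iff[of ex] by blast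
  then obtain J B L where f: "fac J B L" "card J = k" unfolding ex_def by blast
  have fin: "finite J" and AB: "\<And>r c. r < m \<Longrightarrow> c < d \<Longrightarrow> A $$ (r, c) = (\<Sum>j\<in>J. B r j * L j c)"
    using f by (auto simp: fac_def)
  have drop: False if "fac (J - {j0}) B' L'" "j0 \<in> J" for j0 B' L'
  proof -
    have "card (J - {j0}) < k" using fin that(2) f(2) by (metis card_Diff1_less)
    then show False using min that(1) unfolding ex_def by blast
  qed
  have inj1: "\<forall>j\<in>J. v j = 0" if "\<And>r. r \<in> {..<m} \<Longrightarrow> (\<Sum>j\<in>J. B r j * v j) = 0" for v
  proof (rule ccontr)
    assume "\<not> (\<forall>j\<in>J. v j = 0)"
    then obtain j0 where j0: "j0 \<in> J" "v j0 \<noteq> 0" by blast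
    have "fac (J - {j0}) B (\<lambda>j c. L j c - v j / v j0 * L j0 c)"
      unfolding fac_def
    proof (intro conjI allI impI)
      fix r c assume "r < m" "c < d"
      then show "A $$ (r, c) = (\<Sum>j\<in>J - {j0}. B r j * (L j c - v j / v j0 * L j0 c))"
        using AB factorization_drop[OF fin, of j0 v B r L c] j0 that by simp
    qed (use fin in simp)
    then show False using drop j0 by blast
  qed
  have inj2: "\<forall>j\<in>J. v j = 0" if "\<And>c. c \<in> {..<d} \<Longrightarrow> (\<Sum>j\<in>J. L j c * v j) = 0" for v
  proof (rule ccontr)
    assume "\<not> (\<forall>j\<in>J. v j = 0)"
    then obtain j0 where j0: "j0 \<in> J" "v j0 \<noteq> 0" by blast
    have "fac (J - {j0}) (\<lambda>r j. B r j - v j / v j0 * B r j0) L"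
      unfolding fac_def
    proof (intro conjI allI impI)
      fix r c assume "r < m" "c < d"
      then have "A $$ (r, c) = (\<Sum>j\<in>J. L j c * B r j)" using AB by (simp add: mult.commute)
      also have "\<dots> = (\<Sum>j\<in>J - {j0}. L j c * (B r j - v j / v j0 * B r j0))"
        using factorization_drop[OF fin, of j0 v "\<lambda>c j. L j c" c "\<lambda>j r. B r j" r] j0 that \<open>c < d\<close> by simp
      finally show "A $$ (r, c) = (\<Sum>j\<in>J - {j0}. (B r j - v j / v j0 * B r j0) * L j c)"
        by (simp add: mult.commute)
    qed (use fin in simp)
    then show False using drop j0 by blast
  qed
  have "\<exists>B'. \<forall>a\<in>J. \<forall>c\<in>J. (\<Sum>r<m. B' a r * B r c) = (if a = c then 1 else 0)"
    by (rule left_inverse_family[OF fin finite_lessThan inj1])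
  then obtain B' where "\<forall>a\<in>J. \<forall>c\<in>J. (\<Sum>r<m. B' a r * B r c) = (if a = c then 1 else 0)" by (rule exE)
  then have B': "\<And>a c. a \<in> J \<Longrightarrow> c \<in> J \<Longrightarrow> (\<Sum>r<m. B' a r * B r c) = (if a = c then 1 else 0)" by simp
  have "\<exists>L'. \<forall>a\<in>J. \<forall>c\<in>J. (\<Sum>r<d. L' a r * L c r) = (if a = c then 1 else 0)"
    by (rule left_inverse_family[OF fin finite_lessThan inj2])
  then obtain L' where "\<forall>a\<in>J. \<forall>c\<in>J. (\<Sum>r<d. L' a r * L c r) = (if a = c then 1 else 0)" by (rule exE)
  then have L': "\<And>a c. a \<in> J \<Longrightarrow> c \<in> J \<Longrightarrow> (\<Sum>r<d. L' a r * L c r) = (if a = c then 1 else 0)" by simp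
  obtain h where h: "bij_betw h {..<k} J"
    using ex_bij_betw_nat_finite[OF fin] f(2) by (auto simp: atLeast0LessThan)
  have hJ: "h i \<in> J" if "i < k" for i using h that by (auto simp: bij_betw_def)
  have hinj: "h i = h j \<longleftrightarrow> i = j" if "i < k" "j < k" for i j
    using h that by (auto simp: bij_betw_def inj_on_def)
  define mB where "mB = mat m k (\<lambda>(r, j). B r (h j))"
  define mL where "mL = mat k d (\<lambda>(j, c). L (h j) c)"
  define mB' where "mB' = mat k m (\<lambda>(j, r). B' (h j) r)"
  define mL' where "mL' = mat d k (\<lambda>(c, j). L' (h j) c)"
  have car: "mB \<in> carrier_mat m k" "mL \<in> carrier_mat k d" "mB' \<in> carrier_mat k m" "mL' \<in> carrier_mat d k"
    by (simp_all add: mB_def mL_def mB'_def mL'_def)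
  have "A = mB * mL"
  proof (rule eq_matI)
    fix r c assume "r < dim_row (mB * mL)" "c < dim_col (mB * mL)"
    then have rc: "r < m" "c < d" using car by auto
    have "(mB * mL) $$ (r, c) = (\<Sum>j<k. B r (h j) * L (h j) c)"
      using rc index_mult_mat_sum[OF car(1,2) rc] by (simp add: mB_def mL_def)
    also have "\<dots> = (\<Sum>j\<in>J. B r j * L j c)" by (rule sum.reindex_bij_betw[OF h])
    finally show "A $$ (r, c) = (mB * mL) $$ (r, c)" using AB rc by simp
  qed (use A car in auto)
  moreover have "mB' * mB = 1\<^sub>m k"
  proof (rule eq_matI)
    fix i j assume "i < dim_row (1\<^sub>m k :: 'a mat)" "j < dim_col (1\<^sub>m k :: 'a mat)"
    then have ij: "i < k" "j < k" by auto
    show "(mB' * mB) $$ (i, j) = 1\<^sub>m k $$ (i, j)"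
      using ij index_mult_mat_sum[OF car(3,1) ij] B'[OF hJ hJ, OF ij] hinj[OF ij] by (simp add: mB_def mB'_def)
  qed (use car in auto)
  moreover have "mL * mL' = 1\<^sub>m k"
  proof (rule eq_matI)
    fix i j assume "i < dim_row (1\<^sub>m k :: 'a mat)" "j < dim_col (1\<^sub>m k :: 'a mat)"
    then have ij: "i < k" "j < k" by auto
    show "(mL * mL') $$ (i, j) = 1\<^sub>m k $$ (i, j)"
      using ij index_mult_mat_sum[OF car(2,4) ij] L'[OF hJ hJ, OF ij(2,1)] hinj[OF ij]
      by (auto simp: mL_def mL'_def mult.commute)
  qed (use car in auto)
  ultimately show ?thesis using car by blast
qed

lemma idempotent_splitting:
  fixes E :: "'a::field mat"
  assumes E: "E \<in> carrier_mat d d" "E * E = E"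
  shows "\<exists>k C D. C \<in> carrier_mat d k \<and> D \<in> carrier_mat k d \<and> E = C * D \<and> D * C = 1\<^sub>m k"
proof -
  obtain k C D C' D' where car: "C \<in> carrier_mat d k" "D \<in> carrier_mat k d" "C' \<in> carrier_mat k d" "D' \<in> carrier_mat d k"
    and eq: "E = C * D" "C' * C = 1\<^sub>m k" "D * D' = 1\<^sub>m k"
    using rank_factorization[OF E(1)] by blast
  note dims = car[THEN carrier_matD(1)] car[THEN carrier_matD(2)]
  have DC: "D * C \<in> carrier_mat k k" using car by simp
  have "D * C = (C' * C) * (D * C) * (D * D')"
    unfolding eq(2,3) left_mult_one_mat[OF DC] right_mult_one_mat[OF DC] ..
  also have "\<dots> = C' * (E * E) * D'" unfolding eq(1) by (simp add: assoc_mult_dim dims)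
  also have "\<dots> = (C' * C) * (D * D')" unfolding E(2) unfolding eq(1) by (simp add: assoc_mult_dim dims)
  also have "\<dots> = 1\<^sub>m k" using eq by simp
  finally show ?thesis using car eq by blast
qed

text \<open>
  The source of all integrality: the trace of an idempotent is its rank.
\<close>

lemma mtrace_idempotent:
  fixes E :: "'a::field mat"
  assumes E: "E \<in> carrier_mat d d" "E * E = E"
  shows "\<exists>k. mtrace E = of_nat k \<and> (k = 0 \<longrightarrow> E = 0\<^sub>m d d)"
proof -
  obtain k C D where *: "C \<in> carrier_mat d k" "D \<in> carrier_mat k d" "E = C * D" "D * C = 1\<^sub>m k"
    using idempotent_splitting[OF E] by blast
  have "mtrace E = of_nat k" using mtrace_comm[OF *(1,2)] * by simp
  moreover have "E = 0\<^sub>m d d" if "k = 0"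
    using *(1,2) that unfolding *(3) by (intro eq_matI) (auto simp: scalar_prod_def)
  ultimately show ?thesis by blast
qed

lemma mult_mat_vec_cols_0:
  assumes "A \<in> carrier_mat m d" "N \<in> carrier_mat d l"
    "\<And>v. v \<in> carrier_vec d \<Longrightarrow> A *\<^sub>v v = 0\<^sub>v m \<Longrightarrow> v = 0\<^sub>v d" "A * N = 0\<^sub>m m l"
  shows "N = (0\<^sub>m d l :: 'a::field mat)"
proof (rule mat_col_eqI)
  fix j assume "j < dim_col (0\<^sub>m d l :: 'a mat)"
  then have j: "j < l" by simp
  have "A *\<^sub>v col N j = col (A * N) j" by (rule col_mult2[OF assms(1,2) j, symmetric])
  also have "\<dots> = 0\<^sub>v m" using j unfolding assms(4) by simp
  finally show "col N j = col (0\<^sub>m d l) j" using assms(2,3) j by (auto simp: col_dim)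
qed (use assms in auto)

lemma left_inverse_mat:
  fixes A :: "'a::field mat"
  assumes A: "A \<in> carrier_mat m d"
    and inj: "\<And>v. v \<in> carrier_vec d \<Longrightarrow> A *\<^sub>v v = 0\<^sub>v m \<Longrightarrow> v = 0\<^sub>v d"
  shows "\<exists>Y\<in>carrier_mat d m. Y * A = 1\<^sub>m d"
proof -
  obtain k B L B' L' where car: "B \<in> carrier_mat m k" "L \<in> carrier_mat k d" "B' \<in> carrier_mat k m" "L' \<in> carrier_mat d k"
    and eq: "A = B * L" "B' * B = 1\<^sub>m k" "L * L' = 1\<^sub>m k"
    using rank_factorization[OF A] by blast
  define N where "N = 1\<^sub>m d - L' * L"
  note dims = car[THEN carrier_matD(1)] car[THEN carrier_matD(2)]
  have N: "N \<in> carrier_mat d d" unfolding N_def by (intro minus_carrier_mat mult_carrier_mat[OF car(4,2)])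
  have LN: "L * N = 0\<^sub>m k d"
  proof -
    have "L * N = L - L * (L' * L)"
      unfolding N_def using mult_minus_distrib_mat[OF car(2) one_carrier_mat mult_carrier_mat[OF car(4,2)]] car(2) by simp
    also have "L * (L' * L) = (L * L') * L" by (simp add: assoc_mult_dim dims)
    finally show ?thesis using car eq by simp
  qed
  have "A * N = B * (L * N)" unfolding eq(1) by (rule assoc_mult_mat[OF car(1,2) N])
  also have "\<dots> = 0\<^sub>m m d" using car LN by simp
  finally have "N = 0\<^sub>m d d" using mult_mat_vec_cols_0[OF A N inj] by blast
  then have LL: "L' * L = 1\<^sub>m d"
  proof -
    have "1\<^sub>m d = N + L' * L" using car unfolding N_def by (intro eq_matI) auto
    then show ?thesis using \<open>N = 0\<^sub>m d d\<close> car by simp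
  qed
  have "(L' * B') * A = L' * ((B' * B) * L)" unfolding eq(1) by (simp add: assoc_mult_dim dims)
  also have "\<dots> = 1\<^sub>m d" using car eq LL by simp
  finally show ?thesis using car by (intro bexI[of _ "L' * B'"]) auto
qed

text \<open>
  The columns of \<open>C\<close> are a basis of the kernel of \<open>A\<close>, and \<open>D\<close> computes coordinates in it. This replaces the
  kernel as a subspace by matrices.
\<close>

lemma kernel_splitting:
  fixes A :: "'a::field mat"
  assumes A: "A \<in> carrier_mat m d"
  obtains C q D where "C \<in> carrier_mat d q" "D \<in> carrier_mat q d" "D * C = 1\<^sub>m q" "A * C = 0\<^sub>m m q"
    "\<And>l Y. Y \<in> carrier_mat d l \<Longrightarrow> A * Y = 0\<^sub>m m l \<Longrightarrow> C * (D * Y) = Y"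
proof -
  obtain k B L B' L' where car: "B \<in> carrier_mat m k" "L \<in> carrier_mat k d" "B' \<in> carrier_mat k m" "L' \<in> carrier_mat d k"
    and eq: "A = B * L" "B' * B = 1\<^sub>m k" "L * L' = 1\<^sub>m k"
    using rank_factorization[OF A] by blast
  define N where "N = 1\<^sub>m d - L' * L"
  note dims = car[THEN carrier_matD(1)] car[THEN carrier_matD(2)]
  have N: "N \<in> carrier_mat d d" unfolding N_def by (intro minus_carrier_mat mult_carrier_mat[OF car(4,2)])
  have NX: "N * Y = Y - L' * (L * Y)" if "Y \<in> carrier_mat d l" for Y l
    unfolding N_def using minus_mult_distrib_mat[OF one_carrier_mat mult_carrier_mat[OF car(4,2)] that]
      that assoc_mult_mat[OF car(4,2) that] by simp
  have LN: "L * N = 0\<^sub>m k d"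
  proof -
    have "L * N = L - L * (L' * L)"
      unfolding N_def using mult_minus_distrib_mat[OF car(2) one_carrier_mat mult_carrier_mat[OF car(4,2)]] car(2) by simp
    also have "L * (L' * L) = (L * L') * L" by (simp add: assoc_mult_dim dims)
    finally show ?thesis using car eq by simp
  qed
  have "N * N = N" using NX[OF N] N car(4) unfolding LN by (intro eq_matI) auto
  from idempotent_splitting[OF N this] obtain q C D where
    CD: "C \<in> carrier_mat d q" "D \<in> carrier_mat q d" "N = C * D" "D * C = 1\<^sub>m q" by blast
  have cd: "dim_row C = d" "dim_col C = q" "dim_row D = q" "dim_col D = d" using CD by auto
  have LCc: "L * C \<in> carrier_mat k q" using CD(1) car(2) by simp
  have "L * C = (L * C) * (D * C)" unfolding CD(4) right_mult_one_mat[OF LCc] ..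
  also have "\<dots> = (L * N) * C" unfolding CD(3) by (simp add: assoc_mult_dim dims cd)
  finally have LC: "L * C = 0\<^sub>m k q" using LN CD(1) by simp
  have "A * C = B * (L * C)" unfolding eq(1) by (simp add: assoc_mult_dim dims cd)
  then have AC: "A * C = 0\<^sub>m m q" using LC car(1) by simp
  have "C * (D * Y) = Y" if Y: "Y \<in> carrier_mat d l" "A * Y = 0\<^sub>m m l" for Y l
  proof -
    have "L * Y = B' * (A * Y)"
    proof -
      have "B' * (A * Y) = (B' * B) * (L * Y)" unfolding eq(1) using Y(1) by (simp add: assoc_mult_dim dims)
      then show ?thesis by (simp only: eq(2) left_mult_one_mat[OF mult_carrier_mat[OF car(2) Y(1)]])
    qed
    then have "L * Y = 0\<^sub>m k l" using Y(2) car(3) by simp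
    have "C * (D * Y) = N * Y" unfolding CD(3) using Y(1) by (simp add: assoc_mult_dim cd)
    then show ?thesis using NX[OF Y(1)] \<open>L * Y = 0\<^sub>m k l\<close> car(4) Y(1) by (intro eq_matI) auto
  qed
  then show ?thesis by (rule that[OF CD(1,2,4) AC])
qed

section \<open>Kronecker products\<close>

lemma tensor_mat_dim [simp]:
  "dim_row (tensor_mat A B) = dim_row A * dim_row B" "dim_col (tensor_mat A B) = dim_col A * dim_col B"
  by (simp_all add: tensor_mat_def)

lemma tensor_mat_carrier [simp]:
  "A \<in> carrier_mat n m \<Longrightarrow> B \<in> carrier_mat n' m' \<Longrightarrow> tensor_mat A B \<in> carrier_mat (n * n') (m * m')"
  by (intro carrier_matI) (simp_all add: carrier_matD)

lemma div_mod_less: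
  assumes "i < n * (m::nat)" shows "i div m < n" "i mod m < m"
proof -
  show "i div m < n" using assms by (rule less_mult_imp_div_less)
  have "m > 0" using assms by (cases m) auto
  then show "i mod m < m" by simp
qed

lemma tensor_mat_index:
  assumes "i < dim_row A * dim_row B" "j < dim_col A * dim_col B"
  shows "tensor_mat A B $$ (i, j) = A $$ (i div dim_row B, j div dim_col B) * B $$ (i mod dim_row B, j mod dim_col B)"
  using assms by (simp add: tensor_mat_def)

lemma sum_div_mod:
  fixes a b :: nat
  shows "(\<Sum>c<a * b. f (c div b) (c mod b)) = (\<Sum>p<a. \<Sum>q<b. (f p q :: 'a::comm_monoid_add))"
proof -
  have le: "p * b + q < a * b" if "p < a" "q < b" for p q
  proof -
    have "p * b + q < Suc p * b" using that by simp
    also have "\<dots> \<le> a * b" using that by (intro mult_right_mono) auto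
    finally show ?thesis .
  qed
  have bij: "bij_betw (\<lambda>c. (c div b, c mod b)) {..<a * b} (Sigma {..<a} (\<lambda>_. {..<b}))"
  proof (rule bij_betw_byWitness[where f' = "\<lambda>x. fst x * b + snd x"], goal_cases)
    case 3
    show ?case
    proof
      fix x assume "x \<in> (\<lambda>c. (c div b, c mod b)) ` {..<a * b}"
      then obtain c where "c < a * b" "x = (c div b, c mod b)" by auto
      then show "x \<in> Sigma {..<a} (\<lambda>_. {..<b})" using div_mod_less[of c a b] by simp
    qed
  next
    case 4
    show ?case
    proof
      fix c assume "c \<in> (\<lambda>x. fst x * b + snd x) ` Sigma {..<a} (\<lambda>_. {..<b})"
      then obtain p q where "p < a" "q < b" "c = p * b + q" by fastforce
      then show "c \<in> {..<a * b}" using le[of p q] by simp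
    qed
  next
    case 1
    show ?case by (simp add: div_mult_mod_eq)
  next
    case 2
    show ?case
    proof
      fix x assume "x \<in> Sigma {..<a} (\<lambda>_. {..<b})"
      then have "snd x < b" by auto
      then show "((fst x * b + snd x) div b, (fst x * b + snd x) mod b) = x"
        by (simp add: prod_eq_iff)
    qed
  qed
  have "(\<Sum>c<a * b. f (c div b) (c mod b)) = (\<Sum>x\<in>Sigma {..<a} (\<lambda>_. {..<b}). f (fst x) (snd x))"
    using sum.reindex_bij_betw[OF bij, of "\<lambda>x. f (fst x) (snd x)"] by simp
  also have "\<dots> = (\<Sum>p<a. \<Sum>q<b. f p q)" by (subst sum.Sigma) (auto simp: split_beta)
  finally show ?thesis .
qed

lemma tensor_mat_mult:
  fixes A :: "'a::field mat"
  assumes "A \<in> carrier_mat n m" "C \<in> carrier_mat m l" "B \<in> carrier_mat n' m'" "D \<in> carrier_mat m' l'"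
  shows "tensor_mat (A * C) (B * D) = tensor_mat A B * tensor_mat C D"
proof (rule eq_matI)
  fix i j assume "i < dim_row (tensor_mat A B * tensor_mat C D)" "j < dim_col (tensor_mat A B * tensor_mat C D)"
  then have ij: "i < n * n'" "j < l * l'" using assms by auto
  note i = div_mod_less[OF ij(1)] and j = div_mod_less[OF ij(2)]
  have "(tensor_mat A B * tensor_mat C D) $$ (i, j) = (\<Sum>k<m * m'. tensor_mat A B $$ (i, k) * tensor_mat C D $$ (k, j))"
    by (rule index_mult_mat_sum[OF tensor_mat_carrier[OF assms(1,3)] tensor_mat_carrier[OF assms(2,4)] ij])
  also have "\<dots> = (\<Sum>k<m * m'. (A $$ (i div n', k div m') * C $$ (k div m', j div l')) * (B $$ (i mod n', k mod m') * D $$ (k mod m', j mod l')))"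
    using assms ij by (intro sum.cong refl) (simp add: tensor_mat_index)
  also have "\<dots> = (\<Sum>p<m. \<Sum>q<m'. (A $$ (i div n', p) * C $$ (p, j div l')) * (B $$ (i mod n', q) * D $$ (q, j mod l')))"
    by (rule sum_div_mod)
  also have "\<dots> = (A * C) $$ (i div n', j div l') * (B * D) $$ (i mod n', j mod l')"
    by (simp add: index_mult_mat_sum[OF assms(1,2) i(1) j(1)] index_mult_mat_sum[OF assms(3,4) i(2) j(2)] sum_product)
  also have "\<dots> = tensor_mat (A * C) (B * D) $$ (i, j)"
    using assms ij by (simp add: tensor_mat_index)
  finally show "tensor_mat (A * C) (B * D) $$ (i, j) = (tensor_mat A B * tensor_mat C D) $$ (i, j)" by simp
qed (use assms in auto)

lemma tensor_mat_one: "tensor_mat (1\<^sub>m a) (1\<^sub>m b) = (1\<^sub>m (a * b) :: 'a::field mat)"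
proof (rule eq_matI)
  fix i j assume "i < dim_row (1\<^sub>m (a * b) :: 'a mat)" "j < dim_col (1\<^sub>m (a * b) :: 'a mat)"
  then have ij: "i < a * b" "j < a * b" by auto
  note i = div_mod_less[OF ij(1)] and j = div_mod_less[OF ij(2)]
  have "i = j \<longleftrightarrow> i div b = j div b \<and> i mod b = j mod b" by (metis div_mult_mod_eq)
  then show "tensor_mat (1\<^sub>m a) (1\<^sub>m b) $$ (i, j) = (1\<^sub>m (a * b) :: 'a mat) $$ (i, j)"
    using ij i j by (auto simp: tensor_mat_index)
qed auto

lemma mtrace_tensor:
  fixes A :: "'a::field mat"
  assumes "A \<in> carrier_mat n n" "B \<in> carrier_mat m m"
  shows "mtrace (tensor_mat A B) = mtrace A * mtrace B"
proof -
  have "mtrace (tensor_mat A B) = (\<Sum>k<n * m. A $$ (k div m, k div m) * B $$ (k mod m, k mod m))"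
    using assms by (simp add: mtrace_def tensor_mat_index)
  also have "\<dots> = (\<Sum>p<n. \<Sum>q<m. A $$ (p, p) * B $$ (q, q))" by (rule sum_div_mod)
  finally show ?thesis using assms by (simp add: mtrace_def sum_product)
qed

text \<open>
  Matches the index order of \<open>tensor_mat\<close>: intertwiners become invariant vectors of a tensor product.
\<close>

definition vectorize :: "nat \<Rightarrow> nat \<Rightarrow> 'a mat \<Rightarrow> 'a vec"
  where "vectorize a b Y = vec (a * b) (\<lambda>c. Y $$ (c div b, c mod b))"

lemma tensor_mat_vectorize:
  fixes A :: "'a::field mat"
  assumes A: "A \<in> carrier_mat a a" and Y: "Y \<in> carrier_mat a b" and B: "B \<in> carrier_mat b b"
  shows "tensor_mat A (transpose_mat B) *\<^sub>v vectorize a b Y = vectorize a b (A * Y * B)"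
proof (rule eq_vecI)
  fix i assume "i < dim_vec (vectorize a b (A * Y * B))"
  then have i: "i < a * b" by (simp add: vectorize_def)
  note i' = div_mod_less[OF i]
  have "(tensor_mat A (transpose_mat B) *\<^sub>v vectorize a b Y) $ i =
      (\<Sum>k<a * b. tensor_mat A (transpose_mat B) $$ (i, k) * vectorize a b Y $ k)"
    using assms i by (simp add: scalar_prod_def vectorize_def atLeast0LessThan)
  also have "\<dots> = (\<Sum>k<a * b. A $$ (i div b, k div b) * B $$ (k mod b, i mod b) * Y $$ (k div b, k mod b))"
    using assms i i' by (intro sum.cong refl) (auto simp: tensor_mat_index vectorize_def div_mod_less)
  also have "\<dots> = (\<Sum>p<a. \<Sum>q<b. A $$ (i div b, p) * B $$ (q, i mod b) * Y $$ (p, q))"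
    by (rule sum_div_mod)
  also have "\<dots> = (\<Sum>q<b. (\<Sum>p<a. A $$ (i div b, p) * Y $$ (p, q)) * B $$ (q, i mod b))"
    by (subst sum.swap) (simp add: sum_distrib_left mult_ac)
  also have "\<dots> = (\<Sum>q<b. (A * Y) $$ (i div b, q) * B $$ (q, i mod b))"
    by (intro sum.cong refl) (simp add: index_mult_mat_sum[OF A Y i'(1)])
  also have "\<dots> = (A * Y * B) $$ (i div b, i mod b)"
    by (rule index_mult_mat_sum[OF mult_carrier_mat[OF A Y] B i', symmetric])
  finally show "(tensor_mat A (transpose_mat B) *\<^sub>v vectorize a b Y) $ i = vectorize a b (A * Y * B) $ i"
    using i by (simp add: vectorize_def)
qed (use assms in \<open>auto simp: vectorize_def\<close>)

lemma vectorize_inj: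
  assumes "Y \<in> carrier_mat a b" "Z \<in> carrier_mat a b" "vectorize a b Y = vectorize a b Z"
  shows "Y = Z"
proof (rule eq_matI)
  fix i j assume "i < dim_row Z" "j < dim_col Z"
  then have ij: "i < a" "j < b" using assms by auto
  have "i * b + j < Suc i * b" using ij by simp
  also have "\<dots> \<le> a * b" using ij by (intro mult_right_mono) auto
  finally have "i * b + j < a * b" .
  then show "Y $$ (i, j) = Z $$ (i, j)"
    using arg_cong[OF assms(3), of "\<lambda>v. v $ (i * b + j)"] ij by (simp add: vectorize_def)
qed (use assms in auto)

lemma vectorize_surj:
  assumes "v \<in> carrier_vec (a * b)"
  shows "v = vectorize a b (mat a b (\<lambda>(i, j). v $ (i * b + j)))"
  using assms by (intro eq_vecI) (auto simp: vectorize_def div_mod_less)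

section \<open>Averaging idempotents\<close>

definition mat_avg :: "nat \<Rightarrow> 'h set \<Rightarrow> ('h \<Rightarrow> 'a::field mat) \<Rightarrow> 'a mat"
  where "mat_avg d H f = mat d d (\<lambda>(i, j). (\<Sum>h\<in>H. f h $$ (i, j)) / of_nat (card H))"

lemma mat_avg_carrier [simp]: "mat_avg d H f \<in> carrier_mat d d"
  by (simp add: mat_avg_def)

lemma mat_avg_cong: "(\<And>h. h \<in> H \<Longrightarrow> f h = g h) \<Longrightarrow> mat_avg d H f = mat_avg d H g"
  by (simp add: mat_avg_def)

lemma mult_mat_avg:
  assumes "A \<in> carrier_mat d d" "\<And>h. h \<in> H \<Longrightarrow> f h \<in> carrier_mat d d"
  shows "A * mat_avg d H f = mat_avg d H (\<lambda>h. A * f h)" "mat_avg d H f * A = mat_avg d H (\<lambda>h. f h * A)"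
proof -
  show "A * mat_avg d H f = mat_avg d H (\<lambda>h. A * f h)"
  proof (rule eq_matI)
    fix i j assume "i < dim_row (mat_avg d H (\<lambda>h. A * f h))" "j < dim_col (mat_avg d H (\<lambda>h. A * f h))"
    then have ij: "i < d" "j < d" by (auto simp: mat_avg_def)
    have "(A * mat_avg d H f) $$ (i, j) = (\<Sum>k<d. A $$ (i, k) * mat_avg d H f $$ (k, j))"
      by (rule index_mult_mat_sum[OF assms(1) mat_avg_carrier ij])
    also have "\<dots> = (\<Sum>k<d. \<Sum>h\<in>H. A $$ (i, k) * f h $$ (k, j)) / of_nat (card H)"
      using ij by (simp add: mat_avg_def sum_divide_distrib sum_distrib_left)
    also have "\<dots> = (\<Sum>h\<in>H. (A * f h) $$ (i, j)) / of_nat (card H)"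
      by (subst sum.swap) (simp add: index_mult_mat_sum[OF assms(1) assms(2) ij])
    finally show "(A * mat_avg d H f) $$ (i, j) = mat_avg d H (\<lambda>h. A * f h) $$ (i, j)"
      using ij by (simp add: mat_avg_def)
  qed (use assms in \<open>auto simp: mat_avg_def\<close>)
  show "mat_avg d H f * A = mat_avg d H (\<lambda>h. f h * A)"
  proof (rule eq_matI)
    fix i j assume "i < dim_row (mat_avg d H (\<lambda>h. f h * A))" "j < dim_col (mat_avg d H (\<lambda>h. f h * A))"
    then have ij: "i < d" "j < d" by (auto simp: mat_avg_def)
    have "(mat_avg d H f * A) $$ (i, j) = (\<Sum>k<d. mat_avg d H f $$ (i, k) * A $$ (k, j))"
      by (rule index_mult_mat_sum[OF mat_avg_carrier assms(1) ij])
    also have "\<dots> = (\<Sum>k<d. \<Sum>h\<in>H. f h $$ (i, k) * A $$ (k, j)) / of_nat (card H)"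
      using ij by (simp add: mat_avg_def sum_divide_distrib sum_distrib_right)
    also have "\<dots> = (\<Sum>h\<in>H. (f h * A) $$ (i, j)) / of_nat (card H)"
      by (subst sum.swap) (simp add: index_mult_mat_sum[OF assms(2) assms(1) ij])
    finally show "(mat_avg d H f * A) $$ (i, j) = mat_avg d H (\<lambda>h. f h * A) $$ (i, j)"
      using ij by (simp add: mat_avg_def)
  qed (use assms in \<open>auto simp: mat_avg_def\<close>)
qed

lemma mtrace_mat_avg:
  assumes "\<And>h. h \<in> H \<Longrightarrow> f h \<in> carrier_mat d d"
  shows "mtrace (mat_avg d H f) = (\<Sum>h\<in>H. mtrace (f h)) / of_nat (card H)"
proof -
  have "mtrace (mat_avg d H f) = (\<Sum>i<d. \<Sum>h\<in>H. f h $$ (i, i)) / of_nat (card H)"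
    by (simp add: mtrace_def mat_avg_def sum_divide_distrib)
  also have "(\<Sum>i<d. \<Sum>h\<in>H. f h $$ (i, i)) = (\<Sum>h\<in>H. mtrace (f h))"
    by (subst sum.swap) (use assms in \<open>auto simp: mtrace_def intro!: sum.cong\<close>)
  finally show ?thesis .
qed

lemma mat_avg_const:
  assumes "A \<in> carrier_mat d d" "finite H" "H \<noteq> {}"
  shows "mat_avg d H (\<lambda>_. A) = (A :: 'a::field_char_0 mat)"
  using assms by (intro eq_matI) (auto simp: mat_avg_def)

lemma mat_avg_vec:
  fixes f :: "'h \<Rightarrow> 'a::field_char_0 mat"
  assumes "finite H" "H \<noteq> {}" "\<And>h. h \<in> H \<Longrightarrow> f h \<in> carrier_mat d d" "v \<in> carrier_vec d"
    and fix_v: "\<And>h. h \<in> H \<Longrightarrow> f h *\<^sub>v v = v"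
  shows "mat_avg d H f *\<^sub>v v = v"
proof (rule eq_vecI)
  fix i assume "i < dim_vec v"
  then have i: "i < d" using assms by simp
  have "(mat_avg d H f *\<^sub>v v) $ i = (\<Sum>k<d. mat_avg d H f $$ (i, k) * v $ k)"
    using i assms(4) by (simp add: mat_avg_def scalar_prod_def atLeast0LessThan)
  also have "\<dots> = (\<Sum>k<d. \<Sum>h\<in>H. f h $$ (i, k) * v $ k) / of_nat (card H)"
    using i by (simp add: mat_avg_def sum_divide_distrib sum_distrib_right)
  also have "(\<Sum>k<d. \<Sum>h\<in>H. f h $$ (i, k) * v $ k) = (\<Sum>h\<in>H. (f h *\<^sub>v v) $ i)"
  proof (subst sum.swap, intro sum.cong refl)
    fix h assume "h \<in> H"
    then show "(\<Sum>k<d. f h $$ (i, k) * v $ k) = (f h *\<^sub>v v) $ i"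
      using i assms(4) carrier_matD[OF assms(3)[of h]] by (simp add: scalar_prod_def atLeast0LessThan)
  qed
  also have "\<dots> = of_nat (card H) * v $ i" using fix_v by simp
  finally show "(mat_avg d H f *\<^sub>v v) $ i = v $ i" using assms(1,2) by simp
qed (use assms in \<open>auto simp: mat_avg_def\<close>)

text \<open>
  The average of a representation over a finite group projects onto the invariants. A finite set closed under
  a cancellative operation covers both the carrier of a group and the signed permutations of a block,
  where the representation is twisted by a linear character.
\<close>

lemma mat_avg_idempotent:
  fixes f :: "'h \<Rightarrow> 'a::field_char_0 mat"
  assumes H: "finite H" "H \<noteq> {}" and f: "\<And>h. h \<in> H \<Longrightarrow> f h \<in> carrier_mat d d"
    and m: "\<And>h k. h \<in> H \<Longrightarrow> k \<in> H \<Longrightarrow> mul h k \<in> H" "\<And>h. h \<in> H \<Longrightarrow> inj_on (mul h) H"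
    and fm: "\<And>h k. h \<in> H \<Longrightarrow> k \<in> H \<Longrightarrow> f (mul h k) = f h * f k"
  shows "h \<in> H \<Longrightarrow> f h * mat_avg d H f = mat_avg d H f"
    "mat_avg d H f * mat_avg d H f = mat_avg d H f"
proof -
  show absorb: "f h * mat_avg d H f = mat_avg d H f" if h: "h \<in> H" for h
  proof -
    have "mul h ` H = H" using m[OF h] H by (intro endo_inj_surj) auto
    then have bij: "bij_betw (mul h) H H" using m(2)[OF h] by (simp add: bij_betw_def)
    have "f h * mat_avg d H f = mat_avg d H (\<lambda>k. f h * f k)" by (rule mult_mat_avg(1)[OF f[OF h] f])
    also have "\<dots> = mat_avg d H (\<lambda>k. f (mul h k))" using fm[OF h] by (intro mat_avg_cong) simp
    also have "\<dots> = mat_avg d H f"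
      unfolding mat_avg_def using sum.reindex_bij_betw[OF bij, of "\<lambda>k. f k $$ _"] by simp
    finally show ?thesis .
  qed
  have "mat_avg d H f * mat_avg d H f = mat_avg d H (\<lambda>h. f h * mat_avg d H f)"
    by (rule mult_mat_avg(2)[OF mat_avg_carrier f])
  also have "\<dots> = mat_avg d H (\<lambda>_. mat_avg d H f)" using absorb by (intro mat_avg_cong) simp
  also have "\<dots> = mat_avg d H f" by (rule mat_avg_const[OF mat_avg_carrier H])
  finally show "mat_avg d H f * mat_avg d H f = mat_avg d H f" .
qed

section \<open>Characters and intertwiners\<close>

lemma group_repD:
  assumes "group_rep G \<rho>"
  shows "g \<in> carrier G \<Longrightarrow> \<rho> g \<in> carrier_mat (rep_degree G \<rho>) (rep_degree G \<rho>)"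
    "\<rho> \<one>\<^bsub>G\<^esub> = 1\<^sub>m (rep_degree G \<rho>)"
    "g \<in> carrier G \<Longrightarrow> h \<in> carrier G \<Longrightarrow> \<rho> (g \<otimes>\<^bsub>G\<^esub> h) = \<rho> g * \<rho> h"
  using assms by (auto simp: group_rep_def)

lemma group_repI:
  assumes "\<And>g. g \<in> carrier G \<Longrightarrow> \<rho> g \<in> carrier_mat d d" "\<rho> \<one>\<^bsub>G\<^esub> = 1\<^sub>m d"
    "\<And>g h. g \<in> carrier G \<Longrightarrow> h \<in> carrier G \<Longrightarrow> \<rho> (g \<otimes>\<^bsub>G\<^esub> h) = \<rho> g * \<rho> h"
  shows "group_rep G \<rho>" "rep_degree G \<rho> = d"
  using assms by (auto simp: group_rep_def rep_degree_def)

lemma group_rep_inv: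
  assumes "group G" "group_rep G \<rho>" "g \<in> carrier G"
  shows "\<rho> (inv\<^bsub>G\<^esub> g) * \<rho> g = 1\<^sub>m (rep_degree G \<rho>)" "\<rho> g * \<rho> (inv\<^bsub>G\<^esub> g) = 1\<^sub>m (rep_degree G \<rho>)"
proof -
  interpret group G by fact
  show "\<rho> (inv\<^bsub>G\<^esub> g) * \<rho> g = 1\<^sub>m (rep_degree G \<rho>)" "\<rho> g * \<rho> (inv\<^bsub>G\<^esub> g) = 1\<^sub>m (rep_degree G \<rho>)"
    using assms(3) group_repD(2,3)[OF assms(2)] by (simp_all flip: group_repD(3)[OF assms(2)])
qed

text \<open>
  The pairing is, up to the group order, the trace of the projection onto the invariants of
  \<open>\<sigma> \<otimes> \<tau>\<^sup>*\<close>, which are the intertwiners from \<open>\<tau>\<close> to \<open>\<sigma>\<close>. So characters detect whether there is a nonzero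
  intertwiner.
\<close>

lemma character_pairing:
  fixes \<tau> \<sigma> :: "'g \<Rightarrow> 'a::field_char_0 mat"
  assumes G: "group G" "finite (carrier G)" and reps: "group_rep G \<tau>" "group_rep G \<sigma>"
  shows "\<exists>k. (\<Sum>g\<in>carrier G. mtrace (\<sigma> g) * mtrace (\<tau> (inv\<^bsub>G\<^esub> g))) = of_nat (card (carrier G)) * of_nat k \<and>
    (k = 0 \<longleftrightarrow> (\<forall>Y. intertwiner G \<tau> \<sigma> Y \<longrightarrow> Y = 0\<^sub>m (rep_degree G \<sigma>) (rep_degree G \<tau>)))"
proof -
  interpret group G by fact
  define a b where "a = rep_degree G \<sigma>" and "b = rep_degree G \<tau>"
  have T: "\<tau> g \<in> carrier_mat b b" if "g \<in> carrier G" for g using group_repD(1)[OF reps(1) that] by (simp add: b_def)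
  have S: "\<sigma> g \<in> carrier_mat a a" if "g \<in> carrier G" for g using group_repD(1)[OF reps(2) that] by (simp add: a_def)
  define f where "f g = tensor_mat (\<sigma> g) (transpose_mat (\<tau> (inv\<^bsub>G\<^esub> g)))" for g
  have f: "f g \<in> carrier_mat (a * b) (a * b)" if "g \<in> carrier G" for g
    unfolding f_def using S[OF that] T[of "inv\<^bsub>G\<^esub> g"] that by simp
  have fm: "f (g \<otimes>\<^bsub>G\<^esub> h) = f g * f h" if "g \<in> carrier G" "h \<in> carrier G" for g h
  proof -
    have "transpose_mat (\<tau> (inv\<^bsub>G\<^esub> (g \<otimes>\<^bsub>G\<^esub> h))) = transpose_mat (\<tau> (inv\<^bsub>G\<^esub> g)) * transpose_mat (\<tau> (inv\<^bsub>G\<^esub> h))"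
      using that T by (simp add: inv_mult_group group_repD(3)[OF reps(1)] transpose_mult[of _ b b _ b])
    then show ?thesis
      unfolding f_def group_repD(3)[OF reps(2) that] using that S T
      by (simp add: tensor_mat_mult[of _ a a _ a _ b b _ b])
  qed
  have one: "\<one>\<^bsub>G\<^esub> \<in> carrier G" by simp
  then have ne: "carrier G \<noteq> {}" by blast
  define E where "E = mat_avg (a * b) (carrier G) f"
  have inj: "inj_on (monoid.mult G g) (carrier G)" if "g \<in> carrier G" for g using that by (rule inj_on_cmult)
  note idem = mat_avg_idempotent[where mul = "monoid.mult G", OF G(2) ne f m_closed inj fm]
  have E': "E \<in> carrier_mat (a * b) (a * b)" "E * E = E" and fE: "f g * E = E" if "g \<in> carrier G" for g
    using idem that one unfolding E_def by simp_all
  obtain k where k: "mtrace E = of_nat k" "k = 0 \<longrightarrow> E = 0\<^sub>m (a * b) (a * b)"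
    using mtrace_idempotent[OF E'[OF one]] by blast
  have "mtrace E = (\<Sum>g\<in>carrier G. mtrace (f g)) / of_nat (card (carrier G))"
    unfolding E_def by (rule mtrace_mat_avg[OF f])
  also have "(\<Sum>g\<in>carrier G. mtrace (f g)) = (\<Sum>g\<in>carrier G. mtrace (\<sigma> g) * mtrace (\<tau> (inv\<^bsub>G\<^esub> g)))"
  proof (rule sum.cong[OF refl])
    fix g assume g: "g \<in> carrier G"
    have "mtrace (transpose_mat (\<tau> (inv\<^bsub>G\<^esub> g))) = mtrace (\<tau> (inv\<^bsub>G\<^esub> g))"
      using T[of "inv\<^bsub>G\<^esub> g"] g by (simp add: mtrace_def)
    then show "mtrace (f g) = mtrace (\<sigma> g) * mtrace (\<tau> (inv\<^bsub>G\<^esub> g))"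
      unfolding f_def using S[OF g] T[of "inv\<^bsub>G\<^esub> g"] g by (simp add: mtrace_tensor[of _ a _ b])
  qed
  finally have eq: "(\<Sum>g\<in>carrier G. mtrace (\<sigma> g) * mtrace (\<tau> (inv\<^bsub>G\<^esub> g))) = of_nat (card (carrier G)) * of_nat k"
    using k(1) G(2) ne by (simp add: field_simps)
  have act: "f g *\<^sub>v vectorize a b Y = vectorize a b (\<sigma> g * Y * \<tau> (inv\<^bsub>G\<^esub> g))"
    if "g \<in> carrier G" "Y \<in> carrier_mat a b" for g Y
    unfolding f_def using S[OF that(1)] T[of "inv\<^bsub>G\<^esub> g"] that by (intro tensor_mat_vectorize) auto
  have "k = 0 \<longleftrightarrow> (\<forall>Y. intertwiner G \<tau> \<sigma> Y \<longrightarrow> Y = 0\<^sub>m a b)"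
  proof
    assume "k = 0"
    then have E0: "E = 0\<^sub>m (a * b) (a * b)" using k by blast
    show "\<forall>Y. intertwiner G \<tau> \<sigma> Y \<longrightarrow> Y = 0\<^sub>m a b"
    proof (intro allI impI)
      fix Y assume Y: "intertwiner G \<tau> \<sigma> Y"
      then have Yc: "Y \<in> carrier_mat a b" by (simp add: intertwiner_def a_def b_def)
      have "f g *\<^sub>v vectorize a b Y = vectorize a b Y" if g: "g \<in> carrier G" for g
      proof -
        have gi: "inv\<^bsub>G\<^esub> g \<in> carrier G" using g by simp
        have "\<sigma> g * Y * \<tau> (inv\<^bsub>G\<^esub> g) = Y * (\<tau> g * \<tau> (inv\<^bsub>G\<^esub> g))"
          using Y g assoc_mult_mat[OF Yc T[OF g] T[OF gi]] by (simp add: intertwiner_def)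
        also have "\<dots> = Y" using group_rep_inv(2)[OF G(1) reps(1) g] Yc by (simp add: b_def)
        finally show ?thesis using act[OF g Yc] by simp
      qed
      then have "E *\<^sub>v vectorize a b Y = vectorize a b Y"
        unfolding E_def by (intro mat_avg_vec[OF G(2) ne f]) (auto simp: vectorize_def)
      moreover have "0\<^sub>m (a * b) (a * b) *\<^sub>v vectorize a b Y = 0\<^sub>v (a * b)"
        by (intro eq_vecI) (auto simp: vectorize_def scalar_prod_def)
      ultimately have "vectorize a b Y = 0\<^sub>v (a * b)" unfolding E0 by simp
      also have "\<dots> = vectorize a b (0\<^sub>m a b)"
        by (intro eq_vecI) (auto simp: vectorize_def div_mod_less)
      finally show "Y = 0\<^sub>m a b" using Yc by (intro vectorize_inj) auto
    qed
  next
    assume all0: "\<forall>Y. intertwiner G \<tau> \<sigma> Y \<longrightarrow> Y = 0\<^sub>m a b"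
    have "col E j = 0\<^sub>v (a * b)" if j: "j < a * b" for j
    proof -
      define v where "v = col E j"
      have v: "v \<in> carrier_vec (a * b)" using E'(1)[OF one] j by (simp add: v_def)
      define Y where "Y = mat a b (\<lambda>(i, j). v $ (i * b + j))"
      have Yc: "Y \<in> carrier_mat a b" by (simp add: Y_def)
      have vY: "v = vectorize a b Y" unfolding Y_def by (rule vectorize_surj[OF v])
      have "intertwiner G \<tau> \<sigma> Y"
        unfolding intertwiner_def a_def[symmetric] b_def[symmetric]
      proof (intro conjI ballI)
        fix g assume g: "g \<in> carrier G"
        have gi: "inv\<^bsub>G\<^esub> g \<in> carrier G" using g by simp
        have "f g *\<^sub>v v = col (f g * E) j" unfolding v_def by (rule col_mult2[OF f[OF g] E'(1)[OF one] j, symmetric])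
        then have "vectorize a b (\<sigma> g * Y * \<tau> (inv\<^bsub>G\<^esub> g)) = vectorize a b Y"
          using act[OF g Yc] fE[OF g] vY by (simp add: v_def)
        then have eqY: "\<sigma> g * Y * \<tau> (inv\<^bsub>G\<^esub> g) = Y"
          using mult_carrier_mat[OF mult_carrier_mat[OF S[OF g] Yc] T[OF gi]] Yc by (intro vectorize_inj)
        have "Y * \<tau> g = (\<sigma> g * Y * \<tau> (inv\<^bsub>G\<^esub> g)) * \<tau> g" by (simp only: eqY)
        also have "\<dots> = \<sigma> g * Y * (\<tau> (inv\<^bsub>G\<^esub> g) * \<tau> g)"
          by (rule assoc_mult_mat[OF mult_carrier_mat[OF S[OF g] Yc] T[OF gi] T[OF g]])
        also have "\<dots> = \<sigma> g * Y"
          unfolding group_rep_inv(1)[OF G(1) reps(1) g] b_def[symmetric]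
          by (rule right_mult_one_mat[OF mult_carrier_mat[OF S[OF g] Yc]])
        finally show "Y * \<tau> g = \<sigma> g * Y" .
      qed (rule Yc)
      then have "Y = 0\<^sub>m a b" using all0 by blast
      then show ?thesis using vY unfolding v_def by (auto simp: vectorize_def div_mod_less intro!: eq_vecI)
    qed
    then have "E = 0\<^sub>m (a * b) (a * b)" using E'(1)[OF one] by (intro mat_col_eqI) auto
    then have "mtrace E = 0" by (simp add: mtrace_def)
    then show "k = 0" using k(1) by simp
  qed
  then show ?thesis using eq by (auto simp: a_def b_def)
qed

section \<open>Exact sequences split over the ground field\<close>

lemma columns_factor:
  fixes A :: "'a::field mat"
  assumes A: "A \<in> carrier_mat n m" and M: "M \<in> carrier_mat n l"
    and ex: "\<And>j. j < l \<Longrightarrow> \<exists>u\<in>carrier_vec m. A *\<^sub>v u = col M j"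
  shows "\<exists>Y\<in>carrier_mat m l. A * Y = M"
proof -
  have "\<forall>j\<in>{..<l}. \<exists>u. u \<in> carrier_vec m \<and> A *\<^sub>v u = col M j" using ex by blast
  then obtain u where u: "\<forall>j\<in>{..<l}. u j \<in> carrier_vec m \<and> A *\<^sub>v u j = col M j" by (rule bchoice[THEN exE])
  define Y where "Y = mat m l (\<lambda>(i, j). u j $ i)"
  have Y: "Y \<in> carrier_mat m l" by (simp add: Y_def)
  have colY: "col Y j = u j" if "j < l" for j
  proof -
    have "u j \<in> carrier_vec m" using u that by simp
    then show ?thesis using that by (intro eq_vecI) (auto simp: Y_def)
  qed
  have "A * Y = M"
  proof (rule mat_col_eqI)
    fix j assume "j < dim_col M"
    then have j: "j < l" using M by simp
    show "col (A * Y) j = col M j" unfolding col_mult2[OF A Y j] colY[OF j] using u j by simp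
  qed (use A Y M in auto)
  then show ?thesis using Y by blast
qed

lemma minus_zero_mat: "A \<in> carrier_mat n m \<Longrightarrow> A - 0\<^sub>m n m = (A :: 'a::group_add mat)"
  by (intro eq_matI) auto

lemma minus_add_cancel_mat:
  "A \<in> carrier_mat n m \<Longrightarrow> B \<in> carrier_mat n m \<Longrightarrow> A - B + B = (A :: 'a::group_add mat)"
  by (intro eq_matI) auto

text \<open>
  A short exact sequence splits as a sequence of vector spaces; \<open>L\<close> and \<open>s\<close> are not intertwiners in general.
\<close>

lemma short_exact_splitting:
  fixes \<alpha> \<beta> \<gamma> :: "'g \<Rightarrow> 'b::field mat"
  assumes "short_exact G \<alpha> \<beta> \<gamma>"
  obtains F L s P where
    "F \<in> carrier_mat (rep_degree G \<beta>) (rep_degree G \<alpha>)" "L \<in> carrier_mat (rep_degree G \<alpha>) (rep_degree G \<beta>)"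
    "s \<in> carrier_mat (rep_degree G \<beta>) (rep_degree G \<gamma>)" "P \<in> carrier_mat (rep_degree G \<gamma>) (rep_degree G \<beta>)"
    "L * F = 1\<^sub>m (rep_degree G \<alpha>)" "P * s = 1\<^sub>m (rep_degree G \<gamma>)" "F * L + s * P = 1\<^sub>m (rep_degree G \<beta>)"
    "P * F = 0\<^sub>m (rep_degree G \<gamma>) (rep_degree G \<alpha>)"
    "\<forall>g\<in>carrier G. F * \<alpha> g = \<beta> g * F" "\<forall>g\<in>carrier G. P * \<beta> g = \<gamma> g * P"
proof -
  define a b c where "a = rep_degree G \<alpha>" and "b = rep_degree G \<beta>" and "c = rep_degree G \<gamma>"
  from assms obtain F P where reps: "group_rep G \<alpha>" "group_rep G \<beta>" "group_rep G \<gamma>"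
    and F: "intertwiner G \<alpha> \<beta> F" and P: "intertwiner G \<beta> \<gamma> P"
    and inj: "inj_on ((*\<^sub>v) F) (carrier_vec a)" and surj: "(*\<^sub>v) P ` carrier_vec b = carrier_vec c"
    and ker: "mat_kernel P = (*\<^sub>v) F ` carrier_vec a"
    unfolding short_exact_def a_def b_def c_def by blast
  have Fc: "F \<in> carrier_mat b a" and Pc: "P \<in> carrier_mat c b"
    and FI: "\<forall>g\<in>carrier G. F * \<alpha> g = \<beta> g * F" and PI: "\<forall>g\<in>carrier G. P * \<beta> g = \<gamma> g * P"
    using F P by (auto simp: intertwiner_def a_def b_def c_def)
  have "\<exists>s\<in>carrier_mat b c. P * s = 1\<^sub>m c"
  proof (rule columns_factor[OF Pc])
    fix j assume "j < c"
    have "col (1\<^sub>m c) j \<in> carrier_vec c" by (intro carrier_vecI) simp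
    then have "col (1\<^sub>m c) j \<in> (*\<^sub>v) P ` carrier_vec b" unfolding surj .
    then obtain u where "col (1\<^sub>m c) j = P *\<^sub>v u" "u \<in> carrier_vec b" by (rule imageE)
    then show "\<exists>u\<in>carrier_vec b. P *\<^sub>v u = col (1\<^sub>m c) j" by (intro bexI[of _ u]) simp_all
  qed simp
  then obtain s where s: "s \<in> carrier_mat b c" "P * s = 1\<^sub>m c" by (rule bexE)
  define M where "M = 1\<^sub>m b - s * P"
  have sP: "s * P \<in> carrier_mat b b" using s Pc by simp
  have Mc: "M \<in> carrier_mat b b" unfolding M_def by (intro minus_carrier_mat sP)
  have PM: "P * M = 0\<^sub>m c b"
  proof -
    have "P * M = P - P * (s * P)"
      unfolding M_def using mult_minus_distrib_mat[OF Pc one_carrier_mat sP] Pc by simp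
    also have "P * (s * P) = P" using assoc_mult_mat[OF Pc s(1) Pc] s(2) Pc by simp
    finally show ?thesis using Pc by simp
  qed
  have "\<exists>L\<in>carrier_mat a b. F * L = M"
  proof (rule columns_factor[OF Fc Mc])
    fix j assume j: "j < b"
    have "P *\<^sub>v col M j = 0\<^sub>v c" using col_mult2[OF Pc Mc j] j unfolding PM by simp
    moreover have "col M j \<in> carrier_vec b" using Mc by (intro carrier_vecI) simp
    ultimately have "col M j \<in> mat_kernel P" using Pc by (simp add: mat_kernel_def)
    then obtain u where "col M j = F *\<^sub>v u" "u \<in> carrier_vec a" unfolding ker by (rule imageE)
    then show "\<exists>u\<in>carrier_vec a. F *\<^sub>v u = col M j" by (intro bexI[of _ u]) simp_all
  qed
  then obtain L where L: "L \<in> carrier_mat a b" "F * L = M" by (rule bexE)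
  have PF: "P * F = 0\<^sub>m c a"
  proof (rule mat_col_eqI)
    fix j assume "j < dim_col (0\<^sub>m c a :: 'b mat)"
    then have j: "j < a" by simp
    have "F *\<^sub>v unit_vec a j = col F j" using col_mult2[OF Fc one_carrier_mat j] Fc j by simp
    then have "col F j \<in> mat_kernel P"
      unfolding ker using imageI[OF unit_vec_carrier, of "(*\<^sub>v) F" a j] by simp
    then have "P *\<^sub>v col F j = 0\<^sub>v c" using Pc by (simp add: mat_kernel_def)
    then show "col (P * F) j = col (0\<^sub>m c a) j" using col_mult2[OF Pc Fc j] j by simp
  qed (use Pc Fc in auto)
  have LFc: "L * F \<in> carrier_mat a a" by (rule mult_carrier_mat[OF L(1) Fc])
  have LF: "L * F = 1\<^sub>m a"
  proof (rule mat_col_eqI)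
    fix j assume "j < dim_col (1\<^sub>m a :: 'b mat)"
    then have j: "j < a" by simp
    have "F * (L * F) = M * F" using assoc_mult_mat[OF Fc L(1) Fc] L(2) by simp
    also have "\<dots> = F - s * P * F"
      unfolding M_def using minus_mult_distrib_mat[OF one_carrier_mat sP Fc] Fc by simp
    also have "s * P * F = 0\<^sub>m b a" using assoc_mult_mat[OF s(1) Pc Fc] s(1) unfolding PF by simp
    finally have "F * (L * F) = F" using minus_zero_mat[OF Fc] by simp
    then have "F *\<^sub>v col (L * F) j = F *\<^sub>v col (1\<^sub>m a) j"
      using col_mult2[OF Fc LFc j] col_mult2[OF Fc one_carrier_mat j] Fc by simp
    moreover have "col (L * F) j \<in> carrier_vec a" using L(1) by (intro carrier_vecI) simp
    moreover have "col (1\<^sub>m a) j \<in> (carrier_vec a :: 'b vec set)" by (intro carrier_vecI) simp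
    ultimately show "col (L * F) j = col (1\<^sub>m a) j"
      by (rule inj_onD[OF inj])
  qed (use L(1) Fc in auto)
  have "F * L + s * P = 1\<^sub>m b" unfolding L(2) M_def by (rule minus_add_cancel_mat[OF one_carrier_mat sP])
  from that[OF Fc[unfolded a_def b_def] L(1)[unfolded a_def b_def] s(1)[unfolded b_def c_def] Pc[unfolded b_def c_def]
      LF[unfolded a_def] s(2)[unfolded c_def] this[unfolded b_def] PF[unfolded a_def c_def] FI PI]
  show thesis .
qed

lemma short_exact_mtrace:
  fixes \<alpha> \<beta> \<gamma> :: "'g \<Rightarrow> 'b::field mat"
  assumes ex: "short_exact G \<alpha> \<beta> \<gamma>" and g: "g \<in> carrier G"
  shows "mtrace (\<beta> g) = mtrace (\<alpha> g) + mtrace (\<gamma> g)"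
proof -
  define a b c where "a = rep_degree G \<alpha>" and "b = rep_degree G \<beta>" and "c = rep_degree G \<gamma>"
  from short_exact_splitting[OF ex, folded a_def b_def c_def]
  obtain F L s P where Fc: "F \<in> carrier_mat b a" and L: "L \<in> carrier_mat a b" and s: "s \<in> carrier_mat b c"
    and Pc: "P \<in> carrier_mat c b" and LF: "L * F = 1\<^sub>m a" and Ps: "P * s = 1\<^sub>m c"
    and one: "F * L + s * P = 1\<^sub>m b"
    and I: "\<forall>g\<in>carrier G. F * \<alpha> g = \<beta> g * F" "\<forall>g\<in>carrier G. P * \<beta> g = \<gamma> g * P" by metis
  note FI = I(1)[rule_format, OF g] and PI = I(2)[rule_format, OF g]
  have reps: "group_rep G \<alpha>" "group_rep G \<beta>" "group_rep G \<gamma>" using ex by (simp_all add: short_exact_def)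
  have al: "\<alpha> g \<in> carrier_mat a a" and be: "\<beta> g \<in> carrier_mat b b" and ga: "\<gamma> g \<in> carrier_mat c c"
    unfolding a_def b_def c_def using reps[THEN group_repD(1), OF g] .
  have FL: "F * L \<in> carrier_mat b b" and sP: "s * P \<in> carrier_mat b b"
    by (rule mult_carrier_mat[OF Fc L], rule mult_carrier_mat[OF s Pc])
  have "\<beta> g = \<beta> g * (F * L + s * P)" using right_mult_one_mat[OF be] one by simp
  also have "\<dots> = \<beta> g * (F * L) + \<beta> g * (s * P)" by (rule mult_add_distrib_mat[OF be FL sP])
  finally have "mtrace (\<beta> g) = mtrace (\<beta> g * (F * L)) + mtrace (\<beta> g * (s * P))"
    using mtrace_add[of "\<beta> g * (F * L)" b "\<beta> g * (s * P)"] mult_carrier_mat[OF be FL] mult_carrier_mat[OF be sP] by simp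
  also have "\<beta> g * (F * L) = F * (\<alpha> g * L)"
    using assoc_mult_mat[OF be Fc L] assoc_mult_mat[OF Fc al L] FI by simp
  also have "mtrace (F * (\<alpha> g * L)) = mtrace (\<alpha> g * L * F)"
    by (rule mtrace_comm[OF Fc mult_carrier_mat[OF al L]])
  also have "\<alpha> g * L * F = \<alpha> g" using assoc_mult_mat[OF al L Fc] LF al by simp
  also have "\<beta> g * (s * P) = \<beta> g * s * P" using assoc_mult_mat[OF be s Pc] by simp
  also have "mtrace (\<beta> g * s * P) = mtrace (P * (\<beta> g * s))"
    by (rule mtrace_comm[OF mult_carrier_mat[OF be s] Pc])
  also have "P * (\<beta> g * s) = \<gamma> g * (P * s)"
    using assoc_mult_mat[OF Pc be s] assoc_mult_mat[OF ga Pc s] PI by simp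
  also have "\<dots> = \<gamma> g" using Ps ga by simp
  finally show ?thesis .
qed

lemma short_exact_degree:
  assumes "short_exact G \<alpha> \<beta> (\<gamma> :: 'g \<Rightarrow> 'a::field_char_0 mat)" "\<one>\<^bsub>G\<^esub> \<in> carrier G"
  shows "rep_degree G \<beta> = rep_degree G \<alpha> + rep_degree G \<gamma>"
proof -
  have reps: "group_rep G \<alpha>" "group_rep G \<beta>" "group_rep G \<gamma>" using assms(1) by (auto simp: short_exact_def)
  have "(of_nat (rep_degree G \<beta>) :: 'a) = of_nat (rep_degree G \<alpha> + rep_degree G \<gamma>)"
    using short_exact_mtrace[OF assms] reps[THEN group_repD(2)] by simp
  then show ?thesis by (simp only: of_nat_eq_iff)
qed

text \<open>
  The quotient representation acts on the kernel of the one-sided inverse \<open>Y\<close>, a linear complement of the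
  image of \<open>F\<close>, after projecting along that image.
\<close>

lemma short_exact_of_injection:
  fixes \<tau> \<rho> :: "'g \<Rightarrow> 'a::field mat"
  assumes G: "group G" and reps: "group_rep G \<tau>" "group_rep G \<rho>"
    and F: "intertwiner G \<tau> \<rho> F" and Y: "Y \<in> carrier_mat (rep_degree G \<tau>) (rep_degree G \<rho>)" "Y * F = 1\<^sub>m (rep_degree G \<tau>)"
  shows "\<exists>\<gamma>. short_exact G \<tau> \<rho> \<gamma>"
proof -
  interpret group G by fact
  define a d where "a = rep_degree G \<tau>" and "d = rep_degree G \<rho>"
  have Fc: "F \<in> carrier_mat d a" and FI: "\<And>g. g \<in> carrier G \<Longrightarrow> F * \<tau> g = \<rho> g * F"
    using F by (auto simp: intertwiner_def a_def d_def)
  note Yc = Y(1)[folded a_def d_def] and YF = Y(2)[folded a_def]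
  have R: "\<rho> g \<in> carrier_mat d d" if "g \<in> carrier G" for g using group_repD(1)[OF reps(2) that] by (simp add: d_def)
  have T: "\<tau> g \<in> carrier_mat a a" if "g \<in> carrier G" for g using group_repD(1)[OF reps(1) that] by (simp add: a_def)
  obtain C q D where C: "C \<in> carrier_mat d q" and D: "D \<in> carrier_mat q d" and DC: "D * C = 1\<^sub>m q"
    and "Y * C = 0\<^sub>m a q" and CD: "\<And>l Z. Z \<in> carrier_mat d l \<Longrightarrow> Y * Z = 0\<^sub>m a l \<Longrightarrow> C * (D * Z) = Z"
    by (rule kernel_splitting[OF Yc]) (rule that, assumption, assumption, assumption, assumption, blast)
  \<comment> \<open>projection along the image of \<open>F\<close> onto the kernel of \<open>Y\<close>\<close>
  define M where "M = 1\<^sub>m d - F * Y"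
  have FY: "F * Y \<in> carrier_mat d d" using Fc Yc by simp
  have M: "M \<in> carrier_mat d d" unfolding M_def by (intro minus_carrier_mat FY)
  define P where "P = D * M"
  have P: "P \<in> carrier_mat q d" unfolding P_def using D M by simp
  have MF: "M * F = 0\<^sub>m d a"
  proof -
    have "M * F = F - F * Y * F" unfolding M_def using minus_mult_distrib_mat[OF one_carrier_mat FY Fc] Fc by simp
    also have "F * Y * F = F" using assoc_mult_mat[OF Fc Yc Fc] YF Fc by simp
    finally show ?thesis using Fc by simp
  qed
  have YM: "Y * M = 0\<^sub>m a d"
  proof -
    have "Y * M = Y - Y * (F * Y)" unfolding M_def using mult_minus_distrib_mat[OF Yc one_carrier_mat FY] Yc by simp
    also have "Y * (F * Y) = Y" using assoc_mult_mat[OF Yc Fc Yc] YF Yc by simp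
    finally show ?thesis using Yc by simp
  qed
  have PF: "P * F = 0\<^sub>m q a" unfolding P_def using assoc_mult_mat[OF D M Fc] D unfolding MF by simp
  have CP: "C * P = M" unfolding P_def by (rule CD[OF M YM])
  have MC: "M * C = C"
  proof -
    have "M * C = C - F * Y * C" unfolding M_def using minus_mult_distrib_mat[OF one_carrier_mat FY C] C by simp
    also have "F * Y * C = 0\<^sub>m d q" using assoc_mult_mat[OF Fc Yc C] \<open>Y * C = 0\<^sub>m a q\<close> Fc by simp
    finally show ?thesis using minus_zero_mat[OF C] by simp
  qed
  have PC: "P * C = 1\<^sub>m q" unfolding P_def using assoc_mult_mat[OF D M C] MC DC by simp
  have CPFY: "C * P + F * Y = 1\<^sub>m d" unfolding CP M_def by (rule minus_add_cancel_mat[OF one_carrier_mat FY])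
  define \<gamma> where "\<gamma> g = P * \<rho> g * C" for g
  have gc: "\<gamma> g \<in> carrier_mat q q" if "g \<in> carrier G" for g unfolding \<gamma>_def using P C R[OF that] by simp
  have PI: "P * \<rho> g = \<gamma> g * P" if g: "g \<in> carrier G" for g
  proof -
    have PR: "P * \<rho> g \<in> carrier_mat q d" using P R[OF g] by simp
    have CPc: "C * P \<in> carrier_mat d d" using C P by simp
    have "P * \<rho> g = P * \<rho> g * (C * P + F * Y)" unfolding CPFY right_mult_one_mat[OF PR] ..
    also have "\<dots> = P * \<rho> g * (C * P) + P * \<rho> g * (F * Y)" by (rule mult_add_distrib_mat[OF PR CPc FY])
    also have "P * \<rho> g * (F * Y) = P * (\<rho> g * F) * Y"
      using assoc_mult_mat[OF PR Fc Yc] assoc_mult_mat[OF P R[OF g] Fc] by simp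
    also have "\<dots> = P * F * \<tau> g * Y" unfolding FI[OF g, symmetric] using assoc_mult_mat[OF P Fc T[OF g]] by simp
    also have "\<dots> = 0\<^sub>m q d" unfolding PF using T[OF g] Yc by simp
    also have "P * \<rho> g * (C * P) = \<gamma> g * P" unfolding \<gamma>_def using assoc_mult_mat[OF PR C P] by simp
    finally show ?thesis using mult_carrier_mat[OF gc[OF g] P] by simp
  qed
  have gam: "group_rep G \<gamma>" "rep_degree G \<gamma> = q"
  proof -
    have 1: "\<gamma> \<one>\<^bsub>G\<^esub> = 1\<^sub>m q" unfolding \<gamma>_def group_repD(2)[OF reps(2)] d_def[symmetric] using P PC by simp
    have 2: "\<gamma> (g \<otimes>\<^bsub>G\<^esub> h) = \<gamma> g * \<gamma> h" if "g \<in> carrier G" "h \<in> carrier G" for g h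
    proof -
      have "\<gamma> (g \<otimes>\<^bsub>G\<^esub> h) = P * \<rho> g * \<rho> h * C"
        unfolding \<gamma>_def group_repD(3)[OF reps(2) that] using assoc_mult_mat[OF P R R, OF that] by simp
      also have "\<dots> = \<gamma> g * P * \<rho> h * C" unfolding PI[OF that(1)] ..
      also have "\<dots> = \<gamma> g * (P * \<rho> h * C)"
        using assoc_mult_mat[OF gc[OF that(1)] P R[OF that(2)]]
          assoc_mult_mat[OF gc[OF that(1)] mult_carrier_mat[OF P R[OF that(2)]] C] by simp
      finally show ?thesis unfolding \<gamma>_def .
    qed
    show "group_rep G \<gamma>" "rep_degree G \<gamma> = q" using group_repI[of G \<gamma> q, OF gc 1 2] by auto
  qed
  have "short_exact G \<tau> \<rho> \<gamma>"
    unfolding short_exact_def gam(2) a_def[symmetric] d_def[symmetric]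
  proof (intro conjI exI)
    show "intertwiner G \<rho> \<gamma> P" unfolding intertwiner_def gam(2) d_def[symmetric] using P PI by blast
    show "inj_on ((*\<^sub>v) F) (carrier_vec a)"
    proof (rule inj_onI)
      fix u v assume uv: "u \<in> carrier_vec a" "v \<in> carrier_vec a" "F *\<^sub>v u = F *\<^sub>v v"
      have "(Y * F) *\<^sub>v u = (Y * F) *\<^sub>v v"
        using uv assoc_mult_mat_vec[OF Yc Fc uv(1)] assoc_mult_mat_vec[OF Yc Fc uv(2)] by simp
      then show "u = v" using uv unfolding YF by simp
    qed
    show "(*\<^sub>v) P ` carrier_vec d = carrier_vec q"
    proof (intro equalityI subsetI)
      fix w :: "'a vec" assume w: "w \<in> carrier_vec q"
      have "P *\<^sub>v (C *\<^sub>v w) = w" using assoc_mult_mat_vec[OF P C w] w unfolding PC by simp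
      then show "w \<in> (*\<^sub>v) P ` carrier_vec d" using mult_mat_vec_carrier[OF C w] imageI[OF mult_mat_vec_carrier[OF C w], of "(*\<^sub>v) P"] by simp
    next
      fix w assume "w \<in> (*\<^sub>v) P ` carrier_vec d"
      then show "w \<in> carrier_vec q" using P by auto
    qed
    show "mat_kernel P = (*\<^sub>v) F ` carrier_vec a"
    proof (intro equalityI subsetI)
      fix v assume "v \<in> mat_kernel P"
      then have v: "v \<in> carrier_vec d" "P *\<^sub>v v = 0\<^sub>v q" using P by (auto simp: mat_kernel_def)
      have "v = (C * P + F * Y) *\<^sub>v v" unfolding CPFY using v by simp
      also have "\<dots> = C * P *\<^sub>v v + F * Y *\<^sub>v v"
        using C P FY v by (intro add_mult_distrib_mat_vec[of _ d d]) auto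
      also have "C * P *\<^sub>v v = 0\<^sub>v d" 
      proof -
        have "C *\<^sub>v 0\<^sub>v q = 0\<^sub>v d" using C by (intro eq_vecI) auto
        then show ?thesis using assoc_mult_mat_vec[OF C P v(1)] v(2) by simp
      qed
      also have "F * Y *\<^sub>v v = F *\<^sub>v (Y *\<^sub>v v)" by (rule assoc_mult_mat_vec[OF Fc Yc v(1)])
      finally have "v = F *\<^sub>v (Y *\<^sub>v v)" using Fc Yc v(1) by simp
      then show "v \<in> (*\<^sub>v) F ` carrier_vec a" by (rule image_eqI[OF _ mult_mat_vec_carrier[OF Yc v(1)]])
    next
      fix v assume "v \<in> (*\<^sub>v) F ` carrier_vec a"
      then obtain u where u: "u \<in> carrier_vec a" "v = F *\<^sub>v u" by auto
      have "P *\<^sub>v v = (P * F) *\<^sub>v u" unfolding u(2) using assoc_mult_mat_vec[OF P Fc u(1)] by simp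
      also have "\<dots> = 0\<^sub>v q" unfolding PF using u(1) by (intro eq_vecI) auto
      finally show "v \<in> mat_kernel P" using P Fc u by (auto simp: mat_kernel_def)
    qed
  qed (use reps gam(1) F in auto)
  then show ?thesis by blast
qed

text \<open>
  Schur's lemma in the form that is needed: a subrepresentation \<open>\<tau>\<close> of least positive degree is irreducible.
  The kernel of a nonzero intertwiner out of \<open>\<tau>\<close> would be a smaller subrepresentation of \<open>\<rho>\<close>, so it is
  zero and the intertwiner has a one-sided inverse.
\<close>

lemma minimal_subrep:
  fixes \<rho> :: "'g \<Rightarrow> 'a::field_char_0 mat"
  assumes G: "group G" and rho: "group_rep G \<rho>" "rep_degree G \<rho> > 0"
  shows "\<exists>\<tau>. group_rep G \<tau> \<and> rep_degree G \<tau> > 0 \<and>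
    (\<exists>F Y. intertwiner G \<tau> \<rho> F \<and> Y \<in> carrier_mat (rep_degree G \<tau>) (rep_degree G \<rho>) \<and> Y * F = 1\<^sub>m (rep_degree G \<tau>)) \<and>
    (\<forall>\<sigma> Z. group_rep G \<sigma> \<and> intertwiner G \<tau> \<sigma> Z \<and> Z \<noteq> 0\<^sub>m (rep_degree G \<sigma>) (rep_degree G \<tau>) \<longrightarrow>
      (\<exists>Y\<in>carrier_mat (rep_degree G \<tau>) (rep_degree G \<sigma>). Y * Z = 1\<^sub>m (rep_degree G \<tau>)))"
proof -
  interpret group G by fact
  define r where "r = rep_degree G \<rho>"
  define sub where "sub \<tau> \<longleftrightarrow> group_rep G \<tau> \<and> rep_degree G \<tau> > 0 \<and>
    (\<exists>F Y. intertwiner G \<tau> \<rho> F \<and> Y \<in> carrier_mat (rep_degree G \<tau>) r \<and> Y * F = 1\<^sub>m (rep_degree G \<tau>))" for \<tau>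
  have "sub \<rho>"
    unfolding sub_def
  proof (intro conjI exI)
    show "intertwiner G \<rho> \<rho> (1\<^sub>m r)"
      unfolding intertwiner_def r_def
    proof (intro conjI ballI)
      fix g assume "g \<in> carrier G"
      note c = group_repD(1)[OF rho(1) this]
      show "1\<^sub>m (rep_degree G \<rho>) * \<rho> g = \<rho> g * 1\<^sub>m (rep_degree G \<rho>)"
        unfolding left_mult_one_mat[OF c] right_mult_one_mat[OF c] ..
    qed simp
    show "1\<^sub>m r \<in> carrier_mat (rep_degree G \<rho>) r" by (simp add: r_def)
    show "1\<^sub>m r * 1\<^sub>m r = (1\<^sub>m (rep_degree G \<rho>) :: 'a mat)" by (simp add: r_def)
  qed (use rho in auto)
  then obtain \<tau> where tau: "sub \<tau>" and min: "\<And>\<kappa>. sub \<kappa> \<Longrightarrow> rep_degree G \<tau> \<le> rep_degree G \<kappa>"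
    using ex_has_least_nat[of sub \<rho> "rep_degree G"] by blast
  define a where "a = rep_degree G \<tau>"
  obtain F Y where F: "intertwiner G \<tau> \<rho> F" and Y: "Y \<in> carrier_mat a r" "Y * F = 1\<^sub>m a" and trep: "group_rep G \<tau>"
    using tau unfolding sub_def a_def by blast
  have Fc: "F \<in> carrier_mat r a" and FI: "\<And>g. g \<in> carrier G \<Longrightarrow> F * \<tau> g = \<rho> g * F"
    using F by (auto simp: intertwiner_def a_def r_def)
  have T: "\<tau> g \<in> carrier_mat a a" if "g \<in> carrier G" for g using group_repD(1)[OF trep that] by (simp add: a_def)
  have R: "\<rho> g \<in> carrier_mat r r" if "g \<in> carrier G" for g using group_repD(1)[OF rho(1) that] by (simp add: r_def)
  have "\<exists>Y\<in>carrier_mat a (rep_degree G \<sigma>). Y * Z = 1\<^sub>m a"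
    if srep: "group_rep G \<sigma>" and ZI: "intertwiner G \<tau> \<sigma> Z" and Z0: "Z \<noteq> 0\<^sub>m (rep_degree G \<sigma>) a" for \<sigma> Z
  proof -
    define b where "b = rep_degree G \<sigma>"
    have Zc: "Z \<in> carrier_mat b a" and ZT: "\<And>g. g \<in> carrier G \<Longrightarrow> Z * \<tau> g = \<sigma> g * Z"
      using ZI by (auto simp: intertwiner_def a_def b_def)
    have S: "\<sigma> g \<in> carrier_mat b b" if "g \<in> carrier G" for g using group_repD(1)[OF srep that] by (simp add: b_def)
    obtain C q D where C: "C \<in> carrier_mat a q" and D: "D \<in> carrier_mat q a" and DC: "D * C = 1\<^sub>m q"
      and ZC: "Z * C = 0\<^sub>m b q" and CD: "\<And>l W. W \<in> carrier_mat a l \<Longrightarrow> Z * W = 0\<^sub>m b l \<Longrightarrow> C * (D * W) = W"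
      by (rule kernel_splitting[OF Zc]) (rule that, assumption, assumption, assumption, assumption, blast)
    define \<kappa> where "\<kappa> g = D * (\<tau> g * C)" for g
    have kc: "\<kappa> g \<in> carrier_mat q q" if "g \<in> carrier G" for g
      unfolding \<kappa>_def using D mult_carrier_mat[OF T[OF that] C] by simp
    have Ck: "C * \<kappa> g = \<tau> g * C" if g: "g \<in> carrier G" for g
      unfolding \<kappa>_def
    proof (rule CD)
      have "Z * (\<tau> g * C) = \<sigma> g * (Z * C)"
        using assoc_mult_mat[OF Zc T[OF g] C] assoc_mult_mat[OF S[OF g] Zc C] ZT[OF g] by simp
      then show "Z * (\<tau> g * C) = 0\<^sub>m b q" unfolding ZC using S[OF g] by simp
    qed (use T[OF g] C in simp)
    have krep: "group_rep G \<kappa>" "rep_degree G \<kappa> = q"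
    proof -
      have 1: "\<kappa> \<one>\<^bsub>G\<^esub> = 1\<^sub>m q" unfolding \<kappa>_def group_repD(2)[OF trep] a_def[symmetric] using C DC by simp
      have 2: "\<kappa> (g \<otimes>\<^bsub>G\<^esub> h) = \<kappa> g * \<kappa> h" if "g \<in> carrier G" "h \<in> carrier G" for g h
      proof -
        have "\<kappa> (g \<otimes>\<^bsub>G\<^esub> h) = D * (\<tau> g * (\<tau> h * C))"
          unfolding \<kappa>_def group_repD(3)[OF trep that] using assoc_mult_mat[OF T T C, OF that] by simp
        also have "\<dots> = D * (\<tau> g * C * \<kappa> h)"
          unfolding Ck[OF that(2), symmetric] using assoc_mult_mat[OF T[OF that(1)] C kc[OF that(2)]] by simp
        also have "\<dots> = \<kappa> g * \<kappa> h"
          unfolding \<kappa>_def[of g] using assoc_mult_mat[OF D mult_carrier_mat[OF T[OF that(1)] C] kc[OF that(2)]] by simp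
        finally show ?thesis .
      qed
      show "group_rep G \<kappa>" "rep_degree G \<kappa> = q" using group_repI[of G \<kappa> q, OF kc 1 2] by auto
    qed
    have "sub \<kappa>" if "q > 0"
      unfolding sub_def krep(2)
    proof (intro conjI exI)
      have FC: "F * C \<in> carrier_mat r q" using Fc C by simp
      show "intertwiner G \<kappa> \<rho> (F * C)"
        unfolding intertwiner_def krep(2) r_def[symmetric]
      proof (intro conjI ballI)
        fix g assume g: "g \<in> carrier G"
        have "F * C * \<kappa> g = F * \<tau> g * C"
          using assoc_mult_mat[OF Fc C kc[OF g]] Ck[OF g] assoc_mult_mat[OF Fc T[OF g] C] by simp
        then show "F * C * \<kappa> g = \<rho> g * (F * C)"
          unfolding FI[OF g] using assoc_mult_mat[OF R[OF g] Fc C] by simp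
      qed (rule FC)
      show "D * Y \<in> carrier_mat q r" using D Y by simp
      have "D * Y * (F * C) = D * (Y * F * C)"
        using assoc_mult_mat[OF D Y(1) FC] assoc_mult_mat[OF Y(1) Fc C] by simp
      then show "D * Y * (F * C) = 1\<^sub>m q" unfolding Y(2) using C DC by simp
    qed (use krep that in auto)
    then have ge: "q > 0 \<Longrightarrow> a \<le> q" using min[of \<kappa>] krep(2) by (simp add: a_def)
    have CDc: "C * D \<in> carrier_mat a a" using C D by simp
    define N where "N = 1\<^sub>m a - C * D"
    have Nc: "N \<in> carrier_mat a a" unfolding N_def by (intro minus_carrier_mat CDc)
    have DN: "D * N = 0\<^sub>m q a"
    proof -
      have "D * N = D - D * (C * D)" unfolding N_def using mult_minus_distrib_mat[OF D one_carrier_mat CDc] D by simp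
      also have "D * (C * D) = D" using assoc_mult_mat[OF D C D] DC D by simp
      finally show ?thesis using D by simp
    qed
    have "N * N = (1\<^sub>m a - C * D) * N" by (simp only: N_def)
    also have "\<dots> = 1\<^sub>m a * N - C * D * N" by (rule minus_mult_distrib_mat[OF one_carrier_mat CDc Nc])
    also have "1\<^sub>m a * N = N" by (rule left_mult_one_mat[OF Nc])
    also have "C * D * N = 0\<^sub>m a a" using assoc_mult_mat[OF C D Nc] C unfolding DN by simp
    finally have "N * N = N" using minus_zero_mat[OF Nc] by simp
    then obtain k where k: "mtrace N = of_nat k" "k = 0 \<longrightarrow> N = 0\<^sub>m a a" using mtrace_idempotent[OF Nc] by blast
    have "mtrace (N + C * D) = mtrace N + mtrace (C * D)" by (rule mtrace_add[OF Nc CDc])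
    moreover have NCD: "N + C * D = 1\<^sub>m a" unfolding N_def by (rule minus_add_cancel_mat[OF one_carrier_mat CDc])
    moreover have "mtrace (C * D) = of_nat q" using mtrace_comm[OF C D] DC by simp
    ultimately have "(of_nat a :: 'a) = of_nat (k + q)" using k(1) by simp
    then have akq: "a = k + q" by (simp only: of_nat_eq_iff)
    have "q = 0"
    proof (rule ccontr)
      assume "q \<noteq> 0"
      then have "k = 0" using ge akq by simp
      then have "C * D = 1\<^sub>m a" using NCD k CDc by simp
      then have "Z = Z * C * D" using assoc_mult_mat[OF Zc C D] Zc by simp
      then have "Z = 0\<^sub>m b a" unfolding ZC using D by simp
      then show False using Z0 by (simp add: b_def)
    qed
    show ?thesis unfolding b_def[symmetric]
    proof (rule left_inverse_mat[OF Zc])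
      fix v assume v: "v \<in> carrier_vec a" "Z *\<^sub>v v = 0\<^sub>v b"
      define W where "W = mat a 1 (\<lambda>(i, j). v $ i)"
      have W: "W \<in> carrier_mat a 1" by (simp add: W_def)
      have colW: "col W 0 = v" using v by (intro eq_vecI) (auto simp: W_def)
      have "Z * W = 0\<^sub>m b 1"
      proof (rule mat_col_eqI)
        fix j assume "j < dim_col (0\<^sub>m b 1 :: 'a mat)"
        then have j: "j = 0" by simp
        show "col (Z * W) j = col (0\<^sub>m b 1) j" unfolding j using col_mult2[OF Zc W, of 0] colW v by simp
      qed (use Zc W in auto)
      from CD[OF W this] have "W = C * (D * W)" by simp
      also have "\<dots> = 0\<^sub>m a 1" using C D W \<open>q = 0\<close> by (intro eq_matI) (auto simp: scalar_prod_def)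
      finally show "v = 0\<^sub>v a" using colW by (auto intro!: eq_vecI)
    qed
  qed
  then show ?thesis using tau unfolding sub_def a_def r_def by blast
qed

section \<open>Exterior powers\<close>

text \<open>
  Rows indexed by \<open>I\<close> and columns by \<open>J\<close>; only used for lists of equal length.
\<close>

definition minor :: "'a::comm_ring_1 mat \<Rightarrow> nat list \<Rightarrow> nat list \<Rightarrow> 'a"
  where "minor A I J = det (mat (length I) (length I) (\<lambda>(a, b). A $$ (I ! a, J ! b)))"

lemma sorted_wrt_subseqs: "sorted_wrt R xs \<Longrightarrow> ys \<in> set (subseqs xs) \<Longrightarrow> sorted_wrt R ys \<and> set ys \<subseteq> set xs"
proof (induction xs arbitrary: ys)
  case (Cons x xs)
  then consider "ys \<in> set (subseqs xs)" | zs where "zs \<in> set (subseqs xs)" "ys = x # zs"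
    by (auto simp: Let_def)
  then show ?case
  proof cases
    case 1
    then show ?thesis using Cons.IH[OF _ 1] Cons.prems by auto
  next
    case 2
    then show ?thesis using Cons.IH[OF _ 2(1)] Cons.prems by auto
  qed
qed simp

text \<open>
  The sublists of an increasing list are the increasing lists with entries in it.
\<close>

lemma set_ext_index: "set (ext_index d k) = {I. sorted_wrt (<) I \<and> set I \<subseteq> {0..<d} \<and> length I = k}"
proof (intro equalityI subsetI)
  fix I assume "I \<in> set (ext_index d k)"
  then have "I \<in> set (subseqs [0..<d])" "length I = k" by (auto simp: ext_index_def)
  then show "I \<in> {I. sorted_wrt (<) I \<and> set I \<subseteq> {0..<d} \<and> length I = k}"
    using sorted_wrt_subseqs[OF sorted_wrt_upt, of I 0 d] by simp
next
  fix I assume "I \<in> {I. sorted_wrt (<) I \<and> set I \<subseteq> {0..<d} \<and> length I = k}"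
  then have I: "sorted_wrt (<) I" "set I \<subseteq> set [0..<d]" "length I = k" by auto
  have "set I \<in> set ` set (subseqs [0..<d])" using I(2) by (simp add: subseqs_powset)
  then obtain K where K: "K \<in> set (subseqs [0..<d])" "set I = set K" by auto
  have "sorted_wrt (<) K" using sorted_wrt_subseqs[OF sorted_wrt_upt K(1)] by simp
  then have "K = I" using I(1) K(2) strict_sorted_equal by blast
  then show "I \<in> set (ext_index d k)" using K I by (simp add: ext_index_def)
qed

lemma distinct_ext_index: "distinct (ext_index d k)"
proof -
  have "distinct (subseqs [0..<d])" using distinct_set_subseqs[of "[0..<d]"] by (simp add: distinct_map)
  then show ?thesis by (simp add: ext_index_def)
qed

lemma ext_indexD:
  assumes "I \<in> set (ext_index d k)" shows "distinct I" "set I \<subseteq> {0..<d}" "length I = k" "sorted_wrt (<) I"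
  using assms by (auto simp: set_ext_index strict_sorted_iff)

lemma sum_ext_index: "(\<Sum>t<length (ext_index d k). f (ext_index d k ! t)) = (\<Sum>I\<in>set (ext_index d k). f I)"
  by (rule sum.reindex_bij_betw) (intro bij_betw_nth distinct_ext_index refl)

lemma ext_mat_carrier:
  "A \<in> carrier_mat n m \<Longrightarrow> ext_mat k A \<in> carrier_mat (length (ext_index n k)) (length (ext_index m k))"
  by (auto simp: ext_mat_def intro!: carrier_matI)

lemma ext_mat_index:
  assumes A: "A \<in> carrier_mat n m" and i: "i < length (ext_index n k)" and j: "j < length (ext_index m k)"
  shows "ext_mat k A $$ (i, j) = minor A (ext_index n k ! i) (ext_index m k ! j)"
proof -
  define I J where "I = ext_index n k ! i" and "J = ext_index m k ! j"
  have I: "set I \<subseteq> {0..<n}" "length I = k" using ext_indexD[of I n k] i by (simp_all add: I_def)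
  have J: "set J \<subseteq> {0..<m}" "length J = k" using ext_indexD[of J m k] j by (simp_all add: J_def)
  have "ext_mat k A $$ (i, j) = wedge n (map (col A) J) $ i"
    using A i j by (simp add: ext_mat_def mat_of_cols_index J_def)
  also have "\<dots> = det (mat k k (\<lambda>(a, b). map (col A) J ! b $ (I ! a)))"
    using i J by (simp add: wedge_def I_def vec_of_list_index)
  also have "mat k k (\<lambda>(a, b). map (col A) J ! b $ (I ! a)) = mat k k (\<lambda>(a, b). A $$ (I ! a, J ! b))"
  proof (rule eq_matI)
    fix a b assume "a < dim_row (mat k k (\<lambda>(a, b). A $$ (I ! a, J ! b)))" "b < dim_col (mat k k (\<lambda>(a, b). A $$ (I ! a, J ! b)))"
    then have ab: "a < k" "b < k" by auto
    have "I ! a \<in> set I" "J ! b \<in> set J" using ab I J by simp_all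
    then have "I ! a < n" "J ! b < m" using I J by auto
    then show "mat k k (\<lambda>(a, b). map (col A) J ! b $ (I ! a)) $$ (a, b) = mat k k (\<lambda>(a, b). A $$ (I ! a, J ! b)) $$ (a, b)"
      using ab A J by simp
  qed auto
  finally show ?thesis unfolding minor_def I_def[symmetric] J_def[symmetric] I(2) .
qed

lemma mtrace_ext_mat:
  assumes "A \<in> carrier_mat n n"
  shows "mtrace (ext_mat k A) = (\<Sum>I\<in>set (ext_index n k). minor A I I)"
  using ext_mat_carrier[OF assms, of k] ext_mat_index[OF assms, of _ k]
  by (simp add: mtrace_def sum_ext_index[of "\<lambda>I. minor A I I", symmetric])

lemma det_mat_permutes:
  "det (mat k k (\<lambda>(a, b). f a b)) = (\<Sum>p | p permutes {0..<k}. of_int (sign p) * (\<Prod>a = 0..<k. f a (p a)))"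
proof -
  have "det (mat k k (\<lambda>(a, b). f a b)) = (\<Sum>p | p permutes {0..<k}. signof p * (\<Prod>a = 0..<k. mat k k (\<lambda>(a, b). f a b) $$ (a, p a)))"
    by (rule det_def') simp
  also have "\<dots> = (\<Sum>p | p permutes {0..<k}. of_int (sign p) * (\<Prod>a = 0..<k. f a (p a)))"
  proof (intro sum.cong refl)
    fix p assume "p \<in> {p. p permutes {0..<k}}"
    then have "p a < k" if "a < k" for a using that permutes_in_image[of p "{0..<k}" a] by simp
    then show "signof p * (\<Prod>a = 0..<k. mat k k (\<lambda>(a, b). f a b) $$ (a, p a)) = of_int (sign p) * (\<Prod>a = 0..<k. f a (p a))"
      by simp
  qed
  finally show ?thesis .
qed

lemma det_rows_not_inj:
  fixes g :: "nat \<Rightarrow> nat \<Rightarrow> 'a::idom"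
  assumes "a < k" "a' < k" "a \<noteq> a'" "f a = f a'"
  shows "det (mat k k (\<lambda>(a, b). g (f a) b)) = 0"
proof (rule det_identical_rows[OF _ assms(3,1,2)])
  show "row (mat k k (\<lambda>(a, b). g (f a) b)) a = row (mat k k (\<lambda>(a, b). g (f a) b)) a'"
    using assms by (intro eq_vecI) auto
qed simp

lemma nth_lt: "set I \<subseteq> {0..<n} \<Longrightarrow> a < length I \<Longrightarrow> I ! a < n"
  by (drule nth_mem, drule (1) subsetD, simp)

text \<open>
  The Cauchy-Binet formula. Expanding the rows of the product gives a sum over all maps from \<open>{0..<k}\<close> to the
  middle indices; the maps that are not injective contribute 0, and an injective map is an increasing list
  followed by a permutation.
\<close>

lemma minor_mult:
  fixes A B :: "'a::field mat"
  assumes A: "A \<in> carrier_mat n m" and B: "B \<in> carrier_mat m l"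
    and I: "set I \<subseteq> {0..<n}" and J: "set J \<subseteq> {0..<l}" and len: "length I = k" "length J = k"
  shows "minor (A * B) I J = (\<Sum>K\<in>set (ext_index m k). minor A I K * minor B K J)"
proof -
  define T where "T = PiE {0..<k} (\<lambda>_. {..<m})"
  define g where "g f = (\<Prod>a = 0..<k. A $$ (I ! a, f a)) * det (mat k k (\<lambda>(a, b). B $$ (f a, J ! b)))" for f
  have In: "I ! a < n" if "a < k" for a by (rule nth_lt[OF I]) (simp add: len that)
  have Jn: "J ! a < l" if "a < k" for a by (rule nth_lt[OF J]) (simp add: len that)
  have finT: "finite T" unfolding T_def by (rule finite_PiE) auto
  have "mat k k (\<lambda>(a, b). (A * B) $$ (I ! a, J ! b)) = mat k k (\<lambda>(a, b). \<Sum>c<m. A $$ (I ! a, c) * B $$ (c, J ! b))"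
    by (rule eq_matI) (auto simp: index_mult_mat_sum[OF A B In Jn])
  then have "minor (A * B) I J = det (mat k k (\<lambda>(a, b). \<Sum>c<m. A $$ (I ! a, c) * B $$ (c, J ! b)))"
    by (simp add: minor_def len)
  also have "\<dots> = (\<Sum>p | p permutes {0..<k}. of_int (sign p) * (\<Prod>a = 0..<k. \<Sum>c<m. A $$ (I ! a, c) * B $$ (c, J ! p a)))"
    by (rule det_mat_permutes)
  also have "\<dots> = (\<Sum>p | p permutes {0..<k}. \<Sum>f\<in>T. of_int (sign p) * (\<Prod>a = 0..<k. A $$ (I ! a, f a) * B $$ (f a, J ! p a)))"
    unfolding T_def by (intro sum.cong refl) (simp add: prod_sum_PiE sum_distrib_left)
  also have "\<dots> = (\<Sum>f\<in>T. \<Sum>p | p permutes {0..<k}. of_int (sign p) * (\<Prod>a = 0..<k. A $$ (I ! a, f a) * B $$ (f a, J ! p a)))"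
    by (rule sum.swap)
  also have "\<dots> = (\<Sum>f\<in>T. g f)"
    unfolding g_def det_mat_permutes by (simp add: prod.distrib sum_distrib_left mult_ac)
  also have "\<dots> = (\<Sum>f\<in>{f \<in> T. inj_on f {0..<k}}. g f)"
  proof (rule sum.mono_neutral_right[OF finT])
    show "\<forall>f\<in>T - {f \<in> T. inj_on f {0..<k}}. g f = 0"
    proof
      fix f assume "f \<in> T - {f \<in> T. inj_on f {0..<k}}"
      then have "\<not> inj_on f {0..<k}" by simp
      then obtain a a' where "a < k" "a' < k" "a \<noteq> a'" "f a = f a'" by (auto simp: inj_on_def)
      then have "det (mat k k (\<lambda>(a, b). B $$ (f a, J ! b))) = 0"
        by (rule det_rows_not_inj[where g = "\<lambda>x b. B $$ (x, J ! b)"])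
      then show "g f = 0" unfolding g_def by simp
    qed
  qed auto
  also have "\<dots> = (\<Sum>x\<in>Sigma (set (ext_index m k)) (\<lambda>_. {p. p permutes {0..<k}}). g (\<lambda>a\<in>{0..<k}. fst x ! snd x a))"
  proof (rule sum.reindex_bij_betw[symmetric], rule bij_betw_imageI)
    show "inj_on (\<lambda>x. \<lambda>a\<in>{0..<k}. fst x ! snd x a) (Sigma (set (ext_index m k)) (\<lambda>_. {p. p permutes {0..<k}}))"
    proof (rule inj_onI)
      fix x y assume "x \<in> Sigma (set (ext_index m k)) (\<lambda>_. {p. p permutes {0..<k}})"
        "y \<in> Sigma (set (ext_index m k)) (\<lambda>_. {p. p permutes {0..<k}})"
        and eq: "(\<lambda>a\<in>{0..<k}. fst x ! snd x a) = (\<lambda>a\<in>{0..<k}. fst y ! snd y a)"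
      then have x: "fst x \<in> set (ext_index m k)" "snd x permutes {0..<k}"
        and y: "fst y \<in> set (ext_index m k)" "snd y permutes {0..<k}" by auto
      have eq': "fst x ! snd x a = fst y ! snd y a" if "a < k" for a using fun_cong[OF eq, of a] that by simp
      have im: "set K = (\<lambda>a. K ! p a) ` {0..<k}" if "K \<in> set (ext_index m k)" "p permutes {0..<k}" for K p
      proof -
        have "(\<lambda>a. K ! p a) ` {0..<k} = (!) K ` (p ` {0..<k})" by (simp add: image_image)
        also have "p ` {0..<k} = {0..<k}" by (rule permutes_image[OF that(2)])
        also have "(!) K ` {0..<k} = set K" using ext_indexD(3)[OF that(1)] by (metis nth_image order_refl take_all)
        finally show ?thesis by simp
      qed
      have "set (fst x) = set (fst y)" unfolding im[OF x] im[OF y] using eq' by (intro image_cong) auto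
      then have fst: "fst x = fst y"
        using ext_indexD(4)[OF x(1)] ext_indexD(4)[OF y(1)] strict_sorted_equal by blast
      have "snd x a = snd y a" for a
      proof (cases "a < k")
        case True
        then have "snd x a < k" "snd y a < k" using permutes_in_image[OF x(2), of a] permutes_in_image[OF y(2), of a] by auto
        then show ?thesis using eq'[OF True] ext_indexD(1,3)[OF y(1)] by (simp add: fst nth_eq_iff_index_eq)
      next
        case False
        then show ?thesis using permutes_not_in[OF x(2)] permutes_not_in[OF y(2)] by simp
      qed
      then show "x = y" using fst by (simp add: prod_eq_iff fun_eq_iff)
    qed
    show "(\<lambda>x. \<lambda>a\<in>{0..<k}. fst x ! snd x a) ` (Sigma (set (ext_index m k)) (\<lambda>_. {p. p permutes {0..<k}})) = {f \<in> T. inj_on f {0..<k}}"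
    proof (intro equalityI subsetI)
      fix f assume "f \<in> (\<lambda>x. \<lambda>a\<in>{0..<k}. fst x ! snd x a) ` (Sigma (set (ext_index m k)) (\<lambda>_. {p. p permutes {0..<k}}))"
      then obtain K p where K: "K \<in> set (ext_index m k)" and p: "p permutes {0..<k}" and f: "f = (\<lambda>a\<in>{0..<k}. K ! p a)" by auto
      have pk: "p a < k" if "a < k" for a using that permutes_in_image[OF p, of a] by simp
      have "f \<in> T" unfolding T_def f
      proof (rule restrict_PiE_iff[THEN iffD2], rule ballI)
        fix a assume "a \<in> {0..<k}"
        then have "K ! p a \<in> set K" using pk ext_indexD(3)[OF K] by simp
        then show "K ! p a \<in> {..<m}" using ext_indexD(2)[OF K] by auto
      qed
      moreover have "inj_on f {0..<k}"
      proof (rule inj_onI)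
        fix a a' assume a: "a \<in> {0..<k}" "a' \<in> {0..<k}" "f a = f a'"
        then have "K ! p a = K ! p a'" by (simp add: f)
        then have "p a = p a'" using a pk ext_indexD(1,3)[OF K] by (simp add: nth_eq_iff_index_eq)
        then show "a = a'" using permutes_inj[OF p] by (simp add: inj_eq)
      qed
      ultimately show "f \<in> {f \<in> T. inj_on f {0..<k}}" by simp
    next
      fix f assume "f \<in> {f \<in> T. inj_on f {0..<k}}"
      then have fT: "f \<in> PiE {0..<k} (\<lambda>_. {..<m})" and inj: "inj_on f {0..<k}" by (auto simp: T_def)
      define K where "K = sorted_list_of_set (f ` {0..<k})"
      have setK: "set K = f ` {0..<k}" and sK: "sorted_wrt (<) K" by (simp_all add: K_def)
      have lK: "length K = k" using inj by (simp add: K_def card_image)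
      have "f ` {0..<k} \<subseteq> {0..<m}" using fT by auto
      then have K: "K \<in> set (ext_index m k)" by (simp add: set_ext_index setK sK lK)
      have bK: "bij_betw ((!) K) {..<k} (f ` {0..<k})"
        by (rule bij_betw_nth) (use ext_indexD(1)[OF K] setK lK in auto)
      define p where "p a = (if a < k then inv_into {..<k} ((!) K) (f a) else a)" for a
      have Kp: "K ! p a = f a" if "a < k" for a
        using that bij_betw_inv_into_right[OF bK, of "f a"] by (simp add: p_def)
      have pk: "p a < k" if "a < k" for a
      proof -
        have "inv_into {..<k} ((!) K) (f a) \<in> {..<k}"
          by (rule inv_into_into) (use bK that in \<open>auto simp: bij_betw_def\<close>)
        then show ?thesis using that by (simp add: p_def)
      qed
      have "inj_on p {0..<k}"
      proof (rule inj_onI)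
        fix a a' assume a: "a \<in> {0..<k}" "a' \<in> {0..<k}" "p a = p a'"
        then have "f a = f a'" using Kp[of a] Kp[of a'] by simp
        then show "a = a'" using inj a by (simp add: inj_on_eq_iff)
      qed
      moreover have "p ` {0..<k} \<subseteq> {0..<k}" using pk by auto
      ultimately have "bij_betw p {0..<k} {0..<k}" by (simp add: bij_betw_def endo_inj_surj)
      then have "p permutes {0..<k}" by (rule bij_imp_permutes) (simp add: p_def)
      moreover have "f = (\<lambda>a\<in>{0..<k}. K ! p a)"
        using fT Kp by (intro ext) (auto simp: restrict_def PiE_def extensional_def)
      ultimately have "(K, p) \<in> Sigma (set (ext_index m k)) (\<lambda>_. {p. p permutes {0..<k}})"
        "f = (\<lambda>a\<in>{0..<k}. fst (K, p) ! snd (K, p) a)" using K by simp_all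
      then show "f \<in> (\<lambda>x. \<lambda>a\<in>{0..<k}. fst x ! snd x a) ` (Sigma (set (ext_index m k)) (\<lambda>_. {p. p permutes {0..<k}}))"
        by (rule image_eqI[rotated])
    qed
  qed
  also have "\<dots> = (\<Sum>K\<in>set (ext_index m k). \<Sum>p | p permutes {0..<k}. g (\<lambda>a\<in>{0..<k}. K ! p a))"
    by (subst sum.Sigma) (auto simp: finite_permutations split_beta)
  also have "\<dots> = (\<Sum>K\<in>set (ext_index m k). minor A I K * minor B K J)"
  proof (rule sum.cong[OF refl])
    fix K assume K: "K \<in> set (ext_index m k)"
    have lK: "length K = k" by (rule ext_indexD(3)[OF K])
    have "g (\<lambda>a\<in>{0..<k}. K ! p a) = (of_int (sign p) * (\<Prod>a = 0..<k. A $$ (I ! a, K ! p a))) * minor B K J"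
      if p: "p permutes {0..<k}" for p
    proof -
      define M where "M = mat k k (\<lambda>(a, b). B $$ (K ! a, J ! b))"
      have M: "M \<in> carrier_mat k k" by (simp add: M_def)
      have pk: "p a < k" if "a < k" for a using that permutes_in_image[OF p, of a] by simp
      have "mat k k (\<lambda>(a, b). B $$ ((\<lambda>a\<in>{0..<k}. K ! p a) a, J ! b)) = mat k k (\<lambda>(a, b). M $$ (p a, b))"
        by (rule eq_matI) (auto simp: M_def pk)
      then have "det (mat k k (\<lambda>(a, b). B $$ ((\<lambda>a\<in>{0..<k}. K ! p a) a, J ! b))) = of_int (sign p) * det M"
        using det_permute_rows[OF M p] by simp
      then show ?thesis by (simp add: g_def minor_def M_def lK mult_ac)
    qed
    then have "(\<Sum>p | p permutes {0..<k}. g (\<lambda>a\<in>{0..<k}. K ! p a)) =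
        (\<Sum>p | p permutes {0..<k}. of_int (sign p) * (\<Prod>a = 0..<k. A $$ (I ! a, K ! p a))) * minor B K J"
      unfolding sum_distrib_right by (intro sum.cong refl) blast
    also have "(\<Sum>p | p permutes {0..<k}. of_int (sign p) * (\<Prod>a = 0..<k. A $$ (I ! a, K ! p a))) = minor A I K"
      unfolding minor_def len det_mat_permutes ..
    finally show "(\<Sum>p | p permutes {0..<k}. g (\<lambda>a\<in>{0..<k}. K ! p a)) = minor A I K * minor B K J" .
  qed
  finally show ?thesis .
qed

text \<open>
  The exterior power is a functor; on matrix entries this is the Cauchy-Binet formula.
\<close>

lemma ext_mat_mult:
  fixes A B :: "'a::field mat"
  assumes A: "A \<in> carrier_mat n m" and B: "B \<in> carrier_mat m l"
  shows "ext_mat k (A * B) = ext_mat k A * ext_mat k B"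
proof (rule eq_matI)
  note cA = ext_mat_carrier[OF A, of k] and cB = ext_mat_carrier[OF B, of k]
  note AB = mult_carrier_mat[OF A B]
  fix i j assume "i < dim_row (ext_mat k A * ext_mat k B)" "j < dim_col (ext_mat k A * ext_mat k B)"
  then have ij: "i < length (ext_index n k)" "j < length (ext_index l k)" using cA cB by auto
  have I: "ext_index n k ! i \<in> set (ext_index n k)" and J: "ext_index l k ! j \<in> set (ext_index l k)" using ij by simp_all
  have "(ext_mat k A * ext_mat k B) $$ (i, j) = (\<Sum>t<length (ext_index m k). ext_mat k A $$ (i, t) * ext_mat k B $$ (t, j))"
    by (rule index_mult_mat_sum[OF cA cB ij])
  also have "\<dots> = (\<Sum>t<length (ext_index m k). minor A (ext_index n k ! i) (ext_index m k ! t) * minor B (ext_index m k ! t) (ext_index l k ! j))"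
    using ext_mat_index[OF A ij(1)] ext_mat_index[OF B _ ij(2)] by (intro sum.cong refl) simp
  also have "\<dots> = (\<Sum>K\<in>set (ext_index m k). minor A (ext_index n k ! i) K * minor B K (ext_index l k ! j))"
    by (rule sum_ext_index)
  also have "\<dots> = minor (A * B) (ext_index n k ! i) (ext_index l k ! j)"
    by (rule minor_mult[OF A B ext_indexD(2)[OF I] ext_indexD(2)[OF J] ext_indexD(3)[OF I] ext_indexD(3)[OF J], symmetric])
  also have "\<dots> = ext_mat k (A * B) $$ (i, j)" by (rule ext_mat_index[OF AB ij, symmetric])
  finally show "ext_mat k (A * B) $$ (i, j) = (ext_mat k A * ext_mat k B) $$ (i, j)" by simp
qed (use ext_mat_carrier[OF A, of k] ext_mat_carrier[OF B, of k] ext_mat_carrier[OF mult_carrier_mat[OF A B], of k] in auto)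

lemma ext_mat_one: "ext_mat k (1\<^sub>m d) = (1\<^sub>m (length (ext_index d k)) :: 'a::field mat)"
proof (rule eq_matI)
  note c = ext_mat_carrier[OF one_carrier_mat[of d], of k]
  fix i j assume "i < dim_row (1\<^sub>m (length (ext_index d k)) :: 'a mat)" "j < dim_col (1\<^sub>m (length (ext_index d k)) :: 'a mat)"
  then have ij: "i < length (ext_index d k)" "j < length (ext_index d k)" by auto
  define I J where "I = ext_index d k ! i" and "J = ext_index d k ! j"
  have I: "I \<in> set (ext_index d k)" and J: "J \<in> set (ext_index d k)" using ij by (simp_all add: I_def J_def)
  note I' = ext_indexD[OF I] and J' = ext_indexD[OF J]
  have lt: "I ! a < d" "J ! a < d" if "a < k" for a
    using that I'(3) J'(3) nth_lt[OF I'(2)] nth_lt[OF J'(2)] by simp_all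
  have "minor (1\<^sub>m d) I J = (if i = j then 1 else (0 :: 'a))"
  proof (cases "i = j")
    case True
    then have "I = J" by (simp add: I_def J_def)
    have "mat k k (\<lambda>(a, b). 1\<^sub>m d $$ (J ! a, J ! b)) = (1\<^sub>m k :: 'a mat)"
      using lt J'(1,3) by (intro eq_matI) (auto simp: nth_eq_iff_index_eq)
    then show ?thesis using True by (simp add: minor_def \<open>I = J\<close> J'(3))
  next
    case False
    then have "I \<noteq> J" using distinct_ext_index[of d k] ij by (simp add: I_def J_def nth_eq_iff_index_eq)
    have "\<not> set I \<subseteq> set J"
    proof
      assume "set I \<subseteq> set J"
      then have "set I = set J" using distinct_card[OF I'(1)] distinct_card[OF J'(1)] I'(3) J'(3)
        by (intro card_subset_eq) auto
      then show False using I'(4) J'(4) strict_sorted_equal \<open>I \<noteq> J\<close> by blast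
    qed
    then obtain a where a: "a < k" "I ! a \<notin> set J" using I'(3) by (metis in_set_conv_nth subsetI)
    have "(\<Prod>a = 0..<k. (1\<^sub>m d :: 'a mat) $$ (I ! a, J ! p a)) = 0" if p: "p permutes {0..<k}" for p
    proof (rule prod_zero)
      have pa: "p a < k" using permutes_in_image[OF p, of a] a(1) by simp
      then have "J ! p a \<in> set J" using J'(3) by simp
      then have "I ! a \<noteq> J ! p a" using a(2) by auto
      then show "\<exists>a\<in>{0..<k}. (1\<^sub>m d :: 'a mat) $$ (I ! a, J ! p a) = 0"
        using a(1) lt(1)[OF a(1)] lt(2)[OF pa] by (intro bexI[of _ a]) simp_all
    qed simp
    then have "(\<Sum>p | p permutes {0..<k}. of_int (sign p) * (\<Prod>a = 0..<k. (1\<^sub>m d :: 'a mat) $$ (I ! a, J ! p a))) = 0"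
      by (intro sum.neutral ballI) simp
    then show ?thesis using False unfolding minor_def I'(3) det_mat_permutes by simp
  qed
  moreover have "ext_mat k (1\<^sub>m d) $$ (i, j) = minor (1\<^sub>m d :: 'a mat) I J"
    unfolding I_def J_def by (rule ext_mat_index[OF one_carrier_mat ij])
  ultimately show "ext_mat k (1\<^sub>m d) $$ (i, j) = (1\<^sub>m (length (ext_index d k)) :: 'a mat) $$ (i, j)"
    using ij by simp
qed (use ext_mat_carrier[OF one_carrier_mat[of d], of k] in auto)

lemma group_rep_ext:
  fixes \<rho> :: "'g \<Rightarrow> 'a::field mat"
  assumes "group_rep G \<rho>" shows "group_rep G (ext_rep k \<rho>)"
proof (rule group_repI(1))
  note D = group_repD[OF assms]
  show "ext_rep k \<rho> g \<in> carrier_mat (length (ext_index (rep_degree G \<rho>) k)) (length (ext_index (rep_degree G \<rho>) k))"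
    if "g \<in> carrier G" for g
    unfolding ext_rep_def by (rule ext_mat_carrier[OF D(1)[OF that]])
  show "ext_rep k \<rho> \<one>\<^bsub>G\<^esub> = 1\<^sub>m (length (ext_index (rep_degree G \<rho>) k))"
    unfolding ext_rep_def D(2) by (rule ext_mat_one)
  show "ext_rep k \<rho> (g \<otimes>\<^bsub>G\<^esub> h) = ext_rep k \<rho> g * ext_rep k \<rho> h" if "g \<in> carrier G" "h \<in> carrier G" for g h
    unfolding ext_rep_def D(3)[OF that] by (rule ext_mat_mult[OF D(1)[OF that(1)] D(1)[OF that(2)]])
qed

lemma mtrace_ext_conj:
  fixes A :: "'a::field mat"
  assumes A: "A \<in> carrier_mat n n" and P: "P \<in> carrier_mat n n" and Q: "Q \<in> carrier_mat n n" and PQ: "P * Q = 1\<^sub>m n"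
  shows "mtrace (ext_mat k (Q * A * P)) = mtrace (ext_mat k A)"
proof -
  note c = ext_mat_carrier[OF A, of k] ext_mat_carrier[OF P, of k] ext_mat_carrier[OF Q, of k]
  have "ext_mat k (Q * A * P) = (ext_mat k Q * ext_mat k A) * ext_mat k P"
    unfolding ext_mat_mult[OF mult_carrier_mat[OF Q A] P] ext_mat_mult[OF Q A] ..
  then have "mtrace (ext_mat k (Q * A * P)) = mtrace (ext_mat k P * (ext_mat k Q * ext_mat k A))"
    using mtrace_comm[OF mult_carrier_mat[OF c(3,1)] c(2)] by simp
  also have "ext_mat k P * (ext_mat k Q * ext_mat k A) = ext_mat k (P * Q) * ext_mat k A"
    unfolding ext_mat_mult[OF P Q] by (rule assoc_mult_mat[OF c(2,3,1), symmetric])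
  also have "\<dots> = ext_mat k A" unfolding PQ ext_mat_one by (rule left_mult_one_mat[OF c(1)])
  finally show ?thesis .
qed

text \<open>
  An increasing list either avoids 0 or starts with it.
\<close>

lemma ext_index_Suc:
  "set (ext_index (Suc m) (Suc k)) = map Suc ` set (ext_index m (Suc k)) \<union> (\<lambda>I. 0 # map Suc I) ` set (ext_index m k)"
proof -
  have shift: "\<exists>I'\<in>set (ext_index m l). I = map Suc I'"
    if "sorted_wrt (<) I" "set I \<subseteq> {1..<Suc m}" "length I = l" for I l
  proof -
    define I' where "I' = map (\<lambda>i. i - 1) I"
    have I: "I = map Suc I'" 
    proof -
      have "map (\<lambda>x. Suc (x - 1)) I = I"
      proof (rule map_idI)
        fix x assume "x \<in> set I"
        then have "x \<in> {1..<Suc m}" using that(2) by (rule subsetD[rotated])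
        then show "Suc (x - 1) = x" by simp
      qed
      then show ?thesis by (simp add: I'_def o_def)
    qed
    have "sorted_wrt (<) I'" using that(1) unfolding I by (simp add: sorted_wrt_map)
    moreover have "set I' \<subseteq> {0..<m}" using that(2) unfolding I by auto
    ultimately show ?thesis using I that(3) by (intro bexI[of _ I']) (auto simp: set_ext_index)
  qed
  show ?thesis
  proof (intro equalityI subsetI)
    fix I assume I: "I \<in> set (ext_index (Suc m) (Suc k))"
    note D = ext_indexD[OF I]
    show "I \<in> map Suc ` set (ext_index m (Suc k)) \<union> (\<lambda>I. 0 # map Suc I) ` set (ext_index m k)"
    proof (cases "0 \<in> set I")
      case False
      have "x \<noteq> 0" if "x \<in> set I" for x by (rule notI) (use that False in simp)
      then have "set I \<subseteq> {1..<Suc m}" using D(2) by (fastforce simp: Suc_le_eq)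
      from shift[OF D(4) this D(3)] show ?thesis by blast
    next
      case True
      obtain x xs where I': "I = x # xs" using D(3) by (cases I) auto
      have x0: "x = 0"
      proof (rule ccontr)
        assume "x \<noteq> 0"
        then have "0 \<in> set xs" using True unfolding I' by simp
        moreover have "\<forall>y\<in>set xs. x < y" using D(4) unfolding I' by simp
        ultimately have "x < 0" by (rule bspec[rotated])
        then show False by simp
      qed
      have "set xs \<subseteq> {1..<Suc m}" using D(2,4) unfolding I' x0 by (auto simp: Suc_le_eq)
      moreover have "sorted_wrt (<) xs" "length xs = k" using D(3,4) unfolding I' by auto
      ultimately show ?thesis using shift[of xs k] unfolding I' x0 by blast
    qed
  next
    fix I assume "I \<in> map Suc ` set (ext_index m (Suc k)) \<union> (\<lambda>I. 0 # map Suc I) ` set (ext_index m k)"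
    then show "I \<in> set (ext_index (Suc m) (Suc k))"
    proof
      assume "I \<in> map Suc ` set (ext_index m (Suc k))"
      then obtain J where J: "J \<in> set (ext_index m (Suc k))" "I = map Suc J" by (rule imageE)
      have "Suc ` set J \<subseteq> Suc ` {0..<m}" by (rule image_mono[OF ext_indexD(2)[OF J(1)]])
      also have "\<dots> \<subseteq> {0..<Suc m}" by simp
      finally show ?thesis
        using ext_indexD(3,4)[OF J(1)] by (simp add: set_ext_index J(2) sorted_wrt_map)
    next
      assume "I \<in> (\<lambda>I. 0 # map Suc I) ` set (ext_index m k)"
      then obtain J where J: "J \<in> set (ext_index m k)" "I = 0 # map Suc J" by (rule imageE)
      have "Suc ` set J \<subseteq> Suc ` {0..<m}" by (rule image_mono[OF ext_indexD(2)[OF J(1)]])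
      also have "\<dots> \<subseteq> {0..<Suc m}" by simp
      finally show ?thesis
        using ext_indexD(3,4)[OF J(1)] by (simp add: set_ext_index J(2) sorted_wrt_map)
    qed
  qed
qed

lemma ext_index_0: "set (ext_index d 0) = {[]}"
  by (auto simp: set_ext_index)

text \<open>
  A block triangular matrix with corner 1 and complementary block \<open>B\<close> has the principal minors of \<open>B\<close>, each
  occurring without and with the index 0. This is \<open>\<Lambda>\<^bsup>k+1\<^esup> (1 \<oplus> B) = \<Lambda>\<^bsup>k+1\<^esup> B + \<Lambda>\<^sup>k B\<close> on traces.
\<close>

lemma mtrace_ext_corner:
  fixes M B :: "'a::field mat"
  assumes M: "M \<in> carrier_mat (Suc m) (Suc m)" and B: "B \<in> carrier_mat m m"
    and corner: "M $$ (0, 0) = 1" "\<And>i. i < m \<Longrightarrow> M $$ (Suc i, 0) = 0"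
    and block: "\<And>i j. i < m \<Longrightarrow> j < m \<Longrightarrow> M $$ (Suc i, Suc j) = B $$ (i, j)"
  shows "mtrace (ext_mat (Suc k) M) = mtrace (ext_mat (Suc k) B) + mtrace (ext_mat k B)"
proof -
  have lt: "I ! a < m" if "I \<in> set (ext_index m l)" "a < l" for I l a
    using that(2) ext_indexD(3)[OF that(1)] nth_lt[OF ext_indexD(2)[OF that(1)]] by simp
  have 1: "minor M (map Suc I) (map Suc I) = minor B I I" if "I \<in> set (ext_index m l)" for I l
  proof -
    have len: "length I = l" by (rule ext_indexD(3)[OF that])
    have "mat l l (\<lambda>(a, b). M $$ (map Suc I ! a, map Suc I ! b)) = mat l l (\<lambda>(a, b). B $$ (I ! a, I ! b))"
      using lt[OF that] len by (intro eq_matI) (auto simp: block)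
    then show ?thesis by (simp add: minor_def len)
  qed
  have 2: "minor M (0 # map Suc I) (0 # map Suc I) = minor B I I" if I: "I \<in> set (ext_index m l)" for I l
  proof -
    have len: "length I = l" by (rule ext_indexD(3)[OF I])
    define N where "N = mat (Suc l) (Suc l) (\<lambda>(a, b). M $$ ((0 # map Suc I) ! a, (0 # map Suc I) ! b))"
    have N: "N \<in> carrier_mat (Suc l) (Suc l)" by (simp add: N_def)
    have N0: "N $$ (a, 0) = (if a = 0 then 1 else 0)" if "a < Suc l" for a
      using that lt[OF I] corner len by (cases a) (auto simp: N_def)
    have "det N = (\<Sum>a<Suc l. N $$ (a, 0) * cofactor N a 0)" by (rule laplace_expansion_column[OF N]) simp
    also have "\<dots> = (\<Sum>a<Suc l. if a = 0 then cofactor N a 0 else 0)"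
      by (intro sum.cong refl) (simp add: N0)
    also have "\<dots> = det (mat_delete N 0 0)" by (simp add: cofactor_def)
    also have "mat_delete N 0 0 = mat l l (\<lambda>(a, b). B $$ (I ! a, I ! b))"
      using lt[OF I] len by (intro eq_matI) (auto simp: mat_delete_def N_def block)
    finally show ?thesis by (simp add: minor_def len N_def)
  qed
  have "mtrace (ext_mat (Suc k) M) = (\<Sum>I\<in>set (ext_index (Suc m) (Suc k)). minor M I I)"
    by (rule mtrace_ext_mat[OF M])
  also have "\<dots> = (\<Sum>I\<in>map Suc ` set (ext_index m (Suc k)). minor M I I) + (\<Sum>I\<in>(\<lambda>I. 0 # map Suc I) ` set (ext_index m k). minor M I I)"
    unfolding ext_index_Suc
  proof (rule sum.union_disjoint)
    show "map Suc ` set (ext_index m (Suc k)) \<inter> (\<lambda>I. 0 # map Suc I) ` set (ext_index m k) = {}"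
    proof (rule ccontr)
      assume "map Suc ` set (ext_index m (Suc k)) \<inter> (\<lambda>I. 0 # map Suc I) ` set (ext_index m k) \<noteq> {}"
      then obtain I J where "map Suc I = 0 # map Suc J" by auto
      then have "0 \<in> set (map Suc I)" by simp
      then show False by auto
    qed
  qed auto
  also have "(\<Sum>I\<in>map Suc ` set (ext_index m (Suc k)). minor M I I) = (\<Sum>I\<in>set (ext_index m (Suc k)). minor B I I)"
    by (subst sum.reindex) (auto simp: inj_on_def 1 intro!: sum.cong)
  also have "(\<Sum>I\<in>(\<lambda>I. 0 # map Suc I) ` set (ext_index m k). minor M I I) = (\<Sum>I\<in>set (ext_index m k). minor B I I)"
    by (subst sum.reindex) (auto simp: inj_on_def 2 intro!: sum.cong)
  finally show ?thesis unfolding mtrace_ext_mat[OF B] .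
qed

lemma mtrace_ext_0:
  assumes "A \<in> carrier_mat n n" shows "mtrace (ext_mat 0 A) = 1"
  unfolding mtrace_ext_mat[OF assms] ext_index_0 by (simp add: minor_def)

section \<open>Signed permutation matrices\<close>

text \<open>
  Row and column \<open>i\<close> correspond to the point \<open>i + 1\<close>, since matrix indices start at 0 and points at 1.
\<close>

definition sp_mat :: "nat \<Rightarrow> sperm \<Rightarrow> 'a::comm_ring_1 mat"
  where "sp_mat n w = mat n n (\<lambda>(i, j). if snd w (Suc j) = Suc i then of_int (fst w (Suc j)) else 0)"

text \<open>
  In the expansion of the determinant a permutation contributes only if it inverts \<open>w\<close> on the points of \<open>I\<close>. There
  is at most one, and none unless these points form a stable set.
\<close>

lemma minor_sp_mat:
  fixes I :: "nat list"
  assumes I: "distinct I" "set I \<subseteq> {0..<n}" and w: "inj (snd w)"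
  shows "minor (sp_mat n w) I I = (if snd w ` (Suc ` set I) = Suc ` set I then of_int (lin_char (True, True) (Suc ` set I) w) else (0::'a::field))"
proof -
  define k A \<sigma> where "k = length I" and "A = Suc ` set I" and "\<sigma> = snd w"
  define h where "h a = Suc (I ! a)" for a
  have h: "bij_betw h {0..<k} A"
  proof -
    have "bij_betw ((!) I) {0..<k} (set I)" by (rule bij_betw_nth[OF I(1)]) (auto simp: k_def)
    moreover have "bij_betw Suc (set I) A" by (simp add: A_def bij_betw_def)
    ultimately have "bij_betw (Suc \<circ> (!) I) {0..<k} A" by (rule bij_betw_trans)
    moreover have "Suc \<circ> (!) I = h" by (simp add: h_def fun_eq_iff)
    ultimately show ?thesis by simp
  qed
  have hinj: "h a = h b \<longleftrightarrow> a = b" if "a < k" "b < k" for a b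
    using h that by (auto simp: bij_betw_def inj_on_def)
  have lt: "I ! a < n" if "a < k" for a using that nth_lt[OF I(2)] by (simp add: k_def)
  have "(minor (sp_mat n w) I I :: 'a) = det (mat k k (\<lambda>(a, b). sp_mat n w $$ (I ! a, I ! b)))"
    by (simp add: minor_def k_def)
  also have "\<dots> = (\<Sum>p | p permutes {0..<k}. of_int (sign p) * (\<Prod>a = 0..<k. sp_mat n w $$ (I ! a, I ! p a)))"
    by (rule det_mat_permutes)
  also have "\<dots> = (\<Sum>p | p permutes {0..<k}. if \<forall>a<k. \<sigma> (h (p a)) = h a then of_int (sign p * (\<Prod>i\<in>A. fst w i)) else 0)"
  proof (intro sum.cong refl)
    fix p assume "p \<in> {p. p permutes {0..<k}}"
    then have p: "p permutes {0..<k}" by simp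
    have pk: "p a < k" if "a < k" for a using that permutes_in_image[OF p, of a] by simp
    have ent: "sp_mat n w $$ (I ! a, I ! p a) = (if \<sigma> (h (p a)) = h a then of_int (fst w (h (p a))) else (0::'a))" if "a < k" for a
      using lt[OF that] lt[OF pk[OF that]] by (simp add: sp_mat_def h_def \<sigma>_def)
    show "of_int (sign p) * (\<Prod>a = 0..<k. sp_mat n w $$ (I ! a, I ! p a)) =
        (if \<forall>a<k. \<sigma> (h (p a)) = h a then of_int (sign p * (\<Prod>i\<in>A. fst w i)) else (0::'a))"
    proof (cases "\<forall>a<k. \<sigma> (h (p a)) = h a")
      case True
      have "bij_betw p {0..<k} {0..<k}" by (rule permutes_imp_bij[OF p])
      then have "bij_betw (h \<circ> p) {0..<k} A" using h by (rule bij_betw_trans)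
      then have "(\<Prod>a = 0..<k. fst w ((h \<circ> p) a)) = (\<Prod>i\<in>A. fst w i)" by (rule prod.reindex_bij_betw)
      moreover have "(\<Prod>a = 0..<k. sp_mat n w $$ (I ! a, I ! p a)) = (\<Prod>a = 0..<k. of_int (fst w ((h \<circ> p) a)) :: 'a)"
        using True ent by (intro prod.cong refl) simp
      ultimately show ?thesis using True by (simp flip: of_int_prod)
    next
      case False
      then obtain a where "a < k" "\<sigma> (h (p a)) \<noteq> h a" by blast
      then have "(\<Prod>a = 0..<k. sp_mat n w $$ (I ! a, I ! p a)) = (0::'a)"
        using ent[of a] by (intro prod_zero) auto
      then show ?thesis unfolding if_not_P[OF False] by simp
    qed
  qed
  also have "\<dots> = (if \<sigma> ` A = A then of_int (lin_char (True, True) A w) else 0)"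
  proof (cases "\<sigma> ` A = A")
    case False
    have "\<not> (\<forall>a<k. \<sigma> (h (p a)) = h a)" if p: "p permutes {0..<k}" for p
    proof
      assume all: "\<forall>a<k. \<sigma> (h (p a)) = h a"
      have "A = h ` {0..<k}" using h by (simp add: bij_betw_def)
      also have "\<dots> = (\<lambda>a. \<sigma> (h (p a))) ` {0..<k}" using all by (intro image_cong) auto
      also have "\<dots> = \<sigma> ` h ` p ` {0..<k}" by (simp add: image_image)
      also have "p ` {0..<k} = {0..<k}" by (rule permutes_image[OF p])
      also have "h ` {0..<k} = A" using h by (simp add: bij_betw_def)
      finally show False using False by simp
    qed
    then have "(\<Sum>p | p permutes {0..<k}. if \<forall>a<k. \<sigma> (h (p a)) = h a then of_int (sign p * (\<Prod>i\<in>A. fst w i)) else 0) = (0::'a)"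
      by (intro sum.neutral ballI if_not_P) simp
    then show ?thesis using False by simp
  next
    case True
    define g where "g = inv_into {0..<k} h"
    have gA: "bij_betw g A {0..<k}" unfolding g_def by (rule bij_betw_inv_into[OF h])
    have gh: "g (h a) = a" if "a < k" for a using bij_betw_inv_into_left[OF h] that by (simp add: g_def)
    have hg: "h (g i) = i" if "i \<in> A" for i using bij_betw_inv_into_right[OF h that] by (simp add: g_def)
    have \<sigma>A: "bij_betw \<sigma> A A" using True w by (auto simp: bij_betw_def \<sigma>_def intro: inj_on_subset)
    define q where "q = restrict_id (\<lambda>a. g (\<sigma> (h a))) {0..<k}"
    have "bij_betw (g \<circ> (\<sigma> \<circ> h)) {0..<k} {0..<k}" by (rule bij_betw_trans[OF bij_betw_trans[OF h \<sigma>A] gA])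
    then have q: "q permutes {0..<k}" unfolding q_def by (intro permutes_restrict_id) (simp add: o_def)
    have qa: "q a = g (\<sigma> (h a))" if "a < k" for a using that by (simp add: q_def)
    have hA: "h a \<in> A" if "a < k" for a using h that by (auto simp: bij_betw_def)
    have \<sigma>hA: "\<sigma> (h a) \<in> A" if "a < k" for a using \<sigma>A hA[OF that] by (auto simp: bij_betw_def)
    have "map_permutation {0..<k} h q = restrict_id \<sigma> A"
    proof -
      have hk: "h ` {0..<k} = A" using h by (simp add: bij_betw_def)
      show ?thesis unfolding map_permutation_def hk
      proof (rule restrict_id_cong[OF _ refl])
        fix i assume "i \<in> A"
        then obtain a where a: "a < k" "i = h a" using hk by auto
        have "inv_into {0..<k} h i = a" using gh[OF a(1)] by (simp add: g_def a(2))
        then show "(h \<circ> q \<circ> inv_into {0..<k} h) i = \<sigma> i"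
          using a qa[OF a(1)] hg[OF \<sigma>hA[OF a(1)]] by simp
      qed
    qed
    then have sq: "sign q = sign_on A \<sigma>"
      using sign_map_permutation[of h "{0..<k}" q] h q by (simp add: sign_on_def bij_betw_def)
    define p0 where "p0 = inv_into UNIV q"
    have p0: "p0 permutes {0..<k}" unfolding p0_def by (rule Permutations.permutes_inv[OF q])
    have qp0: "q (p0 a) = a" for a unfolding p0_def by (rule permutes_inverses(1)[OF q])
    have iff: "(\<forall>a<k. \<sigma> (h (p a)) = h a) \<longleftrightarrow> p = p0" if p: "p permutes {0..<k}" for p
    proof -
      have pk: "p a < k" if "a < k" for a using that permutes_in_image[OF p, of a] by simp
      have "\<sigma> (h (p a)) = h a \<longleftrightarrow> q (p a) = a" if a: "a < k" for a
        using qa[OF pk[OF a]] hg[OF \<sigma>hA[OF pk[OF a]]] gh[OF a] by (metis)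
      then have "(\<forall>a<k. \<sigma> (h (p a)) = h a) \<longleftrightarrow> (\<forall>a<k. q (p a) = q (p0 a))" using qp0 by simp
      also have "\<dots> \<longleftrightarrow> (\<forall>a<k. p a = p0 a)" using permutes_inj[OF q] by (simp add: inj_eq)
      also have "\<dots> \<longleftrightarrow> p = p0"
      proof
        assume *: "\<forall>a<k. p a = p0 a"
        show "p = p0"
        proof
          fix a show "p a = p0 a"
            by (cases "a < k") (use * permutes_not_in[OF p] permutes_not_in[OF p0] in simp_all)
        qed
      qed simp
      finally show ?thesis .
    qed
    have "(\<Sum>p | p permutes {0..<k}. if \<forall>a<k. \<sigma> (h (p a)) = h a then of_int (sign p * (\<Prod>i\<in>A. fst w i)) else (0::'a)) =
        (\<Sum>p | p permutes {0..<k}. if p = p0 then of_int (sign p * (\<Prod>i\<in>A. fst w i)) else 0)"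
      using iff by (intro sum.cong refl if_cong) simp_all
    also have "\<dots> = of_int (sign p0 * (\<Prod>i\<in>A. fst w i))"
      using p0 by (simp add: finite_permutations)
    also have "sign p0 = sign_on A \<sigma>"
      unfolding p0_def using sign_inverse[OF permutes_imp_permutation[OF _ q]] sq by simp
    finally show ?thesis using True by (simp add: lin_char_def \<sigma>_def)
  qed
  finally show ?thesis by (simp only: A_def \<sigma>_def)
qed

text \<open>
  The link between representations and combinatorics: exterior powers of the signed permutation
  representation have one-block characters.
\<close>

lemma mtrace_ext_sp_mat:
  assumes w: "snd w permutes {1..n}"
  shows "mtrace (ext_mat k (sp_mat n w)) = (of_int (block_char {1..n} [(k, True, True)] w) :: 'a::field)"
proof -
  have c: "sp_mat n w \<in> carrier_mat n n" by (simp add: sp_mat_def)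
  define T where "T = {A. A \<subseteq> {1..n} \<and> card A = k}"
  have bij: "bij_betw (\<lambda>I. Suc ` set I) (set (ext_index n k)) T"
  proof (rule bij_betw_imageI)
    show "inj_on (\<lambda>I. Suc ` set I) (set (ext_index n k))"
    proof (rule inj_onI)
      fix I J assume IJ: "I \<in> set (ext_index n k)" "J \<in> set (ext_index n k)" "Suc ` set I = Suc ` set J"
      then have "set I = set J" by (simp add: inj_image_eq_iff)
      then show "I = J" using ext_indexD(4)[OF IJ(1)] ext_indexD(4)[OF IJ(2)] strict_sorted_equal by blast
    qed
    show "(\<lambda>I. Suc ` set I) ` set (ext_index n k) = T"
    proof (intro equalityI subsetI)
      fix A assume "A \<in> (\<lambda>I. Suc ` set I) ` set (ext_index n k)"
      then obtain I where I: "I \<in> set (ext_index n k)" "A = Suc ` set I" by auto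
      have "card A = k" using distinct_card[OF ext_indexD(1)[OF I(1)]] ext_indexD(3)[OF I(1)] by (simp add: I(2) card_image)
      then show "A \<in> T" using ext_indexD(2)[OF I(1)] by (auto simp: T_def I(2))
    next
      fix A assume "A \<in> T"
      then have A: "A \<subseteq> {1..n}" "card A = k" by (auto simp: T_def)
      define B where "B = {i. Suc i \<in> A}"
      have AB: "A = Suc ` B"
      proof (intro equalityI subsetI)
        fix x assume "x \<in> A"
        then obtain i where "x = Suc i" using A(1) by (cases x) auto
        then show "x \<in> Suc ` B" using \<open>x \<in> A\<close> by (auto simp: B_def)
      qed (auto simp: B_def)
      have B: "B \<subseteq> {0..<n}" using A(1) by (auto simp: B_def)
      have finB: "finite B" using B finite_subset by blast
      have "card B = k" using A(2) by (simp add: AB card_image)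
      then have "sorted_list_of_set B \<in> set (ext_index n k)" using B finB by (simp add: set_ext_index)
      moreover have "A = Suc ` set (sorted_list_of_set B)" using finB AB by simp
      ultimately show "A \<in> (\<lambda>I. Suc ` set I) ` set (ext_index n k)" by (rule image_eqI[rotated])
    qed
  qed
  have "mtrace (ext_mat k (sp_mat n w)) = (\<Sum>I\<in>set (ext_index n k). minor (sp_mat n w) I I :: 'a)"
    by (rule mtrace_ext_mat[OF c])
  also have "\<dots> = (\<Sum>I\<in>set (ext_index n k). (\<lambda>A. if snd w ` A = A then of_int (lin_char (True, True) A w) else 0) (Suc ` set I))"
    using minor_sp_mat[OF ext_indexD(1) ext_indexD(2) permutes_inj[OF w]] by (intro sum.cong refl) blast
  also have "\<dots> = (\<Sum>A\<in>T. if snd w ` A = A then of_int (lin_char (True, True) A w) else 0)"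
    by (rule sum.reindex_bij_betw[OF bij])
  also have "\<dots> = (\<Sum>A\<in>stable_subsets k {1..n} w. of_int (lin_char (True, True) A w))"
  proof -
    have "finite T" by (rule finite_subset[of _ "Pow {1..n}"]) (auto simp: T_def)
    moreover have "stable_subsets k {1..n} w = {A \<in> T. snd w ` A = A}" by (auto simp: stable_subsets_def T_def)
    ultimately show ?thesis by (simp add: sum.inter_filter)
  qed
  finally show ?thesis by simp
qed

section \<open>Characters have integral averages\<close>

lemma sp_mult_cancel:
  assumes u: "u \<in> signed_perms S" and eq: "u \<star> v = u \<star> v'" shows "v = v'"
proof (rule prod_eqI)
  have "snd u \<circ> snd v = snd u \<circ> snd v'" using arg_cong[OF eq, of snd] by (simp add: sp_mult_def)
  then show s: "snd v = snd v'" using permutes_inj[OF signed_permsD(1)[OF u]] by (simp add: fun.inj_map_strong inj_eq fun_eq_iff)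
  show "fst v = fst v'"
  proof
    fix j
    have "fst v j * fst u (snd v j) = fst v' j * fst u (snd v j)"
      using fun_cong[OF arg_cong[OF eq, of fst], of j] by (simp add: sp_mult_def s)
    then show "fst v j = fst v' j" using signed_permsD(2)[OF u, of "snd v j"] by auto
  qed
qed

lemma lin_char_mult:
  assumes u: "u \<in> signed_perms S" and v: "v \<in> signed_perms S"
  shows "lin_char (False, b) S (u \<star> v) = lin_char (False, b) S u * lin_char (False, b) S v"
proof -
  have "(\<Prod>i\<in>S. fst u (snd v i)) = (\<Prod>i\<in>S. fst u i)"
    by (rule prod.reindex_bij_betw[OF permutes_imp_bij[OF signed_permsD(1)[OF v]]])
  then show ?thesis by (simp add: lin_char_def sp_mult_def prod.distrib mult.commute)
qed

text \<open>
  Averaging \<open>w \<mapsto> tr(P \<sqdot> r(w))\<close> over a block multiplies \<open>P\<close> by the idempotent that projects onto the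
  \<open>\<epsilon>\<^sup>b\<close>-isotypic part for that block. This idempotent commutes with \<open>P\<close> and with the group on the
  remaining points, so the product is again an idempotent of the same kind. When all points are used up, the
  value is the trace of an idempotent.
\<close>

lemma iter_avg_rep:
  fixes r :: "sperm \<Rightarrow> 'a::field_char_0 mat"
  assumes fin: "finite S" and r: "\<And>w. w \<in> signed_perms S \<Longrightarrow> r w \<in> carrier_mat d d"
    and r_one: "r sp_one = 1\<^sub>m d"
    and r_mult: "\<And>w v. w \<in> signed_perms S \<Longrightarrow> v \<in> signed_perms S \<Longrightarrow> r (w \<star> v) = r w * r v"
    and "blocks S' l" "S' \<subseteq> S" "P \<in> carrier_mat d d" "P * P = P"
    and "\<And>w. w \<in> signed_perms S' \<Longrightarrow> P * r w = r w * P"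
    and "\<And>w. w \<in> signed_perms S' \<Longrightarrow> y w = mtrace (P * r w)"
  shows "iter_avg l y sp_one \<in> \<int>"
  using assms(5-)
proof (induction l arbitrary: S' P y)
  case Nil
  have "y sp_one = mtrace P" using Nil.prems(6)[of sp_one] Nil.prems(3) by (simp add: r_one)
  moreover obtain k where "mtrace P = of_nat k" using mtrace_idempotent[OF Nil.prems(3,4)] by blast
  ultimately show ?case by simp
next
  case (Cons Rb l)
  obtain R b where Rb: "Rb = (R, b)" by (rule prod.exhaust)
  note P = Cons.prems(3) and PP = Cons.prems(4) and Pr = Cons.prems(5)
  have RS': "R \<subseteq> S'" and bl: "blocks (S' - R) l" using Cons.prems(1) by (auto simp: Rb)
  have RS: "R \<subseteq> S" using RS' Cons.prems(2) by simp
  define H where "H = signed_perms R"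
  define f where "f u = of_int (lin_char (False, b) R u) \<cdot>\<^sub>m r u" for u
  define Q where "Q = mat_avg d H f"
  have H: "finite H" "H \<noteq> {}" 
    unfolding H_def using finite_signed_perms[OF finite_subset[OF RS fin]] sp_one_in by blast+
  have HS: "u \<in> signed_perms S" "u \<in> signed_perms S'" if "u \<in> H" for u
    using signed_perms_mono[OF RS] signed_perms_mono[OF RS'] that by (simp_all add: H_def)
  have f: "f u \<in> carrier_mat d d" if "u \<in> H" for u unfolding f_def by (intro smult_carrier_mat r HS[OF that])
  have Q: "Q \<in> carrier_mat d d" by (simp add: Q_def)
  have QQ: "Q * Q = Q" unfolding Q_def
  proof (rule mat_avg_idempotent(2)[where mul = "(\<star>)", OF H f])
    show "inj_on ((\<star>) h) H" if "h \<in> H" for h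
      by (rule inj_onI) (rule sp_mult_cancel[OF that[unfolded H_def]])
    fix h k assume hk: "h \<in> H" "k \<in> H"
    show "h \<star> k \<in> H" using hk unfolding H_def by (rule sp_mult_in)
    have "f h * f k = of_int (lin_char (False, b) R h) \<cdot>\<^sub>m (r h * (of_int (lin_char (False, b) R k) \<cdot>\<^sub>m r k))"
      unfolding f_def by (rule mult_smult_assoc_mat[OF r[OF HS(1)[OF hk(1)]] smult_carrier_mat[OF r[OF HS(1)[OF hk(2)]]]])
    also have "r h * (of_int (lin_char (False, b) R k) \<cdot>\<^sub>m r k) = of_int (lin_char (False, b) R k) \<cdot>\<^sub>m (r h * r k)"
      by (rule mult_smult_distrib[OF r[OF HS(1)[OF hk(1)]] r[OF HS(1)[OF hk(2)]]])
    finally show "f (h \<star> k) = f h * f k"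
      using lin_char_mult[OF hk[unfolded H_def], of b] r_mult[OF HS(1)[OF hk(1)] HS(1)[OF hk(2)]]
      by (auto simp: f_def mult.assoc intro!: eq_matI)
  qed
  have Pf: "P * f u = f u * P" if "u \<in> H" for u
    using mult_smult_distrib[OF P r[OF HS(1)[OF that]]] mult_smult_assoc_mat[OF r[OF HS(1)[OF that]] P] Pr[OF HS(2)[OF that]]
    by (simp add: f_def)
  have PQ: "P * Q = Q * P"
  proof -
    have "P * Q = mat_avg d H (\<lambda>u. P * f u)" unfolding Q_def by (rule mult_mat_avg(1)[OF P f])
    also have "\<dots> = mat_avg d H (\<lambda>u. f u * P)" by (rule mat_avg_cong) (rule Pf)
    also have "\<dots> = Q * P" unfolding Q_def by (rule mult_mat_avg(2)[OF P f, symmetric])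
    finally show ?thesis .
  qed
  have wS: "w \<in> signed_perms S'" "w \<in> signed_perms S" if "w \<in> signed_perms (S' - R)" for w
    using signed_perms_mono[of "S' - R" S', OF _ that] signed_perms_mono[of "S' - R" S, OF _ that] Cons.prems(2) by auto
  have fr: "f u * r w = r w * f u" if u: "u \<in> H" and w: "w \<in> signed_perms (S' - R)" for u w
  proof -
    note ru = r[OF HS(1)[OF u]] and rw = r[OF wS(2)[OF w]]
    have "u \<star> w = w \<star> u" by (rule sp_mult_commute[OF u[unfolded H_def] w]) auto
    then have "r u * r w = r w * r u" using r_mult[OF HS(1)[OF u] wS(2)[OF w]] r_mult[OF wS(2)[OF w] HS(1)[OF u]] by simp
    then show ?thesis using mult_smult_distrib[OF rw ru] mult_smult_assoc_mat[OF ru rw] by (simp add: f_def)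
  qed
  have Qr: "Q * r w = r w * Q" if w: "w \<in> signed_perms (S' - R)" for w
  proof -
    note rw = r[OF wS(2)[OF w]]
    have "Q * r w = mat_avg d H (\<lambda>u. f u * r w)" unfolding Q_def by (rule mult_mat_avg(2)[OF rw f])
    also have "\<dots> = mat_avg d H (\<lambda>u. r w * f u)" by (rule mat_avg_cong) (rule fr[OF _ w])
    also have "\<dots> = r w * Q" unfolding Q_def by (rule mult_mat_avg(1)[OF rw f, symmetric])
    finally show ?thesis .
  qed
  have avg: "block_avg R b y w = mtrace (P * Q * r w)" if w: "w \<in> signed_perms (S' - R)" for w
  proof -
    note rw = r[OF wS(2)[OF w]]
    have PQe: "P * Q = mat_avg d H (\<lambda>u. P * f u)" unfolding Q_def by (rule mult_mat_avg(1)[OF P f])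
    have "P * Q * r w = mat_avg d H (\<lambda>u. P * f u * r w)"
      unfolding PQe by (rule mult_mat_avg(2)[OF rw]) (rule mult_carrier_mat[OF P f])
    then have "mtrace (P * Q * r w) = (\<Sum>u\<in>H. mtrace (P * f u * r w)) / of_nat (card H)"
      using mtrace_mat_avg[of H "\<lambda>u. P * f u * r w" d] mult_carrier_mat[OF mult_carrier_mat[OF P f] rw] by simp
    also have "(\<Sum>u\<in>H. mtrace (P * f u * r w)) = (\<Sum>u\<in>H. of_int (lin_char (False, b) R u) * y (u \<star> w))"
    proof (rule sum.cong[OF refl])
      fix u assume u: "u \<in> H"
      note ru = r[OF HS(1)[OF u]]
      have "P * f u * r w = of_int (lin_char (False, b) R u) \<cdot>\<^sub>m (P * (r u * r w))"
        using mult_smult_distrib[OF P ru] mult_smult_assoc_mat[OF mult_carrier_mat[OF P ru] rw] assoc_mult_mat[OF P ru rw]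
        by (simp add: f_def)
      moreover have "P * (r u * r w) \<in> carrier_mat d d" by (intro mult_carrier_mat[OF P] mult_carrier_mat[OF ru rw])
      moreover have "y (u \<star> w) = mtrace (P * (r u * r w))"
        using Cons.prems(6)[OF sp_mult_in[OF HS(2)[OF u] wS(1)[OF w]]] r_mult[OF HS(1)[OF u] wS(2)[OF w]] by simp
      ultimately show "mtrace (P * f u * r w) = of_int (lin_char (False, b) R u) * y (u \<star> w)"
        by (simp only:) (simp add: mtrace_def sum_distrib_left del: index_mult_mat)
    qed
    finally show ?thesis by (simp add: block_avg_def H_def)
  qed
  have PQc: "P * Q \<in> carrier_mat d d" by (rule mult_carrier_mat[OF P Q])
  have PQr: "P * Q * r w = r w * (P * Q)" if w: "w \<in> signed_perms (S' - R)" for w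
  proof -
    note rw = r[OF wS(2)[OF w]]
    have "P * Q * r w = P * r w * Q" using assoc_mult_mat[OF P Q rw] assoc_mult_mat[OF P rw Q] Qr[OF w] by simp
    then show ?thesis using assoc_mult_mat[OF rw P Q] Pr[OF wS(1)[OF w]] by simp
  qed
  have idem: "P * Q * (P * Q) = P * Q"
  proof -
    have "P * Q * (P * Q) = P * (Q * P) * Q"
      using assoc_mult_mat[OF PQc P Q] assoc_mult_mat[OF P Q P] by simp
    also have "P * (Q * P) = P * Q" using assoc_mult_mat[OF P P Q] PP PQ by simp
    also have "P * Q * Q = P * Q" using assoc_mult_mat[OF P Q Q] QQ by simp
    finally show ?thesis .
  qed
  have "iter_avg l (block_avg R b y) sp_one \<in> \<int>"
    by (rule Cons.IH[OF bl _ PQc idem PQr avg]) (use Cons.prems(2) in auto)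
  then show ?case by (simp add: Rb)
qed

lemma integral_averages_rep:
  fixes r :: "sperm \<Rightarrow> 'a::field_char_0 mat"
  assumes "finite S" "\<And>w. w \<in> signed_perms S \<Longrightarrow> r w \<in> carrier_mat d d" "r sp_one = 1\<^sub>m d"
    and "\<And>w v. w \<in> signed_perms S \<Longrightarrow> v \<in> signed_perms S \<Longrightarrow> r (w \<star> v) = r w * r v"
  shows "integral_averages S (\<lambda>w. mtrace (r w))"
  unfolding integral_averages_def
proof (intro allI impI)
  fix l assume l: "blocks S l"
  show "iter_avg l (\<lambda>w. mtrace (r w)) sp_one \<in> \<int>"
    by (rule iter_avg_rep[where S = S and d = d and r = r and S' = S and P = "1\<^sub>m d", OF assms l subset_refl one_carrier_mat])
      (simp_all add: left_mult_one_mat[OF assms(2)] right_mult_one_mat[OF assms(2)])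
qed

text \<open>
  In a basis adapted to the subrepresentation \<open>\<alpha>\<close>, the matrix of \<open>\<beta>\<close> is block triangular with corner 1 and
  complementary block \<open>\<gamma>\<close>.
\<close>

lemma mtrace_ext_short_exact:
  fixes \<alpha> \<beta> \<gamma> :: "'g \<Rightarrow> 'b::field_char_0 mat"
  assumes G: "group G" and ex: "short_exact G \<alpha> \<beta> \<gamma>" and \<alpha>: "rep_degree G \<alpha> = 1" "\<alpha> g = 1\<^sub>m 1" and g: "g \<in> carrier G"
  shows "mtrace (ext_mat (Suc k) (\<beta> g)) = mtrace (ext_mat (Suc k) (\<gamma> g)) + mtrace (ext_mat k (\<gamma> g))"
proof -
  define c where "c = rep_degree G \<gamma>"
  have b: "rep_degree G \<beta> = Suc c"
    using short_exact_degree[OF ex monoid.one_closed[OF group.is_monoid[OF G]]] by (simp add: \<alpha>(1) c_def)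
  from short_exact_splitting[OF ex, unfolded b \<alpha>(1), folded c_def]
  obtain F L s P where Fc: "F \<in> carrier_mat (Suc c) 1" and L: "L \<in> carrier_mat 1 (Suc c)" and s: "s \<in> carrier_mat (Suc c) c"
    and Pc: "P \<in> carrier_mat c (Suc c)" and LF: "L * F = 1\<^sub>m 1" and Ps: "P * s = 1\<^sub>m c"
    and one: "F * L + s * P = 1\<^sub>m (Suc c)" and PF: "P * F = 0\<^sub>m c 1"
    and I: "\<forall>g\<in>carrier G. F * \<alpha> g = \<beta> g * F" "\<forall>g\<in>carrier G. P * \<beta> g = \<gamma> g * P" by metis
  have reps: "group_rep G \<beta>" "group_rep G \<gamma>" using ex by (simp_all add: short_exact_def)
  define A where "A = \<beta> g"
  have A: "A \<in> carrier_mat (Suc c) (Suc c)" using group_repD(1)[OF reps(1) g] by (simp add: b A_def)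
  have B: "\<gamma> g \<in> carrier_mat c c" using group_repD(1)[OF reps(2) g] by (simp add: c_def)
  have AF: "A * F = F" using I(1)[rule_format, OF g] right_mult_one_mat[OF Fc] by (simp add: A_def \<alpha>(2))
  have PA: "P * A = \<gamma> g * P" using I(2)[rule_format, OF g] by (simp add: A_def)
  \<comment> \<open>\<open>T = [F | s]\<close> and \<open>T\'\<close> has the rows of \<open>L\<close> and \<open>P\<close>\<close>
  define T where "T = mat (Suc c) (Suc c) (\<lambda>(i, j). case j of 0 \<Rightarrow> F $$ (i, 0) | Suc j' \<Rightarrow> s $$ (i, j'))"
  define T' where "T' = mat (Suc c) (Suc c) (\<lambda>(i, j). case i of 0 \<Rightarrow> L $$ (0, j) | Suc i' \<Rightarrow> P $$ (i', j))"
  have T: "T \<in> carrier_mat (Suc c) (Suc c)" and T': "T' \<in> carrier_mat (Suc c) (Suc c)" by (simp_all add: T_def T'_def)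
  have TT': "T * T' = 1\<^sub>m (Suc c)"
  proof (rule eq_matI)
    fix i j assume "i < dim_row (1\<^sub>m (Suc c) :: 'b mat)" "j < dim_col (1\<^sub>m (Suc c) :: 'b mat)"
    then have ij: "i < Suc c" "j < Suc c" by auto
    have "(T * T') $$ (i, j) = (\<Sum>k<Suc c. T $$ (i, k) * T' $$ (k, j))" by (rule index_mult_mat_sum[OF T T' ij])
    also have "\<dots> = F $$ (i, 0) * L $$ (0, j) + (\<Sum>k<c. s $$ (i, k) * P $$ (k, j))"
      unfolding sum.lessThan_Suc_shift using ij by (simp add: T_def T'_def)
    also have "\<dots> = (F * L + s * P) $$ (i, j)"
      using index_mult_mat_sum[OF Fc L ij] index_mult_mat_sum[OF s Pc ij] ij carrier_matD[OF mult_carrier_mat[OF s Pc]] s Pc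
      by (subst index_add_mat) (simp_all del: index_mult_mat(1))
    finally show "(T * T') $$ (i, j) = 1\<^sub>m (Suc c) $$ (i, j)" by (simp only: one)
  qed (use T T' in auto)
  define M where "M = T' * A * T"
  have M: "M \<in> carrier_mat (Suc c) (Suc c)" unfolding M_def by (intro mult_carrier_mat[OF mult_carrier_mat[OF T' A] T])
  have left: "(T' * A) $$ (i, j) = (case i of 0 \<Rightarrow> (L * A) $$ (0, j) | Suc i' \<Rightarrow> (P * A) $$ (i', j))" if "i < Suc c" "j < Suc c" for i j
    using that index_mult_mat_sum[OF T' A that] index_mult_mat_sum[OF L A _ that(2)] index_mult_mat_sum[OF Pc A _ that(2)]
    by (cases i) (simp_all add: T'_def)
  have right: "M $$ (i, j) = (\<Sum>k<Suc c. (T' * A) $$ (i, k) * (case j of 0 \<Rightarrow> F $$ (k, 0) | Suc j' \<Rightarrow> s $$ (k, j')))"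
    if "i < Suc c" "j < Suc c" for i j
    unfolding M_def using that index_mult_mat_sum[OF mult_carrier_mat[OF T' A] T that] by (simp add: T_def)
  have M00: "M $$ (0, 0) = 1"
  proof -
    have "M $$ (0, 0) = (L * A * F) $$ (0, 0)"
      using index_mult_mat_sum[OF mult_carrier_mat[OF L A] Fc, of 0 0] by (simp add: right left)
    also have "L * A * F = 1\<^sub>m 1" using assoc_mult_mat[OF L A Fc] AF LF by simp
    finally show ?thesis by simp
  qed
  have M10: "M $$ (Suc i, 0) = 0" if "i < c" for i
  proof -
    have "M $$ (Suc i, 0) = (P * A * F) $$ (i, 0)"
      using that index_mult_mat_sum[OF mult_carrier_mat[OF Pc A] Fc, of i 0] by (simp add: right left)
    also have "P * A * F = 0\<^sub>m c 1" using assoc_mult_mat[OF Pc A Fc] AF PF by simp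
    finally show ?thesis using that by simp
  qed
  have M11: "M $$ (Suc i, Suc j) = \<gamma> g $$ (i, j)" if "i < c" "j < c" for i j
  proof -
    have "M $$ (Suc i, Suc j) = (P * A * s) $$ (i, j)"
      using that index_mult_mat_sum[OF mult_carrier_mat[OF Pc A] s that] by (simp add: right left)
    also have "P * A * s = \<gamma> g" using assoc_mult_mat[OF B Pc s] PA Ps right_mult_one_mat[OF B] by simp
    finally show ?thesis .
  qed
  have "mtrace (ext_mat (Suc k) (\<beta> g)) = mtrace (ext_mat (Suc k) M)"
    unfolding M_def using mtrace_ext_conj[OF A T T' TT', of "Suc k"] by (simp add: A_def)
  also have "\<dots> = mtrace (ext_mat (Suc k) (\<gamma> g)) + mtrace (ext_mat k (\<gamma> g))"
    by (rule mtrace_ext_corner[OF M B M00 M10 M11])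
  finally show ?thesis .
qed

section \<open>The wreath product as a group of signed permutations\<close>

lemma carrier_wreath: "carrier (wreath G I) = (I \<rightarrow>\<^sub>E carrier G) \<times> {\<sigma>. \<sigma> permutes I}"
  and mult_wreath: "(f, \<sigma>) \<otimes>\<^bsub>wreath G I\<^esub> (g, \<tau>) = (\<lambda>i\<in>I. f i \<otimes>\<^bsub>G\<^esub> g (inv_into UNIV \<sigma> i), \<sigma> \<circ> \<tau>)"
  and one_wreath: "\<one>\<^bsub>wreath G I\<^esub> = (\<lambda>i\<in>I. \<one>\<^bsub>G\<^esub>, id)"
  by (simp_all add: wreath_def)

lemma snd_mult_wreath: "snd (x \<otimes>\<^bsub>wreath G I\<^esub> y) = snd x \<circ> snd y"
  by (simp add: wreath_def split_beta)

lemma group_wreath: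
  assumes "group G" shows "group (wreath G I)"
proof -
  interpret group G by fact
  have mem: "inv_into UNIV \<sigma> i \<in> I \<longleftrightarrow> i \<in> I" if "\<sigma> permutes I" for \<sigma> i
    by (rule permutes_in_image[OF permutes_inv[OF that]])
  have val: "f i \<in> carrier G" if "f \<in> I \<rightarrow>\<^sub>E carrier G" "i \<in> I" for f i
    using that by (rule PiE_mem)
  show ?thesis
  proof (rule groupI)
    fix x y assume "x \<in> carrier (wreath G I)" "y \<in> carrier (wreath G I)"
    then obtain f \<sigma> g \<tau> where x: "x = (f, \<sigma>)" "f \<in> I \<rightarrow>\<^sub>E carrier G" "\<sigma> permutes I"
      and y: "y = (g, \<tau>)" "g \<in> I \<rightarrow>\<^sub>E carrier G" "\<tau> permutes I" unfolding carrier_wreath by auto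
    show "x \<otimes>\<^bsub>wreath G I\<^esub> y \<in> carrier (wreath G I)"
      unfolding x y mult_wreath carrier_wreath
      using permutes_compose[OF y(3) x(3)] val[OF x(2)] val[OF y(2)] mem[OF x(3)] by simp
  next
    show "\<one>\<^bsub>wreath G I\<^esub> \<in> carrier (wreath G I)"
      by (simp add: one_wreath carrier_wreath permutes_id)
  next
    fix x y z assume "x \<in> carrier (wreath G I)" "y \<in> carrier (wreath G I)" "z \<in> carrier (wreath G I)"
    then obtain f \<sigma> g \<tau> h \<pi> where x: "x = (f, \<sigma>)" "f \<in> I \<rightarrow>\<^sub>E carrier G" "\<sigma> permutes I"
      and y: "y = (g, \<tau>)" "g \<in> I \<rightarrow>\<^sub>E carrier G" "\<tau> permutes I"
      and z: "z = (h, \<pi>)" "h \<in> I \<rightarrow>\<^sub>E carrier G" "\<pi> permutes I" unfolding carrier_wreath by auto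
    have inv: "inv_into UNIV (\<sigma> \<circ> \<tau>) i = inv_into UNIV \<tau> (inv_into UNIV \<sigma> i)" for i
      using fun_cong[OF permutes_inv_o(1)[OF x(3)]] permutes_bij[OF x(3)] permutes_bij[OF y(3)]
      by (simp add: o_inv_distrib)
    show "x \<otimes>\<^bsub>wreath G I\<^esub> y \<otimes>\<^bsub>wreath G I\<^esub> z = x \<otimes>\<^bsub>wreath G I\<^esub> (y \<otimes>\<^bsub>wreath G I\<^esub> z)"
      unfolding x y z mult_wreath
      using val[OF x(2)] val[OF y(2)] val[OF z(2)] mem[OF x(3)] mem[OF y(3)]
      by (auto simp: inv m_assoc o_assoc intro!: restrict_ext)
  next
    fix x assume "x \<in> carrier (wreath G I)"
    then obtain f \<sigma> where x: "x = (f, \<sigma>)" "f \<in> I \<rightarrow>\<^sub>E carrier G" "\<sigma> permutes I" unfolding carrier_wreath by auto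
    have "restrict f I = f" using x(2) by (simp add: PiE_def extensional_restrict)
    then show "\<one>\<^bsub>wreath G I\<^esub> \<otimes>\<^bsub>wreath G I\<^esub> x = x"
      unfolding x one_wreath mult_wreath using val[OF x(2)] by (simp add: inv_id cong: restrict_cong)
    define y where "y = ((\<lambda>i\<in>I. inv\<^bsub>G\<^esub> f (\<sigma> i)), inv_into UNIV \<sigma>)"
    have s: "\<sigma> i \<in> I \<longleftrightarrow> i \<in> I" for i by (rule permutes_in_image[OF x(3)])
    have "y \<in> carrier (wreath G I)"
      unfolding y_def carrier_wreath using permutes_inv[OF x(3)] val[OF x(2)] s by simp
    moreover have "y \<otimes>\<^bsub>wreath G I\<^esub> x = \<one>\<^bsub>wreath G I\<^esub>"
      unfolding y_def x one_wreath mult_wreath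
      using val[OF x(2)] s permutes_inv_o(2)[OF x(3)] permutes_inv_inv[OF x(3)] by (auto intro!: restrict_ext)
    ultimately show "\<exists>y\<in>carrier (wreath G I). y \<otimes>\<^bsub>wreath G I\<^esub> x = \<one>\<^bsub>wreath G I\<^esub>" by (rule bexI[rotated])
  qed
qed

lemma finite_wreath: "finite I \<Longrightarrow> finite (carrier G) \<Longrightarrow> finite (carrier (wreath G I))"
  by (simp add: carrier_wreath finite_PiE finite_permutations)

abbreviation sign_group :: "int monoid" where "sign_group \<equiv> integer_mod_group 2"

text \<open>
  In the wreath product the coordinate \<open>f i\<close> belongs to the target point \<open>i\<close>, but the sign of a signed permutation
  is attached to the source \<open>j\<close>; hence the sign at \<open>j\<close> is read at \<open>\<sigma> j\<close>.
\<close>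

definition to_sperm :: "nat \<Rightarrow> (nat \<Rightarrow> int) \<times> (nat \<Rightarrow> nat) \<Rightarrow> sperm"
  where "to_sperm n x = (\<lambda>j. if j \<in> {1..n} then (-1) ^ nat (fst x (snd x j)) else 1, snd x)"

lemma carrier_sign_group: "carrier sign_group = {0, 1}"
  by (auto simp: carrier_integer_mod_group)

lemma snd_to_sperm [simp]: "snd (to_sperm n x) = snd x"
  by (simp add: to_sperm_def)

lemma to_sperm_mult:
  assumes x: "x \<in> carrier (wreath sign_group {1..n})" and y: "y \<in> carrier (wreath sign_group {1..n})"
  shows "to_sperm n (x \<otimes>\<^bsub>wreath sign_group {1..n}\<^esub> y) = to_sperm n x \<star> to_sperm n y"
proof -
  note One_nat_def [simp del]
  obtain f \<sigma> where x: "x = (f, \<sigma>)" "f \<in> {1..n} \<rightarrow>\<^sub>E {0, 1}" "\<sigma> permutes {1..n}"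
    using x unfolding carrier_wreath carrier_sign_group by auto
  obtain g \<tau> where y: "y = (g, \<tau>)" "g \<in> {1..n} \<rightarrow>\<^sub>E {0, 1}" "\<tau> permutes {1..n}"
    using y unfolding carrier_wreath carrier_sign_group by auto
  have pow: "(-1) ^ nat ((a + b) mod 2) = ((-1) ^ nat b * (-1) ^ nat a :: int)" if "a \<in> {0, 1}" "b \<in> {0, 1}" for a b :: int
    using that by auto
  show ?thesis
  proof (rule prod_eqI)
    show "fst (to_sperm n (x \<otimes>\<^bsub>wreath sign_group {1..n}\<^esub> y)) = fst (to_sperm n x \<star> to_sperm n y)"
    proof
      fix j
      show "fst (to_sperm n (x \<otimes>\<^bsub>wreath sign_group {1..n}\<^esub> y)) j = fst (to_sperm n x \<star> to_sperm n y) j"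
      proof (cases "j \<in> {1..n}")
        case True
        then have \<tau>j: "\<tau> j \<in> {1..n}" using permutes_in_image[OF y(3)] by simp
        then have \<sigma>j: "\<sigma> (\<tau> j) \<in> {1..n}" using permutes_in_image[OF x(3)] by simp
        show ?thesis
          using True \<tau>j \<sigma>j pow[OF PiE_mem[OF x(2) \<sigma>j] PiE_mem[OF y(2) \<tau>j]] permutes_inverses(2)[OF x(3)]
          unfolding to_sperm_def x(1) y(1) mult_wreath sp_mult_def by simp
      next
        case False
        then have "\<tau> j = j" "\<sigma> j = j" by (rule permutes_not_in[OF y(3)], rule permutes_not_in[OF x(3)])
        then show ?thesis using False unfolding to_sperm_def x(1) y(1) mult_wreath sp_mult_def by auto
      qed
    qed
  qed (simp add: sp_mult_def snd_mult_wreath)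
qed

lemma to_sperm_one: "to_sperm n \<one>\<^bsub>wreath sign_group {1..n}\<^esub> = sp_one"
  by (auto simp: to_sperm_def sp_one_def one_wreath)

lemma bij_betw_to_sperm: "bij_betw (to_sperm n) (carrier (wreath sign_group {1..n})) (signed_perms {1..n})"
proof (rule bij_betw_imageI)
  note One_nat_def [simp del]
  show "inj_on (to_sperm n) (carrier (wreath sign_group {1..n}))"
  proof (rule inj_onI)
    fix x y assume "x \<in> carrier (wreath sign_group {1..n})" "y \<in> carrier (wreath sign_group {1..n})"
      and eq: "to_sperm n x = to_sperm n y"
    then obtain f \<sigma> g \<tau> where x: "x = (f, \<sigma>)" "f \<in> {1..n} \<rightarrow>\<^sub>E {0, 1}" "\<sigma> permutes {1..n}"
      and y: "y = (g, \<tau>)" "g \<in> {1..n} \<rightarrow>\<^sub>E {0, 1}" "\<tau> permutes {1..n}"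
      unfolding carrier_wreath carrier_sign_group by auto
    have s: "\<tau> = \<sigma>" using arg_cong[OF eq, of snd] by (simp add: x y)
    have "f = g"
    proof (rule PiE_ext[OF x(2) y(2)])
      fix i assume i: "i \<in> {1..n}"
      define j where "j = inv_into UNIV \<sigma> i"
      have j: "\<sigma> j = i" unfolding j_def by (rule permutes_inverses(1)[OF x(3)])
      have jn: "j \<in> {1..n}" using i permutes_in_image[OF x(3), of j] by (simp only: j)
      have "(-1) ^ nat (f i) = ((-1) ^ nat (g i) :: int)"
        using fun_cong[OF arg_cong[OF eq, of fst], of j] jn by (simp add: x(1) y(1) s to_sperm_def j)
      then show "f i = g i" using PiE_mem[OF x(2) i] PiE_mem[OF y(2) i] by auto
    qed
    then show "x = y" by (simp add: x y s)
  qed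
  show "to_sperm n ` carrier (wreath sign_group {1..n}) = signed_perms {1..n}"
  proof (intro equalityI subsetI)
    fix w assume "w \<in> to_sperm n ` carrier (wreath sign_group {1..n})"
    then obtain x where x: "x \<in> carrier (wreath sign_group {1..n})" "w = to_sperm n x" by (rule imageE)
    have "snd x permutes {1..n}" using x(1) by (auto simp: carrier_wreath)
    moreover have "((-1) ^ k = (1::int)) \<or> (-1) ^ k = (-1::int)" for k :: nat by (induction k) auto
    ultimately show "w \<in> signed_perms {1..n}" unfolding x(2) by (auto simp: signed_perms_def to_sperm_def)
  next
    fix w assume w: "w \<in> signed_perms {1..n}"
    note D = signed_permsD[OF w]
    define f :: "nat \<Rightarrow> int" where "f = (\<lambda>i\<in>{1..n}. if fst w (inv_into UNIV (snd w) i) = 1 then 0 else 1)"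
    have x: "(f, snd w) \<in> carrier (wreath sign_group {1..n})"
      using D(1) by (simp add: carrier_wreath carrier_sign_group f_def)
    have "to_sperm n (f, snd w) = w"
    proof (rule prod_eqI)
      show "fst (to_sperm n (f, snd w)) = fst w"
      proof
        fix j
        have "snd w j \<in> {1..n} \<longleftrightarrow> j \<in> {1..n}" by (rule permutes_in_image[OF D(1)])
        then show "fst (to_sperm n (f, snd w)) j = fst w j"
          using D(2,3)[of j] permutes_inverses(2)[OF D(1), of j] by (auto simp: to_sperm_def f_def)
      qed
    qed simp
    then show "w \<in> to_sperm n ` carrier (wreath sign_group {1..n})" using x by (rule image_eqI[OF sym])
  qed
qed

lemma sp_mat_carrier [simp]: "sp_mat n w \<in> carrier_mat n n" "dim_row (sp_mat n w) = n" "dim_col (sp_mat n w) = n"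
  by (simp_all add: sp_mat_def)

lemma sp_mat_mult:
  assumes w: "w \<in> signed_perms {1..n}" and v: "v \<in> signed_perms {1..n}"
  shows "sp_mat n (w \<star> v) = (sp_mat n w * sp_mat n v :: 'a::comm_ring_1 mat)"
proof (rule eq_matI)
  fix i j assume "i < dim_row (sp_mat n w * sp_mat n v :: 'a mat)" "j < dim_col (sp_mat n w * sp_mat n v :: 'a mat)"
  then have ij: "i < n" "j < n" by auto
  have "snd v (Suc j) \<in> {1..n}" using permutes_in_image[OF signed_permsD(1)[OF v], of "Suc j"] ij by simp
  then obtain c where c: "snd v (Suc j) = Suc c" "c < n" by (cases "snd v (Suc j)") auto
  have "(sp_mat n w * sp_mat n v) $$ (i, j) = (\<Sum>k<n. sp_mat n w $$ (i, k) * sp_mat n v $$ (k, j) :: 'a)"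
    by (rule index_mult_mat_sum[OF sp_mat_carrier(1) sp_mat_carrier(1) ij])
  also have "\<dots> = (\<Sum>k<n. if k = c then sp_mat n w $$ (i, c) * of_int (fst v (Suc j)) else 0)"
    using ij c by (intro sum.cong refl) (auto simp: sp_mat_def)
  also have "\<dots> = sp_mat n w $$ (i, c) * of_int (fst v (Suc j))" using c(2) by simp
  also have "\<dots> = sp_mat n (w \<star> v) $$ (i, j)"
    using ij c by (simp add: sp_mat_def sp_mult_def mult.commute)
  finally show "sp_mat n (w \<star> v) $$ (i, j) = (sp_mat n w * sp_mat n v :: 'a mat) $$ (i, j)" by simp
qed auto

lemma sp_mat_one: "sp_mat n sp_one = 1\<^sub>m n"
  by (rule eq_matI) (auto simp: sp_mat_def sp_one_def)

section \<open>The induced representation\<close>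

lemma left_transversal_exists:
  assumes fin: "finite (carrier G)" shows "\<exists>ts. left_transversal G H ts"
proof -
  define C where "C = lcosets\<^bsub>G\<^esub> H"
  have "\<forall>c\<in>C. \<exists>t. t \<in> carrier G \<and> t <#\<^bsub>G\<^esub> H = c" by (auto simp: C_def LCOSETS_def)
  then obtain f where f: "\<forall>c\<in>C. f c \<in> carrier G \<and> f c <#\<^bsub>G\<^esub> H = c" by (rule bchoice[THEN exE])
  have "finite C" using fin by (simp add: C_def LCOSETS_def)
  then have "\<exists>ts. set ts = f ` C \<and> distinct ts" by (intro finite_distinct_list) simp
  then obtain ts where ts: "set ts = f ` C" "distinct ts" by (elim exE conjE)
  have "bij_betw (\<lambda>t. t <#\<^bsub>G\<^esub> H) (set ts) C"
    by (rule bij_betw_byWitness[where f' = f]) (use f ts in auto)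
  then show ?thesis using f ts by (intro exI[of _ ts]) (auto simp: left_transversal_def C_def)
qed

text \<open>
  The subgroup from which \<open>V\<close> is induced is the stabilizer of the point 1, so its cosets are the points.
\<close>

lemma wreath_embed_image:
  assumes n: "1 \<le> n"
  shows "wreath_embed ` carrier (G \<times>\<times> wreath G {2..n}) = {x \<in> carrier (wreath G {1..n}). snd x 1 = 1}"
proof -
  have ins: "{1..n} = insert 1 {2..n}" using n by auto
  show ?thesis
  proof (intro equalityI subsetI)
    fix h assume "h \<in> wreath_embed ` carrier (G \<times>\<times> wreath G {2..n})"
    then obtain x f \<sigma> where x: "x \<in> carrier G" "f \<in> {2..n} \<rightarrow>\<^sub>E carrier G" "\<sigma> permutes {2..n}" "h = (f(1 := x), \<sigma>)"
      by (auto simp: DirProd_def carrier_wreath wreath_embed_def)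
    have "f(1 := x) \<in> {1..n} \<rightarrow>\<^sub>E carrier G" unfolding ins by (rule PiE_fun_upd[OF x(1,2)])
    moreover have "\<sigma> permutes {1..n}" by (rule permutes_subset[OF x(3)]) (use ins in blast)
    moreover have "\<sigma> 1 = 1" by (rule permutes_not_in[OF x(3)]) simp
    ultimately show "h \<in> {x \<in> carrier (wreath G {1..n}). snd x 1 = 1}" by (simp add: carrier_wreath x(4))
  next
    fix h assume "h \<in> {x \<in> carrier (wreath G {1..n}). snd x 1 = 1}"
    then obtain f \<sigma> where h: "h = (f, \<sigma>)" "f \<in> {1..n} \<rightarrow>\<^sub>E carrier G" "\<sigma> permutes {1..n}" "\<sigma> 1 = 1"
      unfolding carrier_wreath by auto
    have "f 1 \<in> carrier G" by (rule PiE_mem[OF h(2)]) (use n in simp)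
    moreover have "f(1 := undefined) \<in> {2..n} \<rightarrow>\<^sub>E carrier G"
      by (rule fun_upd_in_PiE) (use h(2) in \<open>simp_all only: ins\<close>, simp)
    moreover have "\<sigma> permutes {2..n}" 
    proof (rule permutes_superset[OF h(3)])
      fix x assume "x \<in> {1..n} - {2..n}"
      then have "x = 1" by auto
      then show "\<sigma> x = x" by (simp only: h(4))
    qed
    ultimately have "(f 1, f(1 := undefined), \<sigma>) \<in> carrier (G \<times>\<times> wreath G {2..n})"
      by (simp add: DirProd_def carrier_wreath)
    moreover have "h = wreath_embed (f 1, f(1 := undefined), \<sigma>)" by (simp add: h(1) wreath_embed_def)
    ultimately show "h \<in> wreath_embed ` carrier (G \<times>\<times> wreath G {2..n})" by (rule image_eqI[rotated])
  qed
qed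

lemma fst_inv_into_wreath_embed:
  assumes "h \<in> wreath_embed ` P" shows "fst (inv_into P wreath_embed h) = fst h 1"
proof -
  obtain x f \<sigma> where e: "inv_into P wreath_embed h = (x, f, \<sigma>)" by (rule prod_cases3)
  then have "wreath_embed (x, f, \<sigma>) = h" using f_inv_into_f[OF assms] by simp
  then show ?thesis unfolding e by (auto simp: wreath_embed_def)
qed

text \<open>
  The value at 1 is a square root of 1 other than 1.
\<close>

lemma sign_group_character:
  fixes \<chi> :: "int \<Rightarrow> 'k::field mat"
  assumes \<chi>: "group_rep sign_group \<chi>" "rep_degree sign_group \<chi> = 1" "\<exists>x\<in>carrier sign_group. \<chi> x \<noteq> trivial_rep x"
    and x: "x \<in> carrier sign_group"
  shows "\<chi> x \<in> carrier_mat 1 1" "\<chi> x $$ (0, 0) = (-1) ^ nat x"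
proof -
  note D = group_repD[OF \<chi>(1), unfolded \<chi>(2)]
  show "\<chi> x \<in> carrier_mat 1 1" by (rule D(1)[OF x])
  have mem: "0 \<in> carrier sign_group" "1 \<in> carrier sign_group" by (simp_all add: carrier_sign_group)
  have zero: "\<chi> 0 = 1\<^sub>m 1" using D(2) by simp
  define c where "c = \<chi> 1 $$ (0, 0)"
  have "\<chi> 1 * \<chi> 1 = 1\<^sub>m 1" using D(3)[OF mem(2,2)] zero by simp
  then have "(\<chi> 1 * \<chi> 1) $$ (0, 0) = 1" by simp
  then have "c * c = 1" using index_mult_mat_sum[OF D(1)[OF mem(2)] D(1)[OF mem(2)], of 0 0] by (simp add: c_def)
  moreover have "c \<noteq> 1"
  proof
    assume c: "c = 1"
    have "\<chi> 1 = 1\<^sub>m 1" using D(1)[OF mem(2)] c by (intro eq_matI) (auto simp: c_def)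
    then show False using \<chi>(3) zero by (auto simp: carrier_sign_group trivial_rep_def)
  qed
  ultimately have "c = -1" by (simp add: square_eq_1_iff)
  then show "\<chi> x $$ (0, 0) = (-1) ^ nat x" using x zero by (auto simp: carrier_sign_group c_def)
qed

text \<open>
  For \<open>h\<close> in the subgroup, \<open>\<chi>\<close> evaluates to the sign of \<open>h\<close> at the point 1. So in both cases of the definition of the
  induced representation the entry is the upper left entry of the signed permutation matrix of \<open>h\<close>.
\<close>

lemma wreath_induced_rep_entries:
  fixes \<chi> :: "int \<Rightarrow> 'k::field mat"
  assumes n: "1 \<le> n"
    and \<chi>: "group_rep sign_group \<chi>" "rep_degree sign_group \<chi> = 1" "\<exists>x\<in>carrier sign_group. \<chi> x \<noteq> trivial_rep x"
  defines "W \<equiv> wreath sign_group {1..n}"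
  obtains ts where "left_transversal W {x \<in> carrier W. snd x 1 = 1} ts"
    "\<forall>g\<in>carrier W. wreath_induced_rep sign_group n \<chi> g = mat (length ts) (length ts)
        (\<lambda>(a, b). sp_mat n (to_sperm n (inv\<^bsub>W\<^esub> (ts ! a) \<otimes>\<^bsub>W\<^esub> g \<otimes>\<^bsub>W\<^esub> ts ! b)) $$ (0, 0))"
proof -
  interpret W: group W unfolding W_def by (rule group_wreath) simp
  define P where "P = carrier (sign_group \<times>\<times> wreath sign_group {2..n})"
  define H where "H = {x \<in> carrier W. snd x 1 = 1}"
  have HP: "wreath_embed ` P = H" unfolding P_def H_def W_def by (rule wreath_embed_image[OF n])
  define \<rho> where "\<rho> h = external_tensor_rep \<chi> trivial_rep (inv_into P wreath_embed h)" for h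
  have val: "\<rho> h = tensor_mat (\<chi> (fst h 1)) (1\<^sub>m 1)" if "h \<in> H" for h
    using fst_inv_into_wreath_embed[of h P] that
    by (simp add: HP \<rho>_def external_tensor_rep_def trivial_rep_def split_beta)
  have f1: "fst h 1 \<in> carrier sign_group" if "h \<in> H" for h
    by (rule PiE_mem[of _ "{1..n}"]) (use that n in \<open>auto simp: H_def W_def carrier_wreath\<close>)
  have one: "\<one>\<^bsub>W\<^esub> \<in> H" using W.one_closed by (simp add: H_def) (simp add: W_def one_wreath)
  have deg: "rep_degree W \<rho> = 1"
    using sign_group_character(1)[OF \<chi> f1[OF one]] by (simp add: rep_degree_def val[OF one] tensor_mat_def)
  have val00: "\<rho> h $$ (0, 0) = (-1) ^ nat (fst h 1)" if "h \<in> H" for h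
    using sign_group_character[OF \<chi> f1[OF that]] by (simp add: val[OF that] tensor_mat_def)
  define ts where "ts = (SOME ts. left_transversal W H ts)"
  have "\<exists>ts. left_transversal W H ts"
    by (rule left_transversal_exists) (simp add: W_def finite_wreath carrier_sign_group)
  then have ts: "left_transversal W H ts" unfolding ts_def by (rule someI_ex)
  have mem: "ts ! a \<in> carrier W" if "a < length ts" for a
    using ts that by (auto simp: left_transversal_def)
  have entry: "(if h \<in> H then \<rho> h $$ (0, 0) else 0) = sp_mat n (to_sperm n h) $$ (0, 0)" if "h \<in> carrier W" for h
    using that n by (cases "h \<in> H") (simp_all add: val00, simp_all add: H_def sp_mat_def to_sperm_def)
  have "wreath_induced_rep sign_group n \<chi> g = mat (length ts) (length ts)
        (\<lambda>(a, b). sp_mat n (to_sperm n (inv\<^bsub>W\<^esub> (ts ! a) \<otimes>\<^bsub>W\<^esub> g \<otimes>\<^bsub>W\<^esub> ts ! b)) $$ (0, 0))" if g: "g \<in> carrier W" for g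
  proof -
    have "wreath_induced_rep sign_group n \<chi> g = induced_rep W H \<rho> g"
      by (simp only: wreath_induced_rep_def Let_def P_def[symmetric] HP W_def[symmetric]) (simp only: \<rho>_def[abs_def])
    also have "\<dots> = mat (length ts) (length ts) (\<lambda>(a, b). let h = inv\<^bsub>W\<^esub> (ts ! a) \<otimes>\<^bsub>W\<^esub> g \<otimes>\<^bsub>W\<^esub> ts ! b in
        if h \<in> H then \<rho> h $$ (0, 0) else 0)"
      unfolding induced_rep_def ts_def[symmetric] deg Let_def div_by_1 mod_by_1 mult_1_right ..
    also have "\<dots> = mat (length ts) (length ts)
        (\<lambda>(a, b). sp_mat n (to_sperm n (inv\<^bsub>W\<^esub> (ts ! a) \<otimes>\<^bsub>W\<^esub> g \<otimes>\<^bsub>W\<^esub> ts ! b)) $$ (0, 0))"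
      by (rule cong_mat[OF refl refl]) (simp only: prod.case Let_def entry W.m_closed W.inv_closed mem g)
    finally show ?thesis .
  qed
  then show thesis by (intro that[OF ts[unfolded H_def]] ballI)
qed

text \<open>
  A left coset of the stabilizer of 1 consists of the elements that send 1 to a given point.
\<close>

lemma transversal_of_point_stabilizer:
  fixes n :: nat
  assumes n: "1 \<le> n"
  defines "W \<equiv> wreath sign_group {1..n}"
  assumes ts: "left_transversal W {x \<in> carrier W. snd x 1 = 1} ts"
  shows "bij_betw (\<lambda>a. snd (ts ! a) 1) {..<length ts} {1..n}"
proof -
  interpret W: group W unfolding W_def by (rule group_wreath) simp
  define H where "H = {x \<in> carrier W. snd x 1 = 1}"
  have perm: "snd x permutes {1..n}" if "x \<in> carrier W" for x using that by (auto simp: W_def carrier_wreath)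
  have mult: "snd (x \<otimes>\<^bsub>W\<^esub> y) i = snd x (snd y i)" for x y i by (simp add: W_def snd_mult_wreath)
  have coset: "g <#\<^bsub>W\<^esub> H = {x \<in> carrier W. snd x 1 = snd g 1}" if g: "g \<in> carrier W" for g
  proof (intro equalityI subsetI)
    fix x assume "x \<in> g <#\<^bsub>W\<^esub> H"
    then obtain h where h: "h \<in> H" "x = g \<otimes>\<^bsub>W\<^esub> h" by (auto simp: l_coset_def)
    then show "x \<in> {x \<in> carrier W. snd x 1 = snd g 1}" using g by (simp add: H_def mult)
  next
    fix x assume x: "x \<in> {x \<in> carrier W. snd x 1 = snd g 1}"
    define h where "h = inv\<^bsub>W\<^esub> g \<otimes>\<^bsub>W\<^esub> x"
    have "snd \<one>\<^bsub>W\<^esub> 1 = 1" by (simp add: W_def one_wreath)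
    then have "snd (inv\<^bsub>W\<^esub> g) (snd g 1) = 1" using mult[of "inv\<^bsub>W\<^esub> g" g 1] W.l_inv[OF g] by simp
    then have "h \<in> H" using x g by (simp add: H_def h_def mult)
    moreover have "x = g \<otimes>\<^bsub>W\<^esub> h" using x g by (simp add: h_def W.m_assoc[symmetric])
    ultimately show "x \<in> g <#\<^bsub>W\<^esub> H" by (auto simp: l_coset_def)
  qed
  have dist: "distinct ts" and carr: "set ts \<subseteq> carrier W"
    and bij: "bij_betw (\<lambda>t. t <#\<^bsub>W\<^esub> H) (set ts) (lcosets\<^bsub>W\<^esub> H)"
    using ts by (simp_all add: left_transversal_def H_def)
  have mem: "ts ! a \<in> set ts" "ts ! a \<in> carrier W" if "a < length ts" for a using that carr by auto
  show ?thesis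
  proof (rule bij_betw_imageI)
    show "inj_on (\<lambda>a. snd (ts ! a) 1) {..<length ts}"
    proof (rule inj_onI)
      fix a b assume "a \<in> {..<length ts}" "b \<in> {..<length ts}" and eq: "snd (ts ! a) 1 = snd (ts ! b) 1"
      then have ab: "a < length ts" "b < length ts" by auto
      have "ts ! a <#\<^bsub>W\<^esub> H = ts ! b <#\<^bsub>W\<^esub> H" using coset mem ab eq by simp
      then have "ts ! a = ts ! b" by (rule inj_onD[OF bij_betw_imp_inj_on[OF bij]]) (use mem ab in auto)
      then show "a = b" using dist ab by (simp add: nth_eq_iff_index_eq)
    qed
    show "(\<lambda>a. snd (ts ! a) 1) ` {..<length ts} = {1..n}"
    proof (intro equalityI subsetI)
      fix i assume "i \<in> (\<lambda>a. snd (ts ! a) 1) ` {..<length ts}"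
      then obtain a where a: "a < length ts" "i = snd (ts ! a) 1" by auto
      show "i \<in> {1..n}" unfolding a(2) permutes_in_image[OF perm[OF mem(2)[OF a(1)]]] using n by simp
    next
      fix i assume i: "i \<in> {1..n}"
      define g where "g = (\<lambda>j\<in>{1..n}. 0 :: int, transpose 1 i)"
      have "transpose 1 i permutes {1..n}" by (rule permutes_swap_id) (use i n in auto)
      then have g: "g \<in> carrier W" by (simp add: g_def W_def carrier_wreath carrier_sign_group)
      have "g <#\<^bsub>W\<^esub> H \<in> lcosets\<^bsub>W\<^esub> H" using g by (auto simp: LCOSETS_def)
      then have "g <#\<^bsub>W\<^esub> H \<in> (\<lambda>t. t <#\<^bsub>W\<^esub> H) ` set ts" using bij by (simp add: bij_betw_def)
      then obtain t where t: "g <#\<^bsub>W\<^esub> H = t <#\<^bsub>W\<^esub> H" "t \<in> set ts" by (rule imageE)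
      have tc: "t \<in> carrier W" using t(2) carr by auto
      have "g \<in> g <#\<^bsub>W\<^esub> H" using g by (simp add: coset[OF g])
      then have "snd t 1 = i" unfolding t(1) coset[OF tc] by (simp add: g_def)
      moreover obtain a where "a < length ts" "ts ! a = t" using t(2) by (auto simp: in_set_conv_nth)
      ultimately show "i \<in> (\<lambda>a. snd (ts ! a) 1) ` {..<length ts}" by (intro image_eqI[of _ _ a]) auto
    qed
  qed
qed

text \<open>
  The entry at \<open>(a, b)\<close> is the upper left entry of \<open>S(t\<^sub>a)\<^sup>-\<^sup>1 S(g) S(t\<^sub>b)\<close> for the signed permutation representation
  \<open>S\<close>. Collecting the first columns of the \<open>S(t\<^sub>b)\<close> in \<open>Q\<close> and the first rows of the \<open>S(t\<^sub>a)\<^sup>-\<^sup>1\<close> in \<open>Q'\<close> exhibits the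
  induced representation as conjugate to \<open>S\<close>, whatever the choice of representatives.
\<close>

lemma wreath_induced_rep_conj:
  fixes \<chi> :: "int \<Rightarrow> 'k::field mat"
  assumes n: "1 \<le> n"
    and \<chi>: "group_rep sign_group \<chi>" "rep_degree sign_group \<chi> = 1" "\<exists>x\<in>carrier sign_group. \<chi> x \<noteq> trivial_rep x"
  defines "W \<equiv> wreath sign_group {1..n}"
  obtains Q Q' where "Q \<in> carrier_mat n n" "Q' \<in> carrier_mat n n" "Q * Q' = 1\<^sub>m n" "Q' * Q = 1\<^sub>m n"
    "\<forall>g\<in>carrier W. wreath_induced_rep sign_group n \<chi> g = Q' * sp_mat n (to_sperm n g) * Q"
proof -
  interpret W: group W unfolding W_def by (rule group_wreath) simp
  obtain ts where ts: "left_transversal W {x \<in> carrier W. snd x 1 = 1} ts"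
    and V: "\<forall>g\<in>carrier W. wreath_induced_rep sign_group n \<chi> g = mat (length ts) (length ts)
        (\<lambda>(a, b). sp_mat n (to_sperm n (inv\<^bsub>W\<^esub> (ts ! a) \<otimes>\<^bsub>W\<^esub> g \<otimes>\<^bsub>W\<^esub> ts ! b)) $$ (0, 0))"
    by (rule wreath_induced_rep_entries[OF n \<chi>, folded W_def])
  have bij: "bij_betw (\<lambda>a. snd (ts ! a) 1) {..<length ts} {1..n}"
    by (rule transversal_of_point_stabilizer[OF n ts[unfolded W_def]])
  have len: "length ts = n" using bij_betw_same_card[OF bij] by simp
  define t where "t a = ts ! a" for a
  have t: "t a \<in> carrier W" if "a < n" for a using ts that by (auto simp: left_transversal_def len t_def)
  have perm: "snd x permutes {1..n}" if "x \<in> carrier W" for x using that by (auto simp: W_def carrier_wreath)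
  define S :: "(nat \<Rightarrow> int) \<times> (nat \<Rightarrow> nat) \<Rightarrow> 'k mat" where "S x = sp_mat n (to_sperm n x)" for x
  have Sc: "S x \<in> carrier_mat n n" for x by (simp add: S_def)
  have sp: "to_sperm n x \<in> signed_perms {1..n}" if "x \<in> carrier W" for x
    by (rule bij_betw_apply[OF bij_betw_to_sperm]) (use that in \<open>simp add: W_def\<close>)
  have S_mult: "S (x \<otimes>\<^bsub>W\<^esub> y) = S x * S y" if "x \<in> carrier W" "y \<in> carrier W" for x y
    using to_sperm_mult[OF that[unfolded W_def]] sp_mat_mult[OF sp[OF that(1)] sp[OF that(2)]]
    by (simp add: S_def W_def)
  have S_one: "S \<one>\<^bsub>W\<^esub> = 1\<^sub>m n" unfolding S_def W_def to_sperm_one sp_mat_one ..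
  define Q Q' where "Q = mat n n (\<lambda>(i, a). S (t a) $$ (i, 0))" and "Q' = mat n n (\<lambda>(a, i). S (inv\<^bsub>W\<^esub> (t a)) $$ (0, i))"
  have Q: "Q \<in> carrier_mat n n" and Q': "Q' \<in> carrier_mat n n" by (simp_all add: Q_def Q'_def)
  have QQ': "Q * Q' = 1\<^sub>m n"
  proof (rule eq_matI)
    fix i j assume "i < dim_row (1\<^sub>m n :: 'k mat)" "j < dim_col (1\<^sub>m n :: 'k mat)"
    then have ij: "i < n" "j < n" by auto
    \<comment> \<open>only the representative that sends 1 to the point of row \<open>i\<close> contributes\<close>
    have "Suc i \<in> (\<lambda>a. snd (ts ! a) 1) ` {..<length ts}" using bij ij by (simp add: bij_betw_def)
    then obtain a where a: "snd (t a) 1 = Suc i" "a < n" by (auto simp: len t_def)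
    have "(Q * Q') $$ (i, j) = (\<Sum>b<n. Q $$ (i, b) * Q' $$ (b, j))" by (rule index_mult_mat_sum[OF Q Q' ij])
    also have "\<dots> = (\<Sum>b<n. if b = a then S (t a) $$ (i, 0) * S (inv\<^bsub>W\<^esub> (t a)) $$ (0, j) else 0)"
    proof (rule sum.cong[OF refl])
      fix b assume "b \<in> {..<n}"
      then have b: "b < n" by simp
      have "snd (t b) 1 \<noteq> Suc i" if "b \<noteq> a"
        using inj_on_eq_iff[OF bij_betw_imp_inj_on[OF bij], of a b] a b that by (simp add: len t_def)
      then show "Q $$ (i, b) * Q' $$ (b, j) = (if b = a then S (t a) $$ (i, 0) * S (inv\<^bsub>W\<^esub> (t a)) $$ (0, j) else 0)"
        using b ij by (auto simp: Q_def Q'_def S_def sp_mat_def)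
    qed
    also have "\<dots> = S (t a) $$ (i, 0) * S (inv\<^bsub>W\<^esub> (t a)) $$ (0, j)" using a(2) by simp
    also have "\<dots> = (\<Sum>k<n. if k = 0 then S (t a) $$ (i, 0) * S (inv\<^bsub>W\<^esub> (t a)) $$ (0, j) else 0)" using n by simp
    also have "\<dots> = (\<Sum>k<n. S (t a) $$ (i, k) * S (inv\<^bsub>W\<^esub> (t a)) $$ (k, j))"
    proof (rule sum.cong[OF refl])
      fix k assume "k \<in> {..<n}"
      moreover have "snd (t a) (Suc k) \<noteq> Suc i" if "k \<noteq> 0"
        unfolding a(1)[symmetric] inj_eq[OF permutes_inj[OF perm[OF t[OF a(2)]]]] using that by simp
      ultimately show "(if k = 0 then S (t a) $$ (i, 0) * S (inv\<^bsub>W\<^esub> (t a)) $$ (0, j) else 0) = S (t a) $$ (i, k) * S (inv\<^bsub>W\<^esub> (t a)) $$ (k, j)"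
        using ij by (auto simp: S_def sp_mat_def)
    qed
    also have "\<dots> = (S (t a) * S (inv\<^bsub>W\<^esub> (t a))) $$ (i, j)" by (rule index_mult_mat_sum[OF Sc Sc ij, symmetric])
    also have "S (t a) * S (inv\<^bsub>W\<^esub> (t a)) = 1\<^sub>m n"
      using S_mult[OF t[OF a(2)] W.inv_closed[OF t[OF a(2)]]] W.r_inv[OF t[OF a(2)]] by (simp add: S_one)
    finally show "(Q * Q') $$ (i, j) = 1\<^sub>m n $$ (i, j)" .
  qed (use Q Q' in auto)
  have Q'Q: "Q' * Q = 1\<^sub>m n" by (rule mat_mult_left_right_inverse[OF Q Q' QQ'])
  have "wreath_induced_rep sign_group n \<chi> g = Q' * S g * Q" if g: "g \<in> carrier W" for g
  proof (rule eq_matI)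
    fix a b assume "a < dim_row (Q' * S g * Q)" "b < dim_col (Q' * S g * Q)"
    then have ab: "a < n" "b < n" using Q Q' by auto
    have left: "(Q' * S g) $$ (a, k) = (S (inv\<^bsub>W\<^esub> (t a)) * S g) $$ (0, k)" if "k < n" for k
      using index_mult_mat_sum[OF Q' Sc ab(1) that] index_mult_mat_sum[OF Sc Sc _ that, of 0] n ab
      by (simp add: Q'_def)
    have "wreath_induced_rep sign_group n \<chi> g $$ (a, b) = S (inv\<^bsub>W\<^esub> (t a) \<otimes>\<^bsub>W\<^esub> g \<otimes>\<^bsub>W\<^esub> t b) $$ (0, 0)"
      using V g ab by (simp add: len t_def S_def)
    also have "S (inv\<^bsub>W\<^esub> (t a) \<otimes>\<^bsub>W\<^esub> g \<otimes>\<^bsub>W\<^esub> t b) = S (inv\<^bsub>W\<^esub> (t a)) * S g * S (t b)"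
      using t ab g by (simp add: S_mult)
    also have "\<dots> $$ (0, 0) = (\<Sum>k<n. (S (inv\<^bsub>W\<^esub> (t a)) * S g) $$ (0, k) * S (t b) $$ (k, 0))"
      by (rule index_mult_mat_sum[OF mult_carrier_mat[OF Sc Sc] Sc]) (use n in auto)
    also have "\<dots> = (\<Sum>k<n. (Q' * S g) $$ (a, k) * Q $$ (k, b))"
      using left ab by (intro sum.cong refl) (simp add: Q_def)
    also have "\<dots> = (Q' * S g * Q) $$ (a, b)"
      by (rule index_mult_mat_sum[OF mult_carrier_mat[OF Q' Sc] Q ab, symmetric])
    finally show "wreath_induced_rep sign_group n \<chi> g $$ (a, b) = (Q' * S g * Q) $$ (a, b)" .
  qed (use V g Q Q' in \<open>simp_all add: len\<close>)
  then show thesis unfolding S_def by (intro that[OF Q Q' QQ' Q'Q] ballI)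
qed

section \<open>The representation ring is a ring of characters\<close>

lemma tensor_mat_assoc: "tensor_mat (tensor_mat A B) C = tensor_mat A (tensor_mat B C)"
proof (rule eq_matI)
  fix i j assume "i < dim_row (tensor_mat A (tensor_mat B C))" "j < dim_col (tensor_mat A (tensor_mat B C))"
  then have i: "i < dim_row A * (dim_row B * dim_row C)" and j: "j < dim_col A * (dim_col B * dim_col C)" by auto
  have i': "i < dim_row A * dim_row B * dim_row C" and j': "j < dim_col A * dim_col B * dim_col C"
    using i j by (simp_all add: mult.assoc)
  have mod: "x mod (m * n) div n = x div n mod m" "x mod (m * n) mod n = x mod n" for x m n :: nat
    by (cases "n = 0"; simp add: mult.commute[of m n] mod_mult2_eq)
      (simp add: mult.commute[of m n] mod_mult_mult2 mod_mod_cancel)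
  have div: "x div (m * n) = x div n div m" for x m n :: nat
    by (simp add: mult.commute[of m n] div_mult2_eq)
  have "tensor_mat (tensor_mat A B) C $$ (i, j) =
      tensor_mat A B $$ (i div dim_row C, j div dim_col C) * C $$ (i mod dim_row C, j mod dim_col C)"
    by (rule tensor_mat_index) (simp_all only: tensor_mat_dim i' j')
  also have "tensor_mat A B $$ (i div dim_row C, j div dim_col C) =
      A $$ (i div dim_row C div dim_row B, j div dim_col C div dim_col B) *
      B $$ (i div dim_row C mod dim_row B, j div dim_col C mod dim_col B)"
    by (rule tensor_mat_index[OF div_mod_less(1)[OF i'] div_mod_less(1)[OF j']])
  finally have 1: "tensor_mat (tensor_mat A B) C $$ (i, j) =
      A $$ (i div dim_row C div dim_row B, j div dim_col C div dim_col B) *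
      B $$ (i div dim_row C mod dim_row B, j div dim_col C mod dim_col B) * C $$ (i mod dim_row C, j mod dim_col C)" .
  have "tensor_mat A (tensor_mat B C) $$ (i, j) =
      A $$ (i div (dim_row B * dim_row C), j div (dim_col B * dim_col C)) *
      tensor_mat B C $$ (i mod (dim_row B * dim_row C), j mod (dim_col B * dim_col C))"
    using tensor_mat_index[of i A "tensor_mat B C" j] i j by (simp only: tensor_mat_dim)
  also have "tensor_mat B C $$ (i mod (dim_row B * dim_row C), j mod (dim_col B * dim_col C)) =
      B $$ (i mod (dim_row B * dim_row C) div dim_row C, j mod (dim_col B * dim_col C) div dim_col C) *
      C $$ (i mod (dim_row B * dim_row C) mod dim_row C, j mod (dim_col B * dim_col C) mod dim_col C)"
    by (rule tensor_mat_index[OF div_mod_less(2)[OF i] div_mod_less(2)[OF j]])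
  finally show "tensor_mat (tensor_mat A B) C $$ (i, j) = tensor_mat A (tensor_mat B C) $$ (i, j)"
    unfolding 1 by (simp only: mod div mult.assoc)
qed (simp_all add: mult.assoc)

lemma tensor_rep_assoc: "tensor_rep (tensor_rep \<rho> \<sigma>) \<tau> = tensor_rep \<rho> (tensor_rep \<sigma> \<tau>)"
  by (simp add: tensor_rep_def tensor_mat_assoc)

lemma tensor_mat_1: "tensor_mat (1\<^sub>m 1) A = A" "tensor_mat A (1\<^sub>m 1) = A"
  by (rule eq_matI; simp add: tensor_mat_index)+

lemma tensor_rep_trivial: "tensor_rep trivial_rep \<rho> = \<rho>" "tensor_rep \<rho> trivial_rep = \<rho>"
  using tensor_mat_1 by (auto simp: tensor_rep_def trivial_rep_def fun_eq_iff)

lemma group_rep_trivial: "group_rep G trivial_rep"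
  by (simp add: group_rep_def trivial_rep_def rep_degree_def)

lemma group_rep_tensor:
  fixes \<rho> \<sigma> :: "'g \<Rightarrow> 'a::field mat"
  assumes "group_rep G \<rho>" "group_rep G \<sigma>" shows "group_rep G (tensor_rep \<rho> \<sigma>)"
proof -
  define a b where "a = rep_degree G \<rho>" and "b = rep_degree G \<sigma>"
  have A: "\<rho> g \<in> carrier_mat a a" and B: "\<sigma> g \<in> carrier_mat b b" if "g \<in> carrier G" for g
    using group_repD(1)[OF assms(1) that] group_repD(1)[OF assms(2) that] by (simp_all add: a_def b_def)
  show ?thesis
  proof (rule group_repI(1)[of _ _ "a * b"])
    show "tensor_rep \<rho> \<sigma> g \<in> carrier_mat (a * b) (a * b)" if "g \<in> carrier G" for g
      unfolding tensor_rep_def by (rule tensor_mat_carrier[OF A[OF that] B[OF that]])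
    show "tensor_rep \<rho> \<sigma> \<one>\<^bsub>G\<^esub> = 1\<^sub>m (a * b)"
      unfolding tensor_rep_def group_repD(2)[OF assms(1)] group_repD(2)[OF assms(2)] a_def b_def by (rule tensor_mat_one)
    show "tensor_rep \<rho> \<sigma> (g \<otimes>\<^bsub>G\<^esub> h) = tensor_rep \<rho> \<sigma> g * tensor_rep \<rho> \<sigma> h"
      if "g \<in> carrier G" "h \<in> carrier G" for g h
      unfolding tensor_rep_def group_repD(3)[OF assms(1) that] group_repD(3)[OF assms(2) that]
      by (rule tensor_mat_mult[OF A[OF that(1)] A[OF that(2)] B[OF that(1)] B[OF that(2)]])
  qed
qed

text \<open>
  The character of a virtual representation.
\<close>

definition frag_char :: "(('g \<Rightarrow> 'k::field mat) \<Rightarrow>\<^sub>0 int) \<Rightarrow> 'g \<Rightarrow> 'k"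
  where "frag_char x g = (\<Sum>\<rho>\<in>Poly_Mapping.keys x. of_int (Poly_Mapping.lookup x \<rho>) * mtrace (\<rho> g))"

lemma frag_char_superset:
  assumes "finite S" "Poly_Mapping.keys x \<subseteq> S"
  shows "frag_char x g = (\<Sum>\<rho>\<in>S. of_int (Poly_Mapping.lookup x \<rho>) * mtrace (\<rho> g))"
  unfolding frag_char_def using assms
  by (intro sum.mono_neutral_left) (auto simp: in_keys_iff)

lemma frag_char_diff: "frag_char (x - y) g = frag_char x g - frag_char y g"
proof -
  define S where "S = Poly_Mapping.keys x \<union> Poly_Mapping.keys y"
  have "finite S" "Poly_Mapping.keys x \<subseteq> S" "Poly_Mapping.keys y \<subseteq> S" "Poly_Mapping.keys (x - y) \<subseteq> S"
    unfolding S_def by (simp, rule Un_upper1, rule Un_upper2, rule keys_diff)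
  then show ?thesis
    by (simp add: frag_char_superset[of S] lookup_minus sum_subtractf left_diff_distrib)
qed

lemma frag_char_0 [simp]: "frag_char 0 g = 0"
  by (simp add: frag_char_def)

lemma frag_char_uminus: "frag_char (- x) g = - frag_char x g"
  using frag_char_diff[of 0 x g] by simp

lemma frag_char_add: "frag_char (x + y) g = frag_char x g + frag_char y g"
  using frag_char_diff[of x "- y" g] by (simp add: frag_char_uminus)

lemma frag_char_of [simp]: "frag_char (frag_of \<rho>) g = mtrace (\<rho> g)"
  by (simp add: frag_char_def keys_frag_of)

lemma frag_char_sum_list: "frag_char (\<Sum>\<rho>\<leftarrow>P. frag_of \<rho>) g = (\<Sum>\<rho>\<leftarrow>P. mtrace (\<rho> g))"
  by (induction P) (simp_all add: frag_char_add)

lemma free_rep_ring_sel: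
  "x \<in> carrier (free_rep_ring G) \<longleftrightarrow> Poly_Mapping.keys x \<subseteq> Collect (group_rep G)"
  "x \<otimes>\<^bsub>free_rep_ring G\<^esub> y = frag_extend (\<lambda>\<rho>. frag_extend (\<lambda>\<sigma>. frag_of (tensor_rep \<rho> \<sigma>)) y) x"
  "\<one>\<^bsub>free_rep_ring G\<^esub> = frag_of trivial_rep" "\<zero>\<^bsub>free_rep_ring G\<^esub> = 0" "x \<oplus>\<^bsub>free_rep_ring G\<^esub> y = x + y"
  by (simp_all add: free_rep_ring_def)

lemma free_rep_ring_closed:
  fixes G :: "('g, 'm) monoid_scheme" and x y :: "('g \<Rightarrow> 'k::field mat) \<Rightarrow>\<^sub>0 int"
  shows "x \<in> carrier (free_rep_ring G) \<Longrightarrow> y \<in> carrier (free_rep_ring G) \<Longrightarrow> x - y \<in> carrier (free_rep_ring G)"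
    "x \<in> carrier (free_rep_ring G) \<Longrightarrow> y \<in> carrier (free_rep_ring G) \<Longrightarrow> x + y \<in> carrier (free_rep_ring G)"
    "x \<in> carrier (free_rep_ring G) \<Longrightarrow> - x \<in> carrier (free_rep_ring G)"
    "0 \<in> carrier (free_rep_ring G :: (('g \<Rightarrow> 'k mat) \<Rightarrow>\<^sub>0 int) ring)"
    "group_rep G \<rho> \<Longrightarrow> frag_of \<rho> \<in> carrier (free_rep_ring G)"
proof -
  show "x \<in> carrier (free_rep_ring G) \<Longrightarrow> y \<in> carrier (free_rep_ring G) \<Longrightarrow> x - y \<in> carrier (free_rep_ring G)"
    unfolding free_rep_ring_sel(1) using keys_diff[of x y] by (meson Un_least subset_trans)
  show "x \<in> carrier (free_rep_ring G) \<Longrightarrow> y \<in> carrier (free_rep_ring G) \<Longrightarrow> x + y \<in> carrier (free_rep_ring G)"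
    unfolding free_rep_ring_sel(1) using keys_add[of x y] by (meson Un_least subset_trans)
  show "x \<in> carrier (free_rep_ring G) \<Longrightarrow> - x \<in> carrier (free_rep_ring G)"
    unfolding free_rep_ring_sel(1) by (simp only: keys_minus)
  show "0 \<in> carrier (free_rep_ring G :: (('g \<Rightarrow> 'k mat) \<Rightarrow>\<^sub>0 int) ring)"
    unfolding free_rep_ring_sel(1) by (simp only: keys_zero empty_subsetI)
  show "group_rep G \<rho> \<Longrightarrow> frag_of \<rho> \<in> carrier (free_rep_ring G)"
    unfolding free_rep_ring_sel(1) keys_frag_of by simp
qed

lemma free_rep_ring_mult_closed:
  assumes "x \<in> carrier (free_rep_ring G)" "y \<in> carrier (free_rep_ring G)"
  shows "x \<otimes>\<^bsub>free_rep_ring G\<^esub> y \<in> carrier (free_rep_ring G)"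
proof -
  have "group_rep G \<mu>" if mu: "\<mu> \<in> Poly_Mapping.keys (x \<otimes>\<^bsub>free_rep_ring G\<^esub> y)" for \<mu>
  proof -
    obtain \<rho> where r: "\<rho> \<in> Poly_Mapping.keys x" "\<mu> \<in> Poly_Mapping.keys (frag_extend (\<lambda>\<sigma>. frag_of (tensor_rep \<rho> \<sigma>)) y)"
      using subsetD[OF keys_frag_extend mu[unfolded free_rep_ring_sel(2)]] by (rule UN_E)
    obtain \<sigma> where "\<sigma> \<in> Poly_Mapping.keys y" "\<mu> \<in> Poly_Mapping.keys (frag_of (tensor_rep \<rho> \<sigma>))"
      using subsetD[OF keys_frag_extend r(2)] by (rule UN_E)
    then have \<sigma>: "\<sigma> \<in> Poly_Mapping.keys y" and \<mu>: "\<mu> = tensor_rep \<rho> \<sigma>" by (simp_all add: keys_frag_of)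
    have "group_rep G \<rho>" using subsetD[OF assms(1)[unfolded free_rep_ring_sel(1)] r(1)] by simp
    moreover have "group_rep G \<sigma>" using subsetD[OF assms(2)[unfolded free_rep_ring_sel(1)] \<sigma>] by simp
    ultimately show ?thesis unfolding \<mu> by (rule group_rep_tensor)
  qed
  then show ?thesis unfolding free_rep_ring_sel(1) by (intro subsetI CollectI)
qed

lemma frag_induct [case_names zero one diff]:
  assumes "P 0" "\<And>a. P (frag_of a)" "\<And>a b. P a \<Longrightarrow> P b \<Longrightarrow> P (a - b)"
  shows "P x"
  using assms by (rule frag_induction[OF subset_UNIV])

lemma frag_extend_fun_diff: "frag_extend (\<lambda>a. f a - g a) x = frag_extend f x - frag_extend g x"
proof (induction x rule: frag_induct)
  case (diff a b)
  then show ?case by (simp add: frag_extend_diff)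
qed (simp_all)

lemma free_rep_ring_mult_diff:
  "(x - y) \<otimes>\<^bsub>free_rep_ring G\<^esub> z = x \<otimes>\<^bsub>free_rep_ring G\<^esub> z - y \<otimes>\<^bsub>free_rep_ring G\<^esub> z"
  "z \<otimes>\<^bsub>free_rep_ring G\<^esub> (x - y) = z \<otimes>\<^bsub>free_rep_ring G\<^esub> x - z \<otimes>\<^bsub>free_rep_ring G\<^esub> y"
  by (simp_all add: free_rep_ring_sel frag_extend_diff frag_extend_fun_diff)

lemma free_rep_ring_mult_0:
  "0 \<otimes>\<^bsub>free_rep_ring G\<^esub> z = 0" "z \<otimes>\<^bsub>free_rep_ring G\<^esub> 0 = 0"
  using free_rep_ring_mult_diff(1)[where x = 0 and y = 0 and z = z and G = G]
    free_rep_ring_mult_diff(2)[where x = 0 and y = 0 and z = z and G = G] by simp_all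

lemma free_rep_ring_mult_of: "frag_of \<rho> \<otimes>\<^bsub>free_rep_ring G\<^esub> frag_of \<sigma> = frag_of (tensor_rep \<rho> \<sigma>)"
  by (simp add: free_rep_ring_sel)

lemma free_rep_ring_assoc:
  "(x \<otimes>\<^bsub>free_rep_ring G\<^esub> y) \<otimes>\<^bsub>free_rep_ring G\<^esub> z = x \<otimes>\<^bsub>free_rep_ring G\<^esub> (y \<otimes>\<^bsub>free_rep_ring G\<^esub> z)"
proof (induction x rule: frag_induct)
  case (one \<rho>)
  show ?case
  proof (induction y rule: frag_induct)
    case (one \<sigma>)
    show ?case
      by (induction z rule: frag_induct)
        (simp_all add: free_rep_ring_mult_diff free_rep_ring_mult_0 free_rep_ring_mult_of tensor_rep_assoc)
  qed (simp_all add: free_rep_ring_mult_diff free_rep_ring_mult_0)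
qed (simp_all add: free_rep_ring_mult_diff free_rep_ring_mult_0)

lemma free_rep_ring_one:
  "frag_of trivial_rep \<otimes>\<^bsub>free_rep_ring G\<^esub> x = x" "x \<otimes>\<^bsub>free_rep_ring G\<^esub> frag_of trivial_rep = x"
  by (induction x rule: frag_induct;
      simp add: free_rep_ring_mult_diff free_rep_ring_mult_0 free_rep_ring_mult_of tensor_rep_trivial)+

lemma free_rep_ring_mult_add:
  "(x + y) \<otimes>\<^bsub>free_rep_ring G\<^esub> z = x \<otimes>\<^bsub>free_rep_ring G\<^esub> z + y \<otimes>\<^bsub>free_rep_ring G\<^esub> z"
  "z \<otimes>\<^bsub>free_rep_ring G\<^esub> (x + y) = z \<otimes>\<^bsub>free_rep_ring G\<^esub> x + z \<otimes>\<^bsub>free_rep_ring G\<^esub> y"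
  using free_rep_ring_mult_diff(1)[where x = "x + y" and y = y and z = z and G = G]
    free_rep_ring_mult_diff(2)[where x = "x + y" and y = y and z = z and G = G] by (simp_all add: eq_diff_eq)

lemma ring_free_rep_ring: "ring (free_rep_ring G)"
proof (rule ringI)
  show "abelian_group (free_rep_ring G)"
  proof (rule abelian_groupI)
    fix x assume "x \<in> carrier (free_rep_ring G)"
    then show "\<exists>y\<in>carrier (free_rep_ring G). y \<oplus>\<^bsub>free_rep_ring G\<^esub> x = \<zero>\<^bsub>free_rep_ring G\<^esub>"
      by (intro bexI[of _ "- x"]) (simp_all add: free_rep_ring_sel(4,5) free_rep_ring_closed)
  qed (simp_all add: free_rep_ring_sel(4,5) free_rep_ring_closed ac_simps)
  show "Group.monoid (free_rep_ring G)"
    by (rule monoidI) (simp_all add: free_rep_ring_mult_closed free_rep_ring_assoc free_rep_ring_sel(3) free_rep_ring_one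
        free_rep_ring_closed group_rep_trivial)
qed (simp_all add: free_rep_ring_sel(5) free_rep_ring_mult_add)

lemma frag_char_mult:
  assumes "g \<in> carrier G" "x \<in> carrier (free_rep_ring G)" "y \<in> carrier (free_rep_ring G)"
  shows "frag_char (x \<otimes>\<^bsub>free_rep_ring G\<^esub> y) g = frag_char x g * frag_char y g"
  using assms(2) unfolding free_rep_ring_sel(1)
proof (induction x rule: frag_induction)
  case (one \<rho>)
  show ?case using assms(3) unfolding free_rep_ring_sel(1)
  proof (induction y rule: frag_induction)
    case (one \<sigma>)
    then show ?case
      using \<open>\<rho> \<in> Collect (group_rep G)\<close> mtrace_tensor[OF group_repD(1)[OF _ assms(1)] group_repD(1)[OF _ assms(1)], of \<rho> \<sigma>]
      by (simp add: free_rep_ring_mult_of tensor_rep_def)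
  qed (simp_all add: free_rep_ring_mult_0 free_rep_ring_mult_diff frag_char_diff right_diff_distrib)
qed (simp_all add: free_rep_ring_mult_0 free_rep_ring_mult_diff frag_char_diff left_diff_distrib)

lemma subgroup_rep_relations:
  fixes G :: "('g, 'm) monoid_scheme"
  shows "subgroup (rep_relations G :: (('g \<Rightarrow> 'k::field mat) \<Rightarrow>\<^sub>0 int) set) (add_monoid (free_rep_ring G))"
proof -
  interpret ring "free_rep_ring G :: (('g \<Rightarrow> 'k mat) \<Rightarrow>\<^sub>0 int) ring" by (rule ring_free_rep_ring)
  show ?thesis unfolding rep_relations_def
  proof (rule add.generate_is_subgroup, clarsimp)
    fix \<alpha> \<beta> \<gamma> :: "'g \<Rightarrow> 'k mat" assume "short_exact G \<alpha> \<beta> \<gamma>"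
    then have "group_rep G \<alpha>" "group_rep G \<beta>" "group_rep G \<gamma>" unfolding short_exact_def by simp_all
    then show "frag_of \<beta> - frag_of \<alpha> - frag_of \<gamma> \<in> carrier (free_rep_ring G)"
      by (intro free_rep_ring_closed(1) free_rep_ring_closed(5))
  qed
qed

lemma rep_relations_closed:
  fixes G :: "('g, 'm) monoid_scheme" and x y :: "('g \<Rightarrow> 'k::field mat) \<Rightarrow>\<^sub>0 int"
  shows "(0 :: ('g \<Rightarrow> 'k mat) \<Rightarrow>\<^sub>0 int) \<in> rep_relations G"
    "x \<in> rep_relations G \<Longrightarrow> y \<in> rep_relations G \<Longrightarrow> x + y \<in> rep_relations G"
    "x \<in> rep_relations G \<Longrightarrow> - x \<in> rep_relations G"
    "x \<in> rep_relations G \<Longrightarrow> x \<in> carrier (free_rep_ring G)"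
    "short_exact G \<alpha> \<beta> \<gamma> \<Longrightarrow> frag_of \<beta> - frag_of \<alpha> - frag_of \<gamma> \<in> rep_relations G"
proof -
  interpret ring "free_rep_ring G :: (('g \<Rightarrow> 'k mat) \<Rightarrow>\<^sub>0 int) ring" by (rule ring_free_rep_ring)
  interpret I: subgroup "rep_relations G :: (('g \<Rightarrow> 'k mat) \<Rightarrow>\<^sub>0 int) set" "add_monoid (free_rep_ring G)"
    by (rule subgroup_rep_relations)
  show "(0 :: ('g \<Rightarrow> 'k mat) \<Rightarrow>\<^sub>0 int) \<in> rep_relations G" using I.one_closed by (simp add: free_rep_ring_sel)
  show "x \<in> rep_relations G \<Longrightarrow> y \<in> rep_relations G \<Longrightarrow> x + y \<in> rep_relations G"
    using I.m_closed[of x y] by (simp add: free_rep_ring_sel)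
  show c: "x \<in> rep_relations G \<Longrightarrow> x \<in> carrier (free_rep_ring G)" for x :: "('g \<Rightarrow> 'k mat) \<Rightarrow>\<^sub>0 int"
    using I.mem_carrier[of x] by simp
  show "- x \<in> rep_relations G" if "x \<in> rep_relations G"
  proof -
    have "\<ominus>\<^bsub>free_rep_ring G\<^esub> x = - x"
      by (rule minus_equality) (use c[OF that] in \<open>simp_all add: free_rep_ring_closed free_rep_ring_sel(4,5)\<close>)
    then show ?thesis using I.m_inv_closed[OF that] by (simp add: a_inv_def)
  qed
  show "short_exact G \<alpha> \<beta> \<gamma> \<Longrightarrow> frag_of \<beta> - frag_of \<alpha> - frag_of \<gamma> \<in> rep_relations G"
    unfolding rep_relations_def by (rule generate.incl) blast
qed

lemma rep_relations_diff:
  "x \<in> rep_relations G \<Longrightarrow> y \<in> rep_relations G \<Longrightarrow> x - y \<in> rep_relations G"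
  using rep_relations_closed(2)[of x G "- y"] rep_relations_closed(3)[of y G] by simp

lemma frag_char_rep_relations:
  fixes x :: "('g \<Rightarrow> 'k::field mat) \<Rightarrow>\<^sub>0 int"
  assumes "x \<in> rep_relations G" "g \<in> carrier G" shows "frag_char x g = 0"
proof -
  interpret ring "free_rep_ring G :: (('g \<Rightarrow> 'k mat) \<Rightarrow>\<^sub>0 int) ring" by (rule ring_free_rep_ring)
  have gen: "frag_char h g = 0 \<and> h \<in> carrier (free_rep_ring G)"
    if "h \<in> {frag_of \<beta> - frag_of \<alpha> - frag_of \<gamma> | \<alpha> \<beta> \<gamma>. short_exact G \<alpha> \<beta> \<gamma>}" for h :: "('g \<Rightarrow> 'k mat) \<Rightarrow>\<^sub>0 int"
  proof -
    from that obtain \<alpha> \<beta> \<gamma> where s: "h = frag_of \<beta> - frag_of \<alpha> - frag_of \<gamma>" "short_exact G \<alpha> \<beta> \<gamma>" by blast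
    have "h \<in> rep_relations G" unfolding s(1) by (rule rep_relations_closed(5)[OF s(2)])
    then show ?thesis
      using short_exact_mtrace[OF s(2) assms(2)] rep_relations_closed(4) by (simp add: s(1) frag_char_diff)
  qed
  show ?thesis
    using assms(1) unfolding rep_relations_def
  proof (induction rule: generate.induct)
    case (inv h)
    have c: "h \<in> carrier (free_rep_ring G)" and z: "frag_char h g = 0" using gen[OF inv] by auto
    have "\<ominus>\<^bsub>free_rep_ring G\<^esub> h = - h"
      by (rule minus_equality) (use c in \<open>simp_all add: free_rep_ring_closed free_rep_ring_sel(4,5)\<close>)
    then show ?case using z unfolding a_inv_def by (simp only: frag_char_uminus neg_equal_0_iff_equal)
  qed (use gen in \<open>simp_all add: free_rep_ring_sel frag_char_add\<close>)
qed

text \<open>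
  A representation \<open>\<rho>\<close> on the zero space gives the exact sequence \<open>0 \<rightarrow> \<rho> \<rightarrow> \<rho> \<rightarrow> \<rho> \<rightarrow> 0\<close>, whose relation is \<open>-[\<rho>]\<close>.
\<close>

lemma degree_0_relation:
  fixes \<rho> :: "'g \<Rightarrow> 'k::field mat"
  assumes "group_rep G \<rho>" "rep_degree G \<rho> = 0" shows "frag_of \<rho> \<in> rep_relations G"
proof -
  have e: "carrier_vec 0 = {0\<^sub>v 0 :: 'k vec}" by auto
  have "short_exact G \<rho> \<rho> \<rho>"
    unfolding short_exact_def assms(2)
  proof (intro conjI exI)
    have c: "\<rho> g \<in> carrier_mat 0 0" if "g \<in> carrier G" for g
      using group_repD(1)[OF assms(1) that] unfolding assms(2) .
    have "1\<^sub>m 0 * \<rho> g = \<rho> g * 1\<^sub>m 0" if "g \<in> carrier G" for g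
      unfolding left_mult_one_mat[OF c[OF that]] right_mult_one_mat[OF c[OF that]] ..
    then show "intertwiner G \<rho> \<rho> (1\<^sub>m 0)" "intertwiner G \<rho> \<rho> (1\<^sub>m 0)"
      unfolding intertwiner_def assms(2) by auto
    show "mat_kernel (1\<^sub>m 0) = (*\<^sub>v) (1\<^sub>m 0) ` (carrier_vec 0 :: 'k vec set)"
      unfolding mat_kernel_def e by auto
  qed (use assms e in auto)
  from rep_relations_closed(3)[OF rep_relations_closed(5)[OF this]] show ?thesis by simp
qed

lemma of_nat_sum_list: "of_nat (\<Sum>x\<leftarrow>xs. f x) = (\<Sum>x\<leftarrow>xs. of_nat (f x) :: 'a::semiring_1)"
  by (induction xs) auto

text \<open>
  Induction on the total degree. An irreducible subrepresentation \<open>\<tau>\<close> of a member of \<open>P\<close> pairs positively with the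
  common character, so it pairs nonzero with some member of \<open>N\<close> and embeds there. Passing to the two quotients
  by \<open>\<tau>\<close> changes both sums by the same class and lowers the degree. The relations for exact
  sequences take the place of complete reducibility.
\<close>

lemma equal_characters_relation:
  fixes P N :: "('g \<Rightarrow> 'k::field_char_0 mat) list"
  assumes G: "group G" "finite (carrier G)"
    and "\<forall>\<rho>\<in>set P. group_rep G \<rho>" "\<forall>\<sigma>\<in>set N. group_rep G \<sigma>"
    and "\<forall>g\<in>carrier G. (\<Sum>\<rho>\<leftarrow>P. mtrace (\<rho> g)) = (\<Sum>\<sigma>\<leftarrow>N. mtrace (\<sigma> g))"
  shows "(\<Sum>\<rho>\<leftarrow>P. frag_of \<rho>) - (\<Sum>\<sigma>\<leftarrow>N. frag_of \<sigma>) \<in> rep_relations G"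
  using assms(3-)
proof (induction "\<Sum>\<rho>\<leftarrow>P. rep_degree G \<rho>" arbitrary: P N rule: less_induct)
  case less
  interpret group G by fact
  have one: "\<one>\<^bsub>G\<^esub> \<in> carrier G" by simp
  note P = less.prems(1) and N = less.prems(2) and eq = less.prems(3)
  have deg: "(\<Sum>\<rho>\<leftarrow>Q. mtrace (\<rho> \<one>\<^bsub>G\<^esub>)) = (of_nat (\<Sum>\<rho>\<leftarrow>Q. rep_degree G \<rho>) :: 'k)"
    if "\<forall>\<rho>\<in>set Q. group_rep G \<rho>" for Q :: "('g \<Rightarrow> 'k mat) list"
    unfolding of_nat_sum_list
    by (intro arg_cong[where f = sum_list] map_cong refl) (use that group_repD(2) in force)
  show ?case
  proof (cases "\<exists>\<rho>\<in>set P. rep_degree G \<rho> > 0")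
    case False
    then have "(\<Sum>\<rho>\<leftarrow>P. rep_degree G \<rho>) = 0" by (simp add: sum_list_eq_0_iff)
    then have "(of_nat (\<Sum>\<sigma>\<leftarrow>N. rep_degree G \<sigma>) :: 'k) = 0" using deg[OF P] deg[OF N] eq one by simp
    then have "(\<Sum>\<sigma>\<leftarrow>N. rep_degree G \<sigma>) = 0" by (simp only: of_nat_eq_0_iff)
    then have N0: "\<forall>\<sigma>\<in>set N. rep_degree G \<sigma> = 0" by (simp add: sum_list_eq_0_iff)
    have zero: "(\<Sum>\<rho>\<leftarrow>Q. frag_of \<rho>) \<in> rep_relations G"
      if "\<forall>\<rho>\<in>set Q. group_rep G \<rho>" "\<forall>\<rho>\<in>set Q. rep_degree G \<rho> = 0" for Q :: "('g \<Rightarrow> 'k mat) list"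
      using that by (induction Q) (auto intro: rep_relations_closed degree_0_relation)
    show ?thesis by (intro rep_relations_diff zero P N N0) (use False in simp)
  next
    case True
    then obtain \<rho> where rho: "\<rho> \<in> set P" "rep_degree G \<rho> > 0" by blast
    obtain P1 P2 where P12: "P = P1 @ \<rho> # P2" using split_list[OF rho(1)] by blast
    have rrep: "group_rep G \<rho>" using P rho by blast
    obtain \<tau> F Y where tau: "group_rep G \<tau>" "rep_degree G \<tau> > 0" and F: "intertwiner G \<tau> \<rho> F"
        "Y \<in> carrier_mat (rep_degree G \<tau>) (rep_degree G \<rho>)" "Y * F = 1\<^sub>m (rep_degree G \<tau>)"
      and inj: "\<And>\<sigma> Z. group_rep G \<sigma> \<Longrightarrow> intertwiner G \<tau> \<sigma> Z \<Longrightarrow> Z \<noteq> 0\<^sub>m (rep_degree G \<sigma>) (rep_degree G \<tau>) \<Longrightarrow>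
        \<exists>Y\<in>carrier_mat (rep_degree G \<tau>) (rep_degree G \<sigma>). Y * Z = 1\<^sub>m (rep_degree G \<tau>)"
      using minimal_subrep[OF G(1) rrep rho(2)] by blast
    define pair where "pair \<sigma> = (\<Sum>g\<in>carrier G. mtrace (\<sigma> g) * mtrace (\<tau> (inv\<^bsub>G\<^esub> g)))" for \<sigma> :: "'g \<Rightarrow> 'k mat"
    define c where "c = card (carrier G)"
    have c0: "c > 0" using G(2) one by (auto simp: c_def card_gt_0_iff)
    have "\<forall>\<sigma>. \<exists>k. group_rep G \<sigma> \<longrightarrow> pair \<sigma> = of_nat (c * k) \<and>
        (k = 0 \<longleftrightarrow> (\<forall>Z. intertwiner G \<tau> \<sigma> Z \<longrightarrow> Z = 0\<^sub>m (rep_degree G \<sigma>) (rep_degree G \<tau>)))"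
      using character_pairing[OF G tau(1)] unfolding pair_def c_def of_nat_mult by blast
    then obtain k where k: "\<And>\<sigma>. group_rep G \<sigma> \<Longrightarrow> pair \<sigma> = of_nat (c * k \<sigma>)"
      "\<And>\<sigma>. group_rep G \<sigma> \<Longrightarrow> k \<sigma> = 0 \<longleftrightarrow> (\<forall>Z. intertwiner G \<tau> \<sigma> Z \<longrightarrow> Z = 0\<^sub>m (rep_degree G \<sigma>) (rep_degree G \<tau>))"
      by metis
    have pair_sum: "(\<Sum>\<sigma>\<leftarrow>Q. pair \<sigma>) = (\<Sum>g\<in>carrier G. (\<Sum>\<sigma>\<leftarrow>Q. mtrace (\<sigma> g)) * mtrace (\<tau> (inv\<^bsub>G\<^esub> g)))" for Q
      by (induction Q) (simp_all add: pair_def sum.distrib distrib_right)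
    have pair_k: "(\<Sum>\<sigma>\<leftarrow>Q. pair \<sigma>) = of_nat (\<Sum>\<sigma>\<leftarrow>Q. c * k \<sigma>)" if "\<forall>\<sigma>\<in>set Q. group_rep G \<sigma>" for Q
      unfolding of_nat_sum_list using that k(1) by (intro arg_cong[where f = sum_list] map_cong refl) blast
    have "(\<Sum>\<sigma>\<leftarrow>P. pair \<sigma>) = (\<Sum>\<sigma>\<leftarrow>N. pair \<sigma>)" unfolding pair_sum using eq by (intro sum.cong refl) simp
    then have "(of_nat (\<Sum>\<sigma>\<leftarrow>P. c * k \<sigma>) :: 'k) = of_nat (\<Sum>\<sigma>\<leftarrow>N. c * k \<sigma>)" using pair_k[OF P] pair_k[OF N] by simp
    then have ksum: "(\<Sum>\<sigma>\<leftarrow>P. c * k \<sigma>) = (\<Sum>\<sigma>\<leftarrow>N. c * k \<sigma>)" by (simp only: of_nat_eq_iff)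
    have "F \<noteq> 0\<^sub>m (rep_degree G \<rho>) (rep_degree G \<tau>)"
    proof
      assume "F = 0\<^sub>m (rep_degree G \<rho>) (rep_degree G \<tau>)"
      then have "1\<^sub>m (rep_degree G \<tau>) = (0\<^sub>m (rep_degree G \<tau>) (rep_degree G \<tau>) :: 'k mat)" using F by simp
      then have "(1\<^sub>m (rep_degree G \<tau>) :: 'k mat) $$ (0, 0) = 0\<^sub>m (rep_degree G \<tau>) (rep_degree G \<tau>) $$ (0, 0)" by (rule arg_cong)
      then show False using tau(2) by simp
    qed
    then have "k \<rho> > 0" using k(2)[OF rrep] F(1) by blast
    then have "(\<Sum>\<sigma>\<leftarrow>P. c * k \<sigma>) > 0" using c0 by (simp add: P12)
    then have "(\<Sum>\<sigma>\<leftarrow>N. c * k \<sigma>) \<noteq> 0" using ksum by linarith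
    then obtain \<sigma> where sig: "\<sigma> \<in> set N" "k \<sigma> \<noteq> 0" unfolding sum_list_eq_0_iff by auto
    obtain N1 N2 where N12: "N = N1 @ \<sigma> # N2" using split_list[OF sig(1)] by blast
    have srep: "group_rep G \<sigma>" using N sig by blast
    obtain Z where Z: "intertwiner G \<tau> \<sigma> Z" "Z \<noteq> 0\<^sub>m (rep_degree G \<sigma>) (rep_degree G \<tau>)" using k(2)[OF srep] sig(2) by blast
    obtain Y' where Y': "Y' \<in> carrier_mat (rep_degree G \<tau>) (rep_degree G \<sigma>)" "Y' * Z = 1\<^sub>m (rep_degree G \<tau>)"
      using inj[OF srep Z] by (rule bexE)
    obtain \<gamma> where gam: "short_exact G \<tau> \<rho> \<gamma>" using short_exact_of_injection[OF G(1) tau(1) rrep F] by blast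
    obtain \<delta> where del: "short_exact G \<tau> \<sigma> \<delta>" using short_exact_of_injection[OF G(1) tau(1) srep Z(1) Y'] by blast
    have "(\<Sum>\<rho>\<leftarrow>P1 @ \<gamma> # P2. frag_of \<rho>) - (\<Sum>\<sigma>\<leftarrow>N1 @ \<delta> # N2. frag_of \<sigma>) \<in> rep_relations G"
    proof (rule less.hyps)
      show "(\<Sum>\<rho>\<leftarrow>P1 @ \<gamma> # P2. rep_degree G \<rho>) < (\<Sum>\<rho>\<leftarrow>P. rep_degree G \<rho>)"
        using short_exact_degree[OF gam one] tau(2) by (simp add: P12)
      show "\<forall>\<rho>\<in>set (P1 @ \<gamma> # P2). group_rep G \<rho>" "\<forall>\<sigma>\<in>set (N1 @ \<delta> # N2). group_rep G \<sigma>"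
        using P N gam del by (auto simp: P12 N12 short_exact_def)
      show "\<forall>g\<in>carrier G. (\<Sum>\<rho>\<leftarrow>P1 @ \<gamma> # P2. mtrace (\<rho> g)) = (\<Sum>\<sigma>\<leftarrow>N1 @ \<delta> # N2. mtrace (\<sigma> g))"
      proof
        fix g assume g: "g \<in> carrier G"
        have "(\<Sum>\<rho>\<leftarrow>P. mtrace (\<rho> g)) = (\<Sum>\<sigma>\<leftarrow>N. mtrace (\<sigma> g))" using eq g by blast
        then show "(\<Sum>\<rho>\<leftarrow>P1 @ \<gamma> # P2. mtrace (\<rho> g)) = (\<Sum>\<sigma>\<leftarrow>N1 @ \<delta> # N2. mtrace (\<sigma> g))"
          using short_exact_mtrace[OF gam g] short_exact_mtrace[OF del g] by (simp add: P12 N12 algebra_simps)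
      qed
    qed
    then have "((\<Sum>\<rho>\<leftarrow>P1 @ \<gamma> # P2. frag_of \<rho>) - (\<Sum>\<sigma>\<leftarrow>N1 @ \<delta> # N2. frag_of \<sigma>)) +
        ((frag_of \<rho> - frag_of \<tau> - frag_of \<gamma>) - (frag_of \<sigma> - frag_of \<tau> - frag_of \<delta>)) \<in> rep_relations G"
      by (rule rep_relations_closed(2)) (intro rep_relations_diff rep_relations_closed(5) gam del)
    then show ?thesis by (simp add: P12 N12 algebra_simps)
  qed
qed

lemma frag_split_lists:
  assumes "x \<in> carrier (free_rep_ring G)"
  shows "\<exists>P N. (\<forall>\<rho>\<in>set P. group_rep G \<rho>) \<and> (\<forall>\<rho>\<in>set N. group_rep G \<rho>) \<and>
    x = (\<Sum>\<rho>\<leftarrow>P. frag_of \<rho>) - (\<Sum>\<rho>\<leftarrow>N. frag_of \<rho>)"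
  using assms unfolding free_rep_ring_sel(1)
proof (induction x rule: frag_induction)
  case zero
  show ?case by (rule exI[of _ "[]"], rule exI[of _ "[]"]) simp
next
  case (one \<rho>)
  then show ?case by (intro exI[of _ "[\<rho>]"] exI[of _ "[]"]) simp
next
  case (diff a b)
  from diff.IH(1) obtain P N where 1: "\<forall>\<rho>\<in>set P. group_rep G \<rho>" "\<forall>\<rho>\<in>set N. group_rep G \<rho>"
    "a = (\<Sum>\<rho>\<leftarrow>P. frag_of \<rho>) - (\<Sum>\<rho>\<leftarrow>N. frag_of \<rho>)" by (elim exE conjE)
  from diff.IH(2) obtain P' N' where 2: "\<forall>\<rho>\<in>set P'. group_rep G \<rho>" "\<forall>\<rho>\<in>set N'. group_rep G \<rho>"
    "b = (\<Sum>\<rho>\<leftarrow>P'. frag_of \<rho>) - (\<Sum>\<rho>\<leftarrow>N'. frag_of \<rho>)" by (elim exE conjE)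
  have "\<forall>\<rho>\<in>set (P @ N'). group_rep G \<rho>" "\<forall>\<rho>\<in>set (N @ P'). group_rep G \<rho>"
    "a - b = (\<Sum>\<rho>\<leftarrow>P @ N'. frag_of \<rho>) - (\<Sum>\<rho>\<leftarrow>N @ P'. frag_of \<rho>)" using 1 2 by auto
  then show ?case by (intro exI conjI)
qed

text \<open>
  The relations are the kernel of the character map. This makes them an ideal and reduces every identity in the
  representation ring to one between functions on the group.
\<close>

theorem rep_relations_iff:
  fixes x :: "('g \<Rightarrow> 'k::field_char_0 mat) \<Rightarrow>\<^sub>0 int"
  assumes G: "group G" "finite (carrier G)"
  shows "x \<in> rep_relations G \<longleftrightarrow> x \<in> carrier (free_rep_ring G) \<and> (\<forall>g\<in>carrier G. frag_char x g = 0)"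
proof
  assume r: "x \<in> rep_relations G"
  show "x \<in> carrier (free_rep_ring G) \<and> (\<forall>g\<in>carrier G. frag_char x g = 0)"
    by (intro conjI ballI rep_relations_closed(4)[OF r] frag_char_rep_relations[OF r])
next
  assume x: "x \<in> carrier (free_rep_ring G) \<and> (\<forall>g\<in>carrier G. frag_char x g = 0)"
  from frag_split_lists[OF conjunct1[OF x]] obtain P N where PN: "\<forall>\<rho>\<in>set P. group_rep G \<rho>" "\<forall>\<rho>\<in>set N. group_rep G \<rho>"
    and xeq: "x = (\<Sum>\<rho>\<leftarrow>P. frag_of \<rho>) - (\<Sum>\<rho>\<leftarrow>N. frag_of \<rho>)" by (elim exE conjE)
  show "x \<in> rep_relations G"
    unfolding xeq
  proof (rule equal_characters_relation[OF G PN], rule ballI)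
    fix g assume "g \<in> carrier G"
    then have "frag_char x g = 0" by (rule bspec[OF conjunct2[OF x]])
    then show "(\<Sum>\<rho>\<leftarrow>P. mtrace (\<rho> g)) = (\<Sum>\<sigma>\<leftarrow>N. mtrace (\<sigma> g))"
      unfolding xeq frag_char_diff frag_char_sum_list by simp
  qed
qed

lemma ideal_rep_relations:
  assumes G: "group G" "finite (carrier G)"
  shows "ideal (rep_relations G :: (('g \<Rightarrow> 'k::field_char_0 mat) \<Rightarrow>\<^sub>0 int) set) (free_rep_ring G)"
proof (rule idealI[OF ring_free_rep_ring subgroup_rep_relations])
  fix a x :: "('g \<Rightarrow> 'k mat) \<Rightarrow>\<^sub>0 int" assume "a \<in> rep_relations G" and x: "x \<in> carrier (free_rep_ring G)"
  then have a: "a \<in> carrier (free_rep_ring G)" "\<forall>g\<in>carrier G. frag_char a g = 0"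
    unfolding rep_relations_iff[OF G] by simp_all
  show "x \<otimes>\<^bsub>free_rep_ring G\<^esub> a \<in> rep_relations G" "a \<otimes>\<^bsub>free_rep_ring G\<^esub> x \<in> rep_relations G"
    unfolding rep_relations_iff[OF G]
    using a x by (simp_all add: free_rep_ring_mult_closed frag_char_mult)
qed

section \<open>Generating the representation ring by characters\<close>

text \<open>
  Functions that agree on the group with the character of an element of the generated subring. It is a ring
  of functions, which lets the combinatorial results be applied to it.
\<close>

definition generated_chars :: "('g, 'm) monoid_scheme \<Rightarrow> (('g \<Rightarrow> 'k::field mat) \<Rightarrow>\<^sub>0 int) set set \<Rightarrow> ('g \<Rightarrow> 'k) set"
  where "generated_chars G H = {y. \<exists>x\<in>carrier (free_rep_ring G).
    rep_relations G +>\<^bsub>free_rep_ring G\<^esub> x \<in> generate_ring (rep_ring G) H \<and> (\<forall>g\<in>carrier G. y g = frag_char x g)}"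

lemma generated_charsI:
  assumes "x \<in> carrier (free_rep_ring G)" "rep_relations G +>\<^bsub>free_rep_ring G\<^esub> x \<in> generate_ring (rep_ring G) H"
    "\<And>g. g \<in> carrier G \<Longrightarrow> y g = frag_char x g"
  shows "y \<in> generated_chars G H"
  using assms unfolding generated_chars_def by blast

lemma generated_charsE:
  assumes "y \<in> generated_chars G H"
  obtains x where "x \<in> carrier (free_rep_ring G)"
    "rep_relations G +>\<^bsub>free_rep_ring G\<^esub> x \<in> generate_ring (rep_ring G) H"
    "\<forall>g\<in>carrier G. y g = frag_char x g"
  using assms unfolding generated_chars_def by blast

context
  fixes G :: "('g, 'm) monoid_scheme" and H :: "(('g \<Rightarrow> 'k::field_char_0 mat) \<Rightarrow>\<^sub>0 int) set set"
  assumes G: "group G" "finite (carrier G)"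
begin

abbreviation (input) "R \<equiv> (free_rep_ring G :: (('g \<Rightarrow> 'k mat) \<Rightarrow>\<^sub>0 int) ring)"
abbreviation (input) "I \<equiv> (rep_relations G :: (('g \<Rightarrow> 'k mat) \<Rightarrow>\<^sub>0 int) set)"

lemma rep_coset_hom: "(+>\<^bsub>R\<^esub>) I \<in> Ring.ring_hom R (rep_ring G)"
  unfolding rep_ring_def by (rule ideal.rcos_ring_hom[OF ideal_rep_relations[OF G]])

lemma ring_rep_ring: "ring (rep_ring G :: (('g \<Rightarrow> 'k mat) \<Rightarrow>\<^sub>0 int) set ring)"
  unfolding rep_ring_def by (rule ideal.quotient_is_ring[OF ideal_rep_relations[OF G]])

lemma generated_chars_one: "(\<lambda>_. 1) \<in> generated_chars G H"
proof (rule generated_charsI)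
  show "frag_of trivial_rep \<in> carrier R" by (rule free_rep_ring_closed(5)[OF group_rep_trivial])
  have "I +>\<^bsub>R\<^esub> \<one>\<^bsub>R\<^esub> = \<one>\<^bsub>rep_ring G\<^esub>" using rep_coset_hom by (rule ring_hom_one)
  then show "I +>\<^bsub>R\<^esub> frag_of trivial_rep \<in> generate_ring (rep_ring G) H"
    using generate_ring.one[of "rep_ring G" H] by (simp add: free_rep_ring_sel)
qed (simp add: trivial_rep_def)

lemma generated_chars_mult:
  assumes "y \<in> generated_chars G H" "z \<in> generated_chars G H"
  shows "(\<lambda>g. y g * z g) \<in> generated_chars G H"
proof -
  from assms(1) obtain x where x: "x \<in> carrier R" "I +>\<^bsub>R\<^esub> x \<in> generate_ring (rep_ring G) H"
    "\<forall>g\<in>carrier G. y g = frag_char x g" by (rule generated_charsE)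
  from assms(2) obtain u where u: "u \<in> carrier R" "I +>\<^bsub>R\<^esub> u \<in> generate_ring (rep_ring G) H"
    "\<forall>g\<in>carrier G. z g = frag_char u g" by (rule generated_charsE)
  show ?thesis
  proof (rule generated_charsI)
    show "x \<otimes>\<^bsub>R\<^esub> u \<in> carrier R" by (rule free_rep_ring_mult_closed[OF x(1) u(1)])
    show "I +>\<^bsub>R\<^esub> (x \<otimes>\<^bsub>R\<^esub> u) \<in> generate_ring (rep_ring G) H"
      unfolding ring_hom_mult[OF rep_coset_hom x(1) u(1)] by (rule generate_ring.eng_mult[OF x(2) u(2)])
    show "y g * z g = frag_char (x \<otimes>\<^bsub>R\<^esub> u) g" if "g \<in> carrier G" for g
      using frag_char_mult[OF that x(1) u(1)] bspec[OF x(3) that] bspec[OF u(3) that] by simp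
  qed
qed

lemma generated_chars_diff:
  assumes "y \<in> generated_chars G H" "z \<in> generated_chars G H"
  shows "(\<lambda>g. y g - z g) \<in> generated_chars G H"
proof -
  interpret Q: ring "rep_ring G :: (('g \<Rightarrow> 'k mat) \<Rightarrow>\<^sub>0 int) set ring" by (rule ring_rep_ring)
  from assms(1) obtain x where x: "x \<in> carrier R" "I +>\<^bsub>R\<^esub> x \<in> generate_ring (rep_ring G) H"
    "\<forall>g\<in>carrier G. y g = frag_char x g" by (rule generated_charsE)
  from assms(2) obtain u where u: "u \<in> carrier R" "I +>\<^bsub>R\<^esub> u \<in> generate_ring (rep_ring G) H"
    "\<forall>g\<in>carrier G. z g = frag_char u g" by (rule generated_charsE)
  have mu: "- u \<in> carrier R" by (rule free_rep_ring_closed(3)[OF u(1)])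
  have h: "I +>\<^bsub>R\<^esub> w \<in> carrier (rep_ring G)" if "w \<in> carrier R" for w
    by (rule ring_hom_closed[OF rep_coset_hom that])
  have "(I +>\<^bsub>R\<^esub> (- u)) \<oplus>\<^bsub>rep_ring G\<^esub> (I +>\<^bsub>R\<^esub> u) = I +>\<^bsub>R\<^esub> (- u \<oplus>\<^bsub>R\<^esub> u)"
    using ring_hom_add[OF rep_coset_hom mu u(1)] by simp
  also have "- u \<oplus>\<^bsub>R\<^esub> u = \<zero>\<^bsub>R\<^esub>" by (simp add: free_rep_ring_sel)
  also have "I +>\<^bsub>R\<^esub> \<zero>\<^bsub>R\<^esub> = \<zero>\<^bsub>rep_ring G\<^esub>"
    by (rule ring_hom_zero[OF rep_coset_hom ring_free_rep_ring ring_rep_ring])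
  finally have neg: "\<ominus>\<^bsub>rep_ring G\<^esub> (I +>\<^bsub>R\<^esub> u) = I +>\<^bsub>R\<^esub> (- u)"
    by (rule Q.minus_equality[OF _ h[OF u(1)] h[OF mu]])
  show ?thesis
  proof (rule generated_charsI)
    show "x + - u \<in> carrier R" by (rule free_rep_ring_closed(2)[OF x(1) mu])
    have "I +>\<^bsub>R\<^esub> (x \<oplus>\<^bsub>R\<^esub> - u) \<in> generate_ring (rep_ring G) H"
      unfolding ring_hom_add[OF rep_coset_hom x(1) mu] neg[symmetric]
      by (rule generate_ring.eng_add[OF x(2) generate_ring.a_inv[OF u(2)]])
    then show "I +>\<^bsub>R\<^esub> (x + - u) \<in> generate_ring (rep_ring G) H" by (simp add: free_rep_ring_sel)
    show "y g - z g = frag_char (x + - u) g" if "g \<in> carrier G" for g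
      using bspec[OF x(3) that] bspec[OF u(3) that] by (simp add: frag_char_diff)
  qed
qed

lemma generated_chars_incl:
  assumes "group_rep G \<rho>" "rep_class G \<rho> \<in> H" shows "(\<lambda>g. mtrace (\<rho> g)) \<in> generated_chars G H"
proof (rule generated_charsI)
  show "frag_of \<rho> \<in> carrier R" by (rule free_rep_ring_closed(5)[OF assms(1)])
  show "I +>\<^bsub>R\<^esub> frag_of \<rho> \<in> generate_ring (rep_ring G) H"
    using generate_ring.incl[OF assms(2)] by (simp add: rep_class_def)
qed simp

text \<open>
  Since virtual representations with equal characters have equal classes, it suffices to find every character among
  those of the generated subring.
\<close>

lemma generate_rep_ring:
  assumes H: "\<And>h. h \<in> H \<Longrightarrow> \<exists>\<rho>. group_rep G \<rho> \<and> h = rep_class G \<rho>"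
    and all: "\<And>\<rho>. group_rep G \<rho> \<Longrightarrow> (\<lambda>g. mtrace (\<rho> g)) \<in> generated_chars G H"
  shows "generate_ring (rep_ring G) H = carrier (rep_ring G)"
proof
  interpret Q: ring "rep_ring G :: (('g \<Rightarrow> 'k mat) \<Rightarrow>\<^sub>0 int) set ring" by (rule ring_rep_ring)
  have "H \<subseteq> carrier (rep_ring G)"
  proof
    fix h assume "h \<in> H"
    then obtain \<rho> where "group_rep G \<rho>" "h = rep_class G \<rho>" using H by blast
    then show "h \<in> carrier (rep_ring G)"
      unfolding rep_class_def using ring_hom_closed[OF rep_coset_hom free_rep_ring_closed(5)] by blast
  qed
  then show "generate_ring (rep_ring G) H \<subseteq> carrier (rep_ring G)" by (rule Q.generate_ring_incl)
  have "(\<lambda>g. frag_char x g) \<in> generated_chars G H" if "Poly_Mapping.keys x \<subseteq> Collect (group_rep G)" for x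
    using that
  proof (induction x rule: frag_induction)
    case zero
    show ?case using generated_chars_diff[OF generated_chars_one generated_chars_one] by simp
  next
    case (one \<rho>)
    then show ?case using all by simp
  next
    case (diff a b)
    then show ?case using generated_chars_diff by (simp add: frag_char_diff)
  qed
  then have all': "(\<lambda>g. frag_char x g) \<in> generated_chars G H" if "x \<in> carrier R" for x
    using that by (simp add: free_rep_ring_sel(1))
  show "carrier (rep_ring G) \<subseteq> generate_ring (rep_ring G) H"
  proof
    fix K :: "(('g \<Rightarrow> 'k mat) \<Rightarrow>\<^sub>0 int) set" assume "K \<in> carrier (rep_ring G)"
    then obtain x where x: "x \<in> carrier R" "K = I +>\<^bsub>R\<^esub> x"
      unfolding rep_ring_def FactRing_def A_RCOSETS_def' by auto
    obtain u where u: "u \<in> carrier R" "I +>\<^bsub>R\<^esub> u \<in> generate_ring (rep_ring G) H"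
      "\<forall>g\<in>carrier G. frag_char x g = frag_char u g"
      using all'[OF x(1)] by (rule generated_charsE)
    have d: "x - u \<in> I" "u - x \<in> I"
      unfolding rep_relations_iff[OF G]
      using x u free_rep_ring_closed(1) by (auto simp: frag_char_diff)
    have "I +>\<^bsub>R\<^esub> x = I +>\<^bsub>R\<^esub> u"
      unfolding a_r_coset_def' free_rep_ring_sel(5)
    proof (intro equalityI subsetI)
      fix w assume "w \<in> (\<Union>h\<in>I. {h + x})"
      then obtain h where "h \<in> I" "w = h + x" by blast
      then have "h + (x - u) \<in> I" "w = (h + (x - u)) + u" using rep_relations_closed(2) d by auto
      then show "w \<in> (\<Union>h\<in>I. {h + u})" by blast
    next
      fix w assume "w \<in> (\<Union>h\<in>I. {h + u})"
      then obtain h where "h \<in> I" "w = h + u" by blast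
      then have "h + (u - x) \<in> I" "w = (h + (u - x)) + x" using rep_relations_closed(2) d by auto
      then show "w \<in> (\<Union>h\<in>I. {h + x})" by blast
    qed
    then show "K \<in> generate_ring (rep_ring G) H" using u(2) x(2) by simp
  qed
qed

end

section \<open>The representation ring of the hyperoctahedral group\<close>

lemma generated_chars_cong:
  assumes "y \<in> generated_chars G H" "\<And>g. g \<in> carrier G \<Longrightarrow> y g = z g"
  shows "z \<in> generated_chars G H"
proof -
  from assms(1) obtain x where x: "x \<in> carrier (free_rep_ring G)"
    "rep_relations G +>\<^bsub>free_rep_ring G\<^esub> x \<in> generate_ring (rep_ring G) H" "\<forall>g\<in>carrier G. y g = frag_char x g"
    by (rule generated_charsE)
  show ?thesis by (rule generated_charsI[OF x(1,2)]) (use x(3) assms(2) in simp)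
qed

text \<open>
  Transport along \<open>to_sperm\<close>: the functions on signed permutations whose pullback is a generated character form a ring
  of functions, and the pullback of a character is an integral class function.
\<close>

lemma hyperoctahedral_characters:
  fixes n :: nat and \<rho> :: "(nat \<Rightarrow> int) \<times> (nat \<Rightarrow> nat) \<Rightarrow> 'k::field_char_0 mat"
  defines "W \<equiv> wreath sign_group {1..n}"
  assumes gen: "\<And>k b. (\<lambda>x. of_int (block_char {1..n} [(k, True, b)] (to_sperm n x))) \<in> generated_chars W H"
    and \<rho>: "group_rep W \<rho>"
  shows "(\<lambda>x. mtrace (\<rho> x)) \<in> generated_chars W H"
proof -
  have G: "group W" unfolding W_def by (rule group_wreath) simp
  have fin: "finite (carrier W)" unfolding W_def by (rule finite_wreath) (simp_all add: carrier_sign_group)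
  interpret W: group W by (rule G)
  have bij: "bij_betw (to_sperm n) (carrier W) (signed_perms {1..n})" unfolding W_def by (rule bij_betw_to_sperm)
  define \<psi> where "\<psi> = inv_into (carrier W) (to_sperm n)"
  have \<psi>: "\<psi> w \<in> carrier W" if "w \<in> signed_perms {1..n}" for w
    unfolding \<psi>_def by (rule bij_betw_apply[OF bij_betw_inv_into[OF bij] that])
  have to_\<psi>: "to_sperm n (\<psi> w) = w" if "w \<in> signed_perms {1..n}" for w
    unfolding \<psi>_def by (rule bij_betw_inv_into_right[OF bij that])
  have \<psi>_to: "\<psi> (to_sperm n x) = x" if "x \<in> carrier W" for x
    unfolding \<psi>_def by (rule bij_betw_inv_into_left[OF bij that])
  have \<psi>_mult: "\<psi> (w \<star> v) = \<psi> w \<otimes>\<^bsub>W\<^esub> \<psi> v" if w: "w \<in> signed_perms {1..n}" and v: "v \<in> signed_perms {1..n}" for w v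
  proof -
    have "to_sperm n (\<psi> w \<otimes>\<^bsub>W\<^esub> \<psi> v) = w \<star> v"
      using to_sperm_mult[OF \<psi>[OF w, unfolded W_def] \<psi>[OF v, unfolded W_def]] to_\<psi>[OF w] to_\<psi>[OF v] by (simp add: W_def)
    then show ?thesis using \<psi>_to[OF W.m_closed[OF \<psi>[OF w] \<psi>[OF v]]] by simp
  qed
  have \<psi>_one: "\<psi> sp_one = \<one>\<^bsub>W\<^esub>"
    using \<psi>_to[OF W.one_closed] to_sperm_one[of n] by (simp add: W_def)
  define \<B> :: "(sperm \<Rightarrow> 'k) set" where "\<B> = {y. (\<lambda>x. y (to_sperm n x)) \<in> generated_chars W H}"
  have ring: "function_ring {1..n} \<B>"
  proof
    show "(\<lambda>_. 1) \<in> \<B>" using generated_chars_one[OF G fin] by (simp add: \<B>_def)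
    fix f g assume f: "f \<in> \<B>"
    show "(\<lambda>w. f w - g w) \<in> \<B>" "(\<lambda>w. f w * g w) \<in> \<B>" if "g \<in> \<B>"
      using generated_chars_diff[OF G fin] generated_chars_mult[OF G fin] f that by (simp_all add: \<B>_def)
    assume eq: "\<And>w. w \<in> signed_perms {1..n} \<Longrightarrow> f w = g w"
    have "(\<lambda>x. g (to_sperm n x)) \<in> generated_chars W H"
      by (rule generated_chars_cong[of "\<lambda>x. f (to_sperm n x)"])
        (use f eq bij_betw_apply[OF bij] in \<open>simp_all add: \<B>_def\<close>)
    then show "g \<in> \<B>" by (simp add: \<B>_def)
  qed simp
  define d where "d = rep_degree W \<rho>"
  note D = group_repD[OF \<rho>, folded d_def]
  have "(\<lambda>w. mtrace (\<rho> (\<psi> w))) \<in> \<B>"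
  proof (rule integral_class_function_in[OF ring])
    show "(\<lambda>w. of_int (block_char {1..n} [(k, True, b)] w)) \<in> \<B>" for k b using gen by (simp add: \<B>_def)
    show "integral_averages {1..n} (\<lambda>w. mtrace (\<rho> (\<psi> w)))"
    proof (rule integral_averages_rep)
      show "\<rho> (\<psi> w) \<in> carrier_mat d d" if "w \<in> signed_perms {1..n}" for w by (rule D(1)[OF \<psi>[OF that]])
      show "\<rho> (\<psi> sp_one) = 1\<^sub>m d" by (simp only: \<psi>_one D(2))
      show "\<rho> (\<psi> (w \<star> v)) = \<rho> (\<psi> w) * \<rho> (\<psi> v)" if "w \<in> signed_perms {1..n}" "v \<in> signed_perms {1..n}" for w v
        unfolding \<psi>_mult[OF that] by (rule D(3)[OF \<psi>[OF that(1)] \<psi>[OF that(2)]])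
    qed simp
    show "class_function {1..n} (\<lambda>w. mtrace (\<rho> (\<psi> w)))"
      unfolding class_function_def
    proof (intro ballI impI)
      fix p w w' assume p: "p \<in> signed_perms {1..n}" and w: "w \<in> signed_perms {1..n}" and w': "w' \<in> signed_perms {1..n}"
        and eq: "p \<star> w = w' \<star> p"
      define g h h' where "g = \<psi> p" and "h = \<psi> w" and "h' = \<psi> w'"
      have carr: "g \<in> carrier W" "h \<in> carrier W" "h' \<in> carrier W" using \<psi> p w w' by (simp_all add: g_def h_def h'_def)
      have gh: "g \<otimes>\<^bsub>W\<^esub> h = h' \<otimes>\<^bsub>W\<^esub> g" using \<psi>_mult[OF p w] \<psi>_mult[OF w' p] eq by (simp add: g_def h_def h'_def)
      have h: "h = inv\<^bsub>W\<^esub> g \<otimes>\<^bsub>W\<^esub> (h' \<otimes>\<^bsub>W\<^esub> g)" unfolding gh[symmetric] using carr by (simp add: W.m_assoc[symmetric])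
      have "\<rho> h = \<rho> (inv\<^bsub>W\<^esub> g) * \<rho> (h' \<otimes>\<^bsub>W\<^esub> g)"
        using D(3)[OF W.inv_closed[OF carr(1)] W.m_closed[OF carr(3,1)]] h by simp
      then have "mtrace (\<rho> h) = mtrace (\<rho> (h' \<otimes>\<^bsub>W\<^esub> g) * \<rho> (inv\<^bsub>W\<^esub> g))"
        using mtrace_comm[OF D(1)[OF W.inv_closed[OF carr(1)]] D(1)[OF W.m_closed[OF carr(3,1)]]] by simp
      also have "\<rho> (h' \<otimes>\<^bsub>W\<^esub> g) * \<rho> (inv\<^bsub>W\<^esub> g) = \<rho> (h' \<otimes>\<^bsub>W\<^esub> g \<otimes>\<^bsub>W\<^esub> inv\<^bsub>W\<^esub> g)"
        by (rule D(3)[OF W.m_closed[OF carr(3,1)] W.inv_closed[OF carr(1)], symmetric])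
      also have "h' \<otimes>\<^bsub>W\<^esub> g \<otimes>\<^bsub>W\<^esub> inv\<^bsub>W\<^esub> g = h'" using carr by (simp add: W.m_assoc)
      finally show "mtrace (\<rho> (\<psi> w)) = mtrace (\<rho> (\<psi> w'))" by (simp add: h_def h'_def)
    qed
  qed
  then have "(\<lambda>x. mtrace (\<rho> (\<psi> (to_sperm n x)))) \<in> generated_chars W H" by (simp add: \<B>_def)
  then show ?thesis by (rule generated_chars_cong) (simp add: \<psi>_to)
qed

text \<open>
  Forgetting the signs turns the \<open>\<epsilon>\<close>-free one-block characters into those of permutation matrices.
\<close>

lemma block_char_unsigned:
  "block_char S [(k, True, False)] w = block_char S [(k, True, True)] (\<lambda>_. 1, snd w)"
  by (simp add: stable_subsets_def lin_char_def)

lemma perm_rep_eq_sp_mat: "perm_rep n \<sigma> = sp_mat n (\<lambda>_. 1, \<sigma>)"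
  by (rule eq_matI) (auto simp: perm_rep_def sp_mat_def)

theorem theorem4p4:
  fixes n :: nat
    and G :: "int monoid"
    and W :: "((nat \<Rightarrow> int) \<times> (nat \<Rightarrow> nat)) monoid"
    and \<chi> :: "int \<Rightarrow> 'k :: {alg_closed_field, field_char_0} mat"
    and U :: "(nat \<Rightarrow> nat) \<Rightarrow> 'k mat"
    and V :: "(nat \<Rightarrow> int) \<times> (nat \<Rightarrow> nat) \<Rightarrow> 'k mat"
  assumes "n \<ge> 1"
    and "G = integer_mod_group 2"
    and "W = wreath G {1..n}"
    and "group_rep G \<chi>" and "rep_degree G \<chi> = 1" and "\<exists>x\<in>carrier G. \<chi> x \<noteq> trivial_rep x"
    and "V = wreath_induced_rep G n \<chi>"
    and "reflection_rep_sym n U"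
  shows "generate_ring (rep_ring W)
      ({rep_class W (ext_rep k (inflate U)) | k. True} \<union> {rep_class W (ext_rep k V) | k. True})
    = carrier (rep_ring W)"
proof -
  note n = assms(1) and \<chi> = assms(4-6)[unfolded assms(2)]
  have W: "W = wreath sign_group {1..n}" by (simp only: assms(2,3))
  have G: "group W" unfolding W by (rule group_wreath) simp
  have fin: "finite (carrier W)" unfolding W by (rule finite_wreath) (simp_all add: carrier_sign_group)
  define H where "H = {rep_class W (ext_rep k (inflate U)) | k. True} \<union> {rep_class W (ext_rep k V) | k. True}"
  have perm: "snd x permutes {1..n}" if "x \<in> carrier W" for x using that unfolding W carrier_wreath by auto
  have sp: "to_sperm n x \<in> signed_perms {1..n}" if "x \<in> carrier W" for x
    by (rule bij_betw_apply[OF bij_betw_to_sperm that[unfolded W]])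
  obtain Q Q' where Q: "Q \<in> carrier_mat n n" "Q' \<in> carrier_mat n n" and QQ': "Q * Q' = 1\<^sub>m n" "Q' * Q = 1\<^sub>m n"
    and V: "\<forall>g\<in>carrier W. V g = Q' * sp_mat n (to_sperm n g) * Q"
    unfolding assms(7) assms(2) W by (rule wreath_induced_rep_conj[OF n \<chi>])
  have S: "sp_mat n w \<in> carrier_mat n n" for w by simp
  have repV: "group_rep W V"
  proof (rule group_repI(1))
    show "V g \<in> carrier_mat n n" if "g \<in> carrier W" for g
      using that V mult_carrier_mat[OF mult_carrier_mat[OF Q(2) S] Q(1)] by simp
    show "V \<one>\<^bsub>W\<^esub> = 1\<^sub>m n"
      using V monoid.one_closed[OF group.is_monoid[OF G]] to_sperm_one[of n, folded W]
      by (simp add: sp_mat_one right_mult_one_mat[OF Q(2)] QQ'(2))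
    fix g h assume gh: "g \<in> carrier W" "h \<in> carrier W"
    define A B :: "'k mat" where "A = sp_mat n (to_sperm n g)" and "B = sp_mat n (to_sperm n h)"
    have AB: "A \<in> carrier_mat n n" "B \<in> carrier_mat n n" by (simp_all add: A_def B_def)
    have "sp_mat n (to_sperm n (g \<otimes>\<^bsub>W\<^esub> h)) = A * B"
      using to_sperm_mult[OF gh[unfolded W], folded W] sp_mat_mult[OF sp[OF gh(1)] sp[OF gh(2)]] by (simp add: A_def B_def)
    then have "V (g \<otimes>\<^bsub>W\<^esub> h) = Q' * (A * B) * Q" using V monoid.m_closed[OF group.is_monoid[OF G] gh] by simp
    \<comment> \<open>insert \<open>Q Q\' = 1\<close> between the two matrices\<close>
    also have "A * B = A * (Q * Q') * B" unfolding QQ'(1) right_mult_one_mat[OF AB(1)] ..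
    also have "\<dots> = A * Q * (Q' * B)"
      using assoc_mult_mat[OF AB(1) Q(1) Q(2)] assoc_mult_mat[OF mult_carrier_mat[OF AB(1) Q(1)] Q(2) AB(2)] by simp
    also have "Q' * (A * Q * (Q' * B)) = Q' * A * Q * (Q' * B)"
      using assoc_mult_mat[OF Q(2) mult_carrier_mat[OF AB(1) Q(1)] mult_carrier_mat[OF Q(2) AB(2)]] assoc_mult_mat[OF Q(2) AB(1) Q(1)] by simp
    also have "\<dots> * Q = Q' * A * Q * (Q' * B * Q)"
      by (rule assoc_mult_mat[OF mult_carrier_mat[OF mult_carrier_mat[OF Q(2) AB(1)] Q(1)] mult_carrier_mat[OF Q(2) AB(2)] Q(1)])
    finally show "V (g \<otimes>\<^bsub>W\<^esub> h) = V g * V h" using V gh by (simp add: A_def B_def)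
  qed
  have ex: "short_exact (sym_group n) trivial_rep (perm_rep n) U"
    using assms(8) by (simp add: reflection_rep_sym_def)
  then have U: "group_rep (sym_group n) U" by (simp add: short_exact_def)
  have sym: "snd x \<in> carrier (sym_group n)" if "x \<in> carrier W" for x using perm[OF that] by (simp add: sym_group_def)
  have inflate: "inflate U x = U (snd x)" for x :: "(nat \<Rightarrow> int) \<times> (nat \<Rightarrow> nat)" by (simp add: inflate_def split_beta)
  have repU: "group_rep W (inflate U)"
  proof (rule group_repI(1))
    show "inflate U g \<in> carrier_mat (rep_degree (sym_group n) U) (rep_degree (sym_group n) U)" if "g \<in> carrier W" for g
      unfolding inflate by (rule group_repD(1)[OF U sym[OF that]])
    show "inflate U \<one>\<^bsub>W\<^esub> = 1\<^sub>m (rep_degree (sym_group n) U)"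
      using group_repD(2)[OF U] by (simp add: inflate W one_wreath sym_group_def)
    show "inflate U (g \<otimes>\<^bsub>W\<^esub> h) = inflate U g * inflate U h" if "g \<in> carrier W" "h \<in> carrier W" for g h
      using group_repD(3)[OF U sym[OF that(1)] sym[OF that(2)]] by (simp add: inflate W snd_mult_wreath sym_group_def)
  qed
  have charV: "(\<lambda>x. mtrace (ext_mat k (V x))) \<in> generated_chars W H" for k
    using generated_chars_incl[OF G fin group_rep_ext[OF repV, of k], of H]
    by (auto simp: H_def ext_rep_def)
  have charU: "(\<lambda>x. mtrace (ext_mat k (U (snd x)))) \<in> generated_chars W H" for k
    using generated_chars_incl[OF G fin group_rep_ext[OF repU, of k], of H]
    by (auto simp: H_def ext_rep_def inflate)
  have add: "(\<lambda>x. f x + g x) \<in> generated_chars W H" if "f \<in> generated_chars W H" "g \<in> generated_chars W H" for f g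
    using generated_chars_diff[OF G fin that(1) generated_chars_diff[OF G fin
          generated_chars_diff[OF G fin generated_chars_one[OF G fin] generated_chars_one[OF G fin]] that(2)]] by simp
  have signed: "(\<lambda>x. of_int (block_char {1..n} [(k, True, True)] (to_sperm n x))) \<in> generated_chars W H" for k
  proof (rule generated_chars_cong[OF charV[of k]])
    fix x assume x: "x \<in> carrier W"
    have "mtrace (ext_mat k (V x)) = mtrace (ext_mat k (sp_mat n (to_sperm n x) :: 'k mat))"
      using mtrace_ext_conj[OF S Q QQ'(1)] V x by simp
    also have "\<dots> = of_int (block_char {1..n} [(k, True, True)] (to_sperm n x))"
      by (rule mtrace_ext_sp_mat) (simp only: snd_to_sperm perm[OF x])
    finally show "mtrace (ext_mat k (V x)) = of_int (block_char {1..n} [(k, True, True)] (to_sperm n x))" .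
  qed
  \<comment> \<open>\<open>\<Lambda>\<^sup>k\<close> of the permutation representation; \<open>\<Lambda>\<^sup>0\<close> is trivial, and for \<open>k > 0\<close> it is \<open>\<Lambda>\<^sup>k U + \<Lambda>\<^bsup>k-1\<^esup> U\<close>\<close>
  have perm_char: "of_int (block_char {1..n} [(k, True, False)] (to_sperm n x)) = mtrace (ext_mat k (perm_rep n (snd x) :: 'k mat))"
    if "x \<in> carrier W" for k x
    unfolding block_char_unsigned perm_rep_eq_sp_mat snd_to_sperm
    by (rule mtrace_ext_sp_mat[symmetric]) (simp only: snd_conv perm[OF that])
  have unsigned: "(\<lambda>x. of_int (block_char {1..n} [(k, True, False)] (to_sperm n x))) \<in> generated_chars W H" for k
  proof (cases k)
    case 0
    show ?thesis
    proof (rule generated_chars_cong[OF generated_chars_one[OF G fin]])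
      fix x assume x: "x \<in> carrier W"
      show "1 = (of_int (block_char {1..n} [(k, True, False)] (to_sperm n x)) :: 'k)"
        unfolding perm_char[OF x] 0 perm_rep_eq_sp_mat mtrace_ext_0[OF S] ..
    qed
  next
    case (Suc l)
    show ?thesis
    proof (rule generated_chars_cong[OF add[OF charU[of "Suc l"] charU[of l]]])
      fix x assume x: "x \<in> carrier W"
      have "rep_degree (sym_group n) (trivial_rep :: _ \<Rightarrow> 'k mat) = 1" by (simp add: rep_degree_def trivial_rep_def)
      then show "mtrace (ext_mat (Suc l) (U (snd x))) + mtrace (ext_mat l (U (snd x))) =
          of_int (block_char {1..n} [(k, True, False)] (to_sperm n x))"
        unfolding perm_char[OF x] Suc
        by (intro mtrace_ext_short_exact[OF sym_group_is_group ex, symmetric] sym[OF x]) (simp_all add: trivial_rep_def)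
    qed
  qed
  have gen: "(\<lambda>x. of_int (block_char {1..n} [(k, True, b)] (to_sperm n x))) \<in> generated_chars W H" for k b
    using signed[of k] unsigned[of k] by (cases b) simp_all
  have "generate_ring (rep_ring W) H = carrier (rep_ring W)"
  proof (rule generate_rep_ring[OF G fin])
    show "\<exists>\<rho>. group_rep W \<rho> \<and> h = rep_class W \<rho>" if "h \<in> H" for h
      using that group_rep_ext[OF repU] group_rep_ext[OF repV] unfolding H_def by auto
    show "(\<lambda>g. mtrace (\<rho> g)) \<in> generated_chars W H" if "group_rep W \<rho>" for \<rho>
      using hyperoctahedral_characters[OF gen[unfolded W] that[unfolded W]] by (simp only: W)
  qed
  then show ?thesis by (simp only: H_def)
qed

end
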